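(* Let $(R,\mathfrak m,k)$ be a local ring. Let $I$ be a quasi-Gorenstein ideal of $R$ with $\operatorname{grade} I=0$ and $\dim_R I/I^2\ge2$. Suppose that either of the following holds. (a) $(0:_RI^2)=(0:_RI)$, or (b) $R/I$ is G-regular. Then for every integer $n\ge1$, there exists a family of exact sequences of $R$-modules $$\{0\to (R/I)^n\to M_{n,u}\to R/(0:_RI)\to0\}_{u\in k}$$ such that the modules $M_{n,u}$ ($u\in k$) are non-free and pairwise non-isomorphic indecomposable totally reflexive $R$-modules with $\nu_R(M_{n,u})=n+1$. In particular, if $k$ is infinite, then for each $n\ge1$ there exist infinitely many such modules $M_{n,u}$.
   Context: All rings are commutative Noetherian local. $\nu_R(X)$ denotes the minimal number of generators of $X$. Put $(-)^*=\operatorname{Hom}_R(-,R)$. A finitely generated $R$-module $X$ is totally reflexive if the evaluation map $X\to X^{**}$ is an isomorphism and $\operatorname{Ext}^i_R(X,R)=0=\operatorname{Ext}^i_R(X^*,R)$ for all $i>0$. A ring is G-regular if all totally reflexive modules over it are free. A proper ideal $I$ of $R$ is quasi-Gorenstein if $\operatorname{Ext}^i_R(R/I,R)\cong R/I$ for $i=\operatorname{grade} I$ and $\operatorname{Ext}^i_R(R/I,R)=0$ for all $i\ne\operatorname{grade} I$. Here $\operatorname{grade} I$ is the maximal length of an $R$-regular sequence in $I$; $\operatorname{grade} I=0$ means $(0:_RI)\ne0$. *)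

theory Defs
  imports "HOL-Library.Extended_Real" "HOL-Algebra.Ring_Divisibility"
    "HOL-Algebra.Ideal_Product" "HOL-Algebra.Module"
begin

section \<open>Modules over a commutative ring\<close>

text \<open>
  The record type of modules extends that of rings. The fields \<open>mult\<close> and \<open>one\<close> play no role
  for modules and are left undefined below, except for the ring itself.
\<close>

definition ring_mod :: "('a, 'r) ring_scheme \<Rightarrow> ('a, 'a) module" where
  "ring_mod R = \<lparr>carrier = carrier R, mult = mult R, one = one R, zero = zero R, add = add R,
     smult = mult R\<rparr>"

definition quot_mod :: "('a, 'r) ring_scheme \<Rightarrow> ('a, 'b) module \<Rightarrow> 'b set \<Rightarrow> ('a, 'b set) module"
  where
  "quot_mod R M N = \<lparr>carrier = a_rcosets\<^bsub>M\<^esub> N, mult = undefined, one = undefined, zero = N,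
     add = set_add M, smult = (\<lambda>a C. \<Union>x\<in>C. N +>\<^bsub>M\<^esub> (a \<odot>\<^bsub>M\<^esub> x))\<rparr>"

text \<open>The \<open>R\<close>-module \<open>R/J\<close>; it has the same carrier as the ring \<open>R Quot J\<close>.\<close>

abbreviation cyclic_mod :: "('a, 'r) ring_scheme \<Rightarrow> 'a set \<Rightarrow> ('a, 'a set) module" where
  "cyclic_mod R J \<equiv> quot_mod R (ring_mod R) J"

definition power_mod :: "('a, 'b) module \<Rightarrow> nat \<Rightarrow> ('a, nat \<Rightarrow> 'b) module" where
  "power_mod M n = \<lparr>carrier = {..<n} \<rightarrow>\<^sub>E carrier M, mult = undefined, one = undefined,
     zero = (\<lambda>i\<in>{..<n}. \<zero>\<^bsub>M\<^esub>), add = (\<lambda>x y. \<lambda>i\<in>{..<n}. x i \<oplus>\<^bsub>M\<^esub> y i),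
     smult = (\<lambda>a x. \<lambda>i\<in>{..<n}. a \<odot>\<^bsub>M\<^esub> x i)\<rparr>"

text \<open>Homomorphisms are taken to be extensional, so that equal homomorphisms are equal functions.\<close>

definition mod_hom ::
  "('a, 'r) ring_scheme \<Rightarrow> ('a, 'b) module \<Rightarrow> ('a, 'c) module \<Rightarrow> ('b \<Rightarrow> 'c) set" where
  "mod_hom R X Y = {f \<in> carrier X \<rightarrow>\<^sub>E carrier Y.
     (\<forall>x\<in>carrier X. \<forall>y\<in>carrier X. f (x \<oplus>\<^bsub>X\<^esub> y) = f x \<oplus>\<^bsub>Y\<^esub> f y) \<and>
     (\<forall>a\<in>carrier R. \<forall>x\<in>carrier X. f (a \<odot>\<^bsub>X\<^esub> x) = a \<odot>\<^bsub>Y\<^esub> f x)}"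

definition mod_iso ::
  "('a, 'r) ring_scheme \<Rightarrow> ('a, 'b) module \<Rightarrow> ('a, 'c) module \<Rightarrow> ('b \<Rightarrow> 'c) set" where
  "mod_iso R X Y = {f \<in> mod_hom R X Y. bij_betw f (carrier X) (carrier Y)}"

definition isomorphic_mod ::
  "('a, 'r) ring_scheme \<Rightarrow> ('a, 'b) module \<Rightarrow> ('a, 'c) module \<Rightarrow> bool" where
  "isomorphic_mod R X Y \<longleftrightarrow> mod_iso R X Y \<noteq> {}"

definition mod_ker :: "('a, 'b) module \<Rightarrow> ('a, 'c) module \<Rightarrow> ('b \<Rightarrow> 'c) \<Rightarrow> 'b set" where
  "mod_ker X Y f = {x \<in> carrier X. f x = \<zero>\<^bsub>Y\<^esub>}"

definition zero_mod :: "('a, 'b) module \<Rightarrow> bool" where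
  "zero_mod M \<longleftrightarrow> carrier M = {\<zero>\<^bsub>M\<^esub>}"

definition short_exact ::
  "('a, 'r) ring_scheme \<Rightarrow> ('a, 'b) module \<Rightarrow> ('b \<Rightarrow> 'c) \<Rightarrow> ('a, 'c) module \<Rightarrow> ('c \<Rightarrow> 'd) \<Rightarrow>
    ('a, 'd) module \<Rightarrow> bool" where
  "short_exact R X f Y g Z \<longleftrightarrow>
     f \<in> mod_hom R X Y \<and> g \<in> mod_hom R Y Z \<and> inj_on f (carrier X) \<and>
     f ` carrier X = mod_ker Y Z g \<and> g ` carrier Y = carrier Z"

definition gen_by :: "('a, 'r) ring_scheme \<Rightarrow> ('a, 'b) module \<Rightarrow> 'b set \<Rightarrow> bool" where
  "gen_by R M S \<longleftrightarrow> S \<subseteq> carrier M \<and> (\<lambda>N. submodule N R M) hull S = carrier M"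

definition fin_gen :: "('a, 'r) ring_scheme \<Rightarrow> ('a, 'b) module \<Rightarrow> bool" where
  "fin_gen R M \<longleftrightarrow> (\<exists>S. finite S \<and> gen_by R M S)"

definition min_gens :: "('a, 'r) ring_scheme \<Rightarrow> ('a, 'b) module \<Rightarrow> nat" where
  "min_gens R M = (LEAST n. \<exists>S. finite S \<and> card S = n \<and> gen_by R M S)"

text \<open>Free of finite rank; only used for finitely generated modules.\<close>

definition free_mod :: "('a, 'r) ring_scheme \<Rightarrow> ('a, 'b) module \<Rightarrow> bool" where
  "free_mod R M \<longleftrightarrow> (\<exists>n. isomorphic_mod R M (power_mod (ring_mod R) n))"

definition indecomposable_mod :: "('a, 'r) ring_scheme \<Rightarrow> ('a, 'b) module \<Rightarrow> bool" where
  "indecomposable_mod R M \<longleftrightarrow> \<not> zero_mod M \<and>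
     (\<forall>A B. submodule A R M \<and> submodule B R M \<and> A <+>\<^bsub>M\<^esub> B = carrier M \<and> A \<inter> B = {\<zero>\<^bsub>M\<^esub>}
        \<longrightarrow> A = {\<zero>\<^bsub>M\<^esub>} \<or> B = {\<zero>\<^bsub>M\<^esub>})"

section \<open>Hom, Ext and total reflexivity\<close>

definition Hom_mod ::
  "('a, 'r) ring_scheme \<Rightarrow> ('a, 'b) module \<Rightarrow> ('a, 'c) module \<Rightarrow> ('a, 'b \<Rightarrow> 'c) module" where
  "Hom_mod R X Y = \<lparr>carrier = mod_hom R X Y, mult = undefined, one = undefined,
     zero = (\<lambda>x\<in>carrier X. \<zero>\<^bsub>Y\<^esub>), add = (\<lambda>f g. \<lambda>x\<in>carrier X. f x \<oplus>\<^bsub>Y\<^esub> g x),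
     smult = (\<lambda>a f. \<lambda>x\<in>carrier X. a \<odot>\<^bsub>Y\<^esub> f x)\<rparr>"

definition dual_mod :: "('a, 'r) ring_scheme \<Rightarrow> ('a, 'b) module \<Rightarrow> ('a, 'b \<Rightarrow> 'a) module" where
  "dual_mod R X = Hom_mod R X (ring_mod R)"

definition eval_map ::
  "('a, 'r) ring_scheme \<Rightarrow> ('a, 'b) module \<Rightarrow> 'b \<Rightarrow> ('b \<Rightarrow> 'a) \<Rightarrow> 'a" where
  "eval_map R X = (\<lambda>x\<in>carrier X. \<lambda>\<phi>\<in>carrier (dual_mod R X). \<phi> x)"

text \<open>
  A resolution \<open>\<dots> \<rightarrow> R^(r 1) \<rightarrow> R^(r 0) \<rightarrow> X \<rightarrow> 0\<close> by free modules of finite rank, with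
  differentials \<open>d i : R^(r (i + 1)) \<rightarrow> R^(r i)\<close> and augmentation \<open>e\<close>. Every finitely generated
  module over a Noetherian ring has one.
\<close>

definition free_resolution ::
  "('a, 'r) ring_scheme \<Rightarrow> ('a, 'b) module \<Rightarrow> (nat \<Rightarrow> nat) \<Rightarrow>
    (nat \<Rightarrow> (nat \<Rightarrow> 'a) \<Rightarrow> (nat \<Rightarrow> 'a)) \<Rightarrow> ((nat \<Rightarrow> 'a) \<Rightarrow> 'b) \<Rightarrow> bool" where
  "free_resolution R X r d e \<longleftrightarrow>
     (let F = (\<lambda>i. power_mod (ring_mod R) (r i)) in
      e \<in> mod_hom R (F 0) X \<and> e ` carrier (F 0) = carrier X \<and>
      (\<forall>i. d i \<in> mod_hom R (F (Suc i)) (F i)) \<and>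
      d 0 ` carrier (F 1) = mod_ker (F 0) X e \<and>
      (\<forall>i. d (Suc i) ` carrier (F (Suc (Suc i))) = mod_ker (F (Suc i)) (F i) (d i)))"

text \<open>The \<open>i\<close>-th cohomology module of the complex \<open>Hom(R^(r 0), Y) \<rightarrow> Hom(R^(r 1), Y) \<rightarrow> \<dots>\<close>.\<close>

definition cocycles ::
  "('a, 'r) ring_scheme \<Rightarrow> (nat \<Rightarrow> nat) \<Rightarrow> (nat \<Rightarrow> (nat \<Rightarrow> 'a) \<Rightarrow> (nat \<Rightarrow> 'a)) \<Rightarrow>
    ('a, 'c) module \<Rightarrow> nat \<Rightarrow> ((nat \<Rightarrow> 'a) \<Rightarrow> 'c) set" where
  "cocycles R r d Y i = {f \<in> mod_hom R (power_mod (ring_mod R) (r i)) Y.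
     \<forall>x\<in>carrier (power_mod (ring_mod R) (r (Suc i))). f (d i x) = \<zero>\<^bsub>Y\<^esub>}"

definition coboundaries ::
  "('a, 'r) ring_scheme \<Rightarrow> (nat \<Rightarrow> nat) \<Rightarrow> (nat \<Rightarrow> (nat \<Rightarrow> 'a) \<Rightarrow> (nat \<Rightarrow> 'a)) \<Rightarrow>
    ('a, 'c) module \<Rightarrow> nat \<Rightarrow> ((nat \<Rightarrow> 'a) \<Rightarrow> 'c) set" where
  "coboundaries R r d Y i = (case i of
      0 \<Rightarrow> {\<zero>\<^bsub>Hom_mod R (power_mod (ring_mod R) (r 0)) Y\<^esub>}
    | Suc j \<Rightarrow> (\<lambda>f. compose (carrier (power_mod (ring_mod R) (r i))) f (d j)) `
        mod_hom R (power_mod (ring_mod R) (r j)) Y)"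

definition cohomology_mod ::
  "('a, 'r) ring_scheme \<Rightarrow> (nat \<Rightarrow> nat) \<Rightarrow> (nat \<Rightarrow> (nat \<Rightarrow> 'a) \<Rightarrow> (nat \<Rightarrow> 'a)) \<Rightarrow>
    ('a, 'c) module \<Rightarrow> nat \<Rightarrow> ('a, ((nat \<Rightarrow> 'a) \<Rightarrow> 'c) set) module" where
  "cohomology_mod R r d Y i =
     quot_mod R ((Hom_mod R (power_mod (ring_mod R) (r i)) Y)\<lparr>carrier := cocycles R r d Y i\<rparr>)
       (coboundaries R r d Y i)"

text \<open>
  \<open>Ext\<close> of a finitely generated module \<open>X\<close> over a Noetherian ring, computed from some fixed
  resolution of \<open>X\<close>; up to isomorphism the choice is immaterial.
\<close>

definition Ext_mod ::
  "('a, 'r) ring_scheme \<Rightarrow> nat \<Rightarrow> ('a, 'b) module \<Rightarrow> ('a, 'c) module \<Rightarrow>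
    ('a, ((nat \<Rightarrow> 'a) \<Rightarrow> 'c) set) module" where
  "Ext_mod R i X Y =
     (let (r, d) = (SOME (r, d). \<exists>e. free_resolution R X r d e) in cohomology_mod R r d Y i)"

definition totally_reflexive :: "('a, 'r) ring_scheme \<Rightarrow> ('a, 'b) module \<Rightarrow> bool" where
  "totally_reflexive R X \<longleftrightarrow>
     module R X \<and> fin_gen R X \<and>
     eval_map R X \<in> mod_iso R X (dual_mod R (dual_mod R X)) \<and>
     (\<forall>i>0. zero_mod (Ext_mod R i X (ring_mod R)) \<and>
            zero_mod (Ext_mod R i (dual_mod R X) (ring_mod R)))"

text \<open>
  Totally reflexive modules are finitely generated, hence isomorphic to a quotient of some \<open>R^n\<close>.
  Such quotients have carriers of type \<open>(nat \<Rightarrow> 'a) set\<close>, so quantifying over modules on this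
  type covers all isomorphism classes.
\<close>

definition G_regular :: "('a, 'r) ring_scheme \<Rightarrow> bool" where
  "G_regular R \<longleftrightarrow>
     (\<forall>X :: ('a, (nat \<Rightarrow> 'a) set) module. totally_reflexive R X \<longrightarrow> free_mod R X)"

section \<open>Local rings, annihilators, dimension and grade\<close>

locale noetherian_local_ring = cring R + noetherian_ring R for R (structure) +
  fixes \<mm> :: "'a set"
  assumes maximal: "maximalideal \<mm> R"
    and maximal_unique: "maximalideal J R \<Longrightarrow> J = \<mm>"

definition annihilator :: "('a, 'r) ring_scheme \<Rightarrow> ('a, 'b) module \<Rightarrow> 'a set" where
  "annihilator R M = {a \<in> carrier R. \<forall>x\<in>carrier M. a \<odot>\<^bsub>M\<^esub> x = \<zero>\<^bsub>M\<^esub>}"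

text \<open>\<open>(0 :\<^sub>R J)\<close>\<close>

definition zero_colon :: "('a, 'r) ring_scheme \<Rightarrow> 'a set \<Rightarrow> 'a set" where
  "zero_colon R J = {a \<in> carrier R. \<forall>x\<in>J. a \<otimes>\<^bsub>R\<^esub> x = \<zero>\<^bsub>R\<^esub>}"

text \<open>
  Krull dimension of a finitely generated module: the supremum of the lengths of chains of primes
  containing its annihilator. The zero module gets \<open>Sup {} = -\<infinity>\<close>.
\<close>

definition krull_dim_mod :: "('a, 'r) ring_scheme \<Rightarrow> ('a, 'b) module \<Rightarrow> ereal" where
  "krull_dim_mod R M = Sup {ereal (real n) | n. \<exists>P :: nat \<Rightarrow> 'a set.
     (\<forall>i\<le>n. primeideal (P i) R \<and> annihilator R M \<subseteq> P i) \<and> (\<forall>i<n. P i \<subset> P (Suc i))}"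

definition conormal_mod :: "('a, 'r) ring_scheme \<Rightarrow> 'a set \<Rightarrow> ('a, 'a set) module" where
  "conormal_mod R I = quot_mod R ((ring_mod R)\<lparr>carrier := I\<rparr>) (I \<cdot>\<^bsub>R\<^esub> I)"

definition regular_seq :: "('a, 'r) ring_scheme \<Rightarrow> 'a list \<Rightarrow> bool" where
  "regular_seq R xs \<longleftrightarrow> set xs \<subseteq> carrier R \<and> Idl\<^bsub>R\<^esub> (set xs) \<noteq> carrier R \<and>
     (\<forall>i<length xs. \<forall>a\<in>carrier R.
        xs ! i \<otimes>\<^bsub>R\<^esub> a \<in> Idl\<^bsub>R\<^esub> (set (take i xs)) \<longrightarrow> a \<in> Idl\<^bsub>R\<^esub> (set (take i xs)))"

definition grade :: "('a, 'r) ring_scheme \<Rightarrow> 'a set \<Rightarrow> enat" where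
  "grade R I = Sup {enat (length xs) | xs. set xs \<subseteq> I \<and> regular_seq R xs}"

definition quasi_Gorenstein :: "('a, 'r) ring_scheme \<Rightarrow> 'a set \<Rightarrow> bool" where
  "quasi_Gorenstein R I \<longleftrightarrow> ideal I R \<and> I \<noteq> carrier R \<and>
     (\<forall>i. if enat i = grade R I
          then isomorphic_mod R (Ext_mod R i (cyclic_mod R I) (ring_mod R)) (cyclic_mod R I)
          else zero_mod (Ext_mod R i (cyclic_mod R I) (ring_mod R)))"

end

theory Submission
  imports Defs
begin

text \<open>
  Total reflexivity can be tested on a single resolution by finitely generated free modules, and by
  the horseshoe lemma totally reflexive modules are closed under extensions. For a quasi-Gorenstein
  ideal \<open>I\<close> of grade \<open>0\<close> one has \<open>(0 : I) = aR\<close> with \<open>(0 : a) = I\<close>, and both \<open>R/I\<close> and \<open>R/aR\<close> are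
  totally reflexive. Hence so is every module \<open>M\<close> with generators \<open>e\<^sub>0, \<dots>, e\<^bsub>n-1\<^esub>, f\<close> and relations
  \<open>I e\<^sub>i = 0\<close>, \<open>a f = z\<^sub>0 e\<^sub>0 + \<dots> + z\<^bsub>n-1\<^esub> e\<^bsub>n-1\<^esub>\<close>, an extension of \<open>R/aR\<close> by \<open>(R/I)\<^sup>n\<close>.

  As \<open>I + (0 : I)\<close> annihilates \<open>I/I\<^sup>2\<close>, the hypothesis \<open>dim I/I\<^sup>2 \<ge> 2\<close> yields primes \<open>P\<^sub>0 \<subset> P\<^sub>1 \<subset> P\<^sub>2\<close>
  containing \<open>I + (0 : I)\<close>. From them one gets, for every \<open>n\<close>, elements \<open>w\<^sub>i = x\<^bsup>i\<^esup> y\<^bsup>k+n-i\<^esup>\<close> such that a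
  combination lying in \<open>P\<^sub>0\<close> has all its coefficients in the maximal ideal, and so deep in the maximal
  ideal that \<open>a\<close> is not in an ideal \<open>Q\<close> containing them. With \<open>z = (w\<^sub>0 + u w\<^sub>1, w\<^sub>2, \<dots>, w\<^sub>n)\<close>, the matrix
  of a homomorphism \<open>M\<^sub>u \<longrightarrow> M\<^sub>v\<close> is, modulo the maximal ideal, block triangular with a scalar block
  \<open>q\<close> on the \<open>e\<^sub>i\<close> and the same scalar on \<open>f\<close>; moreover \<open>q (u - v)\<close> vanishes in the residue field. An
  isomorphism thus forces \<open>u = v\<close>, and an idempotent endomorphism is trivial by Nakayama's lemma.
\<close>

section \<open>Linear maps and free modules\<close>

text \<open>The resolution of \<open>R/aR\<close> starts with multiplication by \<open>a\<close> on
  \<open>R\<close>, whose kernel is \<open>I\<close>; hence extensions of \<open>R/aR\<close> by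
  \<open>R/I\<close> are classified by \<open>R/(I + (0 : I))\<close>, and \<open>z\<close> is a
  vector of such classes. Isomorphic middle terms need not come from isomorphic extensions, so
  homomorphisms have to be controlled directly. Two things could go wrong. An \<open>e_i\<close>
  could be sent to something involving \<open>f\<close> with a unit coefficient; this is excluded
  because \<open>z_0\<close> is not in \<open>P_0\<close>, hence does not annihilate
  \<open>I\<close>. And the scalar on \<open>f\<close> could differ from that on the
  \<open>e_i\<close>, since coefficients of \<open>a\<close> can only be compared modulo the
  \<open>z_i\<close>; this is why the \<open>w_i\<close> are pushed into an ideal \<open>Q\<close>
  that misses \<open>a\<close>. Two steps above \<open>P_0\<close> are needed to have room: forms of
  degree \<open>n\<close> in two elements provide \<open>n + 1\<close> independent elements for
  every \<open>n\<close>, whereas ideals of a one-dimensional Noetherian local domain have a bounded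
  number of generators. The parameter lives on the line through \<open>w_0\<close> and
  \<open>w_1\<close>: a common unit scalar relates \<open>w_0 + u w_1\<close> to
  \<open>w_0 + v w_1\<close> only if \<open>u\<close> and \<open>v\<close> agree in the residue
  field.\<close>

definition lin ::
  "('a, 'r) ring_scheme \<Rightarrow> ('a, 'b) module \<Rightarrow> ('a, 'c) module \<Rightarrow> ('b \<Rightarrow> 'c) \<Rightarrow> bool" where
  "lin R X Y f \<longleftrightarrow> (\<forall>x\<in>carrier X. f x \<in> carrier Y) \<and>
     (\<forall>x\<in>carrier X. \<forall>y\<in>carrier X. f (x \<oplus>\<^bsub>X\<^esub> y) = f x \<oplus>\<^bsub>Y\<^esub> f y) \<and>
     (\<forall>a\<in>carrier R. \<forall>x\<in>carrier X. f (a \<odot>\<^bsub>X\<^esub> x) = a \<odot>\<^bsub>Y\<^esub> f x)"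

lemma linI:
  assumes "\<And>x. x \<in> carrier X \<Longrightarrow> f x \<in> carrier Y"
    and "\<And>x y. x \<in> carrier X \<Longrightarrow> y \<in> carrier X \<Longrightarrow> f (x \<oplus>\<^bsub>X\<^esub> y) = f x \<oplus>\<^bsub>Y\<^esub> f y"
    and "\<And>a x. a \<in> carrier R \<Longrightarrow> x \<in> carrier X \<Longrightarrow> f (a \<odot>\<^bsub>X\<^esub> x) = a \<odot>\<^bsub>Y\<^esub> f x"
  shows "lin R X Y f"
  using assms by (simp add: lin_def)

lemma lin_closed: "lin R X Y f \<Longrightarrow> x \<in> carrier X \<Longrightarrow> f x \<in> carrier Y"
  by (simp add: lin_def)

lemma lin_add:
  "lin R X Y f \<Longrightarrow> x \<in> carrier X \<Longrightarrow> y \<in> carrier X \<Longrightarrow> f (x \<oplus>\<^bsub>X\<^esub> y) = f x \<oplus>\<^bsub>Y\<^esub> f y"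
  by (simp add: lin_def)

lemma lin_smult:
  "lin R X Y f \<Longrightarrow> a \<in> carrier R \<Longrightarrow> x \<in> carrier X \<Longrightarrow> f (a \<odot>\<^bsub>X\<^esub> x) = a \<odot>\<^bsub>Y\<^esub> f x"
  by (simp add: lin_def)

lemma lin_id: "lin R X X (\<lambda>x. x)"
  by (simp add: lin_def)

lemma lin_comp: "lin R X Y f \<Longrightarrow> lin R Y Z g \<Longrightarrow> lin R X Z (\<lambda>x. g (f x))"
  by (simp add: lin_def)

lemma lin_zero:
  assumes "module R X" "module R Y" "lin R X Y f"
  shows "f \<zero>\<^bsub>X\<^esub> = \<zero>\<^bsub>Y\<^esub>"
proof -
  interpret X: module R X by fact
  interpret Y: module R Y by fact
  have "f \<zero>\<^bsub>X\<^esub> = f (\<zero>\<^bsub>R\<^esub> \<odot>\<^bsub>X\<^esub> \<zero>\<^bsub>X\<^esub>)" by simp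
  also have "\<dots> = \<zero>\<^bsub>R\<^esub> \<odot>\<^bsub>Y\<^esub> f \<zero>\<^bsub>X\<^esub>" by (rule lin_smult[OF assms(3)]) auto
  also have "\<dots> = \<zero>\<^bsub>Y\<^esub>" using lin_closed[OF assms(3)] by simp
  finally show ?thesis .
qed

lemma lin_neg:
  assumes "module R X" "module R Y" "lin R X Y f" "x \<in> carrier X"
  shows "f (\<ominus>\<^bsub>X\<^esub> x) = \<ominus>\<^bsub>Y\<^esub> f x"
proof -
  interpret X: module R X by fact
  interpret Y: module R Y by fact
  have "f (\<ominus>\<^bsub>X\<^esub> x) \<oplus>\<^bsub>Y\<^esub> f x = f (\<ominus>\<^bsub>X\<^esub> x \<oplus>\<^bsub>X\<^esub> x)"
    using lin_add[OF assms(3)] assms(4) by simp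
  also have "\<dots> = \<zero>\<^bsub>Y\<^esub>" using lin_zero[OF assms(1-3)] assms(4) by (simp add: X.l_neg)
  finally show ?thesis
    using lin_closed[OF assms(3)] assms(4) by (simp add: Y.minus_equality)
qed

lemma lin_minus:
  assumes "module R X" "module R Y" "lin R X Y f" "x \<in> carrier X" "y \<in> carrier X"
  shows "f (x \<ominus>\<^bsub>X\<^esub> y) = f x \<ominus>\<^bsub>Y\<^esub> f y"
proof -
  interpret X: module R X by fact
  show ?thesis using assms by (simp add: a_minus_def lin_add[of R X Y] lin_neg[of R X Y])
qed

lemma lin_finsum:
  assumes "module R X" "module R Y" "lin R X Y f" "finite S" "\<And>i. i \<in> S \<Longrightarrow> x i \<in> carrier X"
  shows "f (finsum X x S) = finsum Y (\<lambda>i. f (x i)) S"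
proof -
  interpret X: module R X by fact
  interpret Y: module R Y by fact
  show ?thesis using assms(4,5)
  proof (induction S)
    case empty
    then show ?case using lin_zero[OF assms(1-3)] by simp
  next
    case (insert s S)
    have m: "finsum X x S \<in> carrier X" "x s \<in> carrier X" using insert by (auto intro: X.finsum_closed)
    have "f (finsum X x (insert s S)) = f (x s) \<oplus>\<^bsub>Y\<^esub> f (finsum X x S)"
      using insert m by (subst X.finsum_insert) (auto simp: lin_add[OF assms(3)])
    also have "\<dots> = finsum Y (\<lambda>i. f (x i)) (insert s S)"
      using insert lin_closed[OF assms(3)] by (subst Y.finsum_insert) auto
    finally show ?case .
  qed
qed

lemma lin_plus:
  assumes "module R Y" "module R X" "lin R X Y f" "lin R X Y g"
  shows "lin R X Y (\<lambda>x. f x \<oplus>\<^bsub>Y\<^esub> g x)"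
proof -
  interpret X: module R X by fact
  interpret Y: module R Y by fact
  show ?thesis using assms(3,4)
    by (intro linI) (auto simp: lin_def Y.a_ac Y.smult_r_distr)
qed

lemma lin_uminus:
  assumes "module R Y" "module R X" "lin R X Y f"
  shows "lin R X Y (\<lambda>x. \<ominus>\<^bsub>Y\<^esub> f x)"
proof -
  interpret X: module R X by fact
  interpret Y: module R Y by fact
  show ?thesis using assms(3)
    by (intro linI) (auto simp: lin_def Y.minus_add Y.smult_r_minus)
qed

lemma lin_sub:
  assumes "module R Y" "module R X" "lin R X Y f" "lin R X Y g"
  shows "lin R X Y (\<lambda>x. f x \<ominus>\<^bsub>Y\<^esub> g x)"
  unfolding a_minus_def by (intro lin_plus lin_uminus assms)

lemma lin_scale:
  assumes "module R X" "module R Y" "lin R X Y f" "a \<in> carrier R"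
  shows "lin R X Y (\<lambda>x. a \<odot>\<^bsub>Y\<^esub> f x)"
proof -
  interpret X: module R X by fact
  interpret Y: module R Y by fact
  show ?thesis using assms(3,4)
    by (intro linI) (auto simp: lin_def Y.smult_r_distr Y.smult_assoc1[symmetric] X.m_comm)
qed

lemma mod_hom_lin: "f \<in> mod_hom R X Y \<Longrightarrow> lin R X Y f"
  by (auto simp: mod_hom_def lin_def)

text \<open>\<open>lin\<close> is \<open>mod_hom\<close> without extensionality, so that lambda
  terms and compositions qualify as they stand; restriction to the carrier is done only where duals,
  \<open>Ext_mod\<close> or \<open>short_exact\<close> demand extensional maps. The carrier is
  closed under the operations of a module, which makes the restriction harmless.\<close>

lemma restrict_mod_hom:
  assumes "module R X"
  shows "restrict f (carrier X) \<in> mod_hom R X Y \<longleftrightarrow> lin R X Y f"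
proof -
  interpret X: module R X by fact
  show ?thesis by (auto simp: mod_hom_def lin_def)
qed

section \<open>The ring and its finite powers as modules\<close>

lemma ring_mod_simps [simp]:
  "carrier (ring_mod R) = carrier R" "zero (ring_mod R) = zero R" "add (ring_mod R) = add R"
  "smult (ring_mod R) = mult R" "a_inv (ring_mod R) = a_inv R"
    "a_minus (ring_mod R) = a_minus R" "finsum (ring_mod R) = finsum R"
proof -
  \<comment> \<open>Inverses, differences and finite sums are computed from the carrier,
    \<open>zero\<close> and \<open>add\<close> alone, and \<open>ring_mod\<close> leaves these
    unchanged.\<close>
  show a: "a_inv (ring_mod R) = a_inv R" by (intro ext) (simp add: ring_mod_def a_inv_def m_inv_def)
  show "a_minus (ring_mod R) = a_minus R"
    by (intro ext) (simp only: a a_minus_def, simp add: ring_mod_def)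
  show "finsum (ring_mod R) = finsum R" by (intro ext) (simp add: ring_mod_def finsum_def finprod_def)
qed (simp_all add: ring_mod_def)

lemma (in cring) ring_mod_module: "module R (ring_mod R)"
  by (intro moduleI abelian_groupI is_cring) (auto simp: a_ac l_distr r_distr m_assoc intro: l_neg)

lemma power_mod_simps:
  "carrier (power_mod M n) = {..<n} \<rightarrow>\<^sub>E carrier M"
  "zero (power_mod M n) = (\<lambda>i\<in>{..<n}. \<zero>\<^bsub>M\<^esub>)"
  "add (power_mod M n) = (\<lambda>x y. \<lambda>i\<in>{..<n}. x i \<oplus>\<^bsub>M\<^esub> y i)"
  "smult (power_mod M n) = (\<lambda>a x. \<lambda>i\<in>{..<n}. a \<odot>\<^bsub>M\<^esub> x i)"
  by (simp_all add: power_mod_def)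

lemma power_mod_eqI:
  assumes "x \<in> carrier (power_mod M n)" "y \<in> carrier (power_mod M n)" "\<And>i. i < n \<Longrightarrow> x i = y i"
  shows "x = y"
  by (rule PiE_ext[OF assms(1,2)[unfolded power_mod_simps]]) (use assms(3) in auto)

lemma power_mod_apply [simp]:
  "i < n \<Longrightarrow> \<zero>\<^bsub>power_mod M n\<^esub> i = \<zero>\<^bsub>M\<^esub>"
  "i < n \<Longrightarrow> (x \<oplus>\<^bsub>power_mod M n\<^esub> y) i = x i \<oplus>\<^bsub>M\<^esub> y i"
  "i < n \<Longrightarrow> (a \<odot>\<^bsub>power_mod M n\<^esub> x) i = a \<odot>\<^bsub>M\<^esub> x i"
  by (simp_all add: power_mod_simps)

lemma power_mod_module:
  assumes "module R M"
  shows "module R (power_mod M n)"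
proof -
  interpret M: module R M by fact
  let ?P = "power_mod M n"
  have mem: "x i \<in> carrier M" if "x \<in> carrier ?P" "i < n" for x i
    using that by (auto simp: power_mod_simps)
  have c: "x \<oplus>\<^bsub>?P\<^esub> y \<in> carrier ?P" if "x \<in> carrier ?P" "y \<in> carrier ?P" for x y
    using that by (auto simp: power_mod_simps PiE_iff)
  have s: "a \<odot>\<^bsub>?P\<^esub> x \<in> carrier ?P" if "x \<in> carrier ?P" "a \<in> carrier R" for x a
    using that by (auto simp: power_mod_simps PiE_iff)
  have z: "\<zero>\<^bsub>?P\<^esub> \<in> carrier ?P" by (auto simp: power_mod_simps)
  show ?thesis
  proof (intro moduleI abelian_groupI M.R.is_cring)
    fix x assume x: "x \<in> carrier ?P"
    show "\<exists>y\<in>carrier ?P. y \<oplus>\<^bsub>?P\<^esub> x = \<zero>\<^bsub>?P\<^esub>"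
    proof
      show n: "(\<lambda>i\<in>{..<n}. \<ominus>\<^bsub>M\<^esub> x i) \<in> carrier ?P"
        using mem[OF x] by (auto simp: power_mod_simps)
      show "(\<lambda>i\<in>{..<n}. \<ominus>\<^bsub>M\<^esub> x i) \<oplus>\<^bsub>?P\<^esub> x = \<zero>\<^bsub>?P\<^esub>"
        by (rule power_mod_eqI[OF c[OF n x] z]) (use x mem M.l_neg in auto)
    qed
  qed (use c s z in \<open>auto intro!: power_mod_eqI[where M = M and n = n] simp: mem M.a_ac M.smult_l_distr M.smult_r_distr M.smult_assoc1\<close>)
qed

lemma power_mod_mem: "x \<in> carrier (power_mod M n) \<Longrightarrow> i < n \<Longrightarrow> x i \<in> carrier M"
  by (auto simp: power_mod_simps)

lemma lin_coord: "i < n \<Longrightarrow> lin R (power_mod M n) M (\<lambda>x. x i)"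
  by (intro linI) (auto simp: power_mod_simps)

lemma power_mod_minus:
  assumes "module R M" "x \<in> carrier (power_mod M n)" "y \<in> carrier (power_mod M n)" "i < n"
  shows "(x \<ominus>\<^bsub>power_mod M n\<^esub> y) i = x i \<ominus>\<^bsub>M\<^esub> y i"
  using lin_minus[OF power_mod_module[OF assms(1)] assms(1) lin_coord[OF assms(4)] assms(2,3)] by simp

section \<open>Bases and projectivity of finite free modules\<close>

abbreviation Fr :: "('a, 'r) ring_scheme \<Rightarrow> nat \<Rightarrow> ('a, nat \<Rightarrow> 'a) module" where
  "Fr R n \<equiv> power_mod (ring_mod R) n"

definition unit_vec :: "('a, 'r) ring_scheme \<Rightarrow> nat \<Rightarrow> nat \<Rightarrow> nat \<Rightarrow> 'a" where
  "unit_vec R n i = (\<lambda>j\<in>{..<n}. if j = i then \<one>\<^bsub>R\<^esub> else \<zero>\<^bsub>R\<^esub>)"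

context cring
begin

lemma Fr_module: "module R (Fr R n)"
  by (intro power_mod_module ring_mod_module)

lemma unit_vec_closed [simp]: "unit_vec R n i \<in> carrier (Fr R n)"
  by (auto simp: unit_vec_def power_mod_simps)

lemma unit_vec_apply: "j < n \<Longrightarrow> unit_vec R n i j = (if j = i then \<one> else \<zero>)"
  by (simp add: unit_vec_def)

lemma free_expand:
  assumes "x \<in> carrier (Fr R n)"
  shows "x = (\<Oplus>\<^bsub>Fr R n\<^esub>i\<in>{..<n}. x i \<odot>\<^bsub>Fr R n\<^esub> unit_vec R n i)"
proof -
  interpret F: module R "Fr R n" by (rule Fr_module)
  have c: "x i \<odot>\<^bsub>Fr R n\<^esub> unit_vec R n i \<in> carrier (Fr R n)" if "i < n" for i
    using that power_mod_mem[OF assms that] by simp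
  show ?thesis
  proof (rule power_mod_eqI[OF assms])
    show "(\<Oplus>\<^bsub>Fr R n\<^esub>i\<in>{..<n}. x i \<odot>\<^bsub>Fr R n\<^esub> unit_vec R n i) \<in> carrier (Fr R n)"
      using c by (intro F.finsum_closed) auto
  next
    fix j assume j: "j < n"
    have "(\<Oplus>\<^bsub>Fr R n\<^esub>i\<in>{..<n}. x i \<odot>\<^bsub>Fr R n\<^esub> unit_vec R n i) j
        = (\<Oplus>\<^bsub>ring_mod R\<^esub>i\<in>{..<n}. (x i \<odot>\<^bsub>Fr R n\<^esub> unit_vec R n i) j)"
      using c by (intro lin_finsum[OF Fr_module ring_mod_module lin_coord[OF j]]) auto
    also have "\<dots> = (\<Oplus>i\<in>{..<n}. if j = i then x i else \<zero>)"
      using j power_mod_mem[OF assms]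
      by (simp, intro finsum_cong') (auto simp: power_mod_simps unit_vec_def)
    also have "\<dots> = x j"
      using j power_mod_mem[OF assms] by (intro finsum_singleton) auto
    finally show "x j = (\<Oplus>\<^bsub>Fr R n\<^esub>i\<in>{..<n}. x i \<odot>\<^bsub>Fr R n\<^esub> unit_vec R n i) j" by simp
  qed
qed

lemma lin_expand:
  assumes "module R Y" "lin R (Fr R n) Y f" "x \<in> carrier (Fr R n)"
  shows "f x = (\<Oplus>\<^bsub>Y\<^esub>i\<in>{..<n}. x i \<odot>\<^bsub>Y\<^esub> f (unit_vec R n i))"
proof -
  interpret F: module R "Fr R n" by (rule Fr_module)
  interpret Y: module R Y by fact
  have c: "x i \<odot>\<^bsub>Fr R n\<^esub> unit_vec R n i \<in> carrier (Fr R n)" if "i < n" for i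
    using that power_mod_mem[OF assms(3) that] by simp
  have "f x = f (\<Oplus>\<^bsub>Fr R n\<^esub>i\<in>{..<n}. x i \<odot>\<^bsub>Fr R n\<^esub> unit_vec R n i)"
    using free_expand[OF assms(3)] by simp
  also have "\<dots> = (\<Oplus>\<^bsub>Y\<^esub>i\<in>{..<n}. f (x i \<odot>\<^bsub>Fr R n\<^esub> unit_vec R n i))"
    using c by (intro lin_finsum[OF Fr_module assms(1,2)]) auto
  also have "\<dots> = (\<Oplus>\<^bsub>Y\<^esub>i\<in>{..<n}. x i \<odot>\<^bsub>Y\<^esub> f (unit_vec R n i))"
    using power_mod_mem[OF assms(3)] lin_closed[OF assms(2)] lin_smult[OF assms(2)]
    by (intro Y.finsum_cong') auto
  finally show ?thesis .
qed

lemma free_hom_lin: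
  assumes "module R Y" "\<And>i. i < n \<Longrightarrow> y i \<in> carrier Y"
  shows "lin R (Fr R n) Y (\<lambda>x. \<Oplus>\<^bsub>Y\<^esub>i\<in>{..<n}. x i \<odot>\<^bsub>Y\<^esub> y i)"
proof -
  interpret Y: module R Y by fact
  have c: "x i \<in> carrier R" if "x \<in> carrier (Fr R n)" "i < n" for x i
    using power_mod_mem[OF that] by simp
  show ?thesis
  proof (rule linI)
    fix x assume "x \<in> carrier (Fr R n)"
    then show "(\<Oplus>\<^bsub>Y\<^esub>i\<in>{..<n}. x i \<odot>\<^bsub>Y\<^esub> y i) \<in> carrier Y"
      using c assms(2) by (intro Y.finsum_closed) auto
  next
    fix x x' assume x: "x \<in> carrier (Fr R n)" "x' \<in> carrier (Fr R n)"
    have "(\<Oplus>\<^bsub>Y\<^esub>i\<in>{..<n}. (x \<oplus>\<^bsub>Fr R n\<^esub> x') i \<odot>\<^bsub>Y\<^esub> y i)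
      = (\<Oplus>\<^bsub>Y\<^esub>i\<in>{..<n}. x i \<odot>\<^bsub>Y\<^esub> y i \<oplus>\<^bsub>Y\<^esub> x' i \<odot>\<^bsub>Y\<^esub> y i)"
      using x c assms(2) by (intro Y.finsum_cong') (auto simp: power_mod_simps Y.smult_l_distr Pi_iff)
    then show "(\<Oplus>\<^bsub>Y\<^esub>i\<in>{..<n}. (x \<oplus>\<^bsub>Fr R n\<^esub> x') i \<odot>\<^bsub>Y\<^esub> y i)
      = (\<Oplus>\<^bsub>Y\<^esub>i\<in>{..<n}. x i \<odot>\<^bsub>Y\<^esub> y i) \<oplus>\<^bsub>Y\<^esub> (\<Oplus>\<^bsub>Y\<^esub>i\<in>{..<n}. x' i \<odot>\<^bsub>Y\<^esub> y i)"
      using x c assms(2) by (simp add: Pi_iff)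
  next
    fix a x assume x: "a \<in> carrier R" "x \<in> carrier (Fr R n)"
    have "(\<Oplus>\<^bsub>Y\<^esub>i\<in>{..<n}. (a \<odot>\<^bsub>Fr R n\<^esub> x) i \<odot>\<^bsub>Y\<^esub> y i)
      = (\<Oplus>\<^bsub>Y\<^esub>i\<in>{..<n}. a \<odot>\<^bsub>Y\<^esub> (x i \<odot>\<^bsub>Y\<^esub> y i))"
      using x c assms(2) by (intro Y.finsum_cong') (auto simp: power_mod_simps Y.smult_assoc1 Pi_iff)
    then show "(\<Oplus>\<^bsub>Y\<^esub>i\<in>{..<n}. (a \<odot>\<^bsub>Fr R n\<^esub> x) i \<odot>\<^bsub>Y\<^esub> y i)
      = a \<odot>\<^bsub>Y\<^esub> (\<Oplus>\<^bsub>Y\<^esub>i\<in>{..<n}. x i \<odot>\<^bsub>Y\<^esub> y i)"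
      using x c assms(2) by (subst Y.finsum_smult_ldistr) (auto simp: Pi_iff)
  qed
qed

lemma free_hom_unit_vec:
  assumes "module R Y" "\<And>i. i < n \<Longrightarrow> y i \<in> carrier Y" "j < n"
  shows "(\<Oplus>\<^bsub>Y\<^esub>i\<in>{..<n}. unit_vec R n j i \<odot>\<^bsub>Y\<^esub> y i) = y j"
proof -
  interpret Y: module R Y by fact
  have "(\<Oplus>\<^bsub>Y\<^esub>i\<in>{..<n}. unit_vec R n j i \<odot>\<^bsub>Y\<^esub> y i) = (\<Oplus>\<^bsub>Y\<^esub>i\<in>{..<n}. if j = i then y i else \<zero>\<^bsub>Y\<^esub>)"
    using assms by (intro Y.finsum_cong') (auto simp: unit_vec_def)
  also have "\<dots> = y j" using assms by (intro Y.finsum_singleton) auto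
  finally show ?thesis .
qed

lemma lin_eq_on_basis:
  assumes "module R Y" "lin R (Fr R n) Y f" "lin R (Fr R n) Y g"
    "\<And>i. i < n \<Longrightarrow> f (unit_vec R n i) = g (unit_vec R n i)" "x \<in> carrier (Fr R n)"
  shows "f x = g x"
proof -
  interpret Y: module R Y by fact
  show ?thesis
    unfolding lin_expand[OF assms(1,2,5)] lin_expand[OF assms(1,3,5)]
    using assms(4) power_mod_mem[OF assms(5)] lin_closed[OF assms(3)]
    by (intro Y.finsum_cong') auto
qed

text \<open>Projectivity of \<open>Fr R n\<close>, by choosing preimages for the images of the basis
  vectors. It suffices that \<open>\<psi>\<close> reaches the values of \<open>\<phi>\<close>, so
  that \<open>\<psi>\<close> may be a differential of a resolution and \<open>\<phi>\<close> a map
  into the kernel of the preceding one.\<close>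

lemma free_lift:
  assumes "module R Y" "module R Z" "lin R (Fr R n) Z \<phi>" "lin R Y Z \<psi>"
    and "\<And>x. x \<in> carrier (Fr R n) \<Longrightarrow> \<exists>y\<in>carrier Y. \<psi> y = \<phi> x"
  shows "\<exists>\<chi>. lin R (Fr R n) Y \<chi> \<and> (\<forall>x\<in>carrier (Fr R n). \<psi> (\<chi> x) = \<phi> x)"
proof -
  \<comment> \<open>For \<open>i\<close> at least \<open>n\<close> the vector
    \<open>unit_vec R n i\<close> is zero and still belongs to the carrier, so the choice can be
    made for all \<open>i\<close> at once.\<close>
  have "\<exists>y. \<forall>i. y i \<in> carrier Y \<and> \<psi> (y i) = \<phi> (unit_vec R n i)"
    using assms(5)[OF unit_vec_closed] by (intro choice) blast
  then obtain y where y: "\<And>i. y i \<in> carrier Y" "\<And>i. \<psi> (y i) = \<phi> (unit_vec R n i)" by blast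
  let ?\<chi> = "\<lambda>x. \<Oplus>\<^bsub>Y\<^esub>i\<in>{..<n}. x i \<odot>\<^bsub>Y\<^esub> y i"
  have l: "lin R (Fr R n) Y ?\<chi>" by (intro free_hom_lin assms y)
  have "\<psi> (?\<chi> x) = \<phi> x" if x: "x \<in> carrier (Fr R n)" for x
    using assms(2) lin_comp[OF l assms(4)] assms(3) _ x
    by (rule lin_eq_on_basis) (simp add: free_hom_unit_vec[OF assms(1)] y)
  then show ?thesis using l by blast
qed

end

section \<open>Free resolutions\<close>

definition res ::
  "('a, 'r) ring_scheme \<Rightarrow> ('a, 'b) module \<Rightarrow> (nat \<Rightarrow> nat) \<Rightarrow>
    (nat \<Rightarrow> (nat \<Rightarrow> 'a) \<Rightarrow> (nat \<Rightarrow> 'a)) \<Rightarrow> ((nat \<Rightarrow> 'a) \<Rightarrow> 'b) \<Rightarrow> bool" where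
  "res R X r d e \<longleftrightarrow> lin R (Fr R (r 0)) X e \<and> (\<forall>x\<in>carrier X. \<exists>y\<in>carrier (Fr R (r 0)). e y = x) \<and>
     (\<forall>i. lin R (Fr R (r (Suc i))) (Fr R (r i)) (d i)) \<and>
     (\<forall>x\<in>carrier (Fr R (r 0)). e x = \<zero>\<^bsub>X\<^esub> \<longleftrightarrow> (\<exists>y\<in>carrier (Fr R (r (Suc 0))). d 0 y = x)) \<and>
     (\<forall>i. \<forall>x\<in>carrier (Fr R (r (Suc i))). d i x = \<zero>\<^bsub>Fr R (r i)\<^esub> \<longleftrightarrow>
        (\<exists>y\<in>carrier (Fr R (r (Suc (Suc i)))). d (Suc i) y = x))"

text \<open>When \<open>(r, d)\<close> resolves \<open>X\<close>, this says that
  \<open>Ext^i(X, R)\<close> vanishes for all \<open>i > 0\<close>. Neither \<open>X\<close> nor the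
  augmentation occurs, so the condition survives shifting \<open>d\<close> when one passes to a
  syzygy.\<close>

definition ext_vanish ::
  "('a, 'r) ring_scheme \<Rightarrow> (nat \<Rightarrow> nat) \<Rightarrow> (nat \<Rightarrow> (nat \<Rightarrow> 'a) \<Rightarrow> (nat \<Rightarrow> 'a)) \<Rightarrow> bool" where
  "ext_vanish R r d \<longleftrightarrow> (\<forall>i f. lin R (Fr R (r (Suc i))) (ring_mod R) f \<and>
      (\<forall>x\<in>carrier (Fr R (r (Suc (Suc i)))). f (d (Suc i) x) = \<zero>\<^bsub>R\<^esub>) \<longrightarrow>
      (\<exists>g. lin R (Fr R (r i)) (ring_mod R) g \<and> (\<forall>x\<in>carrier (Fr R (r (Suc i))). f x = g (d i x))))"

lemma resD:
  assumes "res R X r d e"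
  shows "lin R (Fr R (r 0)) X e" "x \<in> carrier X \<Longrightarrow> \<exists>y\<in>carrier (Fr R (r 0)). e y = x"
    "lin R (Fr R (r (Suc i))) (Fr R (r i)) (d i)"
    "y \<in> carrier (Fr R (r (Suc 0))) \<Longrightarrow> e (d 0 y) = \<zero>\<^bsub>X\<^esub>"
    "y \<in> carrier (Fr R (r (Suc (Suc i)))) \<Longrightarrow> d i (d (Suc i) y) = \<zero>\<^bsub>Fr R (r i)\<^esub>"
    "y \<in> carrier (Fr R (r 0)) \<Longrightarrow> e y = \<zero>\<^bsub>X\<^esub> \<Longrightarrow> \<exists>z\<in>carrier (Fr R (r (Suc 0))). d 0 z = y"
    "y \<in> carrier (Fr R (r (Suc i))) \<Longrightarrow> d i y = \<zero>\<^bsub>Fr R (r i)\<^esub> \<Longrightarrow>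
       \<exists>z\<in>carrier (Fr R (r (Suc (Suc i)))). d (Suc i) z = y"
proof -
  note * = assms[unfolded res_def]
  show "lin R (Fr R (r 0)) X e" "x \<in> carrier X \<Longrightarrow> \<exists>y\<in>carrier (Fr R (r 0)). e y = x"
    and l: "\<And>i. lin R (Fr R (r (Suc i))) (Fr R (r i)) (d i)"
    and "y \<in> carrier (Fr R (r 0)) \<Longrightarrow> e y = \<zero>\<^bsub>X\<^esub> \<Longrightarrow> \<exists>z\<in>carrier (Fr R (r (Suc 0))). d 0 z = y"
    and "y \<in> carrier (Fr R (r (Suc i))) \<Longrightarrow> d i y = \<zero>\<^bsub>Fr R (r i)\<^esub> \<Longrightarrow>
       \<exists>z\<in>carrier (Fr R (r (Suc (Suc i)))). d (Suc i) z = y"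
    using * by blast+
  show "y \<in> carrier (Fr R (r (Suc 0))) \<Longrightarrow> e (d 0 y) = \<zero>\<^bsub>X\<^esub>"
    using * lin_closed[OF l, of y 0] by blast
  show "y \<in> carrier (Fr R (r (Suc (Suc i)))) \<Longrightarrow> d i (d (Suc i) y) = \<zero>\<^bsub>Fr R (r i)\<^esub>"
    using * lin_closed[OF l, of y "Suc i"] by blast
qed

lemma resI:
  assumes "lin R (Fr R (r 0)) X e" "\<And>x. x \<in> carrier X \<Longrightarrow> \<exists>y\<in>carrier (Fr R (r 0)). e y = x"
    "\<And>i. lin R (Fr R (r (Suc i))) (Fr R (r i)) (d i)"
    "\<And>y. y \<in> carrier (Fr R (r (Suc 0))) \<Longrightarrow> e (d 0 y) = \<zero>\<^bsub>X\<^esub>"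
    "\<And>i y. y \<in> carrier (Fr R (r (Suc (Suc i)))) \<Longrightarrow> d i (d (Suc i) y) = \<zero>\<^bsub>Fr R (r i)\<^esub>"
    "\<And>y. y \<in> carrier (Fr R (r 0)) \<Longrightarrow> e y = \<zero>\<^bsub>X\<^esub> \<Longrightarrow>
       \<exists>z\<in>carrier (Fr R (r (Suc 0))). d 0 z = y"
    "\<And>i y. y \<in> carrier (Fr R (r (Suc i))) \<Longrightarrow> d i y = \<zero>\<^bsub>Fr R (r i)\<^esub> \<Longrightarrow>
       \<exists>z\<in>carrier (Fr R (r (Suc (Suc i)))). d (Suc i) z = y"
  shows "res R X r d e"
  using assms unfolding res_def by blast

lemma ext_vanishD:
  assumes "ext_vanish R r d" "lin R (Fr R (r (Suc i))) (ring_mod R) f"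
    "\<And>x. x \<in> carrier (Fr R (r (Suc (Suc i)))) \<Longrightarrow> f (d (Suc i) x) = \<zero>\<^bsub>R\<^esub>"
  obtains g where "lin R (Fr R (r i)) (ring_mod R) g"
    "\<And>x. x \<in> carrier (Fr R (r (Suc i))) \<Longrightarrow> f x = g (d i x)"
  using assms unfolding ext_vanish_def by metis

lemma ext_vanishI:
  assumes "\<And>i f. lin R (Fr R (r (Suc i))) (ring_mod R) f \<Longrightarrow>
    (\<And>x. x \<in> carrier (Fr R (r (Suc (Suc i)))) \<Longrightarrow> f (d (Suc i) x) = \<zero>\<^bsub>R\<^esub>) \<Longrightarrow>
    \<exists>g. lin R (Fr R (r i)) (ring_mod R) g \<and> (\<forall>x\<in>carrier (Fr R (r (Suc i))). f x = g (d i x))"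
  shows "ext_vanish R r d"
  using assms unfolding ext_vanish_def by blast

context abelian_group
begin

lemma diff_eq_iff:
  assumes "a \<in> carrier G" "b \<in> carrier G" "c \<in> carrier G"
  shows "a \<ominus> b = c \<longleftrightarrow> a = c \<oplus> b"
  using assms by (metis a_minus_def a_assoc a_inv_closed l_neg r_neg r_zero a_closed)

lemma diff_self: "a \<in> carrier G \<Longrightarrow> a \<ominus> a = \<zero>"
  by (simp add: a_minus_def r_neg)

lemma diff_zero_right: "a \<in> carrier G \<Longrightarrow> a \<ominus> \<zero> = a"
  by (simp add: a_minus_def)

lemma diff_eq_zero_iff: "a \<in> carrier G \<Longrightarrow> b \<in> carrier G \<Longrightarrow> a \<ominus> b = \<zero> \<longleftrightarrow> a = b"
  by (simp add: diff_eq_iff)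

end

lemma lin_diff_zero:
  assumes "module R X" "module R Y" "lin R X Y f" "x \<in> carrier X" "y \<in> carrier X" "f x = f y"
  shows "f (x \<ominus>\<^bsub>X\<^esub> y) = \<zero>\<^bsub>Y\<^esub>"
proof -
  interpret Y: module R Y by fact
  show ?thesis unfolding lin_minus[OF assms(1-5)] assms(6) using lin_closed[OF assms(3,5)] by (rule Y.diff_self)
qed

section \<open>Comparison of resolutions\<close>

context cring
begin

text \<open>The comparison theorem. Each degree is a lifting problem along \<open>d' i\<close>; the
  invariant \<open>P\<close> records that it is solvable, namely that \<open>\<alpha> i\<close> maps
  boundaries to boundaries, and \<open>Q\<close> is the commuting square with the next map.\<close>

lemma chain_lift:
  assumes X: "module R X" "res R X r d e" and Y: "module R Y" "res R Y r' d' e'"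
    and \<phi>: "lin R X Y \<phi>"
  shows "\<exists>\<alpha>. (\<forall>i. lin R (Fr R (r i)) (Fr R (r' i)) (\<alpha> i)) \<and>
     (\<forall>x\<in>carrier (Fr R (r 0)). e' (\<alpha> 0 x) = \<phi> (e x)) \<and>
     (\<forall>i. \<forall>x\<in>carrier (Fr R (r (Suc i))). d' i (\<alpha> (Suc i) x) = \<alpha> i (d i x))"
proof -
  note rX = resD[OF X(2)] and rY = resD[OF Y(2)]
  define P where "P = (\<lambda>i \<alpha>. lin R (Fr R (r i)) (Fr R (r' i)) \<alpha> \<and>
     (\<forall>x\<in>carrier (Fr R (r (Suc i))). \<exists>y\<in>carrier (Fr R (r' (Suc i))). d' i y = \<alpha> (d i x)))"
  define Q where "Q = (\<lambda>i \<alpha> \<alpha>'. \<forall>x\<in>carrier (Fr R (r (Suc i))). d' i (\<alpha>' x) = \<alpha> (d i x))"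
  have "\<exists>y\<in>carrier (Fr R (r' 0)). e' y = \<phi> (e x)" if "x \<in> carrier (Fr R (r 0))" for x
    using rY(2)[OF lin_closed[OF lin_comp[OF rX(1) \<phi>] that]] .
  from free_lift[OF Fr_module Y(1) lin_comp[OF rX(1) \<phi>] rY(1) this]
  obtain \<alpha>0 where \<alpha>0: "lin R (Fr R (r 0)) (Fr R (r' 0)) \<alpha>0"
    "\<And>x. x \<in> carrier (Fr R (r 0)) \<Longrightarrow> e' (\<alpha>0 x) = \<phi> (e x)" by blast
  have P0: "P 0 \<alpha>0"
    unfolding P_def
  proof (intro conjI ballI \<alpha>0(1) rY(6))
    fix x assume x: "x \<in> carrier (Fr R (r (Suc 0)))"
    then show "\<alpha>0 (d 0 x) \<in> carrier (Fr R (r' 0))"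
      using lin_closed[OF rX(3)] lin_closed[OF \<alpha>0(1)] by blast
    show "e' (\<alpha>0 (d 0 x)) = \<zero>\<^bsub>Y\<^esub>"
      using x \<alpha>0(2)[OF lin_closed[OF rX(3) x]] rX(4)[OF x] lin_zero[OF X(1) Y(1) \<phi>] by simp
  qed
  have step: "\<exists>\<alpha>'. P (Suc i) \<alpha>' \<and> Q i \<alpha> \<alpha>'" if "P i \<alpha>" for i \<alpha>
  proof -
    have l: "lin R (Fr R (r i)) (Fr R (r' i)) \<alpha>" using that by (simp add: P_def)
    have "\<exists>y\<in>carrier (Fr R (r' (Suc i))). d' i y = \<alpha> (d i x)" if "x \<in> carrier (Fr R (r (Suc i)))" for x
      using \<open>P i \<alpha>\<close> that by (simp add: P_def)
    from free_lift[OF Fr_module Fr_module lin_comp[OF rX(3) l] rY(3) this]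
    obtain \<alpha>' where \<alpha>': "lin R (Fr R (r (Suc i))) (Fr R (r' (Suc i))) \<alpha>'"
      "\<And>x. x \<in> carrier (Fr R (r (Suc i))) \<Longrightarrow> d' i (\<alpha>' x) = \<alpha> (d i x)" by blast
    have "P (Suc i) \<alpha>'"
      unfolding P_def
    proof (intro conjI ballI \<alpha>'(1) rY(7))
      fix x assume x: "x \<in> carrier (Fr R (r (Suc (Suc i))))"
      then show "\<alpha>' (d (Suc i) x) \<in> carrier (Fr R (r' (Suc i)))"
        using lin_closed[OF rX(3)] lin_closed[OF \<alpha>'(1)] by blast
      show "d' i (\<alpha>' (d (Suc i) x)) = \<zero>\<^bsub>Fr R (r' i)\<^esub>"
        using \<alpha>'(2)[OF lin_closed[OF rX(3) x]] rX(5)[OF x] lin_zero[OF Fr_module Fr_module l] by simp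
    qed
    then show ?thesis using \<alpha>'(2) by (auto simp: Q_def)
  qed
  \<comment> \<open>The clause on \<open>i = 0\<close> pins the chosen sequence to
    \<open>\<alpha>0\<close>, since the square with the augmentations is known for
    \<open>\<alpha>0\<close> and is not part of \<open>P\<close>.\<close>
  have "\<exists>f. \<forall>i. (P i (f i) \<and> (i = 0 \<longrightarrow> f i = \<alpha>0)) \<and> Q i (f i) (f (Suc i))"
    by (rule dependent_nat_choice) (use P0 step in auto)
  then obtain f where f: "\<And>i. P i (f i)" "f 0 = \<alpha>0" "\<And>i. Q i (f i) (f (Suc i))" by blast
  show ?thesis
    using f \<alpha>0(2) unfolding P_def Q_def by (intro exI[of _ f]) auto
qed

text \<open>A chain map over the zero map is null-homotopic. The recursion carries
  \<open>d i (h (d i x)) = \<theta> i (d i x)\<close>, an identity on boundaries; it is what makes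
  \<open>\<theta> (Suc i) x\<close> minus \<open>h (d i x)\<close> a cycle. The homotopy identity is
  recorded in positive degrees, the ones that \<open>ext_vanish\<close> is about.\<close>

lemma chain_homotopy:
  assumes X: "module R X" "res R X r d e"
    and \<theta>: "\<And>i. lin R (Fr R (r i)) (Fr R (r i)) (\<theta> i)"
      "\<And>x. x \<in> carrier (Fr R (r 0)) \<Longrightarrow> e (\<theta> 0 x) = \<zero>\<^bsub>X\<^esub>"
      "\<And>i x. x \<in> carrier (Fr R (r (Suc i))) \<Longrightarrow> d i (\<theta> (Suc i) x) = \<theta> i (d i x)"
  shows "\<exists>h. (\<forall>i. lin R (Fr R (r i)) (Fr R (r (Suc i))) (h i)) \<and>
     (\<forall>i. \<forall>x\<in>carrier (Fr R (r (Suc i))).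
        d (Suc i) (h (Suc i) x) = \<theta> (Suc i) x \<ominus>\<^bsub>Fr R (r (Suc i))\<^esub> h i (d i x))"
proof -
  note rX = resD[OF X(2)]
  define P where "P = (\<lambda>i h. lin R (Fr R (r i)) (Fr R (r (Suc i))) h \<and>
     (\<forall>x\<in>carrier (Fr R (r (Suc i))). d i (h (d i x)) = \<theta> i (d i x)))"
  define Q where "Q = (\<lambda>i h h'. \<forall>x\<in>carrier (Fr R (r (Suc i))).
     d (Suc i) (h' x) = \<theta> (Suc i) x \<ominus>\<^bsub>Fr R (r (Suc i))\<^esub> h (d i x))"
  have "\<exists>h. P 0 h"
  proof -
    have "\<exists>y\<in>carrier (Fr R (r (Suc 0))). d 0 y = \<theta> 0 x" if "x \<in> carrier (Fr R (r 0))" for x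
      by (rule rX(6)[OF lin_closed[OF \<theta>(1) that] \<theta>(2)[OF that]])
    from free_lift[OF Fr_module Fr_module \<theta>(1) rX(3) this]
    obtain h where "lin R (Fr R (r 0)) (Fr R (r (Suc 0))) h"
      "\<And>x. x \<in> carrier (Fr R (r 0)) \<Longrightarrow> d 0 (h x) = \<theta> 0 x" by blast
    then show ?thesis unfolding P_def using lin_closed[OF rX(3)] by blast
  qed
  moreover have "\<exists>h'. P (Suc i) h' \<and> Q i h h'" if "P i h" for i h
  proof -
    interpret F: module R "Fr R (r (Suc i))" by (rule Fr_module)
    have l: "lin R (Fr R (r i)) (Fr R (r (Suc i))) h" using that by (simp add: P_def)
    have c: "\<theta> (Suc i) x \<in> carrier (Fr R (r (Suc i)))" "h (d i x) \<in> carrier (Fr R (r (Suc i)))"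
      if "x \<in> carrier (Fr R (r (Suc i)))" for x
      using that lin_closed[OF \<theta>(1)] lin_closed[OF l] lin_closed[OF rX(3)] by blast+
    let ?\<phi> = "\<lambda>x. \<theta> (Suc i) x \<ominus>\<^bsub>Fr R (r (Suc i))\<^esub> h (d i x)"
    have ex: "\<exists>y\<in>carrier (Fr R (r (Suc (Suc i)))). d (Suc i) y = ?\<phi> x" if x: "x \<in> carrier (Fr R (r (Suc i)))" for x
    proof (rule rX(7))
      show "?\<phi> x \<in> carrier (Fr R (r (Suc i)))" using c[OF x] by simp
      show "d i (?\<phi> x) = \<zero>\<^bsub>Fr R (r i)\<^esub>"
        using \<open>P i h\<close> x by (intro lin_diff_zero[OF Fr_module Fr_module rX(3)] c) (auto simp: P_def \<theta>(3))
    qed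
    have "lin R (Fr R (r (Suc i))) (Fr R (r (Suc i))) ?\<phi>"
      by (intro lin_sub Fr_module \<theta>(1) lin_comp[OF rX(3) l])
    from free_lift[OF Fr_module Fr_module this rX(3) ex]
    obtain h' where h': "lin R (Fr R (r (Suc i))) (Fr R (r (Suc (Suc i)))) h'"
      "\<And>x. x \<in> carrier (Fr R (r (Suc i))) \<Longrightarrow> d (Suc i) (h' x) = ?\<phi> x" by blast
    have "d (Suc i) (h' (d (Suc i) x)) = \<theta> (Suc i) (d (Suc i) x)"
      if x: "x \<in> carrier (Fr R (r (Suc (Suc i))))" for x
    proof -
      have m: "d (Suc i) x \<in> carrier (Fr R (r (Suc i)))" using lin_closed[OF rX(3) x] .
      show ?thesis using h'(2)[OF m] rX(5)[OF x] lin_zero[OF Fr_module Fr_module l] c[OF m]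
        by (simp add: a_minus_def)
    qed
    then show ?thesis using h' by (auto simp: P_def Q_def)
  qed
  ultimately obtain h where "\<And>i. P i (h i)" "\<And>i. Q i (h i) (h (Suc i))"
    using dependent_nat_choice[of P Q] by metis
  then show ?thesis unfolding P_def Q_def by blast
qed

text \<open>Two resolutions of the same module are homotopy equivalent.\<close>

lemma ext_vanish_independent:
  assumes X: "module R X" "res R X r d e" "res R X r' d' e'" and v: "ext_vanish R r' d'"
  shows "ext_vanish R r d"
proof (rule ext_vanishI)
  note rX = resD[OF X(2)] and rY = resD[OF X(3)]
  obtain \<alpha> where \<alpha>: "\<And>i. lin R (Fr R (r i)) (Fr R (r' i)) (\<alpha> i)"
     "\<And>x. x \<in> carrier (Fr R (r 0)) \<Longrightarrow> e' (\<alpha> 0 x) = e x"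
     "\<And>i x. x \<in> carrier (Fr R (r (Suc i))) \<Longrightarrow> d' i (\<alpha> (Suc i) x) = \<alpha> i (d i x)"
    using chain_lift[OF X(1,2) X(1,3) lin_id] by blast
  obtain \<beta> where \<beta>: "\<And>i. lin R (Fr R (r' i)) (Fr R (r i)) (\<beta> i)"
     "\<And>x. x \<in> carrier (Fr R (r' 0)) \<Longrightarrow> e (\<beta> 0 x) = e' x"
     "\<And>i x. x \<in> carrier (Fr R (r' (Suc i))) \<Longrightarrow> d i (\<beta> (Suc i) x) = \<beta> i (d' i x)"
    using chain_lift[OF X(1,3) X(1,2) lin_id] by blast
  define \<theta> where "\<theta> = (\<lambda>i x. \<beta> i (\<alpha> i x) \<ominus>\<^bsub>Fr R (r i)\<^esub> x)"
  have \<beta>\<alpha>: "lin R (Fr R (r i)) (Fr R (r i)) (\<lambda>x. \<beta> i (\<alpha> i x))" for i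
    by (rule lin_comp[OF \<alpha>(1) \<beta>(1)])
  have \<theta>1: "lin R (Fr R (r i)) (Fr R (r i)) (\<theta> i)" for i
    unfolding \<theta>_def by (intro lin_sub Fr_module \<beta>\<alpha> lin_id)
  have \<theta>2: "e (\<theta> 0 x) = \<zero>\<^bsub>X\<^esub>" if "x \<in> carrier (Fr R (r 0))" for x
    unfolding \<theta>_def
    by (intro lin_diff_zero[OF Fr_module X(1) rX(1)])
      (use that \<beta>(2)[OF lin_closed[OF \<alpha>(1) that]] \<alpha>(2)[OF that] lin_closed[OF \<beta>\<alpha> that] in auto)
  have \<theta>3: "d i (\<theta> (Suc i) x) = \<theta> i (d i x)" if x: "x \<in> carrier (Fr R (r (Suc i)))" for i x
    unfolding \<theta>_def
    using \<beta>(3)[OF lin_closed[OF \<alpha>(1) x]] \<alpha>(3)[OF x] lin_closed[OF \<beta>\<alpha> x] x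
    by (simp add: lin_minus[OF Fr_module Fr_module rX(3)])
  obtain h where h: "\<And>i. lin R (Fr R (r i)) (Fr R (r (Suc i))) (h i)"
     "\<And>i x. x\<in>carrier (Fr R (r (Suc i))) \<Longrightarrow>
        d (Suc i) (h (Suc i) x) = \<theta> (Suc i) x \<ominus>\<^bsub>Fr R (r (Suc i))\<^esub> h i (d i x)"
    using chain_homotopy[OF X(1,2) \<theta>1 \<theta>2 \<theta>3] by blast
  fix i f assume f: "lin R (Fr R (r (Suc i))) (ring_mod R) f"
    and f0: "\<And>x. x \<in> carrier (Fr R (r (Suc (Suc i)))) \<Longrightarrow> f (d (Suc i) x) = \<zero>"
  have "f (\<beta> (Suc i) (d' (Suc i) x)) = \<zero>" if x: "x \<in> carrier (Fr R (r' (Suc (Suc i))))" for x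
    unfolding \<beta>(3)[OF x, symmetric] by (rule f0[OF lin_closed[OF \<beta>(1) x]])
  from ext_vanishD[OF v lin_comp[OF \<beta>(1) f] this]
  obtain g where g: "lin R (Fr R (r' i)) (ring_mod R) g"
    "\<And>x. x \<in> carrier (Fr R (r' (Suc i))) \<Longrightarrow> f (\<beta> (Suc i) x) = g (d' i x)" by blast
  \<comment> \<open>As \<open>f\<close> kills boundaries, the homotopy gives \<open>f \<circ>
    \<beta> \<circ> \<alpha> - f = f \<circ> h \<circ> d\<close>. With
    \<open>f \<circ> \<beta> = g \<circ> d'\<close> and the chain map property of
    \<open>\<alpha>\<close> this becomes
    \<open>f = (g \<circ> \<alpha> - f \<circ> h) \<circ> d\<close>.\<close>
  let ?g = "\<lambda>x. g (\<alpha> i x) \<ominus>\<^bsub>ring_mod R\<^esub> f (h i x)"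
  have "lin R (Fr R (r i)) (ring_mod R) ?g"
    by (intro lin_sub ring_mod_module Fr_module lin_comp[OF \<alpha>(1) g(1)] lin_comp[OF h(1) f])
  moreover have "f x = ?g (d i x)" if x: "x \<in> carrier (Fr R (r (Suc i)))" for x
  proof -
    interpret F: module R "Fr R (r (Suc i))" by (rule Fr_module)
    have m: "\<beta> (Suc i) (\<alpha> (Suc i) x) \<in> carrier (Fr R (r (Suc i)))" using lin_closed[OF \<beta>\<alpha> x] .
    have mh: "h i (d i x) \<in> carrier (Fr R (r (Suc i)))" using lin_closed[OF h(1) lin_closed[OF rX(3) x]] .
    have m\<theta>: "\<theta> (Suc i) x \<in> carrier (Fr R (r (Suc i)))" using lin_closed[OF \<theta>1 x] .
    have c: "f x \<in> carrier R" "f (h i (d i x)) \<in> carrier R" "f (\<beta> (Suc i) (\<alpha> (Suc i) x)) \<in> carrier R"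
      using lin_closed[OF f] x m mh by auto
    have "f (d (Suc i) (h (Suc i) x)) = \<zero>" using f0 lin_closed[OF h(1) x] by blast
    then have "f (\<theta> (Suc i) x) \<ominus> f (h i (d i x)) = \<zero>"
      using h(2)[OF x] lin_minus[OF Fr_module ring_mod_module f m\<theta> mh] by simp
    moreover have "f (\<theta> (Suc i) x) = f (\<beta> (Suc i) (\<alpha> (Suc i) x)) \<ominus> f x"
      unfolding \<theta>_def using lin_minus[OF Fr_module ring_mod_module f m x] by simp
    ultimately have "f (\<beta> (Suc i) (\<alpha> (Suc i) x)) \<ominus> f x = f (h i (d i x))"
      using c by simp
    moreover have "f (\<beta> (Suc i) (\<alpha> (Suc i) x)) = g (\<alpha> i (d i x))"
      using g(2)[OF lin_closed[OF \<alpha>(1) x]] \<alpha>(3)[OF x] by simp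
    ultimately show ?thesis using c diff_eq_iff[of "g (\<alpha> i (d i x))" "f x" "f (h i (d i x))"]
        diff_eq_iff[of "g (\<alpha> i (d i x))" "f (h i (d i x))" "f x"] by (auto simp: a_comm)
  qed
  ultimately show "\<exists>g. lin R (Fr R (r i)) (ring_mod R) g \<and>
      (\<forall>x\<in>carrier (Fr R (r (Suc i))). f x = g (d i x))" by blast
qed

end

section \<open>The horseshoe lemma\<close>

definition exact3 ::
  "('a, 'r) ring_scheme \<Rightarrow> ('a, 'b) module \<Rightarrow> ('b \<Rightarrow> 'c) \<Rightarrow> ('a, 'c) module \<Rightarrow> ('c \<Rightarrow> 'd) \<Rightarrow>
    ('a, 'd) module \<Rightarrow> bool" where
  "exact3 R A f B g C \<longleftrightarrow> lin R A B f \<and> lin R B C g \<and> inj_on f (carrier A) \<and>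
     (\<forall>b\<in>carrier B. g b = \<zero>\<^bsub>C\<^esub> \<longleftrightarrow> (\<exists>a\<in>carrier A. f a = b)) \<and>
     (\<forall>c\<in>carrier C. \<exists>b\<in>carrier B. g b = c)"

lemma exact3D:
  assumes "exact3 R A f B g C"
  shows "lin R A B f" "lin R B C g" "a \<in> carrier A \<Longrightarrow> a' \<in> carrier A \<Longrightarrow> f a = f a' \<Longrightarrow> a = a'"
    "a \<in> carrier A \<Longrightarrow> g (f a) = \<zero>\<^bsub>C\<^esub>"
    "b \<in> carrier B \<Longrightarrow> g b = \<zero>\<^bsub>C\<^esub> \<Longrightarrow> \<exists>a\<in>carrier A. f a = b"
    "c \<in> carrier C \<Longrightarrow> \<exists>b\<in>carrier B. g b = c"
proof -
  note * = assms[unfolded exact3_def]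
  show l: "lin R A B f" and "lin R B C g" "a \<in> carrier A \<Longrightarrow> a' \<in> carrier A \<Longrightarrow> f a = f a' \<Longrightarrow> a = a'"
    "b \<in> carrier B \<Longrightarrow> g b = \<zero>\<^bsub>C\<^esub> \<Longrightarrow> \<exists>a\<in>carrier A. f a = b"
    "c \<in> carrier C \<Longrightarrow> \<exists>b\<in>carrier B. g b = c"
    using * by (blast dest: inj_onD)+
  show "a \<in> carrier A \<Longrightarrow> g (f a) = \<zero>\<^bsub>C\<^esub>" using * lin_closed[OF l, of a] by blast
qed

section \<open>Direct sums of free modules as concatenation of vectors\<close>

definition vjoin :: "nat \<Rightarrow> nat \<Rightarrow> (nat \<Rightarrow> 'a) \<Rightarrow> (nat \<Rightarrow> 'a) \<Rightarrow> nat \<Rightarrow> 'a" where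
  "vjoin m k x y = (\<lambda>i\<in>{..<m + k}. if i < m then x i else y (i - m))"

definition vfst :: "nat \<Rightarrow> (nat \<Rightarrow> 'a) \<Rightarrow> nat \<Rightarrow> 'a" where
  "vfst m x = (\<lambda>i\<in>{..<m}. x i)"

definition vsnd :: "nat \<Rightarrow> nat \<Rightarrow> (nat \<Rightarrow> 'a) \<Rightarrow> nat \<Rightarrow> 'a" where
  "vsnd m k x = (\<lambda>i\<in>{..<k}. x (m + i))"

lemma vjoin_closed:
  "x \<in> carrier (power_mod M m) \<Longrightarrow> y \<in> carrier (power_mod M k) \<Longrightarrow>
    vjoin m k x y \<in> carrier (power_mod M (m + k))"
  by (auto simp: vjoin_def power_mod_simps PiE_iff)

lemma vfst_closed: "x \<in> carrier (power_mod M (m + k)) \<Longrightarrow> vfst m x \<in> carrier (power_mod M m)"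
  by (auto simp: vfst_def power_mod_simps PiE_iff)

lemma vsnd_closed: "x \<in> carrier (power_mod M (m + k)) \<Longrightarrow> vsnd m k x \<in> carrier (power_mod M k)"
  by (auto simp: vsnd_def power_mod_simps PiE_iff)

lemma vfst_vjoin: "x \<in> carrier (power_mod M m) \<Longrightarrow> vfst m (vjoin m k x y) = x"
  by (auto simp: vjoin_def vfst_def power_mod_simps PiE_iff extensional_def)

lemma vsnd_vjoin: "y \<in> carrier (power_mod M k) \<Longrightarrow> vsnd m k (vjoin m k x y) = y"
  by (auto simp: vjoin_def vsnd_def power_mod_simps PiE_iff extensional_def)

lemma vjoin_vfst_vsnd:
  "x \<in> carrier (power_mod M (m + k)) \<Longrightarrow> vjoin m k (vfst m x) (vsnd m k x) = x"
  by (auto simp: vjoin_def vfst_def vsnd_def power_mod_simps PiE_iff extensional_def)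

lemma lin_vfst: "lin R (power_mod M (m + k)) (power_mod M m) (vfst m)"
proof (rule linI)
  show "vfst m x \<in> carrier (power_mod M m)" if "x \<in> carrier (power_mod M (m + k))" for x
    by (rule vfst_closed[OF that])
qed (unfold vfst_def power_mod_simps, (rule restrict_ext, simp)+)

lemma lin_vsnd: "lin R (power_mod M (m + k)) (power_mod M k) (vsnd m k)"
proof (rule linI)
  show "vsnd m k x \<in> carrier (power_mod M k)" if "x \<in> carrier (power_mod M (m + k))" for x
    by (rule vsnd_closed[OF that])
qed (unfold vsnd_def power_mod_simps, (rule restrict_ext, simp)+)

lemma lin_vjoin:
  assumes "lin R X (power_mod M m) f" "lin R X (power_mod M k) g"
  shows "lin R X (power_mod M (m + k)) (\<lambda>x. vjoin m k (f x) (g x))"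
proof (rule linI)
  show "vjoin m k (f x) (g x) \<in> carrier (power_mod M (m + k))" if "x \<in> carrier X" for x
    using assms that by (intro vjoin_closed) (auto dest: lin_closed)
qed (use assms in \<open>auto simp: lin_def vjoin_def power_mod_simps intro!: restrict_ext\<close>)

lemma vjoin_zero: "vjoin m k \<zero>\<^bsub>power_mod M m\<^esub> \<zero>\<^bsub>power_mod M k\<^esub> = \<zero>\<^bsub>power_mod M (m + k)\<^esub>"
  by (auto simp: vjoin_def power_mod_simps intro!: restrict_ext)

lemma vjoin_eq_zero:
  assumes "vjoin m k x y = \<zero>\<^bsub>power_mod M (m + k)\<^esub>"
    "x \<in> carrier (power_mod M m)" "y \<in> carrier (power_mod M k)"
  shows "x = \<zero>\<^bsub>power_mod M m\<^esub>" "y = \<zero>\<^bsub>power_mod M k\<^esub>"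
proof -
  show "x = \<zero>\<^bsub>power_mod M m\<^esub>"
    by (rule trans[OF vfst_vjoin[OF assms(2), of k y, symmetric]], unfold assms(1))
      (auto simp: vfst_def power_mod_simps intro!: restrict_ext)
  show "y = \<zero>\<^bsub>power_mod M k\<^esub>"
    by (rule trans[OF vsnd_vjoin[OF assms(3), of m x, symmetric]], unfold assms(1))
      (auto simp: vsnd_def power_mod_simps intro!: restrict_ext)
qed

lemma vjoin_split:
  assumes "z \<in> carrier (power_mod M (m + k))"
  obtains x y where "x \<in> carrier (power_mod M m)" "y \<in> carrier (power_mod M k)" "z = vjoin m k x y"
  using vfst_closed[OF assms] vsnd_closed[OF assms] vjoin_vfst_vsnd[OF assms] by metis

lemma vjoin_sum:
  assumes "module R M" "x \<in> carrier (power_mod M m)" "y \<in> carrier (power_mod M k)"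
  shows "vjoin m k x y = vjoin m k x \<zero>\<^bsub>power_mod M k\<^esub> \<oplus>\<^bsub>power_mod M (m + k)\<^esub> vjoin m k \<zero>\<^bsub>power_mod M m\<^esub> y"
proof -
  interpret M: module R M by fact
  show ?thesis using assms(2,3)
    by (auto simp: vjoin_def power_mod_simps PiE_iff intro!: restrict_ext)
qed

lemma lin_const_zero:
  assumes "module R X" "module R Y"
  shows "lin R X Y (\<lambda>x. \<zero>\<^bsub>Y\<^esub>)"
proof -
  interpret X: module R X by fact
  interpret Y: module R Y by fact
  show ?thesis by (intro linI) auto
qed

context cring
begin

text \<open>The differential of the middle resolution is triangular, sending \<open>(x, y)\<close>
  to \<open>(dA x + \<tau> y, dC y)\<close>, with the correction \<open>\<tau>\<close> found by
  lifting degree by degree. The claim on \<open>ext_vanish\<close> belongs to the same statement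
  because its proof works with this shape of \<open>dB\<close>; it replaces the long exact sequence
  for \<open>Ext\<close>.\<close>

lemma horseshoe:
  assumes A: "module R A" "res R A rA dA eA" and C: "module R C" "res R C rC dC eC"
    and B: "module R B" and ex: "exact3 R A f B g C"
  shows "\<exists>dB eB. res R B (\<lambda>i. rA i + rC i) dB eB \<and>
    (ext_vanish R rA dA \<longrightarrow> ext_vanish R rC dC \<longrightarrow> ext_vanish R (\<lambda>i. rA i + rC i) dB)"
proof -
  interpret A: module R A by (rule A)
  interpret B: module R B by (rule B)
  interpret C: module R C by (rule C)
  interpret F: module R "Fr R n" for n by (rule Fr_module)
  note a = resD[OF A(2)] and c = resD[OF C(2)] and fg = exact3D[OF ex]
  note lz = lin_zero[OF Fr_module Fr_module]
  have "\<exists>b\<in>carrier B. g b = eC x" if "x \<in> carrier (Fr R (rC 0))" for x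
    by (rule fg(6)[OF lin_closed[OF c(1) that]])
  from free_lift[OF B C(1) c(1) fg(2) this]
  obtain \<epsilon> where \<epsilon>: "lin R (Fr R (rC 0)) B \<epsilon>" "\<And>x. x \<in> carrier (Fr R (rC 0)) \<Longrightarrow> g (\<epsilon> x) = eC x"
    by blast
  \<comment> \<open>The sign is dictated by \<open>eB (dB 0 z) = 0\<close>: the part of the
    augmentation that passes through \<open>A\<close> has to cancel
    \<open>\<epsilon> (dC 0 x)\<close>.\<close>
  have ex0: "\<exists>y\<in>carrier (Fr R (rA 0)). f (eA y) = \<ominus>\<^bsub>B\<^esub> \<epsilon> (dC 0 x)"
    if x: "x \<in> carrier (Fr R (rC (Suc 0)))" for x
  proof -
    have m: "dC 0 x \<in> carrier (Fr R (rC 0))" "\<epsilon> (dC 0 x) \<in> carrier B"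
      using lin_closed[OF c(3) x] lin_closed[OF \<epsilon>(1)] by auto
    have "g (\<ominus>\<^bsub>B\<^esub> \<epsilon> (dC 0 x)) = \<zero>\<^bsub>C\<^esub>"
      using lin_neg[OF B C(1) fg(2) m(2)] \<epsilon>(2)[OF m(1)] c(4)[OF x] by simp
    from fg(5)[OF _ this] m obtain b where "b \<in> carrier A" "f b = \<ominus>\<^bsub>B\<^esub> \<epsilon> (dC 0 x)" by auto
    then show ?thesis using a(2) by metis
  qed
  have l0: "lin R (Fr R (rC (Suc 0))) B (\<lambda>x. \<ominus>\<^bsub>B\<^esub> \<epsilon> (dC 0 x))"
    by (intro lin_uminus B Fr_module lin_comp[OF c(3) \<epsilon>(1)])
  from free_lift[OF Fr_module B l0 lin_comp[OF a(1) fg(1)] ex0]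
  obtain \<tau>0 where \<tau>0: "lin R (Fr R (rC (Suc 0))) (Fr R (rA 0)) \<tau>0"
    "\<And>x. x \<in> carrier (Fr R (rC (Suc 0))) \<Longrightarrow> f (eA (\<tau>0 x)) = \<ominus>\<^bsub>B\<^esub> \<epsilon> (dC 0 x)" by blast
  \<comment> \<open>\<open>P\<close> keeps the next lifting problem solvable, while \<open>Q\<close>
    is the relation \<open>dA \<circ> \<tau>' = - \<tau> \<circ> dC\<close>, which makes the square
    of \<open>dB\<close> vanish.\<close>
  define P where "P = (\<lambda>i \<tau>. lin R (Fr R (rC (Suc i))) (Fr R (rA i)) \<tau> \<and>
    (\<forall>x\<in>carrier (Fr R (rC (Suc (Suc i)))). \<exists>y\<in>carrier (Fr R (rA (Suc i))).
       dA i y = \<ominus>\<^bsub>Fr R (rA i)\<^esub> \<tau> (dC (Suc i) x)))"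
  define Q where "Q = (\<lambda>i \<tau> \<tau>'. \<forall>x\<in>carrier (Fr R (rC (Suc (Suc i)))).
    dA i (\<tau>' x) = \<ominus>\<^bsub>Fr R (rA i)\<^esub> \<tau> (dC (Suc i) x))"
  have P0: "P 0 \<tau>0"
    unfolding P_def
  proof (intro conjI ballI \<tau>0(1) a(6))
    fix x assume x: "x \<in> carrier (Fr R (rC (Suc (Suc 0))))"
    have m: "dC (Suc 0) x \<in> carrier (Fr R (rC (Suc 0)))" by (rule lin_closed[OF c(3) x])
    have m': "\<tau>0 (dC (Suc 0) x) \<in> carrier (Fr R (rA 0))" by (rule lin_closed[OF \<tau>0(1) m])
    show "\<ominus>\<^bsub>Fr R (rA 0)\<^esub> \<tau>0 (dC (Suc 0) x) \<in> carrier (Fr R (rA 0))" using m' by simp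
    have "f (eA (\<tau>0 (dC (Suc 0) x))) = f \<zero>\<^bsub>A\<^esub>"
      using \<tau>0(2)[OF m] c(5)[OF x] lin_zero[OF Fr_module B \<epsilon>(1)] lin_zero[OF A(1) B fg(1)] by simp
    then have "eA (\<tau>0 (dC (Suc 0) x)) = \<zero>\<^bsub>A\<^esub>"
      by (intro fg(3)) (use lin_closed[OF a(1) m'] in auto)
    then show "eA (\<ominus>\<^bsub>Fr R (rA 0)\<^esub> \<tau>0 (dC (Suc 0) x)) = \<zero>\<^bsub>A\<^esub>"
      using lin_neg[OF Fr_module A(1) a(1) m'] by simp
  qed
  have step: "\<exists>\<tau>'. P (Suc i) \<tau>' \<and> Q i \<tau> \<tau>'" if "P i \<tau>" for i \<tau>
  proof -
    have l: "lin R (Fr R (rC (Suc i))) (Fr R (rA i)) \<tau>" using that by (simp add: P_def)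
    have l': "lin R (Fr R (rC (Suc (Suc i)))) (Fr R (rA i)) (\<lambda>x. \<ominus>\<^bsub>Fr R (rA i)\<^esub> \<tau> (dC (Suc i) x))"
      by (intro lin_uminus Fr_module lin_comp[OF c(3) l])
    have "\<exists>y\<in>carrier (Fr R (rA (Suc i))). dA i y = \<ominus>\<^bsub>Fr R (rA i)\<^esub> \<tau> (dC (Suc i) x)"
      if "x \<in> carrier (Fr R (rC (Suc (Suc i))))" for x
      using \<open>P i \<tau>\<close> that by (simp add: P_def)
    from free_lift[OF Fr_module Fr_module l' a(3) this]
    obtain \<tau>' where \<tau>': "lin R (Fr R (rC (Suc (Suc i)))) (Fr R (rA (Suc i))) \<tau>'"
      "\<And>x. x \<in> carrier (Fr R (rC (Suc (Suc i)))) \<Longrightarrow> dA i (\<tau>' x) = \<ominus>\<^bsub>Fr R (rA i)\<^esub> \<tau> (dC (Suc i) x)"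
      by blast
    have "P (Suc i) \<tau>'"
      unfolding P_def
    proof (intro conjI ballI \<tau>'(1) a(7))
      fix x assume x: "x \<in> carrier (Fr R (rC (Suc (Suc (Suc i)))))"
      have m: "dC (Suc (Suc i)) x \<in> carrier (Fr R (rC (Suc (Suc i))))" by (rule lin_closed[OF c(3) x])
      have m': "\<tau>' (dC (Suc (Suc i)) x) \<in> carrier (Fr R (rA (Suc i)))" by (rule lin_closed[OF \<tau>'(1) m])
      then show "\<ominus>\<^bsub>Fr R (rA (Suc i))\<^esub> \<tau>' (dC (Suc (Suc i)) x) \<in> carrier (Fr R (rA (Suc i)))" by simp
      show "dA i (\<ominus>\<^bsub>Fr R (rA (Suc i))\<^esub> \<tau>' (dC (Suc (Suc i)) x)) = \<zero>\<^bsub>Fr R (rA i)\<^esub>"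
        using lin_neg[OF Fr_module Fr_module a(3) m'] \<tau>'(2)[OF m] c(5)[OF x] lz[OF l] by simp
    qed
    then show ?thesis using \<tau>'(2) by (auto simp: Q_def)
  qed
  have "\<exists>\<tau>. \<forall>i. (P i (\<tau> i) \<and> (i = 0 \<longrightarrow> \<tau> i = \<tau>0)) \<and> Q i (\<tau> i) (\<tau> (Suc i))"
    by (rule dependent_nat_choice) (use P0 step in auto)
  then obtain \<tau> where \<tau>': "\<And>i. P i (\<tau> i)" "\<tau> 0 = \<tau>0" "\<And>i. Q i (\<tau> i) (\<tau> (Suc i))" by blast
  have \<tau>: "lin R (Fr R (rC (Suc i))) (Fr R (rA i)) (\<tau> i)" for i using \<tau>'(1) by (simp add: P_def)
  have \<tau>d: "dA i (\<tau> (Suc i) x) = \<ominus>\<^bsub>Fr R (rA i)\<^esub> \<tau> i (dC (Suc i) x)"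
    if "x \<in> carrier (Fr R (rC (Suc (Suc i))))" for i x using \<tau>'(3) that by (simp add: Q_def)
  have \<tau>e: "f (eA (\<tau> 0 x)) = \<ominus>\<^bsub>B\<^esub> \<epsilon> (dC 0 x)" if "x \<in> carrier (Fr R (rC (Suc 0)))" for x
    using \<tau>0(2)[OF that] \<tau>'(2) by simp
  define dB where "dB = (\<lambda>i z. vjoin (rA i) (rC i)
     (dA i (vfst (rA (Suc i)) z) \<oplus>\<^bsub>Fr R (rA i)\<^esub> \<tau> i (vsnd (rA (Suc i)) (rC (Suc i)) z))
     (dC i (vsnd (rA (Suc i)) (rC (Suc i)) z)))"
  define eB where "eB = (\<lambda>z. f (eA (vfst (rA 0) z)) \<oplus>\<^bsub>B\<^esub> \<epsilon> (vsnd (rA 0) (rC 0) z))"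
  have dB: "dB i (vjoin (rA (Suc i)) (rC (Suc i)) x y) =
      vjoin (rA i) (rC i) (dA i x \<oplus>\<^bsub>Fr R (rA i)\<^esub> \<tau> i y) (dC i y)"
    if "x \<in> carrier (Fr R (rA (Suc i)))" "y \<in> carrier (Fr R (rC (Suc i)))" for i x y
    using that by (simp add: dB_def vfst_vjoin vsnd_vjoin)
  have eB: "eB (vjoin (rA 0) (rC 0) x y) = f (eA x) \<oplus>\<^bsub>B\<^esub> \<epsilon> y"
    if "x \<in> carrier (Fr R (rA 0))" "y \<in> carrier (Fr R (rC 0))" for x y
    using that by (simp add: eB_def vfst_vjoin vsnd_vjoin)
  note clA = lin_closed[OF a(3)] lin_closed[OF a(1)] and clC = lin_closed[OF c(3)] lin_closed[OF c(1)]
    and cl\<tau> = lin_closed[OF \<tau>] and cl\<epsilon> = lin_closed[OF \<epsilon>(1)] and clf = lin_closed[OF fg(1)]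
    and clg = lin_closed[OF fg(2)]
  have "res R B (\<lambda>i. rA i + rC i) dB eB"
  proof (rule resI)
    show "lin R (Fr R (rA 0 + rC 0)) B eB"
      unfolding eB_def
      by (intro lin_plus B Fr_module lin_comp[OF lin_vfst lin_comp[OF a(1) fg(1)]] lin_comp[OF lin_vsnd \<epsilon>(1)])
    show "lin R (Fr R (rA (Suc i) + rC (Suc i))) (Fr R (rA i + rC i)) (dB i)" for i
      unfolding dB_def
      by (intro lin_vjoin lin_plus Fr_module lin_comp[OF lin_vfst a(3)] lin_comp[OF lin_vsnd \<tau>]
          lin_comp[OF lin_vsnd c(3)])
  next
    fix b assume b: "b \<in> carrier B"
    obtain y where y: "y \<in> carrier (Fr R (rC 0))" "eC y = g b" using c(2)[OF clg[OF b]] by blast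
    have "g (b \<ominus>\<^bsub>B\<^esub> \<epsilon> y) = \<zero>\<^bsub>C\<^esub>"
      using y b \<epsilon>(2)[OF y(1)] by (intro lin_diff_zero[OF B C(1) fg(2)] cl\<epsilon>) auto
    then obtain a0 where a0: "a0 \<in> carrier A" "f a0 = b \<ominus>\<^bsub>B\<^esub> \<epsilon> y"
      using fg(5)[of "b \<ominus>\<^bsub>B\<^esub> \<epsilon> y"] b cl\<epsilon>[OF y(1)] by auto
    obtain x where x: "x \<in> carrier (Fr R (rA 0))" "eA x = a0" using a(2)[OF a0(1)] by blast
    have "eB (vjoin (rA 0) (rC 0) x y) = b"
      using a0 x b cl\<epsilon>[OF y(1)] B.diff_eq_iff[of b "\<epsilon> y" "f a0"] clf[OF a0(1)] by (simp add: eB[OF x(1) y(1)])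
    then show "\<exists>z\<in>carrier (Fr R (rA 0 + rC 0)). eB z = b" using vjoin_closed[OF x(1) y(1)] by blast
  next
    fix z assume "z \<in> carrier (Fr R (rA (Suc 0) + rC (Suc 0)))"
    then obtain x y where xy: "x \<in> carrier (Fr R (rA (Suc 0)))" "y \<in> carrier (Fr R (rC (Suc 0)))"
      and z: "z = vjoin (rA (Suc 0)) (rC (Suc 0)) x y" by (rule vjoin_split)
    show "eB (dB 0 z) = \<zero>\<^bsub>B\<^esub>"
      using xy clA cl\<tau> clC cl\<epsilon> clf
      by (simp add: z dB eB lin_add[OF a(1)] lin_add[OF fg(1)] a(4) \<tau>e lin_zero[OF A(1) B fg(1)] B.l_neg)
  next
    fix i z assume "z \<in> carrier (Fr R (rA (Suc (Suc i)) + rC (Suc (Suc i))))"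
    then obtain x y where xy: "x \<in> carrier (Fr R (rA (Suc (Suc i))))" "y \<in> carrier (Fr R (rC (Suc (Suc i))))"
      and z: "z = vjoin (rA (Suc (Suc i))) (rC (Suc (Suc i))) x y" by (rule vjoin_split)
    show "dB i (dB (Suc i) z) = \<zero>\<^bsub>Fr R (rA i + rC i)\<^esub>"
      using xy clA cl\<tau> clC
      by (simp add: z dB lin_add[OF a(3)] a(5) c(5) \<tau>d F.l_neg vjoin_zero)
  next
    fix z assume "z \<in> carrier (Fr R (rA 0 + rC 0))" and "eB z = \<zero>\<^bsub>B\<^esub>"
    then obtain x y where xy: "x \<in> carrier (Fr R (rA 0))" "y \<in> carrier (Fr R (rC 0))"
      and z: "z = vjoin (rA 0) (rC 0) x y" and 0: "f (eA x) \<oplus>\<^bsub>B\<^esub> \<epsilon> y = \<zero>\<^bsub>B\<^esub>"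
      using eB by (metis vjoin_split)
    have m: "eA x \<in> carrier A" "f (eA x) \<in> carrier B" "\<epsilon> y \<in> carrier B"
      using xy clA cl\<epsilon> clf by auto
    have "g (f (eA x)) \<oplus>\<^bsub>C\<^esub> g (\<epsilon> y) = \<zero>\<^bsub>C\<^esub>"
      using lin_add[OF fg(2) m(2,3)] 0 lin_zero[OF B C(1) fg(2)] by simp
    then have "eC y = \<zero>\<^bsub>C\<^esub>" using fg(4)[OF m(1)] \<epsilon>(2)[OF xy(2)] clC(2)[OF xy(2)] by simp
    then obtain y' where y': "y' \<in> carrier (Fr R (rC (Suc 0)))" "dC 0 y' = y" using c(6)[OF xy(2)] by blast
    have m\<tau>: "\<tau> 0 y' \<in> carrier (Fr R (rA 0))" by (rule cl\<tau>[OF y'(1)])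
    have "f (eA x) = f (eA (\<tau> 0 y'))"
      using \<tau>e[OF y'(1)] y'(2) 0 m by (simp add: B.minus_equality)
    then have "eA x = eA (\<tau> 0 y')" by (intro fg(3) m clA(2) m\<tau>)
    then have "eA (x \<ominus>\<^bsub>Fr R (rA 0)\<^esub> \<tau> 0 y') = \<zero>\<^bsub>A\<^esub>"
      by (intro lin_diff_zero[OF Fr_module A(1) a(1) xy(1) m\<tau>])
    then obtain x' where x': "x' \<in> carrier (Fr R (rA (Suc 0)))" "dA 0 x' = x \<ominus>\<^bsub>Fr R (rA 0)\<^esub> \<tau> 0 y'"
      using a(6)[of "x \<ominus>\<^bsub>Fr R (rA 0)\<^esub> \<tau> 0 y'"] xy m\<tau> by auto
    have "dB 0 (vjoin (rA (Suc 0)) (rC (Suc 0)) x' y') = z"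
      using x'(2) y' xy m\<tau> F.diff_eq_iff[OF xy(1) m\<tau> clA(1)[OF x'(1)]] by (simp add: dB[OF x'(1) y'(1)] z)
    then show "\<exists>w\<in>carrier (Fr R (rA (Suc 0) + rC (Suc 0))). dB 0 w = z"
      using vjoin_closed[OF x'(1) y'(1)] by blast
  next
    fix i z assume "z \<in> carrier (Fr R (rA (Suc i) + rC (Suc i)))" and "dB i z = \<zero>\<^bsub>Fr R (rA i + rC i)\<^esub>"
    then obtain x y where xy: "x \<in> carrier (Fr R (rA (Suc i)))" "y \<in> carrier (Fr R (rC (Suc i)))"
      and z: "z = vjoin (rA (Suc i)) (rC (Suc i)) x y"
      and 0: "vjoin (rA i) (rC i) (dA i x \<oplus>\<^bsub>Fr R (rA i)\<^esub> \<tau> i y) (dC i y) = \<zero>\<^bsub>Fr R (rA i + rC i)\<^esub>"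
      using dB by (metis vjoin_split)
    have m: "dA i x \<in> carrier (Fr R (rA i))" "\<tau> i y \<in> carrier (Fr R (rA i))" "dC i y \<in> carrier (Fr R (rC i))"
      using xy clA cl\<tau> clC by auto
    have 1: "dA i x \<oplus>\<^bsub>Fr R (rA i)\<^esub> \<tau> i y = \<zero>\<^bsub>Fr R (rA i)\<^esub>" "dC i y = \<zero>\<^bsub>Fr R (rC i)\<^esub>"
      using vjoin_eq_zero[OF 0] m by auto
    then obtain y' where y': "y' \<in> carrier (Fr R (rC (Suc (Suc i))))" "dC (Suc i) y' = y" using c(7)[OF xy(2)] by blast
    have m\<tau>: "\<tau> (Suc i) y' \<in> carrier (Fr R (rA (Suc i)))" by (rule cl\<tau>[OF y'(1)])
    have "dA i x = dA i (\<tau> (Suc i) y')"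
      using \<tau>d[OF y'(1)] y'(2) 1 m by (simp add: F.minus_equality)
    then have "dA i (x \<ominus>\<^bsub>Fr R (rA (Suc i))\<^esub> \<tau> (Suc i) y') = \<zero>\<^bsub>Fr R (rA i)\<^esub>"
      by (intro lin_diff_zero[OF Fr_module Fr_module a(3) xy(1) m\<tau>])
    then obtain x' where x': "x' \<in> carrier (Fr R (rA (Suc (Suc i))))"
        "dA (Suc i) x' = x \<ominus>\<^bsub>Fr R (rA (Suc i))\<^esub> \<tau> (Suc i) y'"
      using a(7)[of "x \<ominus>\<^bsub>Fr R (rA (Suc i))\<^esub> \<tau> (Suc i) y'"] xy m\<tau> by auto
    have "dB (Suc i) (vjoin (rA (Suc (Suc i))) (rC (Suc (Suc i))) x' y') = z"
      using x'(2) y' xy m\<tau> F.diff_eq_iff[OF xy(1) m\<tau> clA(1)[OF x'(1)]] by (simp add: dB[OF x'(1) y'(1)] z)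
    then show "\<exists>w\<in>carrier (Fr R (rA (Suc (Suc i)) + rC (Suc (Suc i)))). dB (Suc i) w = z"
      using vjoin_closed[OF x'(1) y'(1)] by blast
  qed
  moreover have "ext_vanish R (\<lambda>i. rA i + rC i) dB" if v: "ext_vanish R rA dA" "ext_vanish R rC dC"
  proof (rule ext_vanishI)
    fix i F assume F: "lin R (Fr R (rA (Suc i) + rC (Suc i))) (ring_mod R) F"
      and F0: "\<And>x. x \<in> carrier (Fr R (rA (Suc (Suc i)) + rC (Suc (Suc i)))) \<Longrightarrow> F (dB (Suc i) x) = \<zero>"
    let ?j = "vjoin (rA (Suc i)) (rC (Suc i))"
    let ?FA = "\<lambda>x. F (?j x \<zero>\<^bsub>Fr R (rC (Suc i))\<^esub>)" and ?FC = "\<lambda>y. F (?j \<zero>\<^bsub>Fr R (rA (Suc i))\<^esub> y)"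
    have FA: "lin R (Fr R (rA (Suc i))) (ring_mod R) ?FA"
      by (rule lin_comp[OF lin_vjoin[OF lin_id lin_const_zero[OF Fr_module Fr_module]] F])
    have FC: "lin R (Fr R (rC (Suc i))) (ring_mod R) ?FC"
      by (rule lin_comp[OF lin_vjoin[OF lin_const_zero[OF Fr_module Fr_module] lin_id] F])
    have Fs: "F (?j x y) = ?FA x \<oplus> ?FC y"
      if "x \<in> carrier (Fr R (rA (Suc i)))" "y \<in> carrier (Fr R (rC (Suc i)))" for x y
      using vjoin_sum[OF ring_mod_module that] lin_add[OF F vjoin_closed vjoin_closed] that by simp
    \<comment> \<open>On the first summand \<open>F\<close> is a cocycle for \<open>A\<close>, hence
      of the form \<open>GA \<circ> dA\<close>. Subtracting \<open>GA \<circ> \<tau>\<close> from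
      its second component leaves a cocycle for \<open>C\<close>, again by
      \<open>dA \<circ> \<tau> = - \<tau> \<circ> dC\<close>.\<close>
    have "?FA (dA (Suc i) x) = \<zero>" if x: "x \<in> carrier (Fr R (rA (Suc (Suc i))))" for x
      using F0[OF vjoin_closed[OF x F.zero_closed]] x clA(1)[OF x]
      by (simp add: dB lz[OF \<tau>] lz[OF c(3)])
    from ext_vanishD[OF v(1) FA this]
    obtain GA where GA: "lin R (Fr R (rA i)) (ring_mod R) GA"
      "\<And>x. x \<in> carrier (Fr R (rA (Suc i))) \<Longrightarrow> ?FA x = GA (dA i x)" by blast
    let ?H = "\<lambda>y. ?FC y \<ominus>\<^bsub>ring_mod R\<^esub> GA (\<tau> i y)"
    have H: "lin R (Fr R (rC (Suc i))) (ring_mod R) ?H"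
      by (intro lin_sub ring_mod_module Fr_module FC lin_comp[OF \<tau> GA(1)])
    note clG = lin_closed[OF GA(1), simplified] and clFA = lin_closed[OF FA, simplified] and clFC = lin_closed[OF FC, simplified]
    have "?H (dC (Suc i) y) = \<zero>" if y: "y \<in> carrier (Fr R (rC (Suc (Suc i))))" for y
    proof -
      have m: "dC (Suc i) y \<in> carrier (Fr R (rC (Suc i)))" "\<tau> (Suc i) y \<in> carrier (Fr R (rA (Suc i)))"
        using clC(1) cl\<tau> y by auto
      have "F (dB (Suc i) (vjoin (rA (Suc (Suc i))) (rC (Suc (Suc i))) \<zero>\<^bsub>Fr R (rA (Suc (Suc i)))\<^esub> y)) = \<zero>"
        by (rule F0[OF vjoin_closed[OF F.zero_closed y]])
      then have "F (?j (\<tau> (Suc i) y) (dC (Suc i) y)) = \<zero>" using y m by (simp add: dB lz[OF a(3)])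
      then have "GA (\<ominus>\<^bsub>Fr R (rA i)\<^esub> \<tau> i (dC (Suc i) y)) \<oplus> ?FC (dC (Suc i) y) = \<zero>"
        using Fs[OF m(2,1)] GA(2)[OF m(2)] \<tau>d[OF y] by simp
      then have "\<ominus> GA (\<tau> i (dC (Suc i) y)) \<oplus> ?FC (dC (Suc i) y) = \<zero>"
        using lin_neg[OF Fr_module ring_mod_module GA(1) cl\<tau>[OF m(1)]] by simp
      then show ?thesis using clG[OF cl\<tau>[OF m(1)]] clFC[OF m(1)]
        by (simp add: a_minus_def a_comm)
    qed
    from ext_vanishD[OF v(2) H this]
    obtain GC where GC: "lin R (Fr R (rC i)) (ring_mod R) GC"
      "\<And>x. x \<in> carrier (Fr R (rC (Suc i))) \<Longrightarrow> ?H x = GC (dC i x)" by blast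
    let ?G = "\<lambda>z. GA (vfst (rA i) z) \<oplus>\<^bsub>ring_mod R\<^esub> GC (vsnd (rA i) (rC i) z)"
    have "lin R (Fr R (rA i + rC i)) (ring_mod R) ?G"
      by (intro lin_plus ring_mod_module Fr_module lin_comp[OF lin_vfst GA(1)] lin_comp[OF lin_vsnd GC(1)])
    moreover have "F z = ?G (dB i z)" if "z \<in> carrier (Fr R (rA (Suc i) + rC (Suc i)))" for z
    proof -
      from that obtain x y where xy: "x \<in> carrier (Fr R (rA (Suc i)))" "y \<in> carrier (Fr R (rC (Suc i)))"
        and z: "z = ?j x y" by (rule vjoin_split)
      have m: "dA i x \<in> carrier (Fr R (rA i))" "\<tau> i y \<in> carrier (Fr R (rA i))" "dC i y \<in> carrier (Fr R (rC i))"
        using xy clA cl\<tau> clC by auto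
      have k: "GA (dA i x) \<in> carrier R" "GA (\<tau> i y) \<in> carrier R" "?FC y \<in> carrier R" using m clG clFC xy by auto
      have "?G (dB i z) = GA (dA i x \<oplus>\<^bsub>Fr R (rA i)\<^esub> \<tau> i y) \<oplus> GC (dC i y)"
        using m by (simp add: z dB[OF xy] vfst_vjoin[of _ "ring_mod R"] vsnd_vjoin[of _ "ring_mod R"])
      also have "\<dots> = GA (dA i x) \<oplus> GA (\<tau> i y) \<oplus> (?FC y \<ominus> GA (\<tau> i y))"
        using lin_add[OF GA(1) m(1,2)] GC(2)[OF xy(2)] by simp
      also have "\<dots> = GA (dA i x) \<oplus> ?FC y" using k by algebra
      also have "\<dots> = F z" using Fs[OF xy] GA(2)[OF xy(1)] by (simp add: z)
      finally show ?thesis by simp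
    qed
    ultimately show "\<exists>G. lin R (Fr R (rA i + rC i)) (ring_mod R) G \<and>
        (\<forall>z\<in>carrier (Fr R (rA (Suc i) + rC (Suc i))). F z = G (dB i z))" by blast
  qed
  ultimately show ?thesis by blast
qed

end

section \<open>Submodules and quotient modules\<close>

lemma submodule_memD:
  assumes "module R M" "submodule N R M"
  shows "x \<in> N \<Longrightarrow> x \<in> carrier M" "\<zero>\<^bsub>M\<^esub> \<in> N" "x \<in> N \<Longrightarrow> y \<in> N \<Longrightarrow> x \<oplus>\<^bsub>M\<^esub> y \<in> N"
    "x \<in> N \<Longrightarrow> \<ominus>\<^bsub>M\<^esub> x \<in> N" "x \<in> N \<Longrightarrow> y \<in> N \<Longrightarrow> x \<ominus>\<^bsub>M\<^esub> y \<in> N"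
    "a \<in> carrier R \<Longrightarrow> x \<in> N \<Longrightarrow> a \<odot>\<^bsub>M\<^esub> x \<in> N"
proof -
  interpret M: module R M by fact
  note * = M.submoduleE[OF assms(2)]
  show z: "x \<in> N \<Longrightarrow> x \<in> carrier M" "x \<in> N \<Longrightarrow> y \<in> N \<Longrightarrow> x \<oplus>\<^bsub>M\<^esub> y \<in> N"
    "x \<in> N \<Longrightarrow> \<ominus>\<^bsub>M\<^esub> x \<in> N" "a \<in> carrier R \<Longrightarrow> x \<in> N \<Longrightarrow> a \<odot>\<^bsub>M\<^esub> x \<in> N" for x y
    using * by auto
  show "x \<in> N \<Longrightarrow> y \<in> N \<Longrightarrow> x \<ominus>\<^bsub>M\<^esub> y \<in> N" unfolding a_minus_def using z by blast
  obtain w where "w \<in> N" using *(2) by blast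
  then show "\<zero>\<^bsub>M\<^esub> \<in> N" using z(2)[OF _ z(3), of w w] z(1)[of w] by (simp add: M.r_neg)
qed

lemma submodule_finsum:
  assumes "module R M" "submodule N R M" "finite S" "\<And>i. i \<in> S \<Longrightarrow> x i \<in> N"
  shows "finsum M x S \<in> N"
proof -
  interpret M: module R M by fact
  note s = submodule_memD[OF assms(1,2)]
  show ?thesis using assms(3,4)
  proof (induction S)
    case empty
    then show ?case using s(2) by simp
  next
    case (insert i S)
    then show ?case using s(1,3) by (subst M.finsum_insert) auto
  qed
qed

lemma submodule_kernel:
  assumes "module R X" "module R Y" "lin R X Y f"
  shows "submodule {x \<in> carrier X. f x = \<zero>\<^bsub>Y\<^esub>} R X"
proof -
  interpret X: module R X by fact
  interpret Y: module R Y by fact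
  show ?thesis
    by (rule X.submoduleI)
      (auto simp: lin_zero[OF assms] lin_neg[OF assms] lin_add[OF assms(3)] lin_smult[OF assms(3)])
qed

lemma submodule_preimage:
  assumes "module R X" "module R Y" "lin R X Y f" "submodule N R Y"
  shows "submodule {x \<in> carrier X. f x \<in> N} R X"
proof -
  interpret X: module R X by fact
  note s = submodule_memD[OF assms(2,4)]
  show ?thesis
    by (rule X.submoduleI)
      (auto simp: lin_zero[OF assms(1-3)] lin_neg[OF assms(1-3)] lin_add[OF assms(3)] lin_smult[OF assms(3)] s)
qed

text \<open>The factorization property of an arbitrary surjection \<open>p\<close>; besides coset
  maps it serves for the projection of \<open>R^n\<close> onto \<open>(R/I)^n\<close> and for a
  surjective restriction map between duals.\<close>

lemma lin_descend:
  assumes "module R X" "module R B" "module R Z" "lin R X B p" "lin R X Z u"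
    "\<And>b. b \<in> carrier B \<Longrightarrow> \<exists>x\<in>carrier X. p x = b"
    "\<And>x. x \<in> carrier X \<Longrightarrow> p x = \<zero>\<^bsub>B\<^esub> \<Longrightarrow> u x = \<zero>\<^bsub>Z\<^esub>"
  shows "\<exists>h. lin R B Z h \<and> (\<forall>x\<in>carrier X. h (p x) = u x)"
proof -
  interpret X: module R X by fact
  interpret B: module R B by fact
  interpret Z: module R Z by fact
  obtain s where s: "\<And>b. b \<in> carrier B \<Longrightarrow> s b \<in> carrier X \<and> p (s b) = b"
    using assms(6) by metis
  have w: "u x = u y" if "x \<in> carrier X" "y \<in> carrier X" "p x = p y" for x y
  proof -
    have "u (x \<ominus>\<^bsub>X\<^esub> y) = \<zero>\<^bsub>Z\<^esub>"
      using that by (intro assms(7) lin_diff_zero[OF assms(1,2,4)]) auto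
    then show ?thesis
      using that lin_closed[OF assms(5)] by (simp add: lin_minus[OF assms(1,3,5)] Z.diff_eq_zero_iff)
  qed
  have "lin R B Z (\<lambda>b. u (s b))"
  proof (rule linI)
    show "u (s b) \<in> carrier Z" if "b \<in> carrier B" for b using s[OF that] lin_closed[OF assms(5)] by blast
    show "u (s (b \<oplus>\<^bsub>B\<^esub> c)) = u (s b) \<oplus>\<^bsub>Z\<^esub> u (s c)" if "b \<in> carrier B" "c \<in> carrier B" for b c
      unfolding lin_add[OF assms(5) conjunct1[OF s[OF that(1)]] conjunct1[OF s[OF that(2)]], symmetric]
      by (rule w) (use s that in \<open>auto simp: lin_add[OF assms(4)]\<close>)
    show "u (s (a \<odot>\<^bsub>B\<^esub> b)) = a \<odot>\<^bsub>Z\<^esub> u (s b)" if "a \<in> carrier R" "b \<in> carrier B" for a b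
      unfolding lin_smult[OF assms(5) that(1) conjunct1[OF s[OF that(2)]], symmetric]
      by (rule w) (use s that in \<open>auto simp: lin_smult[OF assms(4)]\<close>)
  qed
  moreover have "u (s (p x)) = u x" if "x \<in> carrier X" for x
    using s[OF lin_closed[OF assms(4) that]] that by (intro w) auto
  ultimately show ?thesis by blast
qed

text \<open>\<open>B\<close> is the sum of the images of \<open>p\<close> and \<open>q\<close>,
  hence the pushout of \<open>X\<close> and \<open>Y\<close> over the pairs with
  \<open>p x = q y\<close>, and two maps that agree on such pairs glue. Well-definedness is reduced
  to \<open>ker\<close> by collecting the differences of \<open>X\<close> and of \<open>Y\<close> on
  opposite sides.\<close>

lemma lin_descend2:
  assumes "module R X" "module R Y" "module R B" "module R Z"
    and p: "lin R X B p" and q: "lin R Y B q" and u: "lin R X Z u" and v: "lin R Y Z v"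
    and sur: "\<And>b. b \<in> carrier B \<Longrightarrow> \<exists>x\<in>carrier X. \<exists>y\<in>carrier Y. p x \<oplus>\<^bsub>B\<^esub> q y = b"
    and ker: "\<And>x y. x \<in> carrier X \<Longrightarrow> y \<in> carrier Y \<Longrightarrow> p x = q y \<Longrightarrow> u x = v y"
  shows "\<exists>h. lin R B Z h \<and> (\<forall>x\<in>carrier X. h (p x) = u x) \<and> (\<forall>y\<in>carrier Y. h (q y) = v y)"
proof -
  interpret X: module R X by fact
  interpret Y: module R Y by fact
  interpret B: module R B by fact
  interpret Z: module R Z by fact
  note cl = lin_closed[OF p] lin_closed[OF q] lin_closed[OF u] lin_closed[OF v]
  obtain s t where s: "\<And>b. b \<in> carrier B \<Longrightarrow> s b \<in> carrier X"
    "\<And>b. b \<in> carrier B \<Longrightarrow> t b \<in> carrier Y" "\<And>b. b \<in> carrier B \<Longrightarrow> p (s b) \<oplus>\<^bsub>B\<^esub> q (t b) = b"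
    using sur by metis
  have w: "u x \<oplus>\<^bsub>Z\<^esub> v y = u x' \<oplus>\<^bsub>Z\<^esub> v y'"
    if m: "x \<in> carrier X" "y \<in> carrier Y" "x' \<in> carrier X" "y' \<in> carrier Y"
      and e: "p x \<oplus>\<^bsub>B\<^esub> q y = p x' \<oplus>\<^bsub>B\<^esub> q y'" for x y x' y'
  proof -
    have "p x \<ominus>\<^bsub>B\<^esub> p x' = q y' \<ominus>\<^bsub>B\<^esub> q y"
    proof -
      have "p x = p x \<oplus>\<^bsub>B\<^esub> q y \<ominus>\<^bsub>B\<^esub> q y" using m cl by (simp add: a_minus_def B.a_assoc B.r_neg)
      also have "\<dots> = p x' \<oplus>\<^bsub>B\<^esub> q y' \<ominus>\<^bsub>B\<^esub> q y" by (simp add: e)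
      also have "\<dots> = (q y' \<ominus>\<^bsub>B\<^esub> q y) \<oplus>\<^bsub>B\<^esub> p x'" using m cl by (simp add: a_minus_def B.a_ac)
      finally show ?thesis using m cl by (subst B.diff_eq_iff) auto
    qed
    then have "u (x \<ominus>\<^bsub>X\<^esub> x') = v (y' \<ominus>\<^bsub>Y\<^esub> y)"
      using m by (intro ker) (auto simp: lin_minus[OF assms(1,3) p] lin_minus[OF assms(2,3) q])
    then have "u x \<ominus>\<^bsub>Z\<^esub> u x' = v y' \<ominus>\<^bsub>Z\<^esub> v y"
      using m by (auto simp: lin_minus[OF assms(1,4) u] lin_minus[OF assms(2,4) v])
    then have "u x = (v y' \<ominus>\<^bsub>Z\<^esub> v y) \<oplus>\<^bsub>Z\<^esub> u x'" using m cl by (subst (asm) Z.diff_eq_iff) auto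
    then have "u x \<oplus>\<^bsub>Z\<^esub> v y = (u x' \<oplus>\<^bsub>Z\<^esub> v y') \<oplus>\<^bsub>Z\<^esub> (\<ominus>\<^bsub>Z\<^esub> v y \<oplus>\<^bsub>Z\<^esub> v y)"
      using m cl by (simp add: a_minus_def Z.a_ac)
    then show ?thesis using m cl by (simp add: Z.l_neg)
  qed
  let ?h = "\<lambda>b. u (s b) \<oplus>\<^bsub>Z\<^esub> v (t b)"
  have "lin R B Z ?h"
  proof (rule linI)
    show "?h b \<in> carrier Z" if "b \<in> carrier B" for b using s that cl by simp
  next
    fix b c assume bc: "b \<in> carrier B" "c \<in> carrier B"
    note m = s(1,2)[OF bc(1)] s(1,2)[OF bc(2)]
    have "?h (b \<oplus>\<^bsub>B\<^esub> c) = u (s b \<oplus>\<^bsub>X\<^esub> s c) \<oplus>\<^bsub>Z\<^esub> v (t b \<oplus>\<^bsub>Y\<^esub> t c)"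
    proof (rule w)
      have "p (s (b \<oplus>\<^bsub>B\<^esub> c)) \<oplus>\<^bsub>B\<^esub> q (t (b \<oplus>\<^bsub>B\<^esub> c)) = b \<oplus>\<^bsub>B\<^esub> c" using bc by (simp add: s)
      also have "\<dots> = (p (s b) \<oplus>\<^bsub>B\<^esub> q (t b)) \<oplus>\<^bsub>B\<^esub> (p (s c) \<oplus>\<^bsub>B\<^esub> q (t c))" using bc by (simp add: s)
      also have "\<dots> = p (s b \<oplus>\<^bsub>X\<^esub> s c) \<oplus>\<^bsub>B\<^esub> q (t b \<oplus>\<^bsub>Y\<^esub> t c)"
        using m cl by (simp add: lin_add[OF p] lin_add[OF q] B.a_ac)
      finally show "p (s (b \<oplus>\<^bsub>B\<^esub> c)) \<oplus>\<^bsub>B\<^esub> q (t (b \<oplus>\<^bsub>B\<^esub> c)) = p (s b \<oplus>\<^bsub>X\<^esub> s c) \<oplus>\<^bsub>B\<^esub> q (t b \<oplus>\<^bsub>Y\<^esub> t c)" .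
    qed (use s bc in auto)
    also have "\<dots> = ?h b \<oplus>\<^bsub>Z\<^esub> ?h c"
      using m cl by (simp add: lin_add[OF u] lin_add[OF v] Z.a_ac)
    finally show "?h (b \<oplus>\<^bsub>B\<^esub> c) = ?h b \<oplus>\<^bsub>Z\<^esub> ?h c" .
  next
    fix a b assume bc: "a \<in> carrier R" "b \<in> carrier B"
    note m = s(1,2)[OF bc(2)]
    have "?h (a \<odot>\<^bsub>B\<^esub> b) = u (a \<odot>\<^bsub>X\<^esub> s b) \<oplus>\<^bsub>Z\<^esub> v (a \<odot>\<^bsub>Y\<^esub> t b)"
    proof (rule w)
      have "p (s (a \<odot>\<^bsub>B\<^esub> b)) \<oplus>\<^bsub>B\<^esub> q (t (a \<odot>\<^bsub>B\<^esub> b)) = a \<odot>\<^bsub>B\<^esub> b" using bc by (simp add: s)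
      also have "\<dots> = a \<odot>\<^bsub>B\<^esub> (p (s b) \<oplus>\<^bsub>B\<^esub> q (t b))" using bc by (simp add: s)
      also have "\<dots> = p (a \<odot>\<^bsub>X\<^esub> s b) \<oplus>\<^bsub>B\<^esub> q (a \<odot>\<^bsub>Y\<^esub> t b)"
        using m cl bc by (simp add: lin_smult[OF p] lin_smult[OF q] B.smult_r_distr)
      finally show "p (s (a \<odot>\<^bsub>B\<^esub> b)) \<oplus>\<^bsub>B\<^esub> q (t (a \<odot>\<^bsub>B\<^esub> b)) = p (a \<odot>\<^bsub>X\<^esub> s b) \<oplus>\<^bsub>B\<^esub> q (a \<odot>\<^bsub>Y\<^esub> t b)" .
    qed (use s bc in auto)
    also have "\<dots> = a \<odot>\<^bsub>Z\<^esub> ?h b"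
      using m cl bc by (simp add: lin_smult[OF u] lin_smult[OF v] Z.smult_r_distr)
    finally show "?h (a \<odot>\<^bsub>B\<^esub> b) = a \<odot>\<^bsub>Z\<^esub> ?h b" .
  qed
  moreover have "?h (p x) = u x" if x: "x \<in> carrier X" for x
  proof -
    have "?h (p x) = u x \<oplus>\<^bsub>Z\<^esub> v \<zero>\<^bsub>Y\<^esub>"
      by (rule w) (use s x cl lin_zero[OF assms(2,3) q] in auto)
    then show ?thesis using x cl lin_zero[OF assms(2,4) v] by simp
  qed
  moreover have "?h (q y) = v y" if y: "y \<in> carrier Y" for y
  proof -
    have "?h (q y) = u \<zero>\<^bsub>X\<^esub> \<oplus>\<^bsub>Z\<^esub> v y"
      by (rule w) (use s y cl lin_zero[OF assms(1,3) p] in auto)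
    then show ?thesis using y cl lin_zero[OF assms(1,4) u] by simp
  qed
  ultimately show ?thesis by blast
qed

context
  fixes R :: "('a, 'r) ring_scheme" and M :: "('a, 'b) module" and N
  assumes M: "module R M" and N: "submodule N R M"
begin

interpretation M: module R M by (rule M)

lemma submodule_abelian_subgroup: "abelian_subgroup N M"
  using N by (intro abelian_subgroupI3 additive_subgroup.intro M.M.abelian_group_axioms)
    (simp add: submodule_def)

interpretation N: abelian_subgroup N M by (rule submodule_abelian_subgroup)

lemma quot_mod_carrier: "carrier (quot_mod R M N) = (\<lambda>x. N +>\<^bsub>M\<^esub> x) ` carrier M"
  by (auto simp: quot_mod_def A_RCOSETS_def')

lemma coset_eq_iff:
  assumes "x \<in> carrier M" "y \<in> carrier M"
  shows "N +>\<^bsub>M\<^esub> x = N +>\<^bsub>M\<^esub> y \<longleftrightarrow> x \<ominus>\<^bsub>M\<^esub> y \<in> N"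
proof
  assume "N +>\<^bsub>M\<^esub> x = N +>\<^bsub>M\<^esub> y"
  then have "x \<in> N +>\<^bsub>M\<^esub> y" using N.a_rcos_self[OF assms(1)] by simp
  then obtain h where h: "h \<in> N" "x = h \<oplus>\<^bsub>M\<^esub> y" by (auto simp: a_r_coset_def')
  then show "x \<ominus>\<^bsub>M\<^esub> y \<in> N" using assms M.diff_eq_iff[of x y h] N.a_subset by auto
next
  assume h: "x \<ominus>\<^bsub>M\<^esub> y \<in> N"
  have "x = (x \<ominus>\<^bsub>M\<^esub> y) \<oplus>\<^bsub>M\<^esub> y" using assms by (simp add: M.diff_eq_iff[symmetric])
  then have "x \<in> N +>\<^bsub>M\<^esub> y" using h by (auto simp: a_r_coset_def')
  then show "N +>\<^bsub>M\<^esub> x = N +>\<^bsub>M\<^esub> y"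
    using M.a_repr_independence[OF _ assms(2)] N.a_subgroup by metis
qed

lemma coset_zero: "N +>\<^bsub>M\<^esub> \<zero>\<^bsub>M\<^esub> = \<zero>\<^bsub>quot_mod R M N\<^esub>"
  using N.a_subset by (simp add: quot_mod_def)

lemma coset_add:
  "x \<in> carrier M \<Longrightarrow> y \<in> carrier M \<Longrightarrow>
    (N +>\<^bsub>M\<^esub> x) \<oplus>\<^bsub>quot_mod R M N\<^esub> (N +>\<^bsub>M\<^esub> y) = N +>\<^bsub>M\<^esub> (x \<oplus>\<^bsub>M\<^esub> y)"
  by (simp add: quot_mod_def N.a_rcos_sum)

lemma coset_smult:
  assumes "a \<in> carrier R" "x \<in> carrier M"
  shows "a \<odot>\<^bsub>quot_mod R M N\<^esub> (N +>\<^bsub>M\<^esub> x) = N +>\<^bsub>M\<^esub> (a \<odot>\<^bsub>M\<^esub> x)"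
proof -
  \<comment> \<open>All members of the union that defines the scalar multiple are the same coset,
    since \<open>N\<close> is closed under scalars.\<close>
  have e: "N +>\<^bsub>M\<^esub> (a \<odot>\<^bsub>M\<^esub> y) = N +>\<^bsub>M\<^esub> (a \<odot>\<^bsub>M\<^esub> x)" if "y \<in> N +>\<^bsub>M\<^esub> x" for y
  proof -
    from that obtain h where h: "h \<in> N" "y = h \<oplus>\<^bsub>M\<^esub> x" by (auto simp: a_r_coset_def')
    have hm: "h \<in> carrier M" using h N.a_subset by blast
    have "a \<odot>\<^bsub>M\<^esub> y \<ominus>\<^bsub>M\<^esub> a \<odot>\<^bsub>M\<^esub> x = a \<odot>\<^bsub>M\<^esub> h"
      using assms hm h(2) by (subst M.diff_eq_iff) (auto simp: M.smult_r_distr)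
    then show ?thesis
      using assms hm h submodule_memD(6)[OF M N assms(1) h(1)] by (subst coset_eq_iff) auto
  qed
  have "(\<Union>y\<in>N +>\<^bsub>M\<^esub> x. N +>\<^bsub>M\<^esub> (a \<odot>\<^bsub>M\<^esub> y)) = N +>\<^bsub>M\<^esub> (a \<odot>\<^bsub>M\<^esub> x)"
    by (rule UN_constant_eq[OF N.a_rcos_self[OF assms(2)]]) (use e in blast)
  then show ?thesis unfolding quot_mod_def module.simps .
qed

lemma quot_mod_module: "module R (quot_mod R M N)"
proof -
  let ?Q = "quot_mod R M N" and ?c = "\<lambda>x. N +>\<^bsub>M\<^esub> x"
  have e: "P X" if "X \<in> carrier ?Q" "\<And>x. x \<in> carrier M \<Longrightarrow> P (?c x)" for P X
    using that by (auto simp: quot_mod_carrier)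
  have m: "?c x \<in> carrier ?Q" if "x \<in> carrier M" for x
    using that by (auto simp: quot_mod_carrier)
  have ac: "X \<oplus>\<^bsub>?Q\<^esub> Y \<in> carrier ?Q" if "X \<in> carrier ?Q" "Y \<in> carrier ?Q" for X Y
    by (rule e[OF that(1)], rule e[OF that(2)]) (simp add: coset_add m)
  have zc: "\<zero>\<^bsub>?Q\<^esub> \<in> carrier ?Q" unfolding coset_zero[symmetric] by (simp add: m)
  have sc: "a \<odot>\<^bsub>?Q\<^esub> X \<in> carrier ?Q" if "a \<in> carrier R" "X \<in> carrier ?Q" for a X
    by (rule e[OF that(2)]) (simp add: coset_smult m that)
  show ?thesis
  proof (intro moduleI abelian_groupI M.R.is_cring ac zc sc)
    fix X Y Z assume X: "X \<in> carrier ?Q" and Y: "Y \<in> carrier ?Q" and Z: "Z \<in> carrier ?Q"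
    show "X \<oplus>\<^bsub>?Q\<^esub> Y \<oplus>\<^bsub>?Q\<^esub> Z = X \<oplus>\<^bsub>?Q\<^esub> (Y \<oplus>\<^bsub>?Q\<^esub> Z)"
      by (rule e[OF X], rule e[OF Y], rule e[OF Z]) (simp add: coset_add M.a_assoc)
  next
    fix X Y assume X: "X \<in> carrier ?Q" and Y: "Y \<in> carrier ?Q"
    show "X \<oplus>\<^bsub>?Q\<^esub> Y = Y \<oplus>\<^bsub>?Q\<^esub> X"
      by (rule e[OF X], rule e[OF Y]) (simp add: coset_add M.a_comm)
  next
    fix X assume X: "X \<in> carrier ?Q"
    show "\<zero>\<^bsub>?Q\<^esub> \<oplus>\<^bsub>?Q\<^esub> X = X"
      unfolding coset_zero[symmetric] by (rule e[OF X], subst coset_add) auto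
    show "\<exists>Y\<in>carrier ?Q. Y \<oplus>\<^bsub>?Q\<^esub> X = \<zero>\<^bsub>?Q\<^esub>"
    proof (rule e[OF X])
      fix x assume x: "x \<in> carrier M"
      have "?c (\<ominus>\<^bsub>M\<^esub> x) \<oplus>\<^bsub>?Q\<^esub> ?c x = \<zero>\<^bsub>?Q\<^esub>"
        unfolding coset_zero[symmetric] using x by (simp only: coset_add M.a_inv_closed M.l_neg)
      then show "\<exists>Y\<in>carrier ?Q. Y \<oplus>\<^bsub>?Q\<^esub> ?c x = \<zero>\<^bsub>?Q\<^esub>" using m x by blast
    qed
  next
    fix a b X assume a: "a \<in> carrier R" and b: "b \<in> carrier R" and X: "X \<in> carrier ?Q"
    show "(a \<oplus>\<^bsub>R\<^esub> b) \<odot>\<^bsub>?Q\<^esub> X = a \<odot>\<^bsub>?Q\<^esub> X \<oplus>\<^bsub>?Q\<^esub> b \<odot>\<^bsub>?Q\<^esub> X"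
      by (rule e[OF X]) (simp add: coset_add coset_smult M.smult_l_distr a b)
    show "(a \<otimes>\<^bsub>R\<^esub> b) \<odot>\<^bsub>?Q\<^esub> X = a \<odot>\<^bsub>?Q\<^esub> (b \<odot>\<^bsub>?Q\<^esub> X)"
      by (rule e[OF X]) (simp add: coset_smult M.smult_assoc1 a b)
  next
    fix a X Y assume a: "a \<in> carrier R" and X: "X \<in> carrier ?Q" and Y: "Y \<in> carrier ?Q"
    show "a \<odot>\<^bsub>?Q\<^esub> (X \<oplus>\<^bsub>?Q\<^esub> Y) = a \<odot>\<^bsub>?Q\<^esub> X \<oplus>\<^bsub>?Q\<^esub> a \<odot>\<^bsub>?Q\<^esub> Y"
      by (rule e[OF X], rule e[OF Y]) (simp add: coset_add coset_smult M.smult_r_distr a)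
  next
    fix X assume X: "X \<in> carrier ?Q"
    show "\<one>\<^bsub>R\<^esub> \<odot>\<^bsub>?Q\<^esub> X = X"
      by (rule e[OF X]) (simp add: coset_smult)
  qed
qed

lemma lin_proj: "lin R M (quot_mod R M N) (\<lambda>x. N +>\<^bsub>M\<^esub> x)"
  by (rule linI) (auto simp: quot_mod_carrier coset_add coset_smult)

lemma coset_eq_zero_iff:
  "x \<in> carrier M \<Longrightarrow> N +>\<^bsub>M\<^esub> x = \<zero>\<^bsub>quot_mod R M N\<^esub> \<longleftrightarrow> x \<in> N"
  unfolding coset_zero[symmetric] by (subst coset_eq_iff) (auto simp: M.diff_zero_right)

lemma quot_lift:
  assumes Z: "module R Z" "lin R M Z u" "\<And>x. x \<in> N \<Longrightarrow> u x = \<zero>\<^bsub>Z\<^esub>"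
  shows "\<exists>h. lin R (quot_mod R M N) Z h \<and> (\<forall>x\<in>carrier M. h (N +>\<^bsub>M\<^esub> x) = u x)"
  using M quot_mod_module Z(1) lin_proj Z(2)
  by (rule lin_descend) (use Z(3) in \<open>auto simp: quot_mod_carrier coset_eq_zero_iff\<close>)

end

section \<open>Homomorphism modules\<close>

lemma mod_hom_eqI:
  "f \<in> mod_hom R X Y \<Longrightarrow> g \<in> mod_hom R X Y \<Longrightarrow> (\<And>x. x \<in> carrier X \<Longrightarrow> f x = g x) \<Longrightarrow> f = g"
  by (auto simp: mod_hom_def intro: PiE_ext)

lemma Hom_mod_module:
  assumes X: "module R X" and Y: "module R Y"
  shows "module R (Hom_mod R X Y)"
proof -
  interpret X: module R X by fact
  interpret Y: module R Y by fact
  let ?H = "Hom_mod R X Y"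
  have cH: "carrier ?H = mod_hom R X Y" by (simp add: Hom_mod_def)
  have zc: "\<zero>\<^bsub>?H\<^esub> \<in> carrier ?H"
    using lin_const_zero[OF X Y] by (simp add: Hom_mod_def restrict_mod_hom[OF X])
  have ac: "f \<oplus>\<^bsub>?H\<^esub> g \<in> carrier ?H" if "f \<in> carrier ?H" "g \<in> carrier ?H" for f g
    using that lin_plus[OF Y X mod_hom_lin mod_hom_lin] by (simp add: Hom_mod_def restrict_mod_hom[OF X])
  have sc: "a \<odot>\<^bsub>?H\<^esub> f \<in> carrier ?H" if "f \<in> carrier ?H" "a \<in> carrier R" for a f
    using that lin_scale[OF X Y mod_hom_lin] by (simp add: Hom_mod_def restrict_mod_hom[OF X])
  have za: "\<zero>\<^bsub>?H\<^esub> x = \<zero>\<^bsub>Y\<^esub>" and aa: "(f \<oplus>\<^bsub>?H\<^esub> g) x = f x \<oplus>\<^bsub>Y\<^esub> g x"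
    and sa: "(a \<odot>\<^bsub>?H\<^esub> f) x = a \<odot>\<^bsub>Y\<^esub> f x" if "x \<in> carrier X" for f g a x
    using that by (simp_all add: Hom_mod_def)
  have m: "f x \<in> carrier Y" if "f \<in> carrier ?H" "x \<in> carrier X" for f x
    using that lin_closed[OF mod_hom_lin] by (auto simp: cH)
  have eqI: "f = g" if "f \<in> carrier ?H" "g \<in> carrier ?H" "\<And>x. x \<in> carrier X \<Longrightarrow> f x = g x" for f g
    using that mod_hom_eqI[of f R X Y g] by (simp add: cH)
  show ?thesis
  proof (intro moduleI abelian_groupI X.R.is_cring)
    fix f assume f: "f \<in> carrier ?H"
    let ?g = "\<lambda>x\<in>carrier X. \<ominus>\<^bsub>Y\<^esub> f x"
    have g: "?g \<in> carrier ?H"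
      using f lin_uminus[OF Y X mod_hom_lin] by (simp add: Hom_mod_def restrict_mod_hom[OF X])
    show "\<exists>y\<in>carrier ?H. y \<oplus>\<^bsub>?H\<^esub> f = \<zero>\<^bsub>?H\<^esub>"
    proof (rule bexI[OF _ g], rule eqI[OF ac[OF g f] zc])
      fix x assume x: "x \<in> carrier X"
      show "(?g \<oplus>\<^bsub>?H\<^esub> f) x = \<zero>\<^bsub>?H\<^esub> x" unfolding za[OF x] aa[OF x] using m[OF f x] x by (simp add: Y.l_neg)
    qed
  qed (use zc ac sc in \<open>auto intro!: eqI simp: za aa sa m Y.a_ac Y.smult_l_distr Y.smult_r_distr Y.smult_assoc1\<close>)
qed

context cring
begin

lemma dual_module: "module R X \<Longrightarrow> module R (dual_mod R X)"
  unfolding dual_mod_def by (intro Hom_mod_module ring_mod_module)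

lemma dual_carrier: "carrier (dual_mod R X) = mod_hom R X (ring_mod R)"
  by (simp add: dual_mod_def Hom_mod_def)

lemma dual_lin: "\<phi> \<in> carrier (dual_mod R X) \<Longrightarrow> lin R X (ring_mod R) \<phi>"
  by (simp add: dual_carrier mod_hom_lin)

lemma dual_restrict:
  "module R X \<Longrightarrow> lin R X (ring_mod R) \<phi> \<Longrightarrow> restrict \<phi> (carrier X) \<in> carrier (dual_mod R X)"
  by (simp add: dual_carrier restrict_mod_hom)

lemma dual_apply:
  "x \<in> carrier X \<Longrightarrow> (\<phi> \<oplus>\<^bsub>dual_mod R X\<^esub> \<psi>) x = \<phi> x \<oplus> \<psi> x"
  "x \<in> carrier X \<Longrightarrow> (a \<odot>\<^bsub>dual_mod R X\<^esub> \<phi>) x = a \<otimes> \<phi> x"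
  "x \<in> carrier X \<Longrightarrow> \<zero>\<^bsub>dual_mod R X\<^esub> x = \<zero>"
  by (simp_all add: dual_mod_def Hom_mod_def)

lemma dual_eqI:
  "\<phi> \<in> carrier (dual_mod R X) \<Longrightarrow> \<psi> \<in> carrier (dual_mod R X) \<Longrightarrow>
    (\<And>x. x \<in> carrier X \<Longrightarrow> \<phi> x = \<psi> x) \<Longrightarrow> \<phi> = \<psi>"
  unfolding dual_carrier by (rule mod_hom_eqI)

lemma dual_map_lin:
  assumes "module R X" "module R Y" "lin R X Y f"
  shows "lin R (dual_mod R Y) (dual_mod R X) (\<lambda>\<phi>. \<lambda>x\<in>carrier X. \<phi> (f x))"
proof (rule linI)
  interpret X: module R X by fact
  interpret Y: module R Y by fact
  interpret DX: module R "dual_mod R X" by (rule dual_module) fact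
  interpret DY: module R "dual_mod R Y" by (rule dual_module) fact
  let ?f = "\<lambda>\<phi>. \<lambda>x\<in>carrier X. \<phi> (f x)"
  show c: "?f \<phi> \<in> carrier (dual_mod R X)" if "\<phi> \<in> carrier (dual_mod R Y)" for \<phi>
    by (rule dual_restrict[OF assms(1) lin_comp[OF assms(3) dual_lin[OF that]]])
  show "?f (\<phi> \<oplus>\<^bsub>dual_mod R Y\<^esub> \<psi>) = ?f \<phi> \<oplus>\<^bsub>dual_mod R X\<^esub> ?f \<psi>"
    if "\<phi> \<in> carrier (dual_mod R Y)" "\<psi> \<in> carrier (dual_mod R Y)" for \<phi> \<psi>
    by (rule dual_eqI) (use that c in \<open>auto simp: dual_apply lin_closed[OF assms(3)]\<close>)
  show "?f (a \<odot>\<^bsub>dual_mod R Y\<^esub> \<phi>) = a \<odot>\<^bsub>dual_mod R X\<^esub> ?f \<phi>"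
    if "a \<in> carrier R" "\<phi> \<in> carrier (dual_mod R Y)" for a \<phi>
    by (rule dual_eqI) (use that c in \<open>auto simp: dual_apply lin_closed[OF assms(3)]\<close>)
qed

end

section \<open>Totally reflexive modules\<close>

text \<open>Existential in the resolution, the convenient form for constructions;
  \<open>ext_acyclic_vanish\<close> transfers the property to every resolution of the
  module.\<close>

definition ext_acyclic :: "('a, 'r) ring_scheme \<Rightarrow> ('a, 'b) module \<Rightarrow> bool" where
  "ext_acyclic R X \<longleftrightarrow> (\<exists>r d e. res R X r d e \<and> ext_vanish R r d)"

text \<open>Injectivity and surjectivity of the evaluation map, tested on elements. The functionals
  on the dual are merely \<open>lin\<close>, so they can be given by lambda terms without passing
  through the carrier of the bidual.\<close>

definition reflexive_mod :: "('a, 'r) ring_scheme \<Rightarrow> ('a, 'b) module \<Rightarrow> bool" where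
  "reflexive_mod R X \<longleftrightarrow>
     (\<forall>x\<in>carrier X. (\<forall>\<phi>\<in>carrier (dual_mod R X). \<phi> x = \<zero>\<^bsub>R\<^esub>) \<longrightarrow> x = \<zero>\<^bsub>X\<^esub>) \<and>
     (\<forall>\<Phi>. lin R (dual_mod R X) (ring_mod R) \<Phi> \<longrightarrow>
        (\<exists>x\<in>carrier X. \<forall>\<phi>\<in>carrier (dual_mod R X). \<Phi> \<phi> = \<phi> x))"

definition tot_refl :: "('a, 'r) ring_scheme \<Rightarrow> ('a, 'b) module \<Rightarrow> bool" where
  "tot_refl R X \<longleftrightarrow> module R X \<and> ext_acyclic R X \<and> ext_acyclic R (dual_mod R X) \<and> reflexive_mod R X"

lemma free_resolution_res:
  assumes "free_resolution R X r d e"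
  shows "res R X r d e"
proof (rule resI)
  note * = assms[unfolded free_resolution_def Let_def One_nat_def]
  note h1 = conjunct1[OF *] and * = conjunct2[OF *]
  note e = conjunct1[OF *] and * = conjunct2[OF *]
  note h3 = conjunct1[OF *] and * = conjunct2[OF *]
  note k0 = conjunct1[OF *] and k = spec[OF conjunct2[OF *]]
  have i: "x \<in> d (Suc i) ` carrier (Fr R (r (Suc (Suc i)))) \<longleftrightarrow>
      x \<in> mod_ker (Fr R (r (Suc i))) (Fr R (r i)) (d i)" for i x by (simp only: k)
  have z: "x \<in> d 0 ` carrier (Fr R (r (Suc 0))) \<longleftrightarrow> x \<in> mod_ker (Fr R (r 0)) X e" for x by (simp only: k0)
  show "lin R (Fr R (r 0)) X e" "lin R (Fr R (r (Suc i))) (Fr R (r i)) (d i)" for i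
    by (rule mod_hom_lin[OF h1], rule mod_hom_lin[OF spec[OF h3]])
  show "\<exists>y\<in>carrier (Fr R (r 0)). e y = x" if "x \<in> carrier X" for x
    using that unfolding e[symmetric] by blast
  show "e (d 0 y) = \<zero>\<^bsub>X\<^esub>" if "y \<in> carrier (Fr R (r (Suc 0)))" for y
    using that z[of "d 0 y"] by (simp add: mod_ker_def)
  show "d i (d (Suc i) y) = \<zero>\<^bsub>Fr R (r i)\<^esub>" if "y \<in> carrier (Fr R (r (Suc (Suc i))))" for i y
    using that i[of "d (Suc i) y" i] by (simp add: mod_ker_def)
  show "\<exists>z\<in>carrier (Fr R (r (Suc 0))). d 0 z = y"
    if "y \<in> carrier (Fr R (r 0))" "e y = \<zero>\<^bsub>X\<^esub>" for y
    using that z[of y] by (auto simp: mod_ker_def)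
  show "\<exists>z\<in>carrier (Fr R (r (Suc (Suc i)))). d (Suc i) z = y"
    if "y \<in> carrier (Fr R (r (Suc i)))" "d i y = \<zero>\<^bsub>Fr R (r i)\<^esub>" for i y
    using that i[of y i] by (auto simp: mod_ker_def)
qed

section \<open>Agreement with \<open>Ext_mod\<close> and \<open>totally_reflexive\<close>\<close>

context cring
begin

lemma res_free_resolution:
  assumes "module R X" "res R X r d e"
  shows "free_resolution R X r (\<lambda>i. restrict (d i) (carrier (Fr R (r (Suc i)))))
    (restrict e (carrier (Fr R (r 0))))"
proof -
  note * = resD[OF assms(2)] and c = lin_closed[OF resD(3)[OF assms(2)]]
  show ?thesis
    unfolding free_resolution_def Let_def restrict_mod_hom[OF Fr_module] One_nat_def
  proof (intro conjI allI *(1,3))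
    show "restrict e (carrier (Fr R (r 0))) ` carrier (Fr R (r 0)) = carrier X"
      using *(2) lin_closed[OF *(1)] by (auto simp: image_iff)
    have "d 0 ` carrier (Fr R (r (Suc 0))) = {x \<in> carrier (Fr R (r 0)). e x = \<zero>\<^bsub>X\<^esub>}"
    proof
      show "{x \<in> carrier (Fr R (r 0)). e x = \<zero>\<^bsub>X\<^esub>} \<subseteq> d 0 ` carrier (Fr R (r (Suc 0)))"
        using *(6) by blast
    qed (use *(4) c in blast)
    then show "restrict (d 0) (carrier (Fr R (r (Suc 0)))) ` carrier (Fr R (r (Suc 0))) =
        mod_ker (Fr R (r 0)) X (restrict e (carrier (Fr R (r 0))))"
      by (simp add: mod_ker_def cong: conj_cong)
    fix i
    have "d (Suc i) ` carrier (Fr R (r (Suc (Suc i)))) =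
        {x \<in> carrier (Fr R (r (Suc i))). d i x = \<zero>\<^bsub>Fr R (r i)\<^esub>}"
    proof
      show "{x \<in> carrier (Fr R (r (Suc i))). d i x = \<zero>\<^bsub>Fr R (r i)\<^esub>} \<subseteq> d (Suc i) ` carrier (Fr R (r (Suc (Suc i))))"
        using *(7) by blast
    qed (use *(5) c in blast)
    then show "restrict (d (Suc i)) (carrier (Fr R (r (Suc (Suc i))))) ` carrier (Fr R (r (Suc (Suc i)))) =
        mod_ker (Fr R (r (Suc i))) (Fr R (r i)) (restrict (d i) (carrier (Fr R (r (Suc i)))))"
      by (simp add: mod_ker_def cong: conj_cong)
  qed
qed

lemma submodule_image:
  assumes "module R X" "module R Y" "lin R X Y f"
  shows "submodule (f ` carrier X) R Y"
proof -
  interpret X: module R X by fact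
  interpret Y: module R Y by fact
  show ?thesis
  proof (rule Y.submoduleI)
    show "f ` carrier X \<subseteq> carrier Y" using lin_closed[OF assms(3)] by blast
    show "\<zero>\<^bsub>Y\<^esub> \<in> f ` carrier X" using lin_zero[OF assms] X.zero_closed by (metis imageI)
    show "\<ominus>\<^bsub>Y\<^esub> y \<in> f ` carrier X" if "y \<in> f ` carrier X" for y
      using that lin_neg[OF assms] by (metis (no_types) X.a_inv_closed imageE imageI)
    show "x \<oplus>\<^bsub>Y\<^esub> y \<in> f ` carrier X" if "x \<in> f ` carrier X" "y \<in> f ` carrier X" for x y
      using that lin_add[OF assms(3)] by (metis (no_types) X.a_closed imageE imageI)
    show "a \<odot>\<^bsub>Y\<^esub> y \<in> f ` carrier X" if "a \<in> carrier R" "y \<in> f ` carrier X" for a y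
      using that lin_smult[OF assms(3)] by (metis (no_types) X.smult_closed imageE imageI)
  qed
qed

text \<open>The cohomology is a quotient of a module whose carrier is cut down to the cocycles. A
  coset is formed from the addition alone, so it may be taken in the whole dual of
  \<open>Fr R (r (Suc i))\<close>, where the coboundaries are the image of a dual map and hence a
  submodule.\<close>

lemma cohomology_zero_iff:
  assumes d: "lin R (Fr R (r (Suc i))) (Fr R (r i)) (d i)"
    and d': "lin R (Fr R (r (Suc (Suc i)))) (Fr R (r (Suc i))) (d (Suc i))"
  shows "zero_mod (cohomology_mod R r d (ring_mod R) (Suc i)) \<longleftrightarrow>
    cocycles R r d (ring_mod R) (Suc i) \<subseteq> coboundaries R r d (ring_mod R) (Suc i)"
proof -
  let ?H = "dual_mod R (Fr R (r (Suc i)))"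
  let ?Z = "cocycles R r d (ring_mod R) (Suc i)" and ?B = "coboundaries R r d (ring_mod R) (Suc i)"
  have "?B = (\<lambda>\<phi>. \<lambda>x\<in>carrier (Fr R (r (Suc i))). \<phi> (d i x)) ` carrier (dual_mod R (Fr R (r i)))"
    by (simp add: coboundaries_def compose_def dual_carrier)
  then have B: "submodule ?B R ?H"
    using submodule_image[OF dual_module dual_module dual_map_lin, OF Fr_module Fr_module Fr_module Fr_module d]
    by simp
  have Z: "?Z \<subseteq> carrier ?H" by (auto simp: cocycles_def dual_carrier)
  have "\<zero>\<^bsub>?H\<^esub> \<in> carrier ?H"
    using submodule_memD(1)[OF dual_module B] submodule_memD(2)[OF dual_module B] Fr_module by blast
  then have "\<zero>\<^bsub>?H\<^esub> \<in> ?Z"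
    using lin_closed[OF d'] by (auto simp: cocycles_def dual_carrier dual_apply)
  then have ne: "?Z \<noteq> {}" by blast
  have co: "?B +>\<^bsub>?H\<lparr>carrier := ?Z\<rparr>\<^esub> a = ?B +>\<^bsub>?H\<^esub> a" for a by (simp add: a_r_coset_def')
  have car: "carrier (cohomology_mod R r d (ring_mod R) (Suc i)) = (\<lambda>a. ?B +>\<^bsub>?H\<^esub> a) ` ?Z"
    unfolding cohomology_mod_def dual_mod_def[symmetric]
    by (auto simp: quot_mod_def A_RCOSETS_def' co)
  have z: "\<zero>\<^bsub>cohomology_mod R r d (ring_mod R) (Suc i)\<^esub> = ?B"
    by (simp add: cohomology_mod_def quot_mod_def)
  have "?B +>\<^bsub>?H\<^esub> a = ?B \<longleftrightarrow> a \<in> ?B" if "a \<in> ?Z" for a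
    using coset_eq_zero_iff[OF dual_module[OF Fr_module] B, of a] that Z by (auto simp: quot_mod_def)
  then show ?thesis unfolding zero_mod_def car z using ne by auto
qed

lemma ext_vanish_iff:
  assumes "\<And>i. lin R (Fr R (r (Suc i))) (Fr R (r i)) (d i)"
  shows "ext_vanish R r d \<longleftrightarrow> (\<forall>i. zero_mod (cohomology_mod R r d (ring_mod R) (Suc i)))"
proof -
  have "(\<forall>f. lin R (Fr R (r (Suc i))) (ring_mod R) f \<and>
      (\<forall>x\<in>carrier (Fr R (r (Suc (Suc i)))). f (d (Suc i) x) = \<zero>\<^bsub>R\<^esub>) \<longrightarrow>
      (\<exists>g. lin R (Fr R (r i)) (ring_mod R) g \<and> (\<forall>x\<in>carrier (Fr R (r (Suc i))). f x = g (d i x)))) \<longleftrightarrow>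
     cocycles R r d (ring_mod R) (Suc i) \<subseteq> coboundaries R r d (ring_mod R) (Suc i)" (is "?l \<longleftrightarrow> ?r") for i
  proof
    note cl = lin_closed[OF assms]
    assume l: ?l
    show ?r
    proof
      fix f assume f: "f \<in> cocycles R r d (ring_mod R) (Suc i)"
      then have fm: "f \<in> mod_hom R (Fr R (r (Suc i))) (ring_mod R)" by (simp add: cocycles_def)
      with l f obtain g where g: "lin R (Fr R (r i)) (ring_mod R) g"
        "\<And>x. x \<in> carrier (Fr R (r (Suc i))) \<Longrightarrow> f x = g (d i x)"
        using mod_hom_lin[OF fm] unfolding cocycles_def by auto
      let ?g = "restrict g (carrier (Fr R (r i)))"
      have gm: "?g \<in> mod_hom R (Fr R (r i)) (ring_mod R)" using g(1) restrict_mod_hom[OF Fr_module] by blast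
      have "f = compose (carrier (Fr R (r (Suc i)))) ?g (d i)"
      proof (rule mod_hom_eqI[OF fm])
        show "compose (carrier (Fr R (r (Suc i)))) ?g (d i) \<in> mod_hom R (Fr R (r (Suc i))) (ring_mod R)"
          unfolding compose_def restrict_mod_hom[OF Fr_module] by (rule lin_comp[OF assms mod_hom_lin[OF gm]])
      qed (simp add: compose_def g(2) cl)
      then show "f \<in> coboundaries R r d (ring_mod R) (Suc i)" using gm by (simp add: coboundaries_def)
    qed
  next
    note cl = lin_closed[OF assms]
    assume r: ?r
    show ?l
    proof (intro allI impI, elim conjE)
      fix f assume f: "lin R (Fr R (r (Suc i))) (ring_mod R) f"
        and f0: "\<forall>x\<in>carrier (Fr R (r (Suc (Suc i)))). f (d (Suc i) x) = \<zero>\<^bsub>R\<^esub>"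
      have "restrict f (carrier (Fr R (r (Suc i)))) \<in> cocycles R r d (ring_mod R) (Suc i)"
        using f f0 restrict_mod_hom[OF Fr_module] cl[of _ "Suc i"] by (auto simp: cocycles_def)
      then have "restrict f (carrier (Fr R (r (Suc i)))) \<in> coboundaries R r d (ring_mod R) (Suc i)" using r by blast
      then obtain g where g: "g \<in> mod_hom R (Fr R (r i)) (ring_mod R)"
        "restrict f (carrier (Fr R (r (Suc i)))) = compose (carrier (Fr R (r (Suc i)))) g (d i)"
        by (auto simp: coboundaries_def)
      have "f x = g (d i x)" if "x \<in> carrier (Fr R (r (Suc i)))" for x
        using fun_cong[OF g(2), of x] that by (simp add: compose_def)
      then show "\<exists>g. lin R (Fr R (r i)) (ring_mod R) g \<and> (\<forall>x\<in>carrier (Fr R (r (Suc i))). f x = g (d i x))"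
        using mod_hom_lin[OF g(1)] by blast
    qed
  qed
  then show ?thesis unfolding ext_vanish_def by (simp add: cohomology_zero_iff assms)
qed

text \<open>The choice inside \<open>Ext_mod\<close> does not depend on the degree, so a single
  resolution computes all degrees; that the chosen pair really is a resolution follows from the
  existence of some resolution.\<close>

lemma Ext_mod_resolution:
  assumes "module R X" "res R X r0 d0 e0"
  obtains r d e where "res R X r d e" "\<And>i. Ext_mod R i X (ring_mod R) = cohomology_mod R r d (ring_mod R) i"
proof -
  let ?rd = "SOME (r, d). \<exists>e. free_resolution R X r d e"
  obtain r d where rd: "?rd = (r, d)" by (cases ?rd)
  have "case ?rd of (r, d) \<Rightarrow> \<exists>e. free_resolution R X r d e"
    by (rule someI_ex[where P = "\<lambda>(r, d). \<exists>e. free_resolution R X r d e"])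
      (use res_free_resolution[OF assms] in blast)
  then obtain e where "free_resolution R X r d e" unfolding rd by auto
  then have "res R X r d e" by (rule free_resolution_res)
  moreover have "Ext_mod R i X (ring_mod R) = cohomology_mod R r d (ring_mod R) i" for i
    unfolding Ext_mod_def rd by simp
  ultimately show thesis by (rule that)
qed

text \<open>Whatever resolution \<open>Ext_mod\<close> has picked,
  \<open>ext_vanish_independent\<close> lets the vanishing be decided on the resolution at
  hand.\<close>

lemma Ext_zero_iff:
  assumes X: "module R X" "res R X r d e"
  shows "ext_vanish R r d \<longleftrightarrow> (\<forall>i>0. zero_mod (Ext_mod R i X (ring_mod R)))"
proof -
  obtain r' d' e' where r': "res R X r' d' e'"
    "\<And>i. Ext_mod R i X (ring_mod R) = cohomology_mod R r' d' (ring_mod R) i"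
    by (rule Ext_mod_resolution[OF X]) blast
  have "ext_vanish R r d \<longleftrightarrow> ext_vanish R r' d'"
    using ext_vanish_independent[OF X(1)] X(2) r'(1) by blast
  also have "\<dots> \<longleftrightarrow> (\<forall>i. zero_mod (Ext_mod R (Suc i) X (ring_mod R)))"
    using ext_vanish_iff resD(3)[OF r'(1)] r'(2) by simp
  also have "\<dots> \<longleftrightarrow> (\<forall>i>0. zero_mod (Ext_mod R i X (ring_mod R)))" by (metis gr0_conv_Suc)
  finally show ?thesis .
qed

lemma ext_acyclic_vanish: "module R X \<Longrightarrow> ext_acyclic R X \<Longrightarrow> res R X r d e \<Longrightarrow> ext_vanish R r d"
  unfolding ext_acyclic_def using ext_vanish_independent by blast

lemma gen_by_image_basis:
  assumes "module R X" "lin R (Fr R n) X e" "\<And>x. x \<in> carrier X \<Longrightarrow> \<exists>y\<in>carrier (Fr R n). e y = x"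
  shows "gen_by R X (e ` unit_vec R n ` {..<n})"
proof -
  interpret X: module R X by fact
  let ?S = "e ` unit_vec R n ` {..<n}"
  have S: "?S \<subseteq> carrier X" using lin_closed[OF assms(2)] by auto
  have "x \<in> N" if x: "x \<in> carrier X" and N: "submodule N R X" "?S \<subseteq> N" for x N
  proof -
    obtain y where y: "y \<in> carrier (Fr R n)" "e y = x" using assms(3)[OF x] by blast
    show ?thesis
      unfolding y(2)[symmetric] lin_expand[OF assms(1,2) y(1)]
      using N(2) power_mod_mem[OF y(1)]
      by (intro submodule_finsum[OF assms(1) N(1)] submodule_memD(6)[OF assms(1) N(1)]) auto
  qed
  then have "carrier X \<subseteq> (\<lambda>N. submodule N R X) hull ?S" by (auto simp: hull_def)
  moreover have "(\<lambda>N. submodule N R X) hull ?S \<subseteq> carrier X"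
    using S X.carrier_is_submodule by (simp add: hull_minimal)
  ultimately show ?thesis unfolding gen_by_def using S by blast
qed

lemma lin_eval:
  assumes x: "x \<in> carrier X"
  shows "lin R (dual_mod R X) (ring_mod R) (\<lambda>\<phi>. \<phi> x)"
proof (rule linI)
  show "\<phi> x \<in> carrier (ring_mod R)" if "\<phi> \<in> carrier (dual_mod R X)" for \<phi>
    by (rule lin_closed[OF dual_lin[OF that] x])
qed (simp_all only: dual_apply(1,2)[OF x] ring_mod_simps)

lemma tot_refl_totally_reflexive:
  assumes "tot_refl R X"
  shows "totally_reflexive R X"
proof -
  have X: "module R X" "ext_acyclic R X" "ext_acyclic R (dual_mod R X)" and rf: "reflexive_mod R X"
    using assms by (auto simp: tot_refl_def)
  interpret X: module R X by (rule X)
  interpret D: module R "dual_mod R X" by (rule dual_module[OF X(1)])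
  obtain r d e where r: "res R X r d e" "ext_vanish R r d" using X(2) by (auto simp: ext_acyclic_def)
  obtain r' d' e' where r': "res R (dual_mod R X) r' d' e'" "ext_vanish R r' d'"
    using X(3) by (auto simp: ext_acyclic_def)
  have fg: "fin_gen R X"
    unfolding fin_gen_def
  proof (intro exI conjI)
    show "gen_by R X (e ` unit_vec R (r 0) ` {..<r 0})"
      by (rule gen_by_image_basis[OF X(1) resD(1)[OF r(1)]]) (rule resD(2)[OF r(1)])
  qed simp
  let ?DD = "dual_mod R (dual_mod R X)"
  have ev: "eval_map R X x \<in> carrier ?DD" if "x \<in> carrier X" for x
    using dual_restrict[OF dual_module[OF X(1)] lin_eval[OF that]] that by (simp add: eval_map_def)
  have ap: "eval_map R X x \<phi> = \<phi> x" if "x \<in> carrier X" "\<phi> \<in> carrier (dual_mod R X)" for x \<phi>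
    using that by (simp add: eval_map_def)
  interpret DD: module R ?DD by (rule dual_module[OF dual_module[OF X(1)]])
  have "eval_map R X \<in> mod_hom R X ?DD"
    unfolding mod_hom_def
  proof (intro CollectI conjI ballI)
    show "eval_map R X \<in> carrier X \<rightarrow>\<^sub>E carrier ?DD" using ev by (auto simp: eval_map_def)
    show "eval_map R X (x \<oplus>\<^bsub>X\<^esub> y) = eval_map R X x \<oplus>\<^bsub>?DD\<^esub> eval_map R X y"
      if xy: "x \<in> carrier X" "y \<in> carrier X" for x y
    proof (rule dual_eqI)
      fix \<phi> assume p: "\<phi> \<in> carrier (dual_mod R X)"
      show "eval_map R X (x \<oplus>\<^bsub>X\<^esub> y) \<phi> = (eval_map R X x \<oplus>\<^bsub>?DD\<^esub> eval_map R X y) \<phi>"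
        using xy p lin_add[OF dual_lin[OF p] xy] by (simp add: dual_apply(1)[OF p] ap)
    qed (use ev xy in auto)
    show "eval_map R X (a \<odot>\<^bsub>X\<^esub> x) = a \<odot>\<^bsub>?DD\<^esub> eval_map R X x"
      if xy: "a \<in> carrier R" "x \<in> carrier X" for a x
    proof (rule dual_eqI)
      fix \<phi> assume p: "\<phi> \<in> carrier (dual_mod R X)"
      show "eval_map R X (a \<odot>\<^bsub>X\<^esub> x) \<phi> = (a \<odot>\<^bsub>?DD\<^esub> eval_map R X x) \<phi>"
        using xy p lin_smult[OF dual_lin[OF p] xy] by (simp add: dual_apply(2)[OF p] ap)
    qed (use ev xy in auto)
  qed
  moreover have "bij_betw (eval_map R X) (carrier X) (carrier ?DD)"
  proof (rule bij_betw_imageI)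
    show "inj_on (eval_map R X) (carrier X)"
    proof (rule inj_onI)
      fix x y assume xy: "x \<in> carrier X" "y \<in> carrier X" "eval_map R X x = eval_map R X y"
      have "\<phi> (x \<ominus>\<^bsub>X\<^esub> y) = \<zero>" if p: "\<phi> \<in> carrier (dual_mod R X)" for \<phi>
      proof -
        have "\<phi> x = \<phi> y" using fun_cong[OF xy(3), of \<phi>] xy(1,2) p by (simp add: eval_map_def)
        then show ?thesis using lin_diff_zero[OF X(1) ring_mod_module dual_lin[OF p] xy(1,2)] by simp
      qed
      then have "x \<ominus>\<^bsub>X\<^esub> y = \<zero>\<^bsub>X\<^esub>" using rf xy unfolding reflexive_mod_def by auto
      then show "x = y" using xy X.diff_eq_zero_iff by blast
    qed
    show "eval_map R X ` carrier X = carrier ?DD"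
    proof
      show "carrier ?DD \<subseteq> eval_map R X ` carrier X"
      proof
        fix \<Phi> assume P: "\<Phi> \<in> carrier ?DD"
        then obtain x where x: "x \<in> carrier X" "\<And>\<phi>. \<phi> \<in> carrier (dual_mod R X) \<Longrightarrow> \<Phi> \<phi> = \<phi> x"
          using rf dual_lin[OF P] unfolding reflexive_mod_def by blast
        have "\<Phi> = eval_map R X x"
          by (rule dual_eqI[OF P ev[OF x(1)]]) (simp add: x eval_map_def)
        then show "\<Phi> \<in> eval_map R X ` carrier X" using x(1) by blast
      qed
    qed (use ev in blast)
  qed
  ultimately have "eval_map R X \<in> mod_iso R X ?DD" by (simp add: mod_iso_def)
  then show ?thesis
    unfolding totally_reflexive_def
    using X(1) fg Ext_zero_iff[OF X(1) r(1)] r(2) Ext_zero_iff[OF dual_module[OF X(1)] r'(1)] r'(2) by blast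
qed

text \<open>This is the vanishing of \<open>Ext^1(C, R)\<close> applied to the extension.
  \<open>\<kappa>\<close> is the cocycle of the extension with values in \<open>A\<close>; composed
  with \<open>h\<close> it becomes a cocycle with values in \<open>R\<close>, hence
  \<open>t \<circ> d 0\<close>, and \<open>t\<close> prescribes the extended functional on the lift
  \<open>\<epsilon>\<close> of the augmentation of \<open>C\<close>.\<close>

lemma hom_extends:
  assumes A: "module R A" and B: "module R B" and C: "module R C" and ex: "exact3 R A f B g C"
    and acyc: "ext_acyclic R C" and h: "lin R A (ring_mod R) h"
  shows "\<exists>h'. lin R B (ring_mod R) h' \<and> (\<forall>a\<in>carrier A. h' (f a) = h a)"
proof -
  interpret A: module R A by (rule A)
  interpret B: module R B by (rule B)
  interpret C: module R C by (rule C)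
  interpret F: module R "Fr R n" for n by (rule Fr_module)
  obtain r d e where r: "res R C r d e" "ext_vanish R r d" using acyc by (auto simp: ext_acyclic_def)
  note c = resD[OF r(1)] and fg = exact3D[OF ex]
  have "\<exists>b\<in>carrier B. g b = e x" if "x \<in> carrier (Fr R (r 0))" for x
    by (rule fg(6)[OF lin_closed[OF c(1) that]])
  from free_lift[OF B C c(1) fg(2) this]
  obtain \<epsilon> where \<epsilon>: "lin R (Fr R (r 0)) B \<epsilon>" "\<And>x. x \<in> carrier (Fr R (r 0)) \<Longrightarrow> g (\<epsilon> x) = e x"
    by blast
  have "\<exists>a\<in>carrier A. f a = \<epsilon> (d 0 x)" if x: "x \<in> carrier (Fr R (r (Suc 0)))" for x
  proof (rule fg(5))
    have m: "d 0 x \<in> carrier (Fr R (r 0))" by (rule lin_closed[OF c(3) x])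
    show "\<epsilon> (d 0 x) \<in> carrier B" by (rule lin_closed[OF \<epsilon>(1) m])
    show "g (\<epsilon> (d 0 x)) = \<zero>\<^bsub>C\<^esub>" using \<epsilon>(2)[OF m] c(4)[OF x] by simp
  qed
  from free_lift[OF A B lin_comp[OF c(3) \<epsilon>(1)] fg(1) this]
  obtain \<kappa> where \<kappa>: "lin R (Fr R (r (Suc 0))) A \<kappa>"
    "\<And>x. x \<in> carrier (Fr R (r (Suc 0))) \<Longrightarrow> f (\<kappa> x) = \<epsilon> (d 0 x)" by blast
  have "h (\<kappa> (d (Suc 0) x)) = \<zero>" if x: "x \<in> carrier (Fr R (r (Suc (Suc 0))))" for x
  proof -
    have m: "d (Suc 0) x \<in> carrier (Fr R (r (Suc 0)))" by (rule lin_closed[OF c(3) x])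
    have "f (\<kappa> (d (Suc 0) x)) = f \<zero>\<^bsub>A\<^esub>"
      using \<kappa>(2)[OF m] c(5)[OF x] lin_zero[OF Fr_module B \<epsilon>(1)] lin_zero[OF A B fg(1)] by simp
    then have "\<kappa> (d (Suc 0) x) = \<zero>\<^bsub>A\<^esub>" by (intro fg(3)) (use lin_closed[OF \<kappa>(1) m] in auto)
    then show ?thesis using lin_zero[OF A ring_mod_module h] by simp
  qed
  from ext_vanishD[OF r(2) lin_comp[OF \<kappa>(1) h] this]
  obtain t where t: "lin R (Fr R (r 0)) (ring_mod R) t"
    "\<And>x. x \<in> carrier (Fr R (r (Suc 0))) \<Longrightarrow> h (\<kappa> x) = t (d 0 x)" by blast
  \<comment> \<open>\<open>B\<close> is the sum of the images of \<open>\<epsilon>\<close> and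
    \<open>f\<close>, and \<open>t\<close> and \<open>h\<close> agree where these meet: if
    \<open>\<epsilon> x = f a\<close>, then \<open>x = d 0 y\<close> with
    \<open>\<kappa> y = a\<close>, and both values are \<open>h (\<kappa> y)\<close>.\<close>
  have "\<exists>h'. lin R B (ring_mod R) h' \<and> (\<forall>x\<in>carrier (Fr R (r 0)). h' (\<epsilon> x) = t x) \<and>
      (\<forall>a\<in>carrier A. h' (f a) = h a)"
  proof (rule lin_descend2[OF Fr_module A B ring_mod_module \<epsilon>(1) fg(1) t(1) h])
    fix b assume b: "b \<in> carrier B"
    obtain x where x: "x \<in> carrier (Fr R (r 0))" "e x = g b" using c(2)[OF lin_closed[OF fg(2) b]] by blast
    have m: "\<epsilon> x \<in> carrier B" by (rule lin_closed[OF \<epsilon>(1) x(1)])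
    have "g (b \<ominus>\<^bsub>B\<^esub> \<epsilon> x) = \<zero>\<^bsub>C\<^esub>"
      by (rule lin_diff_zero[OF B C fg(2) b m]) (simp add: \<epsilon>(2)[OF x(1)] x(2))
    then obtain a where a: "a \<in> carrier A" "f a = b \<ominus>\<^bsub>B\<^esub> \<epsilon> x" using fg(5)[of "b \<ominus>\<^bsub>B\<^esub> \<epsilon> x"] b m by auto
    then have "\<epsilon> x \<oplus>\<^bsub>B\<^esub> f a = b"
      using B.diff_eq_iff[OF b m lin_closed[OF fg(1) a(1)]] m lin_closed[OF fg(1) a(1)] by (simp add: B.a_comm)
    then show "\<exists>x\<in>carrier (Fr R (r 0)). \<exists>y\<in>carrier A. \<epsilon> x \<oplus>\<^bsub>B\<^esub> f y = b" using x(1) a(1) by blast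
  next
    fix x a assume x: "x \<in> carrier (Fr R (r 0))" and a: "a \<in> carrier A" and eq: "\<epsilon> x = f a"
    have "e x = \<zero>\<^bsub>C\<^esub>" using \<epsilon>(2)[OF x] fg(4)[OF a] eq by simp
    then obtain y where y: "y \<in> carrier (Fr R (r (Suc 0)))" "d 0 y = x" using c(6)[OF x] by blast
    have "f (\<kappa> y) = f a" using \<kappa>(2)[OF y(1)] y(2) eq by simp
    then have "\<kappa> y = a" by (intro fg(3) a lin_closed[OF \<kappa>(1) y(1)])
    then show "t x = h a" using t(2)[OF y(1)] y(2) by simp
  qed
  then show ?thesis by blast
qed

text \<open>Exactness at the first two places is formal; surjectivity of the restriction to
  \<open>A\<close> is \<open>hom_extends\<close>.\<close>

lemma exact3_dual:
  assumes A: "module R A" and B: "module R B" and C: "module R C" and ex: "exact3 R A f B g C"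
    and acyc: "ext_acyclic R C"
  shows "exact3 R (dual_mod R C) (\<lambda>\<phi>. \<lambda>b\<in>carrier B. \<phi> (g b)) (dual_mod R B)
    (\<lambda>\<psi>. \<lambda>a\<in>carrier A. \<psi> (f a)) (dual_mod R A)"
  unfolding exact3_def
proof (intro conjI ballI inj_onI)
  interpret A: module R A by (rule A)
  interpret B: module R B by (rule B)
  note fg = exact3D[OF ex]
  show "lin R (dual_mod R C) (dual_mod R B) (\<lambda>\<phi>. \<lambda>b\<in>carrier B. \<phi> (g b))"
    by (rule dual_map_lin[OF B C fg(2)])
  show "lin R (dual_mod R B) (dual_mod R A) (\<lambda>\<psi>. \<lambda>a\<in>carrier A. \<psi> (f a))"
    by (rule dual_map_lin[OF A B fg(1)])
  show "\<phi> = \<psi>" if p: "\<phi> \<in> carrier (dual_mod R C)" "\<psi> \<in> carrier (dual_mod R C)"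
    and e: "(\<lambda>b\<in>carrier B. \<phi> (g b)) = (\<lambda>b\<in>carrier B. \<psi> (g b))" for \<phi> \<psi>
  proof (rule dual_eqI[OF p])
    fix c assume "c \<in> carrier C"
    then obtain b where "b \<in> carrier B" "g b = c" using fg(6) by blast
    then show "\<phi> c = \<psi> c" using fun_cong[OF e, of b] by auto
  qed
  show "(\<lambda>a\<in>carrier A. \<psi> (f a)) = \<zero>\<^bsub>dual_mod R A\<^esub> \<longleftrightarrow>
      (\<exists>\<phi>\<in>carrier (dual_mod R C). (\<lambda>b\<in>carrier B. \<phi> (g b)) = \<psi>)" (is "?l \<longleftrightarrow> ?r")
    if p: "\<psi> \<in> carrier (dual_mod R B)" for \<psi>
  proof
    assume l: ?l
    have k: "\<psi> b = \<zero>" if b: "b \<in> carrier B" "g b = \<zero>\<^bsub>C\<^esub>" for b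
    proof -
      obtain a where "a \<in> carrier A" "f a = b" using fg(5)[OF b] by blast
      then show ?thesis using fun_cong[OF l, of a] by (simp add: dual_apply)
    qed
    from lin_descend[OF B C ring_mod_module fg(2) dual_lin[OF p] fg(6)] k
    obtain h where h: "lin R C (ring_mod R) h" "\<And>b. b \<in> carrier B \<Longrightarrow> h (g b) = \<psi> b" by auto
    show ?r
    proof
      show m: "restrict h (carrier C) \<in> carrier (dual_mod R C)" by (rule dual_restrict[OF C h(1)])
      show "(\<lambda>b\<in>carrier B. restrict h (carrier C) (g b)) = \<psi>"
        by (rule dual_eqI[OF dual_restrict[OF B lin_comp[OF fg(2) dual_lin[OF m]]] p])
          (simp add: h lin_closed[OF fg(2)])
    qed
  next
    assume ?r
    then obtain \<phi> where q: "\<phi> \<in> carrier (dual_mod R C)" "(\<lambda>b\<in>carrier B. \<phi> (g b)) = \<psi>" by blast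
    have "\<psi> (f a) = \<zero>" if "a \<in> carrier A" for a
      unfolding q(2)[symmetric] using that lin_closed[OF fg(1) that] fg(4)[OF that]
        lin_zero[OF C ring_mod_module dual_lin[OF q(1)]] by simp
    then show ?l by (auto simp: dual_mod_def Hom_mod_def)
  qed
  show "\<exists>\<psi>\<in>carrier (dual_mod R B). (\<lambda>a\<in>carrier A. \<psi> (f a)) = \<phi>" if p: "\<phi> \<in> carrier (dual_mod R A)" for \<phi>
  proof -
    obtain h where h: "lin R B (ring_mod R) h" "\<And>a. a \<in> carrier A \<Longrightarrow> h (f a) = \<phi> a"
      using hom_extends[OF A B C ex acyc dual_lin[OF p]] by blast
    have m: "restrict h (carrier B) \<in> carrier (dual_mod R B)" by (rule dual_restrict[OF B h(1)])
    have "(\<lambda>a\<in>carrier A. restrict h (carrier B) (f a)) = \<phi>"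
      by (rule dual_eqI[OF dual_restrict[OF A lin_comp[OF fg(1) dual_lin[OF m]]] p])
        (simp add: h lin_closed[OF fg(1)])
    then show ?thesis using m by blast
  qed
qed

lemma ext_acyclic_extension:
  assumes "module R A" "module R B" "module R C" "exact3 R A f B g C" "ext_acyclic R A" "ext_acyclic R C"
  shows "ext_acyclic R B"
  using assms horseshoe unfolding ext_acyclic_def by meson

text \<open>Acyclicity of \<open>B\<close> is the horseshoe lemma for the given sequence, acyclicity
  of its dual the same for the dual sequence, which is exact because \<open>C\<close> is acyclic.
  Biduality is the five lemma, chased through elements since \<open>reflexive_mod\<close> is stated
  on elements.\<close>

lemma tot_refl_extension:
  assumes trA: "tot_refl R A" and trC: "tot_refl R C" and B: "module R B" and ex: "exact3 R A f B g C"
  shows "tot_refl R B"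
proof -
  have A: "module R A" "ext_acyclic R A" "ext_acyclic R (dual_mod R A)" and rA: "reflexive_mod R A"
    using trA by (auto simp: tot_refl_def)
  have C: "module R C" "ext_acyclic R C" "ext_acyclic R (dual_mod R C)" and rC: "reflexive_mod R C"
    using trC by (auto simp: tot_refl_def)
  interpret A: module R A by (rule A)
  interpret B: module R B by (rule B)
  interpret C: module R C by (rule C)
  note fg = exact3D[OF ex]
  let ?G = "\<lambda>\<phi>. \<lambda>b\<in>carrier B. \<phi> (g b)" and ?F = "\<lambda>\<psi>. \<lambda>a\<in>carrier A. \<psi> (f a)"
  note exd = exact3_dual[OF A(1) B C(1) ex C(2)]
  note FG = exact3D[OF exd]
  have refl: "reflexive_mod R B"
    unfolding reflexive_mod_def
  proof (intro conjI ballI allI impI)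
    fix b assume b: "b \<in> carrier B" and z: "\<forall>\<phi>\<in>carrier (dual_mod R B). \<phi> b = \<zero>"
    have "\<phi> (g b) = \<zero>" if "\<phi> \<in> carrier (dual_mod R C)" for \<phi>
      using z lin_closed[OF FG(1) that] b by auto
    then have "g b = \<zero>\<^bsub>C\<^esub>" using rC lin_closed[OF fg(2) b] unfolding reflexive_mod_def by blast
    then obtain a where a: "a \<in> carrier A" "f a = b" using fg(5)[OF b] by blast
    have "\<phi> a = \<zero>" if ph: "\<phi> \<in> carrier (dual_mod R A)" for \<phi>
    proof -
      obtain \<psi> where "\<psi> \<in> carrier (dual_mod R B)" "?F \<psi> = \<phi>" using FG(6)[OF ph] by blast
      then show ?thesis using z a by auto
    qed
    then have "a = \<zero>\<^bsub>A\<^esub>" using rA a(1) unfolding reflexive_mod_def by blast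
    then show "b = \<zero>\<^bsub>B\<^esub>" using a(2) lin_zero[OF A(1) B fg(1)] by simp
  next
    fix \<Phi> assume P: "lin R (dual_mod R B) (ring_mod R) \<Phi>"
    obtain c where c: "c \<in> carrier C" "\<And>\<phi>. \<phi> \<in> carrier (dual_mod R C) \<Longrightarrow> \<Phi> (?G \<phi>) = \<phi> c"
      using rC lin_comp[OF FG(1) P] unfolding reflexive_mod_def by blast
    obtain b where b: "b \<in> carrier B" "g b = c" using fg(6)[OF c(1)] by blast
    \<comment> \<open>\<open>\<Phi>\<close> on the functionals that come from \<open>C\<close> is
      evaluation at \<open>c\<close>. After evaluation at the preimage \<open>b\<close> is
      subtracted, it vanishes on them and descends to the dual of \<open>A\<close>, where it is
      evaluation at some \<open>a\<close>; altogether \<open>\<Phi>\<close> is evaluation at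
      \<open>f a\<close> plus \<open>b\<close>.\<close>
    let ?\<Psi> = "\<lambda>\<psi>. \<Phi> \<psi> \<ominus>\<^bsub>ring_mod R\<^esub> \<psi> b"
    note ev = lin_eval[OF b(1)]
    have Ps: "lin R (dual_mod R B) (ring_mod R) ?\<Psi>"
      by (intro lin_sub ring_mod_module dual_module B P ev)
    have "?\<Psi> \<psi> = \<zero>\<^bsub>ring_mod R\<^esub>" if p: "\<psi> \<in> carrier (dual_mod R B)" and z: "?F \<psi> = \<zero>\<^bsub>dual_mod R A\<^esub>" for \<psi>
    proof -
      obtain \<phi> where q: "\<phi> \<in> carrier (dual_mod R C)" "?G \<phi> = \<psi>" using FG(5)[OF p z] by blast
      have "\<Phi> \<psi> = \<phi> c" using c(2)[OF q(1)] unfolding q(2) .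
      moreover have "\<psi> b = \<phi> c" unfolding q(2)[symmetric] using b by simp
      ultimately show ?thesis using lin_closed[OF dual_lin[OF q(1)] c(1)] by simp
    qed
    from lin_descend[OF dual_module[OF B] dual_module[OF A(1)] ring_mod_module FG(2) Ps FG(6) this]
    obtain \<Theta> where th: "lin R (dual_mod R A) (ring_mod R) \<Theta>"
      "\<And>\<psi>. \<psi> \<in> carrier (dual_mod R B) \<Longrightarrow> \<Theta> (?F \<psi>) = ?\<Psi> \<psi>" by blast
    obtain a where a: "a \<in> carrier A" "\<And>\<phi>. \<phi> \<in> carrier (dual_mod R A) \<Longrightarrow> \<Theta> \<phi> = \<phi> a"
      using rA th(1) unfolding reflexive_mod_def by blast
    have m: "f a \<in> carrier B" by (rule lin_closed[OF fg(1) a(1)])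
    show "\<exists>x\<in>carrier B. \<forall>\<psi>\<in>carrier (dual_mod R B). \<Phi> \<psi> = \<psi> x"
    proof (intro bexI ballI)
      fix \<psi> assume p: "\<psi> \<in> carrier (dual_mod R B)"
      have "\<Phi> \<psi> \<ominus> \<psi> b = \<psi> (f a)"
        using th(2)[OF p] a(2)[OF lin_closed[OF FG(2) p]] a(1) by simp
      then show "\<Phi> \<psi> = \<psi> (f a \<oplus>\<^bsub>B\<^esub> b)"
        using lin_closed[OF P p] lin_closed[OF dual_lin[OF p] b(1)] lin_closed[OF dual_lin[OF p] m]
        by (simp add: diff_eq_iff lin_add[OF dual_lin[OF p] m b(1)])
    qed (use m b in simp)
  qed
  have "ext_acyclic R (dual_mod R B)"
    by (rule ext_acyclic_extension[OF dual_module[OF C(1)] dual_module[OF B] dual_module[OF A(1)] exd C(3) A(3)])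
  then show ?thesis
    using refl B ext_acyclic_extension[OF A(1) B C(1) ex A(2) C(2)] by (simp add: tot_refl_def)
qed

lemma ext_acyclic_iso:
  assumes "module R X" "module R Y" "lin R X Y \<phi>" "bij_betw \<phi> (carrier X) (carrier Y)" "ext_acyclic R X"
  shows "ext_acyclic R Y"
proof -
  interpret X: module R X by fact
  obtain r d e where r: "res R X r d e" "ext_vanish R r d" using assms(5) by (auto simp: ext_acyclic_def)
  note c = resD[OF r(1)]
  have z: "\<phi> x = \<zero>\<^bsub>Y\<^esub> \<longleftrightarrow> x = \<zero>\<^bsub>X\<^esub>" if "x \<in> carrier X" for x
    using lin_zero[OF assms(1-3)] bij_betw_imp_inj_on[OF assms(4)] that X.zero_closed by (metis inj_onD)
  have "res R Y r d (\<lambda>x. \<phi> (e x))"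
  proof (rule resI)
    show "lin R (Fr R (r 0)) Y (\<lambda>x. \<phi> (e x))" by (rule lin_comp[OF c(1) assms(3)])
    show "lin R (Fr R (r (Suc i))) (Fr R (r i)) (d i)" for i by (rule c(3))
    show "d i (d (Suc i) y) = \<zero>\<^bsub>Fr R (r i)\<^esub>" if "y \<in> carrier (Fr R (r (Suc (Suc i))))" for i y
      by (rule c(5)[OF that])
    show "\<exists>z\<in>carrier (Fr R (r (Suc (Suc i)))). d (Suc i) z = y"
      if "y \<in> carrier (Fr R (r (Suc i)))" "d i y = \<zero>\<^bsub>Fr R (r i)\<^esub>" for i y
      by (rule c(7)[OF that])
    show "\<exists>x\<in>carrier (Fr R (r 0)). \<phi> (e x) = y" if y: "y \<in> carrier Y" for y
    proof -
      have "y \<in> \<phi> ` carrier X" using y by (simp add: bij_betw_imp_surj_on[OF assms(4)])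
      then obtain x where x: "x \<in> carrier X" "\<phi> x = y" by blast
      obtain w where "w \<in> carrier (Fr R (r 0))" "e w = x" using c(2)[OF x(1)] by blast
      then show ?thesis using x(2) by blast
    qed
    show "\<phi> (e (d 0 y)) = \<zero>\<^bsub>Y\<^esub>" if "y \<in> carrier (Fr R (r (Suc 0)))" for y
      using c(4)[OF that] lin_zero[OF assms(1-3)] by simp
    show "\<exists>w\<in>carrier (Fr R (r (Suc 0))). d 0 w = y" if "y \<in> carrier (Fr R (r 0))" "\<phi> (e y) = \<zero>\<^bsub>Y\<^esub>" for y
      using c(6)[OF that(1)] that(2) z[OF lin_closed[OF c(1) that(1)]] by blast
  qed
  then show ?thesis using r(2) by (auto simp: ext_acyclic_def)
qed

end

section \<open>Existence of resolutions\<close>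

lemma power_mod_zero_carrier: "carrier (power_mod M 0) = {\<zero>\<^bsub>power_mod M 0\<^esub>}"
  by (simp add: power_mod_simps restrict_def)

text \<open>Finite generation in the form in which resolutions consume it: a submodule covered by a
  finite free module.\<close>

definition fg_sub :: "('a, 'r) ring_scheme \<Rightarrow> ('a, 'b) module \<Rightarrow> 'b set \<Rightarrow> bool" where
  "fg_sub R X N \<longleftrightarrow> (\<exists>k \<phi>. lin R (Fr R k) X \<phi> \<and> \<phi> ` carrier (Fr R k) = N)"

section \<open>Submodules of finite free modules over a Noetherian ring\<close>

context cring
begin

lemma ideal_submodule:
  assumes "ideal I R"
  shows "submodule I R (ring_mod R)"
proof -
  interpret I: ideal I R by fact
  show ?thesis
  proof (rule module.submoduleI[OF ring_mod_module], unfold ring_mod_simps)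
    show "I \<subseteq> carrier R" by (rule I.a_subset)
    show "\<zero> \<in> I" by (rule I.zero_closed)
    show "\<ominus> x \<in> I" if "x \<in> I" for x by (rule I.a_inv_closed[OF that])
    show "x \<oplus> y \<in> I" if "x \<in> I" "y \<in> I" for x y by (rule I.a_closed[OF that])
    show "a \<otimes> x \<in> I" if "a \<in> carrier R" "x \<in> I" for a x by (rule I.I_l_closed[OF that(2,1)])
  qed
qed

lemma submodule_ideal:
  assumes s: "submodule I R (ring_mod R)"
  shows "ideal I R"
proof (rule idealI[OF ring_axioms])
  note sm = submodule_memD[OF ring_mod_module s, unfolded ring_mod_simps]
  show "subgroup I (add_monoid R)"
    by (rule subgroup.intro) (use sm(1,2,3,4) in \<open>simp_all add: a_inv_def[symmetric] subset_iff\<close>)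
  show "x \<otimes> y \<in> I" if "y \<in> I" "x \<in> carrier R" for x y by (rule sm(6)[OF that(2,1)])
  then show "y \<otimes> x \<in> I" if "y \<in> I" "x \<in> carrier R" for x y
    using that m_comm[OF that(2) sm(1)[OF that(1)]] by metis
qed

lemma fg_sub_ideal:
  assumes "noetherian_ring R" "ideal I R"
  shows "fg_sub R (ring_mod R) I"
proof -
  interpret I: ideal I R by fact
  obtain A where A: "A \<subseteq> carrier R" "finite A" "I = Idl A"
    using noetherian_ring.finetely_gen[OF assms] by blast
  obtain a where a: "bij_betw a {..<card A} A"
    using ex_bij_betw_nat_finite[OF A(2)] by (auto simp: atLeast0LessThan)
  have aA: "a i \<in> A" if "i < card A" for i using a that by (auto simp: bij_betw_def)
  have aI: "a i \<in> I" if "i < card A" for i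
    unfolding A(3) using genideal_self[OF A(1)] aA[OF that] by blast
  have c: "a i \<in> carrier (ring_mod R)" if "i < card A" for i using aA[OF that] A(1) by auto
  let ?\<phi> = "\<lambda>x. \<Oplus>\<^bsub>ring_mod R\<^esub>i\<in>{..<card A}. x i \<odot>\<^bsub>ring_mod R\<^esub> a i"
  have l: "lin R (Fr R (card A)) (ring_mod R) ?\<phi>" by (rule free_hom_lin[OF ring_mod_module c])
  note sub = ideal_submodule[OF assms(2)]
  have "?\<phi> ` carrier (Fr R (card A)) = I"
  proof
    show "?\<phi> ` carrier (Fr R (card A)) \<subseteq> I"
    proof (rule image_subsetI)
      fix x assume x: "x \<in> carrier (Fr R (card A))"
      show "?\<phi> x \<in> I"
      proof (rule submodule_finsum[OF ring_mod_module sub])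
        fix i assume "i \<in> {..<card A}"
        then have i: "i < card A" by simp
        have "x i \<in> carrier R" using power_mod_mem[OF x i] by simp
        then show "x i \<odot>\<^bsub>ring_mod R\<^esub> a i \<in> I" using I.I_l_closed[OF aI[OF i]] by simp
      qed simp
    qed
    have "ideal (?\<phi> ` carrier (Fr R (card A))) R"
      by (rule submodule_ideal[OF submodule_image[OF Fr_module ring_mod_module l]])
    moreover have "A \<subseteq> ?\<phi> ` carrier (Fr R (card A))"
    proof
      fix b assume "b \<in> A"
      then have "b \<in> a ` {..<card A}" by (simp add: bij_betw_imp_surj_on[OF a])
      then obtain i where i: "i < card A" "a i = b" by blast
      have "?\<phi> (unit_vec R (card A) i) = b"
        using free_hom_unit_vec[OF ring_mod_module c i(1)] i(2) by simp
      then show "b \<in> ?\<phi> ` carrier (Fr R (card A))" using unit_vec_closed by blast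
    qed
    ultimately show "I \<subseteq> ?\<phi> ` carrier (Fr R (card A))"
      unfolding A(3) by (rule genideal_minimal)
  qed
  then show ?thesis unfolding fg_sub_def using l by blast
qed

text \<open>Generators of the kernel part together with lifts of generators of the image; this is
  the extension step in the proof that \<open>R^n\<close> is Noetherian.\<close>

lemma fg_sub_extension:
  assumes X: "module R X" and Y: "module R Y" and \<pi>: "lin R X Y \<pi>" and N: "submodule N R X"
    and im: "fg_sub R Y (\<pi> ` N)" and ker: "fg_sub R X {x \<in> N. \<pi> x = \<zero>\<^bsub>Y\<^esub>}"
  shows "fg_sub R X N"
proof -
  interpret X: module R X by (rule X)
  interpret Y: module R Y by (rule Y)
  note sm = submodule_memD[OF X N]
  obtain k \<phi> where \<phi>: "lin R (Fr R k) Y \<phi>" "\<phi> ` carrier (Fr R k) = \<pi> ` N"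
    using im by (auto simp: fg_sub_def)
  obtain l \<psi> where \<psi>: "lin R (Fr R l) X \<psi>" "\<psi> ` carrier (Fr R l) = {x \<in> N. \<pi> x = \<zero>\<^bsub>Y\<^esub>}"
    using ker by (auto simp: fg_sub_def)
  let ?N = "X\<lparr>carrier := N\<rparr>"
  have mN: "module R ?N" by (rule submodule.submodule_is_module[OF N X])
  have "lin R ?N Y \<pi>" using \<pi> sm(1) by (auto simp: lin_def)
  moreover have "\<exists>y\<in>carrier ?N. \<pi> y = \<phi> x" if x: "x \<in> carrier (Fr R k)" for x
  proof -
    have "\<phi> x \<in> \<pi> ` N" using \<phi>(2) x by blast
    then show ?thesis by auto
  qed
  ultimately obtain \<chi> where \<chi>: "lin R (Fr R k) ?N \<chi>" "\<And>x. x \<in> carrier (Fr R k) \<Longrightarrow> \<pi> (\<chi> x) = \<phi> x"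
    using free_lift[OF mN Y \<phi>(1), of \<pi>] by blast
  have \<chi>N: "\<chi> x \<in> N" if "x \<in> carrier (Fr R k)" for x using lin_closed[OF \<chi>(1) that] by simp
  have \<chi>X: "lin R (Fr R k) X \<chi>" using \<chi>(1) sm(1) by (auto simp: lin_def)
  have \<psi>N: "\<psi> x \<in> N" "\<pi> (\<psi> x) = \<zero>\<^bsub>Y\<^esub>" if "x \<in> carrier (Fr R l)" for x
  proof -
    have "\<psi> x \<in> {x \<in> N. \<pi> x = \<zero>\<^bsub>Y\<^esub>}" using \<psi>(2) that by blast
    then show "\<psi> x \<in> N" "\<pi> (\<psi> x) = \<zero>\<^bsub>Y\<^esub>" by auto
  qed
  let ?\<Phi> = "\<lambda>z. \<psi> (vfst l z) \<oplus>\<^bsub>X\<^esub> \<chi> (vsnd l k z)"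
  have "lin R (Fr R (l + k)) X ?\<Phi>"
    by (intro lin_plus X Fr_module lin_comp[OF lin_vfst \<psi>(1)] lin_comp[OF lin_vsnd \<chi>X])
  moreover have "?\<Phi> ` carrier (Fr R (l + k)) = N"
  proof
    show "?\<Phi> ` carrier (Fr R (l + k)) \<subseteq> N"
      by (intro image_subsetI sm(3) \<psi>N(1) \<chi>N vfst_closed vsnd_closed)
    show "N \<subseteq> ?\<Phi> ` carrier (Fr R (l + k))"
    proof
      fix x assume x: "x \<in> N"
      have "\<pi> x \<in> \<phi> ` carrier (Fr R k)" unfolding \<phi>(2) using x by blast
      then obtain y where y: "y \<in> carrier (Fr R k)" "\<phi> y = \<pi> x" by auto
      have m: "x \<in> carrier X" "\<chi> y \<in> carrier X" using sm(1)[OF x] sm(1)[OF \<chi>N[OF y(1)]] .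
      have "\<pi> (x \<ominus>\<^bsub>X\<^esub> \<chi> y) = \<zero>\<^bsub>Y\<^esub>"
        by (rule lin_diff_zero[OF X Y \<pi> m]) (simp add: \<chi>(2)[OF y(1)] y(2))
      then have "x \<ominus>\<^bsub>X\<^esub> \<chi> y \<in> \<psi> ` carrier (Fr R l)"
        unfolding \<psi>(2) using sm(5)[OF x \<chi>N[OF y(1)]] by simp
      then obtain w where w: "w \<in> carrier (Fr R l)" "\<psi> w = x \<ominus>\<^bsub>X\<^esub> \<chi> y" by auto
      have "x = \<psi> w \<oplus>\<^bsub>X\<^esub> \<chi> y"
        using X.diff_eq_iff[OF m lin_closed[OF \<psi>(1) w(1)]] w(2) by simp
      then have "x = ?\<Phi> (vjoin l k w y)"
        by (simp add: vfst_vjoin[OF w(1)] vsnd_vjoin[OF y(1)])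
      then show "x \<in> ?\<Phi> ` carrier (Fr R (l + k))" using vjoin_closed[OF w(1) y(1)] by blast
    qed
  qed
  ultimately show ?thesis unfolding fg_sub_def by blast
qed

lemma fg_sub_image:
  assumes "fg_sub R X N" "lin R X Y f"
  shows "fg_sub R Y (f ` N)"
proof -
  obtain k \<phi> where \<phi>: "lin R (Fr R k) X \<phi>" "\<phi> ` carrier (Fr R k) = N"
    using assms(1) by (auto simp: fg_sub_def)
  have "(\<lambda>x. f (\<phi> x)) ` carrier (Fr R k) = f ` N" unfolding \<phi>(2)[symmetric] by blast
  then show ?thesis unfolding fg_sub_def using lin_comp[OF \<phi>(1) assms(2)] by blast
qed

text \<open>Induction on the rank along the last coordinate: its values on \<open>N\<close> form an
  ideal of \<open>R\<close>, and the elements of \<open>N\<close> on which it vanishes come, by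
  padding with a zero, from a submodule of a free module of smaller rank.\<close>

lemma fg_sub_Fr:
  assumes "noetherian_ring R"
  shows "submodule N R (Fr R n) \<Longrightarrow> fg_sub R (Fr R n) N"
proof (induction n arbitrary: N)
  case 0
  have "N = carrier (Fr R 0)"
    using submodule_memD(1,2)[OF Fr_module 0] unfolding power_mod_zero_carrier by blast
  then show ?case unfolding fg_sub_def using lin_id by (intro exI[of _ 0] exI[of _ "\<lambda>x. x"]) auto
next
  case (Suc n)
  note sm = submodule_memD[OF Fr_module Suc.prems]
  have \<pi>: "lin R (Fr R (Suc n)) (ring_mod R) (\<lambda>x. x n)" by (rule lin_coord) simp
  have \<iota>: "lin R (Fr R n) (Fr R (n + 1)) (\<lambda>x. vjoin n 1 x \<zero>\<^bsub>Fr R 1\<^esub>)"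
    by (rule lin_vjoin[OF lin_id lin_const_zero[OF Fr_module Fr_module]])
  show ?case
  proof (rule fg_sub_extension[OF Fr_module ring_mod_module \<pi> Suc.prems])
    have s: "submodule ((\<lambda>x. x n) ` N) R (ring_mod R)"
      using submodule_image[OF submodule.submodule_is_module[OF Suc.prems Fr_module] ring_mod_module, of "\<lambda>x. x n"]
        \<pi> sm(1) by (simp add: lin_def)
    have "ideal ((\<lambda>x. x n) ` N) R" by (rule submodule_ideal[OF s])
    then show "fg_sub R (ring_mod R) ((\<lambda>x. x n) ` N)" by (rule fg_sub_ideal[OF assms])
    let ?N = "{x \<in> carrier (Fr R n). vjoin n 1 x \<zero>\<^bsub>Fr R 1\<^esub> \<in> N}"
    have "fg_sub R (Fr R n) ?N"
      using Suc.IH submodule_preimage[OF Fr_module Fr_module \<iota>] Suc.prems by simp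
    then have "fg_sub R (Fr R (n + 1)) ((\<lambda>x. vjoin n 1 x \<zero>\<^bsub>Fr R 1\<^esub>) ` ?N)"
      by (rule fg_sub_image[OF _ \<iota>])
    moreover have "(\<lambda>x. vjoin n 1 x \<zero>\<^bsub>Fr R 1\<^esub>) ` ?N = {x \<in> N. x n = \<zero>\<^bsub>ring_mod R\<^esub>}"
    proof
      show "(\<lambda>x. vjoin n 1 x \<zero>\<^bsub>Fr R 1\<^esub>) ` ?N \<subseteq> {x \<in> N. x n = \<zero>\<^bsub>ring_mod R\<^esub>}"
        by (auto simp: vjoin_def)
      show "{x \<in> N. x n = \<zero>\<^bsub>ring_mod R\<^esub>} \<subseteq> (\<lambda>x. vjoin n 1 x \<zero>\<^bsub>Fr R 1\<^esub>) ` ?N"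
      proof
        fix x assume "x \<in> {x \<in> N. x n = \<zero>\<^bsub>ring_mod R\<^esub>}"
        then have x: "x \<in> N" "x n = \<zero>" "x \<in> carrier (Fr R (n + 1))" using sm(1) by auto
        have "vsnd n 1 x = \<zero>\<^bsub>Fr R 1\<^esub>"
          by (rule power_mod_eqI[OF vsnd_closed[OF x(3)] module.axioms(2)[OF Fr_module, THEN abelian_group.axioms(1), THEN abelian_monoid.zero_closed]])
            (use x(2) in \<open>auto simp: vsnd_def\<close>)
        then have e: "x = vjoin n 1 (vfst n x) \<zero>\<^bsub>Fr R 1\<^esub>" using vjoin_vfst_vsnd[OF x(3)] by simp
        have "vfst n x \<in> ?N" using x(1) vfst_closed[OF x(3)] e[symmetric] by simp
        then show "x \<in> (\<lambda>x. vjoin n 1 x \<zero>\<^bsub>Fr R 1\<^esub>) ` ?N"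
          by (rule rev_image_eqI) (rule e)
      qed
    qed
    ultimately show "fg_sub R (Fr R (Suc n)) {x \<in> N. x n = \<zero>\<^bsub>ring_mod R\<^esub>}" by simp
  qed
qed

text \<open>Each step covers the kernel of the previous map by a finite free module. A state
  \<open>(k, l, d)\<close> of the dependent choice is one map from \<open>R^l\<close> to
  \<open>R^k\<close>; \<open>Q\<close> makes consecutive states composable and exact, and the
  augmentation enters at index zero. The first rank is kept in the conclusion because
  \<open>R/I\<close> will be resolved starting with \<open>R\<close> itself.\<close>

lemma res_exists:
  assumes "noetherian_ring R" "module R X" "lin R (Fr R n) X e"
    "\<And>x. x \<in> carrier X \<Longrightarrow> \<exists>y\<in>carrier (Fr R n). e y = x"
  shows "\<exists>r d. res R X r d e \<and> r 0 = n"
proof -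
  define P where "P = (\<lambda>i :: nat. \<lambda>(k, l, d). lin R (Fr R l) (Fr R k) d \<and>
    (i = 0 \<longrightarrow> k = n \<and> d ` carrier (Fr R l) = {x \<in> carrier (Fr R n). e x = \<zero>\<^bsub>X\<^esub>}))"
  define Q where "Q = (\<lambda>i :: nat. \<lambda>(k, l, d) (k', l', d'). k' = l \<and>
    d' ` carrier (Fr R l') = {x \<in> carrier (Fr R l). d x = \<zero>\<^bsub>Fr R k\<^esub>})"
  have "\<exists>s. P 0 s"
    using fg_sub_Fr[OF assms(1) submodule_kernel[OF Fr_module assms(2,3)]] by (auto simp: fg_sub_def P_def)
  moreover have "\<exists>s'. P (Suc i) s' \<and> Q i s s'" if "P i s" for i s
  proof -
    obtain k l d where s: "s = (k, l, d)" by (cases s)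
    have "lin R (Fr R l) (Fr R k) d" using that by (simp add: P_def s)
    from fg_sub_Fr[OF assms(1) submodule_kernel[OF Fr_module Fr_module this]]
    show ?thesis by (auto simp: fg_sub_def P_def Q_def s)
  qed
  ultimately obtain s where s: "\<And>i. P i (s i)" "\<And>i. Q i (s i) (s (Suc i))"
    using dependent_nat_choice[of P Q] by metis
  define r where "r i = fst (s i)" for i
  define d where "d i = snd (snd (s i))" for i
  have si: "s i = (r i, r (Suc i), d i)" for i
    using s(2)[of i] by (cases "s i"; cases "s (Suc i)") (auto simp: Q_def r_def d_def)
  have l: "lin R (Fr R (r (Suc i))) (Fr R (r i)) (d i)" for i using s(1)[of i] by (simp add: P_def si)
  have r0: "r 0 = n" and d0: "d 0 ` carrier (Fr R (r (Suc 0))) = {x \<in> carrier (Fr R n). e x = \<zero>\<^bsub>X\<^esub>}"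
    using s(1)[of 0] by (auto simp: P_def si)
  have dS: "d (Suc i) ` carrier (Fr R (r (Suc (Suc i)))) = {x \<in> carrier (Fr R (r (Suc i))). d i x = \<zero>\<^bsub>Fr R (r i)\<^esub>}" for i
    using s(2)[of i] by (simp add: Q_def si)
  have m0: "x \<in> d 0 ` carrier (Fr R (r (Suc 0))) \<longleftrightarrow> x \<in> carrier (Fr R n) \<and> e x = \<zero>\<^bsub>X\<^esub>" for x
    by (simp only: d0 mem_Collect_eq)
  have mS: "x \<in> d (Suc i) ` carrier (Fr R (r (Suc (Suc i)))) \<longleftrightarrow>
      x \<in> carrier (Fr R (r (Suc i))) \<and> d i x = \<zero>\<^bsub>Fr R (r i)\<^esub>" for i x
    by (simp only: dS mem_Collect_eq)
  have "res R X r d e"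
  proof (rule resI)
    show "e (d 0 y) = \<zero>\<^bsub>X\<^esub>" if "y \<in> carrier (Fr R (r (Suc 0)))" for y
      using m0[of "d 0 y"] that by blast
    show "d i (d (Suc i) y) = \<zero>\<^bsub>Fr R (r i)\<^esub>" if "y \<in> carrier (Fr R (r (Suc (Suc i))))" for i y
      using mS[of "d (Suc i) y" i] that by blast
    show "\<exists>z\<in>carrier (Fr R (r (Suc 0))). d 0 z = y"
      if "y \<in> carrier (Fr R (r 0))" "e y = \<zero>\<^bsub>X\<^esub>" for y
      using m0[of y] that r0 by auto
    show "\<exists>z\<in>carrier (Fr R (r (Suc (Suc i)))). d (Suc i) z = y"
      if "y \<in> carrier (Fr R (r (Suc i)))" "d i y = \<zero>\<^bsub>Fr R (r i)\<^esub>" for i y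
      using mS[of y i] that by auto
  qed (use assms(3,4) r0 l in auto)
  then show ?thesis using r0 by blast
qed

lemma zero_ext_acyclic:
  assumes "module R X" "carrier X = {\<zero>\<^bsub>X\<^esub>}"
  shows "ext_acyclic R X"
proof -
  interpret X: module R X by fact
  note c = power_mod_zero_carrier[of "ring_mod R"]
  let ?r = "\<lambda>i :: nat. 0 :: nat" and ?d = "\<lambda>(i :: nat) (x :: nat \<Rightarrow> 'a). \<zero>\<^bsub>Fr R 0\<^esub>"
  have "res R X ?r ?d (\<lambda>x. \<zero>\<^bsub>X\<^esub>)"
    by (rule resI; (intro lin_const_zero Fr_module assms(1))?) (simp_all add: c assms(2))
  moreover have "ext_vanish R ?r ?d"
  proof (rule ext_vanishI)
    fix i and f :: "(nat \<Rightarrow> 'a) \<Rightarrow> 'a" assume f: "lin R (Fr R 0) (ring_mod R) f"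
    show "\<exists>g. lin R (Fr R 0) (ring_mod R) g \<and> (\<forall>x\<in>carrier (Fr R 0). f x = g \<zero>\<^bsub>Fr R 0\<^esub>)"
      by (rule exI[of _ f]) (simp add: f c)
  qed
  ultimately show ?thesis unfolding ext_acyclic_def by blast
qed

lemma zero_tot_refl:
  assumes X: "module R X" "carrier X = {\<zero>\<^bsub>X\<^esub>}"
  shows "tot_refl R X"
proof -
  interpret D: module R "dual_mod R X" by (rule dual_module[OF X(1)])
  have "\<phi> = \<zero>\<^bsub>dual_mod R X\<^esub>" if p: "\<phi> \<in> carrier (dual_mod R X)" for \<phi>
  proof (rule dual_eqI[OF p D.zero_closed])
    fix x assume "x \<in> carrier X"
    then have "x = \<zero>\<^bsub>X\<^esub>" using X(2) by blast
    then show "\<phi> x = \<zero>\<^bsub>dual_mod R X\<^esub> x"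
      using lin_zero[OF X(1) ring_mod_module dual_lin[OF p]] X(2) by (simp add: dual_apply)
  qed
  then have dz: "carrier (dual_mod R X) = {\<zero>\<^bsub>dual_mod R X\<^esub>}" using D.zero_closed by blast
  have "reflexive_mod R X"
    unfolding reflexive_mod_def dz
    using X(2) lin_zero[OF dual_module[OF X(1)] ring_mod_module] by (auto simp: dual_apply)
  then show ?thesis
    unfolding tot_refl_def using X zero_ext_acyclic[OF X] zero_ext_acyclic[OF dual_module[OF X(1)] dz] by blast
qed

text \<open>Presents a power as an extension of a smaller power by its last factor, so that total
  reflexivity of powers is an induction with \<open>tot_refl_extension\<close>.\<close>

lemma power_mod_exact:
  assumes "module R M"
  shows "exact3 R M (\<lambda>t. \<lambda>i\<in>{..<Suc n}. if i = n then t else \<zero>\<^bsub>M\<^esub>) (power_mod M (Suc n))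
    (\<lambda>x. \<lambda>i\<in>{..<n}. x i) (power_mod M n)"
  unfolding exact3_def
proof (intro conjI ballI)
  interpret M: module R M by fact
  let ?f = "\<lambda>t. \<lambda>i\<in>{..<Suc n}. if i = n then t else \<zero>\<^bsub>M\<^esub>" and ?g = "\<lambda>x. \<lambda>i\<in>{..<n}. x i"
  have fc: "?f t \<in> carrier (power_mod M (Suc n))" if "t \<in> carrier M" for t
    using that by (auto simp: power_mod_simps)
  have gc: "?g x \<in> carrier (power_mod M n)" if "x \<in> carrier (power_mod M (Suc n))" for x
    using power_mod_mem[OF that] by (auto simp: power_mod_simps)
  show "lin R M (power_mod M (Suc n)) ?f"
    by (rule linI) (auto simp: fc power_mod_simps intro!: restrict_ext)
  show "lin R (power_mod M (Suc n)) (power_mod M n) ?g"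
    using lin_vfst[of R M n 1] by (simp add: vfst_def[abs_def])
  show "inj_on ?f (carrier M)"
  proof (rule inj_onI)
    fix s t assume "?f s = ?f t"
    from fun_cong[OF this, of n] show "s = t" by simp
  qed
  show "?g x = \<zero>\<^bsub>power_mod M n\<^esub> \<longleftrightarrow> (\<exists>t\<in>carrier M. ?f t = x)"
    if x: "x \<in> carrier (power_mod M (Suc n))" for x
  proof
    assume l: "?g x = \<zero>\<^bsub>power_mod M n\<^esub>"
    have "?f (x n) = x"
    proof (rule power_mod_eqI[OF fc x])
      fix i assume "i < Suc n"
      then show "?f (x n) i = x i" using fun_cong[OF l, of i] by (cases "i = n") (auto simp: power_mod_simps)
    qed (use power_mod_mem[OF x, of n] in auto)
    then show "\<exists>t\<in>carrier M. ?f t = x" using power_mod_mem[OF x, of n] by auto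
  next
    assume "\<exists>t\<in>carrier M. ?f t = x"
    then show "?g x = \<zero>\<^bsub>power_mod M n\<^esub>" by (auto simp: power_mod_simps intro!: restrict_ext)
  qed
  show "\<exists>x\<in>carrier (power_mod M (Suc n)). ?g x = y" if y: "y \<in> carrier (power_mod M n)" for y
  proof
    show m: "(\<lambda>i\<in>{..<Suc n}. if i < n then y i else \<zero>\<^bsub>M\<^esub>) \<in> carrier (power_mod M (Suc n))"
      using power_mod_mem[OF y] by (auto simp: power_mod_simps)
    show "?g (\<lambda>i\<in>{..<Suc n}. if i < n then y i else \<zero>\<^bsub>M\<^esub>) = y"
      by (rule power_mod_eqI[OF gc[OF m] y]) simp
  qed
qed

lemma tot_refl_power:
  assumes "tot_refl R M"
  shows "tot_refl R (power_mod M n)"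
proof (induction n)
  case 0
  have M: "module R M" using assms by (simp add: tot_refl_def)
  show ?case by (rule zero_tot_refl[OF power_mod_module[OF M] power_mod_zero_carrier])
next
  case (Suc n)
  have M: "module R M" using assms by (simp add: tot_refl_def)
  show ?case by (rule tot_refl_extension[OF assms Suc power_mod_module[OF M] power_mod_exact[OF M]])
qed

end

section \<open>Quasi-Gorenstein ideals of grade zero\<close>

context cring
begin

lemma zero_submodule:
  assumes "module R M"
  shows "submodule {\<zero>\<^bsub>M\<^esub>} R M"
proof -
  interpret M: module R M by fact
  show ?thesis by (rule M.submoduleI) auto
qed

text \<open>In grade zero the isomorphism in the definition is one between
  \<open>Hom(R/I, R) = (0 : I)\<close> and \<open>R/I\<close>, and \<open>a\<close> is the element
  of \<open>(0 : I)\<close> that corresponds to the class of one. The work lies in the fact that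
  \<open>Ext_mod\<close> uses an unknown resolution, whose first module may have any rank:
  \<open>Hom(R/I, R)\<close> appears as the cocycles \<open>Z\<close> on \<open>R^(r 0)\<close>, and
  evaluation at a preimage \<open>x0\<close> of the class of one turns a cocycle into an element of
  \<open>(0 : I)\<close>.\<close>

lemma quasi_Gorenstein_generator:
  assumes noeth: "noetherian_ring R" and qG: "quasi_Gorenstein R I" and gr: "grade R I = 0"
  shows "\<exists>a\<in>carrier R. (\<forall>r\<in>carrier R. r \<otimes> a = \<zero> \<longleftrightarrow> r \<in> I) \<and>
    (\<forall>t\<in>carrier R. t \<in> zero_colon R I \<longleftrightarrow> (\<exists>r\<in>carrier R. t = r \<otimes> a))"
    and "ext_acyclic R (cyclic_mod R I)"
proof -
  have I: "ideal I R" using qG by (simp add: quasi_Gorenstein_def)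
  have Ext: "if i = 0 then isomorphic_mod R (Ext_mod R i (cyclic_mod R I) (ring_mod R)) (cyclic_mod R I)
    else zero_mod (Ext_mod R i (cyclic_mod R I) (ring_mod R))" for i
    using qG gr unfolding quasi_Gorenstein_def by (metis enat_0 enat_0_iff(1))
  interpret I: ideal I R by (rule I)
  note sub = ideal_submodule[OF I]
  let ?T = "cyclic_mod R I" and ?\<pi> = "\<lambda>r. I +>\<^bsub>ring_mod R\<^esub> r"
  have T: "module R ?T" by (rule quot_mod_module[OF ring_mod_module sub])
  interpret T: module R ?T by (rule T)
  note \<pi> = lin_proj[OF ring_mod_module sub]
  have \<pi>1: "r \<odot>\<^bsub>?T\<^esub> ?\<pi> \<one> = ?\<pi> r" if "r \<in> carrier R" for r
    using coset_smult[OF ring_mod_module sub that, of \<one>] that by simp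
  have \<pi>c: "?\<pi> r \<in> carrier ?T" if "r \<in> carrier R" for r using lin_closed[OF \<pi>, of r] that by simp
  have \<pi>s: "\<exists>r\<in>carrier R. ?\<pi> r = t" if "t \<in> carrier ?T" for t
    using that unfolding quot_mod_carrier[OF ring_mod_module sub] by auto
  have \<pi>z: "?\<pi> r = \<zero>\<^bsub>?T\<^esub> \<longleftrightarrow> r \<in> I" if "r \<in> carrier R" for r
    using coset_eq_zero_iff[OF ring_mod_module sub, of r] that by simp
  \<comment> \<open>The resolution \<open>r1\<close> shows that resolutions exist and carries the
    vanishing in positive degrees; degree zero is computed further down from \<open>r\<close>,
    \<open>d\<close>, \<open>e\<close>, the resolution picked by \<open>Ext_mod\<close>.\<close>
  have "lin R (Fr R 1) ?T (\<lambda>x. ?\<pi> (x 0))" by (rule lin_comp[OF lin_coord \<pi>]) simp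
  moreover have "\<exists>y\<in>carrier (Fr R 1). ?\<pi> (y 0) = x" if x: "x \<in> carrier ?T" for x
  proof -
    obtain r where r: "r \<in> carrier R" "?\<pi> r = x" using \<pi>s[OF x] by blast
    have "(\<lambda>i\<in>{..<1}. r) \<in> carrier (Fr R 1)" using r(1) by (auto simp: power_mod_simps)
    then show ?thesis by (rule rev_bexI) (simp add: r(2))
  qed
  ultimately obtain r1 d1 where r1: "res R ?T r1 d1 (\<lambda>x. ?\<pi> (x 0))"
    using res_exists[OF noeth T] by blast
  have "ext_vanish R r1 d1" unfolding Ext_zero_iff[OF T r1] using Ext by (metis neq0_conv)
  then show "ext_acyclic R ?T" using r1 unfolding ext_acyclic_def by blast
  obtain r d e where r: "res R ?T r d e" "\<And>i. Ext_mod R i ?T (ring_mod R) = cohomology_mod R r d (ring_mod R) i"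
    by (rule Ext_mod_resolution[OF T r1]) blast
  note c = resD[OF r(1)]
  let ?H = "dual_mod R (Fr R (r 0))"
  define Z where "Z = cocycles R r d (ring_mod R) 0"
  let ?M = "?H\<lparr>carrier := Z\<rparr>"
  interpret H: module R ?H by (rule dual_module[OF Fr_module])
  have Zc: "f \<in> Z \<longleftrightarrow> f \<in> carrier ?H \<and> (\<forall>x\<in>carrier (Fr R (r (Suc 0))). f (d 0 x) = \<zero>)" for f
    by (simp add: Z_def cocycles_def dual_carrier)
  have Zsub: "submodule Z R ?H"
  proof (rule H.submoduleI)
    show "Z \<subseteq> carrier ?H" using Zc by blast
    show "\<zero>\<^bsub>?H\<^esub> \<in> Z" unfolding Zc using lin_closed[OF c(3)] by (simp add: dual_apply)
    show "\<ominus>\<^bsub>?H\<^esub> f \<in> Z" if f: "f \<in> Z" for f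
      unfolding Zc
    proof (intro conjI ballI)
      fix x assume "x \<in> carrier (Fr R (r (Suc 0)))"
      then show "(\<ominus>\<^bsub>?H\<^esub> f) (d 0 x) = \<zero>"
        using f lin_neg[OF dual_module[OF Fr_module] ring_mod_module lin_eval[OF lin_closed[OF c(3)]]] by (auto simp: Zc)
    qed (use f Zc in auto)
    show "f \<oplus>\<^bsub>?H\<^esub> g \<in> Z" if "f \<in> Z" "g \<in> Z" for f g
      using that lin_closed[OF c(3)] unfolding Zc by (simp add: dual_apply)
    show "a \<odot>\<^bsub>?H\<^esub> f \<in> Z" if "a \<in> carrier R" "f \<in> Z" for a f
      using that lin_closed[OF c(3)] unfolding Zc by (simp add: dual_apply)
  qed
  have M: "module R ?M" by (rule submodule.submodule_is_module[OF Zsub dual_module[OF Fr_module]])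
  interpret M: module R ?M by (rule M)
  \<comment> \<open>In degree zero the only coboundary is zero, so \<open>?q\<close> identifies
    \<open>Z\<close> with \<open>Ext^0\<close>, and \<open>k\<close> becomes an isomorphism from
    \<open>Z\<close> onto \<open>R/I\<close>.\<close>
  have B: "submodule {\<zero>\<^bsub>?M\<^esub>} R ?M" by (rule zero_submodule[OF M])
  have E0: "Ext_mod R 0 ?T (ring_mod R) = quot_mod R ?M {\<zero>\<^bsub>?M\<^esub>}"
    unfolding r(2) cohomology_mod_def Z_def by (simp add: coboundaries_def dual_mod_def)
  let ?E = "quot_mod R ?M {\<zero>\<^bsub>?M\<^esub>}" and ?q = "\<lambda>f. {\<zero>\<^bsub>?M\<^esub>} +>\<^bsub>?M\<^esub> f"
  have E: "module R ?E" by (rule quot_mod_module[OF M B])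
  have "isomorphic_mod R ?E ?T" using Ext[of 0] E0 by simp
  then obtain h where h: "h \<in> mod_hom R ?E ?T" "bij_betw h (carrier ?E) (carrier ?T)"
    by (auto simp: isomorphic_mod_def mod_iso_def)
  define k where "k = (\<lambda>f. h (?q f))"
  have kl: "lin R ?M ?T k" unfolding k_def by (rule lin_comp[OF lin_proj[OF M B] mod_hom_lin[OF h(1)]])
  have kinj: "f = \<zero>\<^bsub>?H\<^esub>" if f: "f \<in> Z" "k f = \<zero>\<^bsub>?T\<^esub>" for f
  proof -
    have "h (?q f) = h (?q \<zero>\<^bsub>?M\<^esub>)"
      using f(2) lin_zero[OF M T kl] by (simp add: k_def)
    then have "?q f = ?q \<zero>\<^bsub>?M\<^esub>"
    proof (rule inj_onD[OF bij_betw_imp_inj_on[OF h(2)]])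
      show "?q f \<in> carrier ?E" by (rule lin_closed[OF lin_proj[OF M B]]) (simp add: f(1))
      show "?q \<zero>\<^bsub>?M\<^esub> \<in> carrier ?E" by (rule lin_closed[OF lin_proj[OF M B] M.zero_closed])
    qed
    then have "?q f = \<zero>\<^bsub>?E\<^esub>" by (simp only: coset_zero[OF M B])
    then show ?thesis using coset_eq_zero_iff[OF M B, of f] f(1) by simp
  qed
  have ksur: "\<exists>f\<in>Z. k f = t" if "t \<in> carrier ?T" for t
  proof -
    have "t \<in> h ` carrier ?E" using that bij_betw_imp_surj_on[OF h(2)] by simp
    then show ?thesis unfolding quot_mod_carrier[OF M B] k_def by auto
  qed
  obtain f where f: "f \<in> Z" "k f = ?\<pi> \<one>" using ksur[OF \<pi>c[OF one_closed]] by blast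
  have fl: "lin R (Fr R (r 0)) (ring_mod R) f" using f(1) Zc dual_lin by blast
  have kr: "k (s \<odot>\<^bsub>?H\<^esub> f) = ?\<pi> s" if "s \<in> carrier R" for s
    using lin_smult[OF kl that, of f] f \<pi>1[OF that] by simp
  have all: "\<exists>s\<in>carrier R. g = s \<odot>\<^bsub>?H\<^esub> f" if g: "g \<in> Z" for g
  proof -
    obtain s where s: "s \<in> carrier R" "?\<pi> s = k g" using \<pi>s[OF lin_closed[OF kl, of g]] g by auto
    have sf: "s \<odot>\<^bsub>?H\<^esub> f \<in> Z" using submodule_memD(6)[OF dual_module[OF Fr_module] Zsub s(1) f(1)] .
    have "k (g \<ominus>\<^bsub>?M\<^esub> (s \<odot>\<^bsub>?H\<^esub> f)) = \<zero>\<^bsub>?T\<^esub>"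
      by (rule lin_diff_zero[OF M T kl]) (use g sf kr[OF s(1)] s(2) in auto)
    moreover have "g \<ominus>\<^bsub>?M\<^esub> (s \<odot>\<^bsub>?H\<^esub> f) \<in> Z" using M.minus_closed[of g "s \<odot>\<^bsub>?H\<^esub> f"] g sf by simp
    ultimately have "g \<ominus>\<^bsub>?M\<^esub> (s \<odot>\<^bsub>?H\<^esub> f) = \<zero>\<^bsub>?M\<^esub>" using kinj by simp
    then have "g = s \<odot>\<^bsub>?H\<^esub> f" using M.diff_eq_zero_iff[of g "s \<odot>\<^bsub>?H\<^esub> f"] g sf by simp
    then show ?thesis using s(1) by blast
  qed
  obtain x0 where x0: "x0 \<in> carrier (Fr R (r 0))" "e x0 = ?\<pi> \<one>" using c(2)[OF \<pi>c[OF one_closed]] by blast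
  \<comment> \<open>A cocycle vanishes on the kernel of \<open>e\<close>, so its value at
    \<open>x\<close> depends on \<open>e x\<close> alone and is governed by its value at
    \<open>x0\<close>.\<close>
  have fac: "g x = s \<otimes> g x0" if g: "g \<in> Z" and x: "x \<in> carrier (Fr R (r 0))" and s: "s \<in> carrier R" "e x = ?\<pi> s"
    for g x s
  proof -
    interpret F: module R "Fr R (r 0)" by (rule Fr_module)
    have gl: "lin R (Fr R (r 0)) (ring_mod R) g" using g Zc dual_lin by blast
    have m: "s \<odot>\<^bsub>Fr R (r 0)\<^esub> x0 \<in> carrier (Fr R (r 0))" using s(1) x0(1) by simp
    have "e (x \<ominus>\<^bsub>Fr R (r 0)\<^esub> s \<odot>\<^bsub>Fr R (r 0)\<^esub> x0) = \<zero>\<^bsub>?T\<^esub>"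
      by (rule lin_diff_zero[OF Fr_module T c(1) x m]) (simp add: lin_smult[OF c(1) s(1) x0(1)] x0(2) \<pi>1[OF s(1)] s(2))
    then obtain y where "y \<in> carrier (Fr R (r (Suc 0)))" "d 0 y = x \<ominus>\<^bsub>Fr R (r 0)\<^esub> s \<odot>\<^bsub>Fr R (r 0)\<^esub> x0"
      using c(6)[OF F.minus_closed[OF x m]] by blast
    then have "g (x \<ominus>\<^bsub>Fr R (r 0)\<^esub> s \<odot>\<^bsub>Fr R (r 0)\<^esub> x0) = \<zero>" using g Zc by metis
    then show ?thesis
      using lin_minus[OF Fr_module ring_mod_module gl x m] lin_smult[OF gl s(1) x0(1)]
        lin_closed[OF gl x] lin_closed[OF gl m] lin_closed[OF gl x0(1)] s(1) by simp
  qed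
  define a where "a = f x0"
  have a: "a \<in> carrier R" using lin_closed[OF fl x0(1)] by (simp add: a_def)
  have ann: "s \<otimes> a = \<zero> \<longleftrightarrow> s \<in> I" if s: "s \<in> carrier R" for s
  proof
    assume 0: "s \<otimes> a = \<zero>"
    have sf: "s \<odot>\<^bsub>?H\<^esub> f \<in> Z" using submodule_memD(6)[OF dual_module[OF Fr_module] Zsub s f(1)] .
    have "s \<odot>\<^bsub>?H\<^esub> f = \<zero>\<^bsub>?H\<^esub>"
    proof (rule dual_eqI)
      fix x assume x: "x \<in> carrier (Fr R (r 0))"
      obtain t where t: "t \<in> carrier R" "?\<pi> t = e x" using \<pi>s[OF lin_closed[OF c(1) x]] by blast
      have "(s \<odot>\<^bsub>?H\<^esub> f) x0 = \<zero>" using 0 by (simp add: dual_apply(2)[OF x0(1)] a_def)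
      then show "(s \<odot>\<^bsub>?H\<^esub> f) x = \<zero>\<^bsub>?H\<^esub> x"
        using fac[OF sf x t(1) t(2)[symmetric]] t(1) by (simp add: dual_apply(3)[OF x])
    qed (use sf Zc in auto)
    then have "k (s \<odot>\<^bsub>?H\<^esub> f) = \<zero>\<^bsub>?T\<^esub>" using lin_zero[OF M T kl] by simp
    then show "s \<in> I" using kr[OF s] \<pi>z[OF s] by simp
  next
    assume "s \<in> I"
    then have "k (s \<odot>\<^bsub>?H\<^esub> f) = \<zero>\<^bsub>?T\<^esub>" using kr[OF s] \<pi>z[OF s] by simp
    then have "s \<odot>\<^bsub>?H\<^esub> f = \<zero>\<^bsub>?H\<^esub>" using kinj submodule_memD(6)[OF dual_module[OF Fr_module] Zsub s f(1)] by blast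
    then have "(s \<odot>\<^bsub>?H\<^esub> f) x0 = \<zero>" by (simp add: dual_apply(3)[OF x0(1)])
    then show "s \<otimes> a = \<zero>" by (simp add: dual_apply(2)[OF x0(1)] a_def)
  qed
  have col: "t \<in> zero_colon R I \<longleftrightarrow> (\<exists>s\<in>carrier R. t = s \<otimes> a)" if t: "t \<in> carrier R" for t
  proof
    assume tI: "t \<in> zero_colon R I"
    \<comment> \<open>Multiplication by an element \<open>t\<close> of \<open>(0 : I)\<close>
      factors through \<open>R/I\<close>; pulled back along \<open>e\<close> it is a cocycle, hence
      a multiple of \<open>f\<close>, and evaluation at \<open>x0\<close> shows that
      \<open>t\<close> is the same multiple of \<open>a\<close>.\<close>
    have "lin R (ring_mod R) (ring_mod R) (\<lambda>s. t \<odot>\<^bsub>ring_mod R\<^esub> s)"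
      by (rule lin_scale[OF ring_mod_module ring_mod_module lin_id t])
    from quot_lift[OF ring_mod_module sub ring_mod_module this] tI
    obtain v where v: "lin R ?T (ring_mod R) v" "\<And>s. s \<in> carrier R \<Longrightarrow> v (?\<pi> s) = t \<otimes> s"
      by (auto simp: zero_colon_def)
    let ?g = "restrict (\<lambda>x. v (e x)) (carrier (Fr R (r 0)))"
    have "?g \<in> Z"
      unfolding Zc
      using dual_restrict[OF Fr_module lin_comp[OF c(1) v(1)]] c(4) lin_closed[OF c(3)] lin_zero[OF T ring_mod_module v(1)]
      by auto
    then obtain s where s: "s \<in> carrier R" "?g = s \<odot>\<^bsub>?H\<^esub> f" using all by blast
    have "t = ?g x0" using x0 v(2)[OF one_closed] t by simp
    also have "\<dots> = s \<otimes> a" unfolding s(2) by (simp add: dual_apply(2)[OF x0(1)] a_def)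
    finally show "\<exists>s\<in>carrier R. t = s \<otimes> a" using s(1) by blast
  next
    assume "\<exists>s\<in>carrier R. t = s \<otimes> a"
    then obtain s where s: "s \<in> carrier R" "t = s \<otimes> a" by blast
    have "s \<otimes> a \<otimes> x = \<zero>" if "x \<in> I" for x
    proof -
      have x: "x \<in> carrier R" "x \<otimes> a = \<zero>" using ann that I.a_subset by auto
      have "s \<otimes> a \<otimes> x = s \<otimes> (x \<otimes> a)" using x(1) s(1) a by (simp add: m_ac)
      then show ?thesis using x(2) s(1) by simp
    qed
    then show "t \<in> zero_colon R I" using t s(2) by (simp add: zero_colon_def)
  qed
  show "\<exists>a\<in>carrier R. (\<forall>r\<in>carrier R. r \<otimes> a = \<zero> \<longleftrightarrow> r \<in> I) \<and>
    (\<forall>t\<in>carrier R. t \<in> zero_colon R I \<longleftrightarrow> (\<exists>r\<in>carrier R. t = r \<otimes> a))"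
    using a ann col by blast
qed

end

section \<open>Total reflexivity of \<open>R/I\<close> and \<open>R/(0 : I)\<close>\<close>

context cring
begin

lemma zero_colon_ideal:
  assumes "I \<subseteq> carrier R"
  shows "ideal (zero_colon R I) R"
proof (rule submodule_ideal)
  show "submodule (zero_colon R I) R (ring_mod R)"
  proof (rule module.submoduleI[OF ring_mod_module], unfold ring_mod_simps)
    show "zero_colon R I \<subseteq> carrier R" by (auto simp: zero_colon_def)
    show "\<zero> \<in> zero_colon R I" using assms by (auto simp: zero_colon_def subset_iff)
    show "\<ominus> x \<in> zero_colon R I" if "x \<in> zero_colon R I" for x
      using that assms by (auto simp: zero_colon_def subset_iff l_minus)
    show "x \<oplus> y \<in> zero_colon R I" if "x \<in> zero_colon R I" "y \<in> zero_colon R I" for x y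
      using that assms by (auto simp: zero_colon_def subset_iff l_distr)
    show "a \<otimes> x \<in> zero_colon R I" if "a \<in> carrier R" "x \<in> zero_colon R I" for a x
      using that assms by (auto simp: zero_colon_def subset_iff m_assoc)
  qed
qed

lemma Fr_one_expand:
  assumes "x \<in> carrier (Fr R 1)"
  shows "x = x 0 \<odot>\<^bsub>Fr R 1\<^esub> unit_vec R 1 0"
proof (rule power_mod_eqI[OF assms])
  have x0: "x 0 \<in> carrier R" using power_mod_mem[OF assms, of 0] by simp
  show "x 0 \<odot>\<^bsub>Fr R 1\<^esub> unit_vec R 1 0 \<in> carrier (Fr R 1)"
    by (rule module.smult_closed[OF Fr_module x0 unit_vec_closed])
  show "x i = (x 0 \<odot>\<^bsub>Fr R 1\<^esub> unit_vec R 1 0) i" if "i < 1" for i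
    using that x0 by (simp add: unit_vec_def)
qed

lemma lin_Fr_one:
  assumes "module R Y" "lin R (Fr R 1) Y f" "x \<in> carrier (Fr R 1)"
  shows "f x = x 0 \<odot>\<^bsub>Y\<^esub> f (unit_vec R 1 0)"
proof -
  have "x 0 \<in> carrier R" using power_mod_mem[OF assms(3), of 0] by simp
  then show ?thesis
    using lin_smult[OF assms(2) _ unit_vec_closed, of "x 0" 0] Fr_one_expand[OF assms(3)] by simp
qed

text \<open>With the three lemmas that follow, this identifies the dual of \<open>R/K\<close> with
  \<open>(0 : K)\<close> by evaluation at the class of one.\<close>

lemma cyclic_lin:
  assumes "ideal K R" "t \<in> carrier R" "\<And>s. s \<in> K \<Longrightarrow> s \<otimes> t = \<zero>"
  shows "\<exists>\<phi>\<in>carrier (dual_mod R (cyclic_mod R K)). \<forall>s\<in>carrier R. \<phi> (K +>\<^bsub>ring_mod R\<^esub> s) = s \<otimes> t"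
proof -
  note sub = ideal_submodule[OF assms(1)]
  have "lin R (ring_mod R) (ring_mod R) (\<lambda>s. t \<odot>\<^bsub>ring_mod R\<^esub> s)"
    by (rule lin_scale[OF ring_mod_module ring_mod_module lin_id assms(2)])
  moreover have "t \<odot>\<^bsub>ring_mod R\<^esub> s = \<zero>\<^bsub>ring_mod R\<^esub>" if "s \<in> K" for s
    using assms(3)[OF that] submodule_memD(1)[OF ring_mod_module sub that] assms(2) by (simp add: m_comm)
  ultimately obtain v where v: "lin R (cyclic_mod R K) (ring_mod R) v"
      "\<And>s. s \<in> carrier R \<Longrightarrow> v (K +>\<^bsub>ring_mod R\<^esub> s) = t \<otimes> s"
    using quot_lift[OF ring_mod_module sub ring_mod_module] by (metis ring_mod_simps(1,4))
  have T: "module R (cyclic_mod R K)" by (rule quot_mod_module[OF ring_mod_module sub])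
  show ?thesis
  proof (rule bexI[OF _ dual_restrict[OF T v(1)]], rule ballI)
    fix s assume s: "s \<in> carrier R"
    have "K +>\<^bsub>ring_mod R\<^esub> s \<in> carrier (cyclic_mod R K)"
      using lin_closed[OF lin_proj[OF ring_mod_module sub], of s] s by simp
    then show "restrict v (carrier (cyclic_mod R K)) (K +>\<^bsub>ring_mod R\<^esub> s) = s \<otimes> t"
      using v(2)[OF s] assms(2) s by (simp add: m_comm)
  qed
qed

lemma cyclic_dual_apply:
  assumes K: "ideal K R" and p: "\<phi> \<in> carrier (dual_mod R (cyclic_mod R K))" and s: "s \<in> carrier R"
  shows "\<phi> (K +>\<^bsub>ring_mod R\<^esub> s) = s \<otimes> \<phi> (K +>\<^bsub>ring_mod R\<^esub> \<one>)"
proof -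
  note sub = ideal_submodule[OF K]
  have "K +>\<^bsub>ring_mod R\<^esub> \<one> \<in> carrier (cyclic_mod R K)"
    using lin_closed[OF lin_proj[OF ring_mod_module sub], of \<one>] by simp
  from lin_smult[OF dual_lin[OF p] s this] show ?thesis
    using coset_smult[OF ring_mod_module sub s, of \<one>] s by simp
qed

lemma cyclic_dual_eqI:
  assumes K: "ideal K R" and p: "\<phi> \<in> carrier (dual_mod R (cyclic_mod R K))"
    "\<psi> \<in> carrier (dual_mod R (cyclic_mod R K))"
    and e: "\<phi> (K +>\<^bsub>ring_mod R\<^esub> \<one>) = \<psi> (K +>\<^bsub>ring_mod R\<^esub> \<one>)"
  shows "\<phi> = \<psi>"
proof (rule dual_eqI[OF p])
  fix x assume "x \<in> carrier (cyclic_mod R K)"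
  then obtain s where s: "s \<in> carrier R" "x = K +>\<^bsub>ring_mod R\<^esub> s"
    unfolding quot_mod_carrier[OF ring_mod_module ideal_submodule[OF K]] by auto
  show "\<phi> x = \<psi> x"
    unfolding s(2) cyclic_dual_apply[OF K p(1) s(1)] cyclic_dual_apply[OF K p(2) s(1)] e ..
qed

lemma cyclic_dual_value:
  assumes K: "ideal K R" and p: "\<phi> \<in> carrier (dual_mod R (cyclic_mod R K))"
  shows "\<phi> (K +>\<^bsub>ring_mod R\<^esub> \<one>) \<in> carrier R"
    "s \<in> K \<Longrightarrow> s \<otimes> \<phi> (K +>\<^bsub>ring_mod R\<^esub> \<one>) = \<zero>"
proof -
  note sub = ideal_submodule[OF K]
  have c: "K +>\<^bsub>ring_mod R\<^esub> \<one> \<in> carrier (cyclic_mod R K)"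
    using lin_closed[OF lin_proj[OF ring_mod_module sub], of \<one>] by simp
  show "\<phi> (K +>\<^bsub>ring_mod R\<^esub> \<one>) \<in> carrier R" using lin_closed[OF dual_lin[OF p] c] by simp
  assume s: "s \<in> K"
  have sc: "s \<in> carrier R" using submodule_memD(1)[OF ring_mod_module sub s] by simp
  have "K +>\<^bsub>ring_mod R\<^esub> s = \<zero>\<^bsub>cyclic_mod R K\<^esub>"
    using coset_eq_zero_iff[OF ring_mod_module sub, of s] s sc by simp
  then show "s \<otimes> \<phi> (K +>\<^bsub>ring_mod R\<^esub> \<one>) = \<zero>"
    using cyclic_dual_apply[OF K p sc] lin_zero[OF quot_mod_module[OF ring_mod_module sub] ring_mod_module dual_lin[OF p]]
    by simp
qed

context
  fixes I a
  assumes noeth: "noetherian_ring R" and I: "ideal I R" and a: "a \<in> carrier R"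
    and ann: "\<And>r. r \<in> carrier R \<Longrightarrow> r \<otimes> a = \<zero> \<longleftrightarrow> r \<in> I"
    and col: "\<And>t. t \<in> carrier R \<Longrightarrow> t \<in> zero_colon R I \<longleftrightarrow> (\<exists>r\<in>carrier R. t = r \<otimes> a)"
    and acyc: "ext_acyclic R (cyclic_mod R I)"
begin

lemma ideal_mem: "s \<in> I \<Longrightarrow> s \<in> carrier R"
  using submodule_memD(1)[OF ring_mod_module ideal_submodule[OF I]] by simp

text \<open>The functional \<open>\<phi>\<close> with value \<open>a\<close> at the class of one
  generates the dual, because \<open>(0 : I) = aR\<close>, and its annihilator is \<open>I\<close>.
  So \<open>R/I\<close> is isomorphic to its own dual, which is therefore acyclic as well. A
  functional on the dual is determined by its value at \<open>\<phi>\<close>; that value is a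
  multiple \<open>r a\<close>, and the functional is evaluation at the class of
  \<open>r\<close>.\<close>

lemma cyclic_tot_refl: "tot_refl R (cyclic_mod R I)"
proof -
  let ?T = "cyclic_mod R I" and ?\<pi> = "\<lambda>r. I +>\<^bsub>ring_mod R\<^esub> r"
  note sub = ideal_submodule[OF I]
  have T: "module R ?T" by (rule quot_mod_module[OF ring_mod_module sub])
  interpret D: module R "dual_mod R ?T" by (rule dual_module[OF T])
  have \<pi>c: "?\<pi> r \<in> carrier ?T" if "r \<in> carrier R" for r
    using lin_closed[OF lin_proj[OF ring_mod_module sub], of r] that by simp
  have \<pi>s: "\<exists>r\<in>carrier R. t = ?\<pi> r" if "t \<in> carrier ?T" for t
    using that unfolding quot_mod_carrier[OF ring_mod_module sub] by auto
  obtain \<phi> where \<phi>: "\<phi> \<in> carrier (dual_mod R ?T)" "\<And>s. s \<in> carrier R \<Longrightarrow> \<phi> (?\<pi> s) = s \<otimes> a"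
    using cyclic_lin[OF I a] ann ideal_mem by metis
  have \<phi>1: "\<phi> (?\<pi> \<one>) = a" using \<phi>(2)[OF one_closed] a by simp
  have all: "\<exists>r\<in>carrier R. \<psi> = r \<odot>\<^bsub>dual_mod R ?T\<^esub> \<phi>" if p: "\<psi> \<in> carrier (dual_mod R ?T)" for \<psi>
  proof -
    have v: "\<psi> (?\<pi> \<one>) \<in> carrier R" by (rule cyclic_dual_value(1)[OF I p])
    have "\<psi> (?\<pi> \<one>) \<in> zero_colon R I"
      unfolding zero_colon_def
    proof (intro CollectI conjI ballI v)
      fix s assume s: "s \<in> I"
      show "\<psi> (?\<pi> \<one>) \<otimes> s = \<zero>" using cyclic_dual_value(2)[OF I p s] v ideal_mem[OF s] by (simp add: m_comm)
    qed
    then obtain r where r: "r \<in> carrier R" "\<psi> (?\<pi> \<one>) = r \<otimes> a" using col[OF v] by blast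
    have "\<psi> = r \<odot>\<^bsub>dual_mod R ?T\<^esub> \<phi>"
      by (rule cyclic_dual_eqI[OF I p D.smult_closed[OF r(1) \<phi>(1)]])
        (simp add: dual_apply(2)[OF \<pi>c[OF one_closed]] \<phi>1 r(2))
    then show ?thesis using r(1) by blast
  qed
  have zr: "r \<odot>\<^bsub>dual_mod R ?T\<^esub> \<phi> = \<zero>\<^bsub>dual_mod R ?T\<^esub> \<longleftrightarrow> r \<in> I" if r: "r \<in> carrier R" for r
  proof
    assume "r \<odot>\<^bsub>dual_mod R ?T\<^esub> \<phi> = \<zero>\<^bsub>dual_mod R ?T\<^esub>"
    then have "(r \<odot>\<^bsub>dual_mod R ?T\<^esub> \<phi>) (?\<pi> \<one>) = \<zero>" by (simp add: dual_apply(3)[OF \<pi>c[OF one_closed]])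
    then show "r \<in> I" using ann[OF r] by (simp add: dual_apply(2)[OF \<pi>c[OF one_closed]] \<phi>1)
  next
    assume "r \<in> I"
    then show "r \<odot>\<^bsub>dual_mod R ?T\<^esub> \<phi> = \<zero>\<^bsub>dual_mod R ?T\<^esub>"
      using ann[OF r]
      by (intro cyclic_dual_eqI[OF I D.smult_closed[OF r \<phi>(1)] D.zero_closed])
        (simp add: dual_apply[OF \<pi>c[OF one_closed]] \<phi>1)
  qed
  have "lin R (ring_mod R) (dual_mod R ?T) (\<lambda>r. r \<odot>\<^bsub>dual_mod R ?T\<^esub> \<phi>)"
    by (rule linI) (simp_all add: \<phi>(1) D.smult_l_distr D.smult_assoc1)
  from quot_lift[OF ring_mod_module sub dual_module[OF T] this] zr ideal_mem
  obtain h where h: "lin R ?T (dual_mod R ?T) h" "\<And>r. r \<in> carrier R \<Longrightarrow> h (?\<pi> r) = r \<odot>\<^bsub>dual_mod R ?T\<^esub> \<phi>"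
    by (metis ring_mod_simps(1))
  have "bij_betw h (carrier ?T) (carrier (dual_mod R ?T))"
  proof (rule bij_betw_imageI)
    interpret T: module R ?T by (rule T)
    show "inj_on h (carrier ?T)"
    proof (rule inj_onI)
      fix x y assume xy: "x \<in> carrier ?T" "y \<in> carrier ?T" "h x = h y"
      obtain r where r: "r \<in> carrier R" "x \<ominus>\<^bsub>?T\<^esub> y = ?\<pi> r" using \<pi>s[OF T.minus_closed[OF xy(1,2)]] by blast
      have "h (?\<pi> r) = \<zero>\<^bsub>dual_mod R ?T\<^esub>"
        using lin_diff_zero[OF T dual_module[OF T] h(1) xy] r(2) by simp
      then have "r \<in> I" using h(2)[OF r(1)] zr[OF r(1)] by simp
      then have "x \<ominus>\<^bsub>?T\<^esub> y = \<zero>\<^bsub>?T\<^esub>" using r coset_eq_zero_iff[OF ring_mod_module sub, of r] by simp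
      then show "x = y" using T.diff_eq_zero_iff[OF xy(1,2)] by blast
    qed
    show "h ` carrier ?T = carrier (dual_mod R ?T)"
    proof
      show "h ` carrier ?T \<subseteq> carrier (dual_mod R ?T)" using lin_closed[OF h(1)] by blast
      show "carrier (dual_mod R ?T) \<subseteq> h ` carrier ?T"
      proof
        fix \<psi> assume "\<psi> \<in> carrier (dual_mod R ?T)"
        then obtain r where "r \<in> carrier R" "\<psi> = r \<odot>\<^bsub>dual_mod R ?T\<^esub> \<phi>" using all by blast
        then show "\<psi> \<in> h ` carrier ?T" using h(2) \<pi>c by (metis imageI)
      qed
    qed
  qed
  then have acd: "ext_acyclic R (dual_mod R ?T)"
    by (rule ext_acyclic_iso[OF T dual_module[OF T] h(1) _ acyc])
  have "reflexive_mod R ?T"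
    unfolding reflexive_mod_def
  proof (intro conjI ballI allI impI)
    fix x assume x: "x \<in> carrier ?T" and z: "\<forall>\<psi>\<in>carrier (dual_mod R ?T). \<psi> x = \<zero>"
    obtain r where r: "r \<in> carrier R" "x = ?\<pi> r" using \<pi>s[OF x] by blast
    have "r \<otimes> a = \<zero>" using z \<phi>(1) \<phi>(2)[OF r(1)] r(2) by auto
    then show "x = \<zero>\<^bsub>?T\<^esub>" using ann[OF r(1)] coset_eq_zero_iff[OF ring_mod_module sub, of r] r by simp
  next
    fix \<Phi> assume P: "lin R (dual_mod R ?T) (ring_mod R) \<Phi>"
    have v: "\<Phi> \<phi> \<in> carrier R" using lin_closed[OF P \<phi>(1)] by simp
    have "\<Phi> \<phi> \<in> zero_colon R I"
      unfolding zero_colon_def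
    proof (intro CollectI conjI ballI v)
      fix s assume s: "s \<in> I"
      have "s \<otimes> \<Phi> \<phi> = \<Phi> (s \<odot>\<^bsub>dual_mod R ?T\<^esub> \<phi>)" using lin_smult[OF P ideal_mem[OF s] \<phi>(1)] by simp
      also have "\<dots> = \<zero>" using zr[OF ideal_mem[OF s]] s lin_zero[OF dual_module[OF T] ring_mod_module P] by simp
      finally show "\<Phi> \<phi> \<otimes> s = \<zero>" using v ideal_mem[OF s] by (simp add: m_comm)
    qed
    then obtain r where r: "r \<in> carrier R" "\<Phi> \<phi> = r \<otimes> a" using col[OF v] by blast
    show "\<exists>x\<in>carrier ?T. \<forall>\<psi>\<in>carrier (dual_mod R ?T). \<Phi> \<psi> = \<psi> x"
    proof (rule bexI[OF _ \<pi>c[OF r(1)]], rule ballI)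
      fix \<psi> assume "\<psi> \<in> carrier (dual_mod R ?T)"
      then obtain s where s: "s \<in> carrier R" "\<psi> = s \<odot>\<^bsub>dual_mod R ?T\<^esub> \<phi>" using all by blast
      show "\<Phi> \<psi> = \<psi> (?\<pi> r)"
        unfolding s(2) using lin_smult[OF P s(1) \<phi>(1)] r(2) by (simp add: dual_apply(2)[OF \<pi>c[OF r(1)]] \<phi>(2)[OF r(1)])
    qed
  qed
  then show ?thesis unfolding tot_refl_def using T acyc acd by blast
qed

text \<open>
  A resolution of \<open>R/aR\<close> arises from one of \<open>R/I\<close> by prepending multiplication by \<open>a\<close>; the dual of
  \<open>R/aR\<close> is the first syzygy \<open>I\<close> of \<open>R/I\<close>.
\<close>

lemma cyclic_colon_tot_refl: "tot_refl R (cyclic_mod R (zero_colon R I))"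
proof -
  let ?J = "zero_colon R I"
  let ?T = "cyclic_mod R I" and ?\<pi> = "\<lambda>r. I +>\<^bsub>ring_mod R\<^esub> r"
  let ?U = "cyclic_mod R ?J" and ?\<rho> = "\<lambda>r. ?J +>\<^bsub>ring_mod R\<^esub> r"
  have J: "ideal ?J R" by (rule zero_colon_ideal) (use ideal_mem in blast)
  note sub = ideal_submodule[OF I] and subJ = ideal_submodule[OF J]
  have T: "module R ?T" by (rule quot_mod_module[OF ring_mod_module sub])
  have U: "module R ?U" by (rule quot_mod_module[OF ring_mod_module subJ])
  interpret F: module R "Fr R n" for n by (rule Fr_module)
  interpret DU: module R "dual_mod R ?U" by (rule dual_module[OF U])
  have \<pi>s: "\<exists>r\<in>carrier R. t = ?\<pi> r" if "t \<in> carrier ?T" for t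
    using that unfolding quot_mod_carrier[OF ring_mod_module sub] by auto
  have \<rho>s: "\<exists>r\<in>carrier R. t = ?\<rho> r" if "t \<in> carrier ?U" for t
    using that unfolding quot_mod_carrier[OF ring_mod_module subJ] by auto
  have \<rho>c: "?\<rho> r \<in> carrier ?U" if "r \<in> carrier R" for r
    using lin_closed[OF lin_proj[OF ring_mod_module subJ], of r] that by simp
  have x0: "x 0 \<in> carrier R" if "x \<in> carrier (Fr R 1)" for x using power_mod_mem[OF that, of 0] by simp
  have v1: "\<exists>x\<in>carrier (Fr R 1). x 0 = r" if "r \<in> carrier R" for r
    using that by (intro bexI[of _ "\<lambda>i\<in>{..<1}. r"]) (auto simp: power_mod_simps)
  have eqz: "x = \<zero>\<^bsub>Fr R 1\<^esub> \<longleftrightarrow> x 0 = \<zero>" if "x \<in> carrier (Fr R 1)" for x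
    using power_mod_eqI[OF that F.zero_closed] by auto
  let ?e = "\<lambda>x. ?\<pi> (x 0)"
  have el: "lin R (Fr R 1) ?T ?e" by (rule lin_comp[OF lin_coord lin_proj[OF ring_mod_module sub]]) simp
  have "\<exists>y\<in>carrier (Fr R 1). ?e y = t" if t: "t \<in> carrier ?T" for t
  proof -
    obtain r where r: "r \<in> carrier R" "t = ?\<pi> r" using \<pi>s[OF t] by blast
    then show ?thesis using v1[OF r(1)] by auto
  qed
  then obtain r d where r: "res R ?T r d ?e" "r 0 = 1" using res_exists[OF noeth T el] by blast
  note c = resD[OF r(1)]
  have v: "ext_vanish R r d" by (rule ext_acyclic_vanish[OF T acyc r(1)])
  have ez: "?e x = \<zero>\<^bsub>?T\<^esub> \<longleftrightarrow> x 0 \<in> I" if "x \<in> carrier (Fr R 1)" for x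
    using coset_eq_zero_iff[OF ring_mod_module sub, of "x 0"] x0[OF that] by simp
  have d0I: "d 0 y 0 \<in> I" if "y \<in> carrier (Fr R (r (Suc 0)))" for y
    using c(4)[OF that] ez[of "d 0 y"] lin_closed[OF c(3) that] r(2) by simp
  have d0ex: "\<exists>y\<in>carrier (Fr R (r (Suc 0))). d 0 y = x" if "x \<in> carrier (Fr R 1)" "x 0 \<in> I" for x
    using c(6)[of x] ez[OF that(1)] that r(2) by simp
  \<comment> \<open>All degrees move up by one; \<open>r 0 = 1\<close> makes the target of
    \<open>d 0\<close> the source of multiplication by \<open>a\<close>.\<close>
  define r' where "r' = (\<lambda>i. case i of 0 \<Rightarrow> 1 | Suc i \<Rightarrow> r i)"
  define d' where "d' = (\<lambda>i. case i of 0 \<Rightarrow> (\<lambda>x. a \<odot>\<^bsub>Fr R 1\<^esub> x) | Suc i \<Rightarrow> d i)"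
  have r's: "r' 0 = 1" "r' (Suc i) = r i" "d' 0 = (\<lambda>x. a \<odot>\<^bsub>Fr R 1\<^esub> x)" "d' (Suc i) = d i" for i
    by (simp_all add: r'_def d'_def)
  have d'l: "lin R (Fr R (r' (Suc i))) (Fr R (r' i)) (d' i)" for i
  proof (cases i)
    case 0
    then show ?thesis using lin_scale[OF Fr_module Fr_module lin_id a] by (simp add: r's r(2))
  next
    case (Suc j)
    then show ?thesis using c(3) by (simp add: r's)
  qed
  have \<rho>z: "?\<rho> t = \<zero>\<^bsub>?U\<^esub> \<longleftrightarrow> (\<exists>s\<in>carrier R. t = s \<otimes> a)" if "t \<in> carrier R" for t
    using coset_eq_zero_iff[OF ring_mod_module subJ, of t] col[OF that] that by simp
  have a0: "(a \<odot>\<^bsub>Fr R 1\<^esub> x) 0 = x 0 \<otimes> a" if "x \<in> carrier (Fr R 1)" for x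
    using x0[OF that] a by (simp add: m_comm)
  have "res R ?U r' d' (\<lambda>x. ?\<rho> (x 0))"
  proof (rule resI)
    show "lin R (Fr R (r' 0)) ?U (\<lambda>x. ?\<rho> (x 0))"
      unfolding r's by (rule lin_comp[OF lin_coord lin_proj[OF ring_mod_module subJ]]) simp
    show "\<exists>y\<in>carrier (Fr R (r' 0)). ?\<rho> (y 0) = x" if "x \<in> carrier ?U" for x
      using \<rho>s[OF that] v1 unfolding r's by metis
    show "lin R (Fr R (r' (Suc i))) (Fr R (r' i)) (d' i)" for i by (rule d'l)
  next
    fix y assume "y \<in> carrier (Fr R (r' (Suc 0)))"
    then have y: "y \<in> carrier (Fr R 1)" by (simp add: r's r(2))
    show "?\<rho> (d' 0 y 0) = \<zero>\<^bsub>?U\<^esub>"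
      unfolding r's a0[OF y] using \<rho>z[of "y 0 \<otimes> a"] x0[OF y] a by blast
  next
    fix i y assume y: "y \<in> carrier (Fr R (r' (Suc (Suc i))))"
    show "d' i (d' (Suc i) y) = \<zero>\<^bsub>Fr R (r' i)\<^esub>"
    proof (cases i)
      case 0
      then have y: "y \<in> carrier (Fr R (r (Suc 0)))" using y by (simp add: r's)
      have m: "d 0 y \<in> carrier (Fr R 1)" using lin_closed[OF c(3) y] r(2) by simp
      have "(a \<odot>\<^bsub>Fr R 1\<^esub> d 0 y) 0 = \<zero>" using a0[OF m] ann[OF x0[OF m]] d0I[OF y] by simp
      then show ?thesis using eqz[OF F.smult_closed[OF a m]] 0 by (simp add: r's)
    next
      case (Suc j)
      then show ?thesis using c(5) y by (simp add: r's)
    qed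
  next
    fix y assume "y \<in> carrier (Fr R (r' 0))" and z: "?\<rho> (y 0) = \<zero>\<^bsub>?U\<^esub>"
    then have y: "y \<in> carrier (Fr R 1)" by (simp add: r's)
    obtain s where s: "s \<in> carrier R" "y 0 = s \<otimes> a" using z \<rho>z[OF x0[OF y]] by blast
    obtain x where x: "x \<in> carrier (Fr R 1)" "x 0 = s" using v1[OF s(1)] by blast
    have "a \<odot>\<^bsub>Fr R 1\<^esub> x = y"
    proof (rule power_mod_eqI[OF F.smult_closed[OF a x(1)] y])
      fix i :: nat assume "i < 1"
      then show "(a \<odot>\<^bsub>Fr R 1\<^esub> x) i = y i" using a0[OF x(1)] s(2) x(2) by simp
    qed
    then show "\<exists>z\<in>carrier (Fr R (r' (Suc 0))). d' 0 z = y" using x(1) by (auto simp: r's r(2))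
  next
    fix i y assume y: "y \<in> carrier (Fr R (r' (Suc i)))" and z: "d' i y = \<zero>\<^bsub>Fr R (r' i)\<^esub>"
    show "\<exists>z\<in>carrier (Fr R (r' (Suc (Suc i)))). d' (Suc i) z = y"
    proof (cases i)
      case 0
      then have y: "y \<in> carrier (Fr R 1)" using y by (simp add: r's r(2))
      have "(a \<odot>\<^bsub>Fr R 1\<^esub> y) 0 = \<zero>" using z 0 by (simp add: r's)
      then have "y 0 \<in> I" using a0[OF y] ann[OF x0[OF y]] by simp
      then show ?thesis using d0ex[OF y] 0 by (simp add: r's)
    next
      case (Suc j)
      then show ?thesis using c(7) y z by (simp add: r's)
    qed
  qed
  moreover have "ext_vanish R r' d'"
  proof (rule ext_vanishI)
    fix i f assume f: "lin R (Fr R (r' (Suc i))) (ring_mod R) f"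
      and f0: "\<And>x. x \<in> carrier (Fr R (r' (Suc (Suc i)))) \<Longrightarrow> f (d' (Suc i) x) = \<zero>"
    show "\<exists>g. lin R (Fr R (r' i)) (ring_mod R) g \<and> (\<forall>x\<in>carrier (Fr R (r' (Suc i))). f x = g (d' i x))"
    proof (cases i)
      case 0
      have f: "lin R (Fr R 1) (ring_mod R) f" using f 0 by (simp add: r's r(2))
      let ?t = "f (unit_vec R 1 0)"
      have t: "?t \<in> carrier R" using lin_closed[OF f unit_vec_closed] by simp
      \<comment> \<open>In the lowest degree a cocycle on \<open>R\<close> is multiplication by an
        element killed by \<open>I\<close>. That it is a coboundary means divisibility by
        \<open>a\<close>, which is \<open>(0 : I) = aR\<close>.\<close>
      have "?t \<in> zero_colon R I"
        unfolding zero_colon_def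
      proof (intro CollectI conjI ballI t)
        fix s assume s: "s \<in> I"
        obtain x where x: "x \<in> carrier (Fr R 1)" "x 0 = s" using v1[OF ideal_mem[OF s]] by blast
        obtain y where "y \<in> carrier (Fr R (r (Suc 0)))" "d 0 y = x" using d0ex x s by blast
        then have "f x = \<zero>" using f0[of y] 0 by (auto simp: r's)
        then show "?t \<otimes> s = \<zero>"
          using lin_Fr_one[OF ring_mod_module f x(1)] x(2) t ideal_mem[OF s] by (simp add: m_comm)
      qed
      then obtain q where q: "q \<in> carrier R" "?t = q \<otimes> a" using col[OF t] by blast
      have "lin R (Fr R 1) (ring_mod R) (\<lambda>x. q \<odot>\<^bsub>ring_mod R\<^esub> x 0)"
        by (rule lin_scale[OF Fr_module ring_mod_module lin_coord q(1)]) simp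
      moreover have "f x = q \<odot>\<^bsub>ring_mod R\<^esub> (a \<odot>\<^bsub>Fr R 1\<^esub> x) 0" if x: "x \<in> carrier (Fr R 1)" for x
        using lin_Fr_one[OF ring_mod_module f x] q a x0[OF x] a0[OF x] by (simp add: m_ac)
      ultimately show ?thesis using 0 r(2) by (auto simp: r's)
    next
      case (Suc j)
      have "lin R (Fr R (r (Suc j))) (ring_mod R) f" using f Suc by (simp add: r's)
      moreover have "f (d (Suc j) x) = \<zero>" if "x \<in> carrier (Fr R (r (Suc (Suc j))))" for x
        using f0[of x] that Suc by (simp add: r's)
      ultimately obtain g where "lin R (Fr R (r j)) (ring_mod R) g"
        "\<And>x. x \<in> carrier (Fr R (r (Suc j))) \<Longrightarrow> f x = g (d j x)"
        using ext_vanishD[OF v, of j f] by metis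
      then show ?thesis using Suc by (auto simp: r's)
    qed
  qed
  ultimately have acU: "ext_acyclic R ?U" unfolding ext_acyclic_def by blast
  \<comment> \<open>Evaluation at the class of one identifies the dual of \<open>R/aR\<close> with
    \<open>(0 : a) = I\<close>. The lift \<open>\<epsilon>\<close> of \<open>d 0\<close> through it
    is the augmentation of the old resolution cut off above degree zero.\<close>
  let ?\<psi> = "\<lambda>\<phi>. \<phi> (?\<rho> \<one>)"
  have \<psi>: "lin R (dual_mod R ?U) (ring_mod R) ?\<psi>" by (rule lin_eval[OF \<rho>c[OF one_closed]])
  have \<psi>I: "\<phi> (?\<rho> \<one>) \<in> I" if p: "\<phi> \<in> carrier (dual_mod R ?U)" for \<phi>
  proof -
    have "a \<in> ?J" using col[OF a] a one_closed by (metis l_one)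
    then have "a \<otimes> \<phi> (?\<rho> \<one>) = \<zero>" by (rule cyclic_dual_value(2)[OF J p])
    then show ?thesis
      using ann[OF cyclic_dual_value(1)[OF J p]] cyclic_dual_value(1)[OF J p] a by (simp add: m_comm)
  qed
  have \<psi>ex: "\<exists>\<phi>\<in>carrier (dual_mod R ?U). (\<forall>q\<in>carrier R. \<phi> (?\<rho> q) = q \<otimes> s) \<and> \<phi> (?\<rho> \<one>) = s"
    if s: "s \<in> I" for s
  proof -
    have "t \<otimes> s = \<zero>" if "t \<in> ?J" for t using that s by (auto simp: zero_colon_def)
    then obtain \<phi> where "\<phi> \<in> carrier (dual_mod R ?U)" "\<forall>q\<in>carrier R. \<phi> (?\<rho> q) = q \<otimes> s"
      using cyclic_lin[OF J ideal_mem[OF s]] by blast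
    then show ?thesis using ideal_mem[OF s] by (intro bexI[of _ \<phi>]) auto
  qed
  have d00: "lin R (Fr R (r (Suc 0))) (ring_mod R) (\<lambda>x. d 0 x 0)"
    by (rule lin_comp[OF c(3)[of 0] lin_coord]) (simp add: r(2))
  have "\<exists>\<phi>\<in>carrier (dual_mod R ?U). ?\<psi> \<phi> = d 0 x 0" if "x \<in> carrier (Fr R (r (Suc 0)))" for x
    using \<psi>ex[OF d0I[OF that]] by blast
  from free_lift[OF dual_module[OF U] ring_mod_module d00 \<psi> this]
  obtain \<epsilon> where \<epsilon>: "lin R (Fr R (r (Suc 0))) (dual_mod R ?U) \<epsilon>"
    "\<And>x. x \<in> carrier (Fr R (r (Suc 0))) \<Longrightarrow> \<epsilon> x (?\<rho> \<one>) = d 0 x 0" by blast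
  have \<epsilon>s: "\<exists>x\<in>carrier (Fr R (r (Suc 0))). \<epsilon> x = \<phi>" if p: "\<phi> \<in> carrier (dual_mod R ?U)" for \<phi>
  proof -
    obtain y where y: "y \<in> carrier (Fr R 1)" "y 0 = \<phi> (?\<rho> \<one>)" using v1[OF ideal_mem[OF \<psi>I[OF p]]] by blast
    obtain x where x: "x \<in> carrier (Fr R (r (Suc 0)))" "d 0 x = y" using d0ex[OF y(1)] \<psi>I[OF p] y(2) by auto
    have "\<epsilon> x = \<phi>"
      by (rule cyclic_dual_eqI[OF J lin_closed[OF \<epsilon>(1) x(1)] p]) (simp add: \<epsilon>(2)[OF x(1)] x(2) y(2))
    then show ?thesis using x(1) by blast
  qed
  have \<epsilon>z: "\<epsilon> x = \<zero>\<^bsub>dual_mod R ?U\<^esub> \<longleftrightarrow> d 0 x = \<zero>\<^bsub>Fr R (r 0)\<^esub>" if x: "x \<in> carrier (Fr R (r (Suc 0)))" for x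
  proof -
    have m: "d 0 x \<in> carrier (Fr R 1)" using lin_closed[OF c(3) x] r(2) by simp
    have "\<epsilon> x = \<zero>\<^bsub>dual_mod R ?U\<^esub> \<longleftrightarrow> \<epsilon> x (?\<rho> \<one>) = \<zero>\<^bsub>dual_mod R ?U\<^esub> (?\<rho> \<one>)"
      using cyclic_dual_eqI[OF J lin_closed[OF \<epsilon>(1) x] DU.zero_closed] by auto
    then show ?thesis
      using \<epsilon>(2)[OF x] eqz[OF m] r(2) by (simp add: dual_apply(3)[OF \<rho>c[OF one_closed]])
  qed
  have "res R (dual_mod R ?U) (\<lambda>i. r (Suc i)) (\<lambda>i. d (Suc i)) \<epsilon>"
  proof (rule resI)
    show "lin R (Fr R (r (Suc (Suc i)))) (Fr R (r (Suc i))) (d (Suc i))" for i by (rule c(3))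
    show "d (Suc i) (d (Suc (Suc i)) y) = \<zero>\<^bsub>Fr R (r (Suc i))\<^esub>"
      if "y \<in> carrier (Fr R (r (Suc (Suc (Suc i)))))" for i y by (rule c(5)[OF that])
    show "\<exists>z\<in>carrier (Fr R (r (Suc (Suc (Suc i))))). d (Suc (Suc i)) z = y"
      if "y \<in> carrier (Fr R (r (Suc (Suc i))))" "d (Suc i) y = \<zero>\<^bsub>Fr R (r (Suc i))\<^esub>" for i y
      by (rule c(7)[OF that])
    show "\<epsilon> (d (Suc 0) y) = \<zero>\<^bsub>dual_mod R ?U\<^esub>" if "y \<in> carrier (Fr R (r (Suc (Suc 0))))" for y
      using \<epsilon>z[OF lin_closed[OF c(3) that]] c(5)[OF that] by simp
    show "\<exists>z\<in>carrier (Fr R (r (Suc (Suc 0)))). d (Suc 0) z = y"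
      if "y \<in> carrier (Fr R (r (Suc 0)))" "\<epsilon> y = \<zero>\<^bsub>dual_mod R ?U\<^esub>" for y
      by (rule c(7)[OF that(1)]) (use \<epsilon>z[OF that(1)] that(2) in simp)
  qed (use \<epsilon>(1) \<epsilon>s in auto)
  moreover have "ext_vanish R (\<lambda>i. r (Suc i)) (\<lambda>i. d (Suc i))"
    using v unfolding ext_vanish_def by blast
  ultimately have acD: "ext_acyclic R (dual_mod R ?U)"
    unfolding ext_acyclic_def by blast
  have "reflexive_mod R ?U"
    unfolding reflexive_mod_def
  proof (intro conjI ballI allI impI)
    fix x assume x: "x \<in> carrier ?U" and z: "\<forall>\<phi>\<in>carrier (dual_mod R ?U). \<phi> x = \<zero>"
    obtain q where q: "q \<in> carrier R" "x = ?\<rho> q" using \<rho>s[OF x] by blast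
    have "q \<in> ?J"
      unfolding zero_colon_def
    proof (intro CollectI conjI ballI q(1))
      fix s assume "s \<in> I"
      from \<psi>ex[OF this] show "q \<otimes> s = \<zero>" using z q by metis
    qed
    then show "x = \<zero>\<^bsub>?U\<^esub>" using coset_eq_zero_iff[OF ring_mod_module subJ, of q] q by simp
  next
    fix \<Phi> assume P: "lin R (dual_mod R ?U) (ring_mod R) \<Phi>"
    \<comment> \<open>\<open>\<Phi> \<circ> \<epsilon>\<close> is a cocycle of degree one for
      \<open>R/I\<close>. Vanishing of \<open>Ext^1(R/I, R)\<close> extends the functional from
      \<open>I\<close> to \<open>R\<close>, so it is multiplication by \<open>?s\<close>, that is,
      evaluation at the class of \<open>?s\<close>.\<close>
    have "\<Phi> (\<epsilon> (d (Suc 0) y)) = \<zero>" if "y \<in> carrier (Fr R (r (Suc (Suc 0))))" for y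
      using \<epsilon>z[OF lin_closed[OF c(3) that]] c(5)[OF that] lin_zero[OF dual_module[OF U] ring_mod_module P] by simp
    from ext_vanishD[OF v lin_comp[OF \<epsilon>(1) P] this]
    obtain g where g: "lin R (Fr R (r 0)) (ring_mod R) g"
      "\<And>x. x \<in> carrier (Fr R (r (Suc 0))) \<Longrightarrow> \<Phi> (\<epsilon> x) = g (d 0 x)" by blast
    have g1: "lin R (Fr R 1) (ring_mod R) g" using g(1) r(2) by simp
    let ?s = "g (unit_vec R 1 0)"
    have s: "?s \<in> carrier R" using lin_closed[OF g1 unit_vec_closed] by simp
    show "\<exists>x\<in>carrier ?U. \<forall>\<phi>\<in>carrier (dual_mod R ?U). \<Phi> \<phi> = \<phi> x"
    proof (rule bexI[OF _ \<rho>c[OF s]], rule ballI)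
      fix \<phi> assume p: "\<phi> \<in> carrier (dual_mod R ?U)"
      obtain x where x: "x \<in> carrier (Fr R (r (Suc 0)))" "\<epsilon> x = \<phi>" using \<epsilon>s[OF p] by blast
      have m: "d 0 x \<in> carrier (Fr R 1)" using lin_closed[OF c(3) x(1)] r(2) by simp
      have "\<Phi> \<phi> = d 0 x 0 \<otimes> ?s" using g(2)[OF x(1)] lin_Fr_one[OF ring_mod_module g1 m] x(2) by simp
      also have "\<dots> = \<phi> (?\<rho> \<one>) \<otimes> ?s" using \<epsilon>(2)[OF x(1)] x(2) by simp
      also have "\<dots> = \<phi> (?\<rho> ?s)" using cyclic_dual_apply[OF J p s] cyclic_dual_value(1)[OF J p] s by (simp add: m_comm)
      finally show "\<Phi> \<phi> = \<phi> (?\<rho> ?s)" .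
    qed
  qed
  then show ?thesis unfolding tot_refl_def using U acU acD by blast
qed

end

end

section \<open>Elements with independent multiples\<close>

context cring
begin

lemma idealD:
  assumes "ideal K R"
  shows "x \<in> K \<Longrightarrow> x \<in> carrier R" "\<zero> \<in> K" "x \<in> K \<Longrightarrow> y \<in> K \<Longrightarrow> x \<oplus> y \<in> K"
    "x \<in> K \<Longrightarrow> \<ominus> x \<in> K" "x \<in> K \<Longrightarrow> y \<in> K \<Longrightarrow> x \<ominus> y \<in> K"
    "r \<in> carrier R \<Longrightarrow> x \<in> K \<Longrightarrow> r \<otimes> x \<in> K" "r \<in> carrier R \<Longrightarrow> x \<in> K \<Longrightarrow> x \<otimes> r \<in> K"
proof -
  note s = submodule_memD[OF ring_mod_module ideal_submodule[OF assms], unfolded ring_mod_simps]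
  show "x \<in> K \<Longrightarrow> x \<in> carrier R" "\<zero> \<in> K" "x \<in> K \<Longrightarrow> y \<in> K \<Longrightarrow> x \<oplus> y \<in> K"
    "x \<in> K \<Longrightarrow> \<ominus> x \<in> K" "x \<in> K \<Longrightarrow> y \<in> K \<Longrightarrow> x \<ominus> y \<in> K" "r \<in> carrier R \<Longrightarrow> x \<in> K \<Longrightarrow> r \<otimes> x \<in> K"
    by (fact s)+
  show "r \<in> carrier R \<Longrightarrow> x \<in> K \<Longrightarrow> x \<otimes> r \<in> K" by (rule ideal.I_r_closed[OF assms])
qed

lemma idealI':
  assumes "K \<subseteq> carrier R" "\<zero> \<in> K" "\<And>x y. x \<in> K \<Longrightarrow> y \<in> K \<Longrightarrow> x \<oplus> y \<in> K"
    "\<And>r x. r \<in> carrier R \<Longrightarrow> x \<in> K \<Longrightarrow> r \<otimes> x \<in> K"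
  shows "ideal K R"
proof (rule submodule_ideal)
  show "submodule K R (ring_mod R)"
  proof (rule module.submoduleI[OF ring_mod_module], unfold ring_mod_simps)
    show "\<ominus> x \<in> K" if "x \<in> K" for x
      using assms(4)[of "\<ominus> \<one>" x] that assms(1) by (auto simp: l_minus)
  qed (use assms in auto)
qed

lemma ideal_cancel_right:
  assumes "ideal K R" "x \<oplus> k \<in> K" "k \<in> K" "x \<in> carrier R"
  shows "x \<in> K"
proof -
  note k = idealD[OF assms(1)]
  have "(x \<oplus> k) \<ominus> k = x" using assms(4) k(1)[OF assms(3)] by (simp add: a_minus_def a_assoc r_neg)
  then show ?thesis using k(5)[OF assms(2,3)] by simp
qed

definition adjoin :: "'a set \<Rightarrow> 'a \<Rightarrow> 'a set" where
  "adjoin K x = {y. \<exists>k\<in>K. \<exists>r\<in>carrier R. y = k \<oplus> x \<otimes> r}"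

lemma adjoin_ideal:
  assumes K: "ideal K R" and x: "x \<in> carrier R"
  shows "ideal (adjoin K x) R" "K \<subseteq> adjoin K x" "x \<in> adjoin K x"
proof -
  note k = idealD[OF K]
  show "ideal (adjoin K x) R"
  proof (rule idealI')
    show "adjoin K x \<subseteq> carrier R" using k(1) x by (auto simp: adjoin_def)
    show "\<zero> \<in> adjoin K x" unfolding adjoin_def using k(2) x by (intro CollectI bexI[of _ \<zero>]) auto
    show "y \<oplus> y' \<in> adjoin K x" if yy: "y \<in> adjoin K x" "y' \<in> adjoin K x" for y y'
    proof -
      obtain p r p' r' where pr: "p \<in> K" "r \<in> carrier R" "y = p \<oplus> x \<otimes> r" "p' \<in> K" "r' \<in> carrier R" "y' = p' \<oplus> x \<otimes> r'"
        using yy by (auto simp: adjoin_def)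
      have "y \<oplus> y' = (p \<oplus> p') \<oplus> x \<otimes> (r \<oplus> r')"
        using pr k(1)[OF pr(1)] k(1)[OF pr(4)] x by (simp add: r_distr a_ac)
      then show ?thesis unfolding adjoin_def using k(3)[OF pr(1,4)] pr(2,5) by blast
    qed
    show "s \<otimes> y \<in> adjoin K x" if s: "s \<in> carrier R" and y: "y \<in> adjoin K x" for s y
    proof -
      obtain p r where pr: "p \<in> K" "r \<in> carrier R" "y = p \<oplus> x \<otimes> r" using y by (auto simp: adjoin_def)
      have "s \<otimes> y = s \<otimes> p \<oplus> x \<otimes> (s \<otimes> r)"
        using pr k(1)[OF pr(1)] x s by (simp add: r_distr m_ac)
      then show ?thesis unfolding adjoin_def using k(6)[OF s pr(1)] pr(2) s by blast
    qed
  qed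
  show "K \<subseteq> adjoin K x"
  proof
    fix p assume p: "p \<in> K"
    have "p = p \<oplus> x \<otimes> \<zero>" using k(1)[OF p] x by simp
    then show "p \<in> adjoin K x" unfolding adjoin_def using p by blast
  qed
  have "x = \<zero> \<oplus> x \<otimes> \<one>" using x by simp
  then show "x \<in> adjoin K x" unfolding adjoin_def using k(2) by blast
qed

definition colon :: "'a set \<Rightarrow> 'a \<Rightarrow> 'a set" where
  "colon K y = {r \<in> carrier R. r \<otimes> y \<in> K}"

lemma colon_ideal:
  assumes "ideal K R" "y \<in> carrier R"
  shows "ideal (colon K y) R"
  by (rule idealI') (use idealD[OF assms(1)] assms(2) in \<open>auto simp: colon_def l_distr m_assoc\<close>)

lemma colon_pow_mono:
  assumes "ideal K R" "y \<in> carrier R" "k \<le> l"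
  shows "colon K (y [^] (k :: nat)) \<subseteq> colon K (y [^] (l :: nat))"
proof
  fix r assume r: "r \<in> colon K (y [^] k)"
  obtain j where j: "l = k + j" using assms(3) by (metis le_add_diff_inverse)
  have "r \<otimes> y [^] l = (r \<otimes> y [^] k) \<otimes> y [^] j"
    using r assms(2) unfolding j colon_def by (simp add: nat_pow_mult[symmetric] m_assoc)
  then show "r \<in> colon K (y [^] l)" using r idealD(7)[OF assms(1)] assms(2) by (auto simp: colon_def)
qed

text \<open>Zorn's lemma applies because in a Noetherian ring the union of a nonempty chain of
  ideals is a member of the chain.\<close>

lemma noetherian_maximal:
  assumes "noetherian_ring R" "S \<noteq> {}" "\<And>K. K \<in> S \<Longrightarrow> ideal K R"
  shows "\<exists>M\<in>S. \<forall>K\<in>S. M \<subseteq> K \<longrightarrow> K = M"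
proof (rule subset_Zorn_nonempty[OF assms(2)])
  fix C assume C: "C \<noteq> {}" "subset.chain S C"
  have "subset.chain {I. ideal I R} C" using C(2) assms(3) unfolding pred_on.chain_def by blast
  then have "\<Union>C \<in> C" by (rule noetherian_ring.ideal_chain_is_trivial[OF assms(1) C(1)])
  then show "\<Union>C \<in> S" using C(2) unfolding pred_on.chain_def by blast
qed

text \<open>The colon ideals increase with the exponent, so a maximal one among them is attained and
  kept. The bound \<open>k \<ge> 1\<close> ensures that \<open>y^k\<close> stays in the maximal
  ideal when \<open>y\<close> is in it.\<close>

lemma colon_stable:
  assumes "noetherian_ring R" "ideal K R" "y \<in> carrier R"
  shows "\<exists>k\<ge>1. \<forall>l\<ge>k. colon K (y [^] (l :: nat)) = colon K (y [^] (k :: nat))"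
proof -
  let ?S = "(\<lambda>k. colon K (y [^] (k :: nat))) ` {1..}"
  have "ideal L R" if L: "L \<in> ?S" for L
  proof -
    obtain k :: nat where "L = colon K (y [^] k)" using L by blast
    then show ?thesis using colon_ideal[OF assms(2) nat_pow_closed[OF assms(3)]] by simp
  qed
  moreover have "?S \<noteq> {}" by simp
  ultimately obtain M where M: "M \<in> ?S" "\<forall>L\<in>?S. M \<subseteq> L \<longrightarrow> L = M"
    using noetherian_maximal[OF assms(1), of ?S] by blast
  then obtain k :: nat where k: "k \<ge> 1" "M = colon K (y [^] k)" by auto
  have "colon K (y [^] l) = colon K (y [^] k)" if "l \<ge> k" for l
  proof -
    have "colon K (y [^] l) \<in> (\<lambda>k. colon K (y [^] (k :: nat))) ` {1..}" using that k(1) by auto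
    then show ?thesis using M(2) colon_pow_mono[OF assms(2,3) that] unfolding k(2) by blast
  qed
  then show ?thesis using k(1) by blast
qed

end

section \<open>Units, separation and parameters in a Noetherian local ring\<close>

context noetherian_local_ring
begin

lemma noetherian: "noetherian_ring R" by (rule noetherian_ring_axioms)

lemma max_prime: "primeideal \<mm> R" by (rule maximalideal_prime[OF maximal])

lemma max_ideal: "ideal \<mm> R" using max_prime by (rule primeideal.axioms(1))

lemma one_not_max: "\<one> \<notin> \<mm>"
  using ideal.one_imp_carrier[OF max_ideal] primeideal.I_notcarr[OF max_prime] by blast

lemma max_primeD: "x \<in> carrier R \<Longrightarrow> y \<in> carrier R \<Longrightarrow> x \<otimes> y \<in> \<mm> \<Longrightarrow> x \<in> \<mm> \<or> y \<in> \<mm>"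
  by (rule primeideal.I_prime[OF max_prime])

lemma proper_ideal_le_max:
  assumes "ideal K R" "K \<noteq> carrier R"
  shows "K \<subseteq> \<mm>"
proof -
  let ?S = "{L. ideal L R \<and> K \<subseteq> L \<and> L \<noteq> carrier R}"
  have "K \<in> ?S" using assms by blast
  then have "\<exists>M\<in>?S. \<forall>L\<in>?S. M \<subseteq> L \<longrightarrow> L = M"
    by (intro noetherian_maximal[OF noetherian]) auto
  then obtain M where M: "M \<in> ?S" "\<forall>L\<in>?S. M \<subseteq> L \<longrightarrow> L = M" by (rule bexE)
  have "maximalideal M R"
  proof (rule maximalidealI)
    fix L assume L: "ideal L R" "M \<subseteq> L"
    have "L = M" if "L \<noteq> carrier R"
    proof -
      have "L \<in> ?S" using M(1) L that by auto
      then show ?thesis using M(2) L(2) by simp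
    qed
    then show "L = M \<or> L = carrier R" by (cases "L = carrier R") simp_all
  qed (use M(1) in auto)
  then have "M = \<mm>" by (rule maximal_unique)
  then show ?thesis using M(1) by blast
qed

lemma unit_of_not_max:
  assumes "x \<in> carrier R" "x \<notin> \<mm>"
  shows "\<exists>y\<in>carrier R. y \<otimes> x = \<one>"
proof -
  have "PIdl x = carrier R"
    using proper_ideal_le_max[OF cgenideal_ideal[OF assms(1)]] cgenideal_self[OF assms(1)] assms(2) by blast
  then have "\<one> \<in> PIdl x" by simp
  then show ?thesis by (auto simp: cgenideal_def)
qed

lemma one_minus_not_max:
  assumes "x \<in> \<mm>"
  shows "\<one> \<ominus> x \<notin> \<mm>"
proof
  assume "\<one> \<ominus> x \<in> \<mm>"
  then have "(\<one> \<ominus> x) \<oplus> x \<in> \<mm>" using idealD(3)[OF max_ideal] assms by blast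
  then show False
    using one_not_max idealD(1)[OF max_ideal assms] by (simp add: a_minus_def a_assoc l_neg)
qed

lemma unit_cancel:
  assumes "ideal K R" "x \<in> carrier R" "x \<notin> \<mm>" "t \<in> carrier R" "x \<otimes> t \<in> K"
  shows "t \<in> K"
proof -
  obtain y where y: "y \<in> carrier R" "y \<otimes> x = \<one>" using unit_of_not_max[OF assms(2,3)] by blast
  have "t = y \<otimes> (x \<otimes> t)" using y assms(2,4) by (simp add: m_assoc[symmetric])
  then show ?thesis using idealD(6)[OF assms(1) y(1) assms(5)] by simp
qed

text \<open>A weak form of the Krull intersection theorem.\<close>

lemma separating_ideal:
  assumes a: "a \<in> carrier R" "a \<noteq> \<zero>" and y: "y \<in> \<mm>"
  shows "\<exists>Q k. ideal Q R \<and> a \<notin> Q \<and> y [^] (k :: nat) \<in> Q"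
proof -
  let ?S = "{L. ideal L R \<and> a \<notin> L}"
  have yc: "y \<in> carrier R" using idealD(1)[OF max_ideal y] .
  have "{\<zero>} \<in> ?S" using a zeroideal by auto
  then have "\<exists>M\<in>?S. \<forall>L\<in>?S. M \<subseteq> L \<longrightarrow> L = M"
    by (intro noetherian_maximal[OF noetherian]) auto
  then obtain Q where QS: "Q \<in> ?S" "\<forall>L\<in>?S. Q \<subseteq> L \<longrightarrow> L = Q" by (rule bexE)
  have Q: "ideal Q R" "a \<notin> Q" using QS(1) by auto
  have Q3: "L = Q" if "ideal L R" "a \<notin> L" "Q \<subseteq> L" for L using QS(2) that by simp
  note q = idealD[OF Q(1)]
  \<comment> \<open>Maximality of \<open>Q\<close> is used in this form: an element \<open>z\<close>
    outside \<open>Q\<close> puts \<open>a\<close> into \<open>Q + (z)\<close>. For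
    \<open>z = a y\<close> this contradicts \<open>a\<close> being outside \<open>Q\<close>, since
    \<open>1 - y r\<close> is a unit. For \<open>z = y^k\<close>, with the colon ideals stationary
    from \<open>k\<close> on, it does so because \<open>a y\<close> in \<open>Q\<close> forces
    \<open>r y^(k+1)\<close>, hence \<open>r y^k\<close>, into \<open>Q\<close>.\<close>
  have grow: "\<exists>p\<in>Q. \<exists>r\<in>carrier R. a = p \<oplus> z \<otimes> r" if z: "z \<in> carrier R" "z \<notin> Q" for z
  proof -
    have "a \<in> adjoin Q z"
      using Q3[OF adjoin_ideal(1)[OF Q(1) z(1)] _ adjoin_ideal(2)[OF Q(1) z(1)]] adjoin_ideal(3)[OF Q(1) z(1)] z(2)
      by metis
    then show ?thesis by (auto simp: adjoin_def)
  qed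
  have ay: "a \<otimes> y \<in> Q"
  proof (rule ccontr)
    assume "a \<otimes> y \<notin> Q"
    then obtain p r where pr: "p \<in> Q" "r \<in> carrier R" "a = p \<oplus> (a \<otimes> y) \<otimes> r" using grow[of "a \<otimes> y"] a yc by blast
    have "(\<one> \<ominus> y \<otimes> r) \<otimes> a = a \<ominus> (a \<otimes> y) \<otimes> r"
      using a yc pr(2) by algebra
    also have "\<dots> = p" by (subst diff_eq_iff) (use a yc pr q(1) in auto)
    finally have "(\<one> \<ominus> y \<otimes> r) \<otimes> a \<in> Q" using pr(1) by simp
    note un = this
    have "a \<in> Q"
      by (rule unit_cancel[OF Q(1) _ one_minus_not_max[OF idealD(7)[OF max_ideal pr(2) y]] a(1) un])
        (use yc pr(2) in simp)
    then show False using Q(2) by blast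
  qed
  obtain k :: nat where k: "k \<ge> 1" "\<And>l. l \<ge> k \<Longrightarrow> colon Q (y [^] l) = colon Q (y [^] k)"
    using colon_stable[OF noetherian Q(1) yc] by blast
  have "y [^] k \<in> Q"
  proof (rule ccontr)
    assume "y [^] k \<notin> Q"
    then obtain p r where pr: "p \<in> Q" "r \<in> carrier R" "a = p \<oplus> y [^] k \<otimes> r" using grow[of "y [^] k"] yc by blast
    have "y \<otimes> p \<oplus> r \<otimes> y [^] Suc k = a \<otimes> y"
      unfolding pr(3) using pr(2) q(1)[OF pr(1)] yc by (simp add: l_distr r_distr m_ac)
    then have F: "r \<otimes> y [^] Suc k \<oplus> y \<otimes> p \<in> Q" using ay pr yc q(1)[OF pr(1)] by (simp add: a_comm)
    have "r \<otimes> y [^] Suc k \<in> Q"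
      by (rule ideal_cancel_right[OF Q(1) F q(6)[OF yc pr(1)]]) (use pr(2) yc in simp)
    then have "r \<in> colon Q (y [^] Suc k)" using pr(2) by (simp add: colon_def)
    then have "r \<otimes> y [^] k \<in> Q" using k(2)[of "Suc k"] by (auto simp: colon_def)
    then have "y [^] k \<otimes> r \<in> Q" using pr(2) yc by (simp add: m_comm)
    then show False using q(3)[OF pr(1)] pr(3) Q(2) by blast
  qed
  then show ?thesis using Q by blast
qed

text \<open>
  Choose \<open>x\<close> with \<open>P0 + (x)\<close> maximal among such ideals, then let \<open>y\<close> be a power of \<open>y0\<close> at which the
  chain of colon ideals \<open>(P0 + (x) : y0\<^sup>k)\<close> is stationary.
\<close>

lemma parameter_pair:
  assumes P: "primeideal P0 R" "primeideal P1 R" "P0 \<subset> P1" and y0: "y0 \<in> \<mm>" "y0 \<notin> P1"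
  shows "\<exists>x y. x \<in> P1 \<and> x \<notin> P0 \<and> y \<in> \<mm> \<and> y \<notin> P1 \<and> (\<forall>t\<in>carrier R. \<forall>p\<in>P0. x \<noteq> y \<otimes> t \<oplus> p) \<and>
    (\<forall>r\<in>carrier R. r \<otimes> (y \<otimes> y) \<in> adjoin P0 x \<longrightarrow> r \<otimes> y \<in> adjoin P0 x)"
proof -
  have i0: "ideal P0 R" and i1: "ideal P1 R" using P(1,2) by (auto dest: primeideal.axioms)
  note d0 = idealD[OF i0] and d1 = idealD[OF i1]
  note pr0 = primeideal.I_prime[OF P(1)] and pr1 = primeideal.I_prime[OF P(2)]
  have yc: "y0 \<in> carrier R" by (rule idealD(1)[OF max_ideal y0(1)])
  let ?S = "adjoin P0 ` (P1 - P0)"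
  have "?S \<noteq> {}" using P(3) by blast
  moreover have "ideal L R" if "L \<in> ?S" for L using that adjoin_ideal(1)[OF i0] d1(1) by auto
  ultimately have "\<exists>M\<in>?S. \<forall>L\<in>?S. M \<subseteq> L \<longrightarrow> L = M" by (rule noetherian_maximal[OF noetherian])
  then obtain M where M: "M \<in> ?S" "\<forall>L\<in>?S. M \<subseteq> L \<longrightarrow> L = M" by (rule bexE)
  from M(1) obtain x where x: "x \<in> P1" "x \<notin> P0" "M = adjoin P0 x" by blast
  have xc: "x \<in> carrier R" by (rule d1(1)[OF x(1)])
  \<comment> \<open>If \<open>x\<close> were a multiple \<open>y0 t\<close> modulo
    \<open>P0\<close>, then \<open>t\<close> would lie in \<open>P1\<close> but not in
    \<open>P0\<close>, and maximality would give \<open>P0 + (t) = P0 + (x)\<close>. So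
    \<open>t\<close> would be a multiple of \<open>x\<close>, hence of \<open>y0 t\<close>, modulo
    \<open>P0\<close>, and a unit factor \<open>1 - y0 r\<close> would put \<open>t\<close> into
    \<open>P0\<close>.\<close>
  have ne: "x \<noteq> y0 \<otimes> t \<oplus> p" if t: "t \<in> carrier R" and p: "p \<in> P0" for t p
  proof
    assume e: "x = y0 \<otimes> t \<oplus> p"
    have pc: "p \<in> carrier R" "p \<in> P1" using d0(1)[OF p] p P(3) by auto
    have "y0 \<otimes> t \<in> P1" by (rule ideal_cancel_right[OF i1 _ pc(2)]) (use e x(1) t yc in auto)
    then have t1: "t \<in> P1" using pr1[OF yc t] y0(2) by blast
    have t0: "t \<notin> P0" using d0(3)[OF d0(6)[OF yc] p] e x(2) by blast
    have sb: "adjoin P0 x \<subseteq> adjoin P0 t"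
    proof
      fix z assume "z \<in> adjoin P0 x"
      then obtain k r where kr: "k \<in> P0" "r \<in> carrier R" "z = k \<oplus> x \<otimes> r" by (auto simp: adjoin_def)
      have "z = (k \<oplus> p \<otimes> r) \<oplus> t \<otimes> (y0 \<otimes> r)"
        unfolding kr(3) e using kr d0(1)[OF kr(1)] pc t yc by algebra
      then show "z \<in> adjoin P0 t"
        unfolding adjoin_def using d0(3)[OF kr(1) d0(7)[OF kr(2) p]] yc kr(2) by blast
    qed
    have "adjoin P0 t \<in> ?S" using t1 t0 by blast
    from mp[OF bspec[OF M(2)[unfolded x(3)] this] sb]
    have "adjoin P0 t = adjoin P0 x" .
    then have "t \<in> adjoin P0 x" using adjoin_ideal(3)[OF i0 t] by simp
    then obtain k r where kr: "k \<in> P0" "r \<in> carrier R" "t = k \<oplus> x \<otimes> r" by (auto simp: adjoin_def)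
    have kc: "k \<in> carrier R" by (rule d0(1)[OF kr(1)])
    have "(\<one> \<ominus> y0 \<otimes> r) \<otimes> t = t \<ominus> y0 \<otimes> t \<otimes> r" using t yc kr(2) by algebra
    also have "\<dots> = k \<oplus> p \<otimes> r"
    proof (subst diff_eq_iff)
      have "t = k \<oplus> (y0 \<otimes> t \<oplus> p) \<otimes> r" using kr(3) unfolding e .
      also have "\<dots> = k \<oplus> p \<otimes> r \<oplus> y0 \<otimes> t \<otimes> r" using kc kr(2) t yc pc by algebra
      finally show "t = k \<oplus> p \<otimes> r \<oplus> y0 \<otimes> t \<otimes> r" .
    qed (use t yc kr(2) kc pc in auto)
    finally have "(\<one> \<ominus> y0 \<otimes> r) \<otimes> t \<in> P0" using d0(3)[OF kr(1) d0(7)[OF kr(2) p]] by simp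
    note un = this
    have "t \<in> P0"
      by (rule unit_cancel[OF i0 _ one_minus_not_max[OF idealD(7)[OF max_ideal kr(2) y0(1)]] t un])
        (use yc kr(2) in simp)
    then show False using t0 by blast
  qed
  have iK: "ideal (adjoin P0 x) R" by (rule adjoin_ideal(1)[OF i0 xc])
  obtain k :: nat where k: "k \<ge> 1" "\<And>l. l \<ge> k \<Longrightarrow> colon (adjoin P0 x) (y0 [^] l) = colon (adjoin P0 x) (y0 [^] k)"
    using colon_stable[OF noetherian iK yc] by blast
  let ?y = "y0 [^] k"
  obtain j where j: "k = Suc j" using k(1) by (cases k) auto
  have "?y \<in> \<mm>" unfolding j using idealD(6)[OF max_ideal _ y0(1), of "y0 [^] j"] yc by simp
  moreover have "y0 [^] (l :: nat) \<notin> P1" for l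
  proof (induction l)
    case 0
    show ?case using ideal.one_imp_carrier[OF i1] primeideal.I_notcarr[OF P(2)] by auto
  next
    case (Suc l)
    then show ?case using pr1[of "y0 [^] l" y0] y0(2) yc by auto
  qed
  then have "?y \<notin> P1" .
  moreover have "x \<noteq> ?y \<otimes> t \<oplus> p" if "t \<in> carrier R" "p \<in> P0" for t p
    using ne[of "y0 [^] j \<otimes> t" p] that yc unfolding j by (simp add: m_ac)
  \<comment> \<open>The colon ideals agree at the exponents \<open>k\<close> and
    \<open>k + k\<close>, that is, for \<open>y\<close> and its square.\<close>
  moreover have "r \<otimes> ?y \<in> adjoin P0 x" if "r \<in> carrier R" "r \<otimes> (?y \<otimes> ?y) \<in> adjoin P0 x" for r
  proof -
    have "r \<in> colon (adjoin P0 x) (y0 [^] (k + k))" using that yc by (simp add: colon_def nat_pow_mult)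
    then show ?thesis using k(2)[of "k + k"] by (auto simp: colon_def)
  qed
  ultimately show ?thesis using x(1,2) by blast
qed

text \<open>The sum of the \<open>c i x^i y^(n - i)\<close>, as \<open>form_finsum\<close> confirms,
  arranged so that the pure power of \<open>y\<close> is split off and one factor \<open>x\<close>
  is taken out of the rest; this is how the degree drops in
  \<open>form_coeffs_in_max\<close>.\<close>

primrec form :: "'a \<Rightarrow> 'a \<Rightarrow> nat \<Rightarrow> (nat \<Rightarrow> 'a) \<Rightarrow> 'a" where
  "form x y 0 c = c 0"
| "form x y (Suc n) c = x \<otimes> form x y n (\<lambda>i. c (Suc i)) \<oplus> c 0 \<otimes> y [^] Suc n"

lemma form_closed:
  "x \<in> carrier R \<Longrightarrow> y \<in> carrier R \<Longrightarrow> (\<And>i. i \<le> n \<Longrightarrow> c i \<in> carrier R) \<Longrightarrow> form x y n c \<in> carrier R"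
  by (induction n arbitrary: c) auto

lemma form_finsum:
  assumes "x \<in> carrier R" "y \<in> carrier R"
  shows "(\<And>i. i \<le> n \<Longrightarrow> c i \<in> carrier R) \<Longrightarrow>
    form x y n c = (\<Oplus>i\<in>{..n}. c i \<otimes> (x [^] i \<otimes> y [^] (n - i)))"
proof (induction n arbitrary: c)
  case 0
  then show ?case using assms by simp
next
  case (Suc n)
  have "(\<Oplus>i\<in>{..Suc n}. c i \<otimes> (x [^] i \<otimes> y [^] (Suc n - i))) =
      (\<Oplus>i\<in>{..n}. c (Suc i) \<otimes> (x [^] Suc i \<otimes> y [^] (n - i))) \<oplus> c 0 \<otimes> y [^] Suc n"
    using Suc.prems assms by (subst finsum_Suc2) auto
  also have "(\<Oplus>i\<in>{..n}. c (Suc i) \<otimes> (x [^] Suc i \<otimes> y [^] (n - i))) =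
      (\<Oplus>i\<in>{..n}. x \<otimes> (c (Suc i) \<otimes> (x [^] i \<otimes> y [^] (n - i))))"
    using Suc.prems assms by (intro finsum_cong') (auto simp: m_ac)
  also have "\<dots> = x \<otimes> (\<Oplus>i\<in>{..n}. c (Suc i) \<otimes> (x [^] i \<otimes> y [^] (n - i)))"
    using Suc.prems assms by (subst finsum_rdistr) auto
  also have "\<dots> = x \<otimes> form x y n (\<lambda>i. c (Suc i))" using Suc.IH[of "\<lambda>i. c (Suc i)"] Suc.prems by simp
  finally show ?case by simp
qed

text \<open>For use after \<open>c 0 \<otimes> y\<close> has been replaced by
  \<open>p \<oplus> x \<otimes> t\<close>: the surplus \<open>t y^n\<close> is absorbed into the
  lowest coefficient of the form of smaller degree.\<close>

lemma form_add0:
  assumes "x \<in> carrier R" "y \<in> carrier R" "t \<in> carrier R" "\<And>i. i \<le> n \<Longrightarrow> c i \<in> carrier R"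
  shows "form x y n (\<lambda>i. if i = 0 then c 0 \<oplus> t else c i) = form x y n c \<oplus> t \<otimes> y [^] n"
proof (cases n)
  case 0
  then show ?thesis using assms by simp
next
  case (Suc m)
  have "form x y m (\<lambda>i. c (Suc i)) \<in> carrier R" using assms Suc by (intro form_closed) auto
  then show ?thesis using assms(1,2,3) assms(4)[of 0] unfolding Suc by (simp add: l_distr a_assoc)
qed

text \<open>
  Let \<open>K = P0 + (x)\<close>. A form in \<open>x, y\<close> lying in \<open>P0\<close> forces \<open>c 0 \<otimes> y\<close> into \<open>K\<close>; writing it as
  \<open>x \<otimes> t\<close> modulo \<open>P0\<close>, one factor \<open>x\<close> cancels and the degree drops.
\<close>

lemma form_coeffs_in_max:
  assumes P: "primeideal P0 R" "primeideal P1 R" "P0 \<subseteq> P1"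
    and x: "x \<in> P1" "x \<notin> P0" and y: "y \<in> \<mm>" "y \<notin> P1"
    and ne: "\<And>t p. t \<in> carrier R \<Longrightarrow> p \<in> P0 \<Longrightarrow> x \<noteq> y \<otimes> t \<oplus> p"
    and st: "\<And>r. r \<in> carrier R \<Longrightarrow> r \<otimes> (y \<otimes> y) \<in> adjoin P0 x \<Longrightarrow> r \<otimes> y \<in> adjoin P0 x"
  shows "(\<And>i. i \<le> n \<Longrightarrow> c i \<in> carrier R) \<Longrightarrow> form x y n c \<in> P0 \<Longrightarrow> i \<le> n \<Longrightarrow> c i \<in> \<mm>"
proof (induction n arbitrary: c i)
  case 0
  have "P0 \<subseteq> \<mm>"
    using primeideal.I_notcarr[OF P(1)] primeideal.axioms(1)[OF P(1)] by (intro proper_ideal_le_max) auto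
  then show ?case using 0 by auto
next
  case (Suc n)
  have i0: "ideal P0 R" and i1: "ideal P1 R" using P(1,2) by (auto dest: primeideal.axioms)
  note d0 = idealD[OF i0] and d1 = idealD[OF i1] and dm = idealD[OF max_ideal]
  have xc: "x \<in> carrier R" and yc: "y \<in> carrier R" using d1(1)[OF x(1)] dm(1)[OF y(1)] by auto
  have K: "ideal (adjoin P0 x) R" by (rule adjoin_ideal(1)[OF i0 xc])
  have KP1: "adjoin P0 x \<subseteq> P1"
    using P(3) d1(3) d1(7)[OF _ x(1)] by (auto simp: adjoin_def)
  have c0: "c 0 \<in> carrier R" using Suc.prems(1) by simp
  let ?c = "\<lambda>i. c (Suc i)"
  have cc: "?c i \<in> carrier R" if "i \<le> n" for i using Suc.prems(1) that by simp
  have fc: "form x y n ?c \<in> carrier R" by (rule form_closed[OF xc yc cc])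
  \<comment> \<open>Repeated use of \<open>st\<close> lowers any positive power of \<open>y\<close>
    to the first one.\<close>
  have pw: "r \<otimes> y \<in> adjoin P0 x" if "r \<in> carrier R" "r \<otimes> y [^] Suc j \<in> adjoin P0 x" for j r
    using that
  proof (induction j arbitrary: r)
    case 0
    then show ?case using yc by simp
  next
    case (Suc j)
    have "(r \<otimes> y) \<otimes> y [^] Suc j \<in> adjoin P0 x" using Suc.prems yc by (simp add: m_ac)
    then have "(r \<otimes> y) \<otimes> y \<in> adjoin P0 x" using Suc.prems(1) yc by (intro Suc.IH) auto
    then show ?case using st[OF Suc.prems(1)] Suc.prems(1) yc by (simp add: m_assoc)
  qed
  have F: "x \<otimes> form x y n ?c \<oplus> c 0 \<otimes> y [^] Suc n \<in> P0" using Suc.prems(2) by simp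
  have "c 0 \<otimes> y [^] Suc n \<in> adjoin P0 x"
  proof (rule ideal_cancel_right[OF K])
    show "c 0 \<otimes> y [^] Suc n \<oplus> x \<otimes> form x y n ?c \<in> adjoin P0 x"
      using F adjoin_ideal(2)[OF i0 xc] fc xc yc c0 by (auto simp: a_comm)
    show "x \<otimes> form x y n ?c \<in> adjoin P0 x" by (rule idealD(7)[OF K fc adjoin_ideal(3)[OF i0 xc]])
  qed (use c0 yc in auto)
  then have yK: "c 0 \<otimes> y \<in> adjoin P0 x" by (rule pw[OF c0])
  then obtain p t where pt: "p \<in> P0" "t \<in> carrier R" "c 0 \<otimes> y = p \<oplus> x \<otimes> t" by (auto simp: adjoin_def)
  have pc: "p \<in> carrier R" by (rule d0(1)[OF pt(1)])
  \<comment> \<open>A unit \<open>c 0\<close> would put \<open>y\<close> into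
    \<open>P0 + (x)\<close>, which lies in \<open>P1\<close>.\<close>
  have c0m: "c 0 \<in> \<mm>"
  proof (rule ccontr)
    assume "c 0 \<notin> \<mm>"
    then have "y \<in> adjoin P0 x" by (rule unit_cancel[OF K c0 _ yc yK])
    then show False using KP1 y(2) by blast
  qed
  \<comment> \<open>A unit \<open>t\<close> would make \<open>x\<close> a multiple of
    \<open>y\<close> modulo \<open>P0\<close>, against \<open>ne\<close>. With \<open>t\<close> in
    the maximal ideal, the induction hypothesis for \<open>c 1 \<oplus> t\<close> also settles
    \<open>c 1\<close>.\<close>
  have tm: "t \<in> \<mm>"
  proof (rule ccontr)
    assume "t \<notin> \<mm>"
    then obtain s where s: "s \<in> carrier R" "s \<otimes> t = \<one>" using unit_of_not_max[OF pt(2)] by blast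
    have "x = (s \<otimes> t) \<otimes> x" using s(2) xc by simp
    also have "\<dots> = s \<otimes> (p \<oplus> x \<otimes> t) \<ominus> s \<otimes> p" using s(1) pt(2) xc pc by algebra
    also have "\<dots> = s \<otimes> (c 0 \<otimes> y) \<ominus> s \<otimes> p" by (simp add: pt(3))
    also have "\<dots> = y \<otimes> (s \<otimes> c 0) \<oplus> (\<ominus> s) \<otimes> p" using s(1) c0 yc pc by algebra
    finally show False using ne[of "s \<otimes> c 0" "(\<ominus> s) \<otimes> p"] s(1) c0 d0(6)[OF _ pt(1)] by auto
  qed
  let ?c' = "\<lambda>i. if i = 0 then ?c 0 \<oplus> t else ?c i"
  have fa: "form x y n ?c' = form x y n ?c \<oplus> t \<otimes> y [^] n"
    by (rule form_add0[OF xc yc pt(2), of n ?c]) (rule cc)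
  have al: "x \<otimes> (g \<oplus> t \<otimes> b) \<oplus> p \<otimes> b = x \<otimes> g \<oplus> (p \<oplus> x \<otimes> t) \<otimes> b"
    if "g \<in> carrier R" "b \<in> carrier R" for g b
    using that xc pt(2) pc by algebra
  have "x \<otimes> form x y n ?c' \<oplus> p \<otimes> y [^] n = x \<otimes> form x y n ?c \<oplus> (p \<oplus> x \<otimes> t) \<otimes> y [^] n"
    unfolding fa by (rule al[OF fc nat_pow_closed[OF yc]])
  also have "\<dots> = x \<otimes> form x y n ?c \<oplus> c 0 \<otimes> y [^] Suc n"
    using c0 yc by (simp add: pt(3)[symmetric] m_ac)
  finally have F': "x \<otimes> form x y n ?c' \<oplus> p \<otimes> y [^] n \<in> P0" using F by simp
  have f'c: "form x y n ?c' \<in> carrier R"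
    by (rule form_closed[OF xc yc]) (use cc pt(2) in auto)
  have "x \<otimes> form x y n ?c' \<in> P0"
    by (rule ideal_cancel_right[OF i0 F' d0(7)[OF nat_pow_closed[OF yc] pt(1)]]) (use xc f'c in simp)
  then have "form x y n ?c' \<in> P0" using primeideal.I_prime[OF P(1) xc f'c] x(2) by blast
  then have IH: "?c' i \<in> \<mm>" if "i \<le> n" for i
    using Suc.IH[of ?c' i] cc pt(2) that by auto
  show ?case
  proof (cases i)
    case 0
    then show ?thesis using c0m by simp
  next
    case (Suc j)
    show ?thesis
    proof (cases "j = 0")
      case True
      have "c 1 \<in> \<mm>" by (rule ideal_cancel_right[OF max_ideal _ tm]) (use IH[of 0] cc[of 0] in auto)
      then show ?thesis using Suc True by simp
    next
      case False
      then show ?thesis using IH[of j] Suc \<open>i \<le> Suc n\<close> by simp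
    qed
  qed
qed

text \<open>Forms of degree \<open>n\<close> in a pair from \<open>parameter_pair\<close> give the
  \<open>n + 1\<close> elements. \<open>P2\<close> supplies an element of the maximal ideal outside
  \<open>P1\<close>, from which \<open>y\<close> is made, while \<open>x\<close> comes from the step
  between \<open>P0\<close> and \<open>P1\<close>.\<close>

lemma independent_elements:
  assumes P: "primeideal P0 R" "primeideal P1 R" "P0 \<subset> P1" and P2: "primeideal P2 R" "P1 \<subset> P2"
    and a: "a \<in> carrier R" "a \<noteq> \<zero>"
  shows "\<exists>Q w. ideal Q R \<and> a \<notin> Q \<and> (\<forall>i. w i \<in> Q \<inter> \<mm>) \<and>
    (\<forall>c. (\<forall>i\<le>n. c i \<in> carrier R) \<longrightarrow> (\<Oplus>i\<in>{..n :: nat}. c i \<otimes> w i) \<in> P0 \<longrightarrow> (\<forall>i\<le>n. c i \<in> \<mm>))"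
proof -
  have "P2 \<subseteq> \<mm>"
    using primeideal.I_notcarr[OF P2(1)] primeideal.axioms(1)[OF P2(1)] by (intro proper_ideal_le_max) auto
  then obtain y0 where "y0 \<in> \<mm>" "y0 \<notin> P1" using P2(2) by blast
  from parameter_pair[OF P this] obtain x y where x: "x \<in> P1" "x \<notin> P0" and y: "y \<in> \<mm>" "y \<notin> P1"
    and ne: "\<And>t p. t \<in> carrier R \<Longrightarrow> p \<in> P0 \<Longrightarrow> x \<noteq> y \<otimes> t \<oplus> p"
    and st: "\<And>r. r \<in> carrier R \<Longrightarrow> r \<otimes> (y \<otimes> y) \<in> adjoin P0 x \<Longrightarrow> r \<otimes> y \<in> adjoin P0 x" by blast
  have i0: "ideal P0 R" and i1: "ideal P1 R" using P(1,2) by (auto dest: primeideal.axioms)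
  have xc: "x \<in> carrier R" and yc: "y \<in> carrier R" using idealD(1)[OF i1 x(1)] idealD(1)[OF max_ideal y(1)] by auto
  obtain Q k where Q: "ideal Q R" "a \<notin> Q" "y [^] (k :: nat) \<in> Q" using separating_ideal[OF a y(1)] by blast
  have yQ: "y [^] Suc k \<in> Q \<inter> \<mm>"
    using idealD(7)[OF Q(1) yc Q(3)] idealD(6)[OF max_ideal nat_pow_closed[OF yc] y(1)] by simp
  \<comment> \<open>The common factor \<open>y^(k+1)\<close> puts every \<open>w i\<close> into
    \<open>Q\<close> and, thanks to the extra \<open>y\<close>, visibly into the maximal ideal. It
    is outside the prime \<open>P0\<close>, so it cancels from any relation modulo \<open>P0\<close>
    and leaves a form of degree \<open>n\<close>.\<close>
  define w where "w i = y [^] Suc k \<otimes> (x [^] i \<otimes> y [^] (n - i))" for i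
  have "w i \<in> Q \<inter> \<mm>" for i
  proof -
    have cx: "x [^] i \<otimes> y [^] (n - i) \<in> carrier R" using xc yc by simp
    show ?thesis
      unfolding w_def
      by (rule IntI[OF idealD(7)[OF Q(1) cx IntD1[OF yQ]] idealD(7)[OF max_ideal cx IntD2[OF yQ]]])
  qed
  moreover have "c i \<in> \<mm>" if c: "\<forall>i\<le>n. c i \<in> carrier R" and z: "(\<Oplus>i\<in>{..n}. c i \<otimes> w i) \<in> P0" and i: "i \<le> n" for c i
  proof -
    have fc: "form x y n c \<in> carrier R" using c by (intro form_closed xc yc) auto
    have ff: "form x y n c = (\<Oplus>i\<in>{..n}. c i \<otimes> (x [^] i \<otimes> y [^] (n - i)))"
      by (rule form_finsum[OF xc yc]) (use c in simp)
    have "(\<Oplus>i\<in>{..n}. c i \<otimes> w i) = (\<Oplus>i\<in>{..n}. y [^] Suc k \<otimes> (c i \<otimes> (x [^] i \<otimes> y [^] (n - i))))"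
      unfolding w_def using c xc yc by (intro finsum_cong') (auto simp: m_ac)
    also have "\<dots> = y [^] Suc k \<otimes> form x y n c"
      unfolding ff using c xc yc by (intro finsum_rdistr[symmetric]) auto
    finally have e: "y [^] Suc k \<otimes> form x y n c \<in> P0" using z by simp
    have "y [^] (l :: nat) \<notin> P0" for l
    proof (induction l)
      case 0
      show ?case using ideal.one_imp_carrier[OF i0] primeideal.I_notcarr[OF P(1)] by auto
    next
      case (Suc l)
      then show ?case using primeideal.I_prime[OF P(1), of "y [^] l" y] y(2) P(3) yc by auto
    qed
    then have "form x y n c \<in> P0"
      using primeideal.I_prime[OF P(1) nat_pow_closed[OF yc] fc e] by blast
    then show ?thesis
      using form_coeffs_in_max[OF P(1,2) _ x y ne st, of n c i] P(3) c i by blast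
  qed
  ultimately show ?thesis using Q by blast
qed

lemma finsum_lessThan_shift:
  assumes "\<And>i. i < Suc n \<Longrightarrow> f i \<in> carrier R"
  shows "(\<Oplus>i\<in>{..<Suc n}. f i) = f 0 \<oplus> (\<Oplus>i\<in>{..<n}. f (Suc i))"
proof -
  have "(\<Oplus>i\<in>{..<Suc n}. f i) = (\<Oplus>i\<in>insert 0 (Suc ` {..<n}). f i)"
    by (simp add: lessThan_Suc_eq_insert_0)
  also have "\<dots> = f 0 \<oplus> (\<Oplus>i\<in>Suc ` {..<n}. f i)" using assms by (subst finsum_insert) auto
  also have "(\<Oplus>i\<in>Suc ` {..<n}. f i) = (\<Oplus>i\<in>{..<n}. f (Suc i))"
    using assms by (subst finsum_reindex) auto
  finally show ?thesis .
qed

text \<open>From \<open>n + 1\<close> independent elements to \<open>n\<close> for each parameter: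
  one of them is spent on the parameter, in \<open>z u 0 = w 0 + u w 1\<close>, and the others are
  shifted by one. As \<open>w 0\<close> and \<open>w 1\<close> are independent, \<open>A 0\<close>
  can be compared with \<open>q\<close> and \<open>A 0 u\<close> with \<open>q v\<close> separately,
  which is what tells \<open>u\<close> from \<open>v\<close>.\<close>

lemma independent_families:
  assumes P: "primeideal P0 R" "primeideal P1 R" "P0 \<subset> P1" and P2: "primeideal P2 R" "P1 \<subset> P2"
    and a: "a \<in> carrier R" "a \<noteq> \<zero>"
  shows "\<exists>Q z. ideal Q R \<and> a \<notin> Q \<and> (\<forall>u\<in>carrier R. \<forall>i. z u i \<in> Q \<inter> \<mm>) \<and>
    (\<forall>u\<in>carrier R. \<forall>v\<in>carrier R. \<forall>A q j. (\<forall>i<n. A i \<in> carrier R) \<longrightarrow> q \<in> carrier R \<longrightarrow> j < n \<longrightarrow>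
      (\<Oplus>i\<in>{..<n :: nat}. A i \<otimes> z u i) \<ominus> q \<otimes> z v j \<in> P0 \<longrightarrow>
      (\<forall>i<n. A i \<ominus> (if i = j then q else \<zero>) \<in> \<mm>) \<and> (j = 0 \<longrightarrow> A 0 \<otimes> u \<ominus> q \<otimes> v \<in> \<mm>))"
proof -
  obtain Q w where Q: "ideal Q R" "a \<notin> Q" and w: "\<And>i. w i \<in> Q \<inter> \<mm>"
    and ind: "\<And>c. \<forall>i\<le>n. c i \<in> carrier R \<Longrightarrow> (\<Oplus>i\<in>{..n}. c i \<otimes> w i) \<in> P0 \<Longrightarrow> \<forall>i\<le>n. c i \<in> \<mm>"
    using independent_elements[OF assms, of n] by blast
  have wc: "w i \<in> carrier R" for i using w[of i] idealD(1)[OF Q(1)] by blast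
  define z where "z u i = (if i = 0 then w 0 \<oplus> u \<otimes> w 1 else w (Suc i))" for u i
  have zK: "z u i \<in> K" if "ideal K R" "u \<in> carrier R" "\<And>i. w i \<in> K" for u i K
    using idealD(3)[OF that(1) that(3)[of 0] idealD(6)[OF that(1,2) that(3)[of 1]]] that(3)[of "Suc i"]
    by (simp add: z_def)
  have zQ: "z u i \<in> Q \<inter> \<mm>" if "u \<in> carrier R" for u i
    using zK[OF Q(1) that] zK[OF max_ideal that] w by blast
  moreover have "(\<forall>i<n. A i \<ominus> (if i = j then q else \<zero>) \<in> \<mm>) \<and> (j = 0 \<longrightarrow> A 0 \<otimes> u \<ominus> q \<otimes> v \<in> \<mm>)"
    if u: "u \<in> carrier R" "v \<in> carrier R" and A: "\<forall>i<n. A i \<in> carrier R" and q: "q \<in> carrier R" and j: "j < n"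
      and e: "(\<Oplus>i\<in>{..<n}. A i \<otimes> z u i) \<ominus> q \<otimes> z v j \<in> P0" for u v A q j
  proof -
    obtain m where m: "n = Suc m" using j by (cases n) auto
    define \<delta> where "\<delta> i = (if i = j then q else \<zero>)" for i
    have \<delta>c: "\<delta> i \<in> carrier R" for i using q by (simp add: \<delta>_def)
    \<comment> \<open>\<open>c\<close> lists the coefficients of \<open>w 0\<close>,
      \<open>w 1\<close>, \<open>w 2\<close> and so on after the given relation is expanded. Writing
      \<open>q z v j\<close> as a combination of all \<open>z v i\<close> with coefficients
      \<open>\<delta>\<close> treats the cases \<open>j = 0\<close> and \<open>j > 0\<close> at
      once.\<close>
    define c where "c i = (case i of 0 \<Rightarrow> A 0 \<ominus> \<delta> 0 | Suc 0 \<Rightarrow> A 0 \<otimes> u \<ominus> \<delta> 0 \<otimes> v | Suc (Suc k) \<Rightarrow> A (Suc k) \<ominus> \<delta> (Suc k))" for i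
    have cs: "c 0 = A 0 \<ominus> \<delta> 0" "c (Suc 0) = A 0 \<otimes> u \<ominus> \<delta> 0 \<otimes> v" "c (Suc (Suc k)) = A (Suc k) \<ominus> \<delta> (Suc k)" for k
      by (simp_all add: c_def)
    have A0: "A 0 \<in> carrier R" using A j by auto
    have AS: "A (Suc k) \<in> carrier R" if "k < m" for k using A that m by simp
    have cc: "c i \<in> carrier R" if "i \<le> n" for i
    proof (cases i)
      case (Suc i')
      then show ?thesis using that A0 AS u \<delta>c m by (cases i') (auto simp: cs)
    qed (use A0 \<delta>c cs in simp)
    let ?T = "\<lambda>f. \<Oplus>i\<in>{..<m}. f i \<otimes> w (Suc (Suc i))"
    have s1: "(\<Oplus>i\<in>{..<n}. f i \<otimes> z u i) = f 0 \<otimes> (w 0 \<oplus> u \<otimes> w 1) \<oplus> ?T (\<lambda>i. f (Suc i))"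
      if "\<forall>i<n. f i \<in> carrier R" "u \<in> carrier R" for f u
      unfolding m using that wc m by (subst finsum_lessThan_shift) (auto simp: z_def)
    have "(\<Oplus>i\<in>{..<n}. \<delta> i \<otimes> z v i) = (\<Oplus>i\<in>{..<n}. if j = i then q \<otimes> z v i else \<zero>)"
      using q zQ[OF u(2)] idealD(1)[OF Q(1)] by (intro finsum_cong') (auto simp: \<delta>_def)
    also have "\<dots> = q \<otimes> z v j"
      using j q zQ[OF u(2)] idealD(1)[OF Q(1)] by (intro finsum_singleton) auto
    finally have s2: "q \<otimes> z v j = \<delta> 0 \<otimes> (w 0 \<oplus> v \<otimes> w 1) \<oplus> ?T (\<lambda>i. \<delta> (Suc i))"
      using s1[of \<delta> v] \<delta>c u(2) by simp
    have TA: "?T (\<lambda>i. A (Suc i)) = ?T (\<lambda>i. A (Suc i) \<ominus> \<delta> (Suc i)) \<oplus> ?T (\<lambda>i. \<delta> (Suc i))"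
    proof -
      have "?T (\<lambda>i. A (Suc i)) = (\<Oplus>i\<in>{..<m}. (A (Suc i) \<ominus> \<delta> (Suc i)) \<otimes> w (Suc (Suc i)) \<oplus> \<delta> (Suc i) \<otimes> w (Suc (Suc i)))"
      proof (intro finsum_cong' refl)
        fix i assume "i \<in> {..<m}"
        then show "A (Suc i) \<otimes> w (Suc (Suc i)) =
            (A (Suc i) \<ominus> \<delta> (Suc i)) \<otimes> w (Suc (Suc i)) \<oplus> \<delta> (Suc i) \<otimes> w (Suc (Suc i))"
          using AS[of i] \<delta>c[of "Suc i"] wc[of "Suc (Suc i)"] by simp algebra
      qed (use AS \<delta>c wc in auto)
      also have "\<dots> = ?T (\<lambda>i. A (Suc i) \<ominus> \<delta> (Suc i)) \<oplus> ?T (\<lambda>i. \<delta> (Suc i))"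
        using AS \<delta>c wc by (intro finsum_addf) auto
      finally show ?thesis .
    qed
    have Tc: "?T (\<lambda>i. A (Suc i) \<ominus> \<delta> (Suc i)) \<in> carrier R" "?T (\<lambda>i. \<delta> (Suc i)) \<in> carrier R"
      using AS \<delta>c wc by (auto intro!: finsum_closed)
    have al: "(A \<ominus> d) \<otimes> w0 \<oplus> ((A \<otimes> u \<ominus> d \<otimes> v) \<otimes> w1 \<oplus> T1) =
        A \<otimes> (w0 \<oplus> u \<otimes> w1) \<oplus> (T1 \<oplus> T2) \<ominus> (d \<otimes> (w0 \<oplus> v \<otimes> w1) \<oplus> T2)"
      if "A \<in> carrier R" "d \<in> carrier R" "u \<in> carrier R" "v \<in> carrier R" "w0 \<in> carrier R"
        "w1 \<in> carrier R" "T1 \<in> carrier R" "T2 \<in> carrier R" for A d u v w0 w1 T1 T2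
      using that by algebra
    have "(\<Oplus>i\<in>{..n}. c i \<otimes> w i) = (\<Oplus>i\<in>{..<Suc (Suc m)}. c i \<otimes> w i)"
      by (simp add: m lessThan_Suc_atMost)
    also have "\<dots> = c 0 \<otimes> w 0 \<oplus> (c 1 \<otimes> w 1 \<oplus> ?T (\<lambda>i. c (Suc (Suc i))))"
      using cc wc m by (simp add: finsum_lessThan_shift)
    also have "\<dots> = (A 0 \<ominus> \<delta> 0) \<otimes> w 0 \<oplus> ((A 0 \<otimes> u \<ominus> \<delta> 0 \<otimes> v) \<otimes> w 1 \<oplus> ?T (\<lambda>i. A (Suc i) \<ominus> \<delta> (Suc i)))"
      by (simp add: cs)
    also have "\<dots> = A 0 \<otimes> (w 0 \<oplus> u \<otimes> w 1) \<oplus> (?T (\<lambda>i. A (Suc i) \<ominus> \<delta> (Suc i)) \<oplus> ?T (\<lambda>i. \<delta> (Suc i)))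
        \<ominus> (\<delta> 0 \<otimes> (w 0 \<oplus> v \<otimes> w 1) \<oplus> ?T (\<lambda>i. \<delta> (Suc i)))"
      by (rule al[OF A0 \<delta>c u wc wc Tc])
    also have "\<dots> = (\<Oplus>i\<in>{..<n}. A i \<otimes> z u i) \<ominus> q \<otimes> z v j"
      using s1[OF A u(1)] s2 TA by simp
    finally have "\<forall>i\<le>n. c i \<in> \<mm>" using ind[of c] cc e by simp
    then have cm: "c i \<in> \<mm>" if "i \<le> n" for i using that by blast
    have "A i \<ominus> \<delta> i \<in> \<mm>" if "i < n" for i
    proof (cases i)
      case 0
      then show ?thesis using cm[of 0] by (simp add: cs)
    next
      case (Suc k)
      then show ?thesis using cm[of "Suc (Suc k)"] that by (simp add: cs)
    qed
    moreover have "A 0 \<otimes> u \<ominus> q \<otimes> v \<in> \<mm>" if "j = 0"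
      using cm[of 1] that m by (simp add: cs \<delta>_def)
    ultimately show ?thesis by (simp add: \<delta>_def)
  qed
  ultimately show ?thesis using Q by (intro exI[of _ Q] exI[of _ z]) blast
qed

end

section \<open>The modules of the family\<close>

text \<open>
  The relations \<open>I e\<^sub>i = 0\<close> (\<open>i < n\<close>) and \<open>a e\<^sub>n = z\<^sub>0 e\<^sub>0 + \<dots> + z\<^bsub>n-1\<^esub> e\<^bsub>n-1\<^esub>\<close>.
\<close>

definition ext_rel ::
  "('a, 'r) ring_scheme \<Rightarrow> 'a set \<Rightarrow> 'a \<Rightarrow> nat \<Rightarrow> (nat \<Rightarrow> 'a) \<Rightarrow> (nat \<Rightarrow> 'a) set" where
  "ext_rel R I a n z = {x \<in> carrier (Fr R (Suc n)). \<exists>q\<in>carrier R. x n = q \<otimes>\<^bsub>R\<^esub> a \<and>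
     (\<forall>i<n. x i \<oplus>\<^bsub>R\<^esub> q \<otimes>\<^bsub>R\<^esub> z i \<in> I)}"

abbreviation ext_mod ::
  "('a, 'r) ring_scheme \<Rightarrow> 'a set \<Rightarrow> 'a \<Rightarrow> nat \<Rightarrow> (nat \<Rightarrow> 'a) \<Rightarrow> ('a, (nat \<Rightarrow> 'a) set) module" where
  "ext_mod R I a n z \<equiv> quot_mod R (Fr R (Suc n)) (ext_rel R I a n z)"

lemma (in abelian_group) diff_diff_add:
  assumes "a \<in> carrier G" "b \<in> carrier G" "c \<in> carrier G"
  shows "(a \<ominus> b \<ominus> c) \<oplus> b = a \<ominus> c"
proof -
  have "(a \<ominus> b \<ominus> c) \<oplus> b = (a \<ominus> c) \<oplus> (\<ominus> b \<oplus> b)" using assms by (simp add: a_minus_def a_ac)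
  then show ?thesis using assms by (simp add: l_neg)
qed

lemma exact3_short_exact:
  assumes "module R A" "module R B" "exact3 R A f B g C"
  shows "short_exact R A (restrict f (carrier A)) B (restrict g (carrier B)) C"
proof -
  note e = exact3D[OF assms(3)]
  have "inj_on (restrict f (carrier A)) (carrier A)" using assms(3) by (auto simp: exact3_def inj_on_def)
  moreover have "f ` carrier A = {x \<in> carrier B. g x = \<zero>\<^bsub>C\<^esub>}"
  proof
    show "f ` carrier A \<subseteq> {x \<in> carrier B. g x = \<zero>\<^bsub>C\<^esub>}" using e(4) lin_closed[OF e(1)] by blast
    show "{x \<in> carrier B. g x = \<zero>\<^bsub>C\<^esub>} \<subseteq> f ` carrier A" using e(5) by blast
  qed
  moreover have "g ` carrier B = carrier C"
  proof
    show "g ` carrier B \<subseteq> carrier C" using lin_closed[OF e(2)] by blast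
    show "carrier C \<subseteq> g ` carrier B" using e(6) by blast
  qed
  ultimately show ?thesis
    unfolding short_exact_def restrict_mod_hom[OF assms(1)] restrict_mod_hom[OF assms(2)] mod_ker_def
    using e(1,2) by (simp cong: conj_cong)
qed

context cring
begin

lemma ideal_finsum:
  assumes "ideal K R" "finite S" "\<And>i. i \<in> S \<Longrightarrow> f i \<in> K"
  shows "finsum R f S \<in> K"
  using submodule_finsum[OF ring_mod_module ideal_submodule[OF assms(1)] assms(2,3)] by simp

lemma finsum_lessThan_Suc:
  assumes "\<And>i. i < Suc n \<Longrightarrow> f i \<in> carrier R"
  shows "(\<Oplus>i\<in>{..<Suc n}. f i) = (\<Oplus>i\<in>{..<n}. f i) \<oplus> f n"
proof -
  have "(\<Oplus>i\<in>{..<Suc n}. f i) = (\<Oplus>i\<in>insert n {..<n}. f i)" by (simp add: lessThan_Suc)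
  also have "\<dots> = f n \<oplus> (\<Oplus>i\<in>{..<n}. f i)" using assms by (subst finsum_insert) auto
  also have "\<dots> = (\<Oplus>i\<in>{..<n}. f i) \<oplus> f n" using assms by (intro a_comm finsum_closed) auto
  finally show ?thesis .
qed

lemma lin_Fr_apply:
  assumes "lin R (Fr R k) (Fr R l) \<Phi>" "x \<in> carrier (Fr R k)" "j < l"
  shows "\<Phi> x j = (\<Oplus>i\<in>{..<k}. x i \<otimes> \<Phi> (unit_vec R k i) j)"
  using lin_expand[OF ring_mod_module lin_comp[OF assms(1) lin_coord[OF assms(3)]] assms(2)] by simp

lemma Fr_mem: "x \<in> carrier (Fr R k) \<Longrightarrow> i < k \<Longrightarrow> x i \<in> carrier R"
  using power_mod_mem[of x "ring_mod R" k i] by simp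

context
  fixes I a and n :: nat and z :: "nat \<Rightarrow> 'a"
  assumes I: "ideal I R" and a: "a \<in> carrier R" and zc: "\<And>i. z i \<in> carrier R"
begin

lemma ext_rel_submodule: "submodule (ext_rel R I a n z) R (Fr R (Suc n))"
proof -
  interpret F: module R "Fr R (Suc n)" by (rule Fr_module)
  note d = idealD[OF I]
  have add: "x \<oplus>\<^bsub>Fr R (Suc n)\<^esub> y \<in> ext_rel R I a n z" if xy: "x \<in> ext_rel R I a n z" "y \<in> ext_rel R I a n z" for x y
  proof -
    obtain p q where pq: "x \<in> carrier (Fr R (Suc n))" "y \<in> carrier (Fr R (Suc n))" "p \<in> carrier R" "q \<in> carrier R"
      "x n = p \<otimes> a" "y n = q \<otimes> a" "\<And>i. i < n \<Longrightarrow> x i \<oplus> p \<otimes> z i \<in> I" "\<And>i. i < n \<Longrightarrow> y i \<oplus> q \<otimes> z i \<in> I"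
      using xy unfolding ext_rel_def by blast
    have "(x \<oplus>\<^bsub>Fr R (Suc n)\<^esub> y) i \<oplus> (p \<oplus> q) \<otimes> z i \<in> I" if i: "i < n" for i
    proof -
      have "(x \<oplus>\<^bsub>Fr R (Suc n)\<^esub> y) i \<oplus> (p \<oplus> q) \<otimes> z i = (x i \<oplus> p \<otimes> z i) \<oplus> (y i \<oplus> q \<otimes> z i)"
        using i pq(3,4) zc Fr_mem[OF pq(1), of i] Fr_mem[OF pq(2), of i] by (simp add: l_distr a_ac)
      then show ?thesis using d(3)[OF pq(7)[OF i] pq(8)[OF i]] by simp
    qed
    moreover have "(x \<oplus>\<^bsub>Fr R (Suc n)\<^esub> y) n = (p \<oplus> q) \<otimes> a" using pq a by (simp add: l_distr)
    ultimately show ?thesis unfolding ext_rel_def using pq by blast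
  qed
  have sm: "r \<odot>\<^bsub>Fr R (Suc n)\<^esub> x \<in> ext_rel R I a n z" if r: "r \<in> carrier R" and x: "x \<in> ext_rel R I a n z" for r x
  proof -
    obtain p where pq: "x \<in> carrier (Fr R (Suc n))" "p \<in> carrier R"
      "x n = p \<otimes> a" "\<And>i. i < n \<Longrightarrow> x i \<oplus> p \<otimes> z i \<in> I"
      using x unfolding ext_rel_def by blast
    have "(r \<odot>\<^bsub>Fr R (Suc n)\<^esub> x) i \<oplus> (r \<otimes> p) \<otimes> z i \<in> I" if i: "i < n" for i
    proof -
      have "(r \<odot>\<^bsub>Fr R (Suc n)\<^esub> x) i \<oplus> (r \<otimes> p) \<otimes> z i = r \<otimes> (x i \<oplus> p \<otimes> z i)"
        using i pq(2) r zc Fr_mem[OF pq(1), of i] by (simp add: r_distr m_assoc)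
      then show ?thesis using d(6)[OF r pq(4)[OF i]] by simp
    qed
    moreover have "(r \<odot>\<^bsub>Fr R (Suc n)\<^esub> x) n = (r \<otimes> p) \<otimes> a" using pq a r by (simp add: m_assoc)
    ultimately show ?thesis unfolding ext_rel_def using pq r by blast
  qed
  have z0: "\<zero>\<^bsub>Fr R (Suc n)\<^esub> \<in> ext_rel R I a n z"
    unfolding ext_rel_def using a zc d(2) by (intro CollectI conjI F.zero_closed bexI[of _ \<zero>]) auto
  show ?thesis
  proof (rule F.submoduleI)
    show "ext_rel R I a n z \<subseteq> carrier (Fr R (Suc n))" by (auto simp: ext_rel_def)
    show "\<ominus>\<^bsub>Fr R (Suc n)\<^esub> x \<in> ext_rel R I a n z" if x: "x \<in> ext_rel R I a n z" for x
    proof -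
      have xc: "x \<in> carrier (Fr R (Suc n))" using x by (simp add: ext_rel_def)
      have "(\<ominus> \<one>) \<odot>\<^bsub>Fr R (Suc n)\<^esub> x = \<ominus>\<^bsub>Fr R (Suc n)\<^esub> x"
        using F.smult_l_minus[OF one_closed xc] F.smult_one[OF xc] by simp
      then show ?thesis using sm[OF _ x, of "\<ominus> \<one>"] by simp
    qed
  qed (fact z0 add sm)+
qed

lemma ext_mod_module: "module R (ext_mod R I a n z)"
  by (rule quot_mod_module[OF Fr_module ext_rel_submodule])

text \<open>The first \<open>n\<close> generators span the copy of \<open>(R/I)^n\<close>, and the
  last coordinate gives the projection. Injectivity is where the annihilator of \<open>a\<close>
  enters: a relation with zero last coordinate has \<open>q a = 0\<close>, so \<open>q\<close> lies
  in \<open>I\<close>, and then the other coordinates do too.\<close>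

lemma ext_mod_exact:
  assumes ann: "\<And>r. r \<in> carrier R \<Longrightarrow> r \<otimes> a = \<zero> \<Longrightarrow> r \<in> I"
    and J: "ideal J R" and col: "\<And>t. t \<in> carrier R \<Longrightarrow> t \<in> J \<longleftrightarrow> (\<exists>r\<in>carrier R. t = r \<otimes> a)"
  shows "\<exists>f g. exact3 R (power_mod (cyclic_mod R I) n) f (ext_mod R I a n z) g (cyclic_mod R J)"
proof -
  let ?P = "Fr R (Suc n)" and ?N = "ext_rel R I a n z" and ?M = "ext_mod R I a n z"
  let ?T = "cyclic_mod R I" and ?U = "cyclic_mod R J"
  let ?c = "\<lambda>x. ?N +>\<^bsub>?P\<^esub> x" and ?\<pi> = "\<lambda>r. I +>\<^bsub>ring_mod R\<^esub> r" and ?\<rho> = "\<lambda>r. J +>\<^bsub>ring_mod R\<^esub> r"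
  note subI = ideal_submodule[OF I] and subJ = ideal_submodule[OF J] and subN = ext_rel_submodule
  note d = idealD[OF I]
  have T: "module R ?T" by (rule quot_mod_module[OF ring_mod_module subI])
  have U: "module R ?U" by (rule quot_mod_module[OF ring_mod_module subJ])
  have Tn: "module R (power_mod ?T n)" by (rule power_mod_module[OF T])
  interpret P: module R ?P by (rule Fr_module)
  interpret M: module R ?M by (rule ext_mod_module)
  interpret Tn: module R "power_mod ?T n" by (rule Tn)
  have \<pi>c: "?\<pi> r \<in> carrier ?T" if "r \<in> carrier R" for r
    using lin_closed[OF lin_proj[OF ring_mod_module subI], of r] that by simp
  have \<pi>z: "?\<pi> r = \<zero>\<^bsub>?T\<^esub> \<longleftrightarrow> r \<in> I" if "r \<in> carrier R" for r
    using coset_eq_zero_iff[OF ring_mod_module subI, of r] that by simp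
  let ?p = "\<lambda>x. \<lambda>i\<in>{..<n}. ?\<pi> (x i)"
  have pc: "?p x \<in> carrier (power_mod ?T n)" if "x \<in> carrier (Fr R n)" for x
    using \<pi>c Fr_mem[OF that] by (auto simp: power_mod_simps)
  have pl: "lin R (Fr R n) (power_mod ?T n) ?p"
  proof (rule linI)
    show "?p (x \<oplus>\<^bsub>Fr R n\<^esub> y) = ?p x \<oplus>\<^bsub>power_mod ?T n\<^esub> ?p y"
      if xy: "x \<in> carrier (Fr R n)" "y \<in> carrier (Fr R n)" for x y
    proof -
      have "?\<pi> ((x \<oplus>\<^bsub>Fr R n\<^esub> y) i) = ?\<pi> (x i) \<oplus>\<^bsub>?T\<^esub> ?\<pi> (y i)" if i: "i < n" for i
        using lin_add[OF lin_proj[OF ring_mod_module subI], of "x i" "y i"] Fr_mem[OF xy(1) i] Fr_mem[OF xy(2) i] i by simp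
      then show ?thesis unfolding power_mod_simps(3)[of ?T] by (intro restrict_ext) simp
    qed
    show "?p (r \<odot>\<^bsub>Fr R n\<^esub> x) = r \<odot>\<^bsub>power_mod ?T n\<^esub> ?p x"
      if r: "r \<in> carrier R" and x: "x \<in> carrier (Fr R n)" for r x
    proof -
      have "?\<pi> ((r \<odot>\<^bsub>Fr R n\<^esub> x) i) = r \<odot>\<^bsub>?T\<^esub> ?\<pi> (x i)" if i: "i < n" for i
        using lin_smult[OF lin_proj[OF ring_mod_module subI] r, of "x i"] Fr_mem[OF x i] i by simp
      then show ?thesis unfolding power_mod_simps(4)[of ?T] by (intro restrict_ext) simp
    qed
  qed (rule pc)
  have ps: "\<exists>x\<in>carrier (Fr R n). ?p x = C" if C: "C \<in> carrier (power_mod ?T n)" for C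
  proof -
    have "\<exists>r. i < n \<longrightarrow> r \<in> carrier R \<and> ?\<pi> r = C i" for i
    proof (cases "i < n")
      case True
      have "C i \<in> carrier ?T" by (rule power_mod_mem[OF C True])
      then show ?thesis unfolding quot_mod_carrier[OF ring_mod_module subI] by auto
    qed simp
    then obtain r where r: "\<And>i. i < n \<Longrightarrow> r i \<in> carrier R \<and> ?\<pi> (r i) = C i" by metis
    show ?thesis
    proof (rule bexI)
      show m: "(\<lambda>i\<in>{..<n}. r i) \<in> carrier (Fr R n)" using r by (auto simp: power_mod_simps)
      show "?p (\<lambda>i\<in>{..<n}. r i) = C"
        by (rule power_mod_eqI[OF pc[OF m] C]) (use r in auto)
    qed
  qed
  let ?\<iota> = "\<lambda>x. \<lambda>i\<in>{..<Suc n}. if i < n then x i else \<zero>"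
  have \<iota>c: "?\<iota> x \<in> carrier ?P" if "x \<in> carrier (Fr R n)" for x
    using Fr_mem[OF that] by (auto simp: power_mod_simps)
  have \<iota>l: "lin R (Fr R n) ?P ?\<iota>"
  proof (rule linI)
    show "?\<iota> (x \<oplus>\<^bsub>Fr R n\<^esub> y) = ?\<iota> x \<oplus>\<^bsub>?P\<^esub> ?\<iota> y" if "x \<in> carrier (Fr R n)" "y \<in> carrier (Fr R n)" for x y
      unfolding power_mod_simps(3)[of "ring_mod R"] by (rule restrict_ext) simp
    show "?\<iota> (r \<odot>\<^bsub>Fr R n\<^esub> x) = r \<odot>\<^bsub>?P\<^esub> ?\<iota> x" if "r \<in> carrier R" "x \<in> carrier (Fr R n)" for r x
      unfolding power_mod_simps(4)[of "ring_mod R"] using that(1) by (intro restrict_ext) simp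
  qed (rule \<iota>c)
  have \<iota>N: "?\<iota> x \<in> ?N \<longleftrightarrow> (\<forall>i<n. x i \<in> I)" if x: "x \<in> carrier (Fr R n)" for x
  proof
    assume "?\<iota> x \<in> ?N"
    then obtain q where q: "q \<in> carrier R" "\<zero> = q \<otimes> a" "\<And>i. i < n \<Longrightarrow> x i \<oplus> q \<otimes> z i \<in> I"
      unfolding ext_rel_def by auto
    have qI: "q \<in> I" using ann[OF q(1)] q(2) by simp
    show "\<forall>i<n. x i \<in> I"
    proof (intro allI impI)
      fix i assume i: "i < n"
      show "x i \<in> I" by (rule ideal_cancel_right[OF I q(3)[OF i] d(7)[OF zc qI] Fr_mem[OF x i]])
    qed
  next
    assume "\<forall>i<n. x i \<in> I"
    then show "?\<iota> x \<in> ?N"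
      unfolding ext_rel_def using \<iota>c[OF x] a zc d(1) by (intro CollectI conjI bexI[of _ \<zero>]) auto
  qed
  have pz: "?p x = \<zero>\<^bsub>power_mod ?T n\<^esub> \<longleftrightarrow> (\<forall>i<n. x i \<in> I)" if x: "x \<in> carrier (Fr R n)" for x
  proof
    assume e: "?p x = \<zero>\<^bsub>power_mod ?T n\<^esub>"
    show "\<forall>i<n. x i \<in> I"
    proof (intro allI impI)
      fix i assume i: "i < n"
      have "?\<pi> (x i) = \<zero>\<^bsub>?T\<^esub>" using fun_cong[OF e, of i] i by simp
      then show "x i \<in> I" using \<pi>z[OF Fr_mem[OF x i]] by blast
    qed
  next
    assume xI: "\<forall>i<n. x i \<in> I"
    show "?p x = \<zero>\<^bsub>power_mod ?T n\<^esub>"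
    proof (rule power_mod_eqI[OF pc[OF x] Tn.zero_closed])
      fix i assume i: "i < n"
      have "?\<pi> (x i) = \<zero>\<^bsub>?T\<^esub>" using \<pi>z[OF Fr_mem[OF x i]] xI i by blast
      then show "?p x i = \<zero>\<^bsub>power_mod ?T n\<^esub> i" using i by simp
    qed
  qed
  have cz: "?c x = \<zero>\<^bsub>?M\<^esub> \<longleftrightarrow> x \<in> ?N" if "x \<in> carrier ?P" for x
    by (rule coset_eq_zero_iff[OF Fr_module subN that])
  have cl: "lin R ?P ?M ?c" by (rule lin_proj[OF Fr_module subN])
  have "?c (?\<iota> x) = \<zero>\<^bsub>?M\<^esub>" if x: "x \<in> carrier (Fr R n)" and "?p x = \<zero>\<^bsub>power_mod ?T n\<^esub>" for x
    using cz[OF \<iota>c[OF x]] \<iota>N[OF x] pz[OF x] that(2) by simp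
  from lin_descend[OF Fr_module Tn ext_mod_module pl lin_comp[OF \<iota>l cl] ps this]
  obtain f where f: "lin R (power_mod ?T n) ?M f" "\<And>x. x \<in> carrier (Fr R n) \<Longrightarrow> f (?p x) = ?c (?\<iota> x)" by blast
  have \<rho>z: "?\<rho> t = \<zero>\<^bsub>?U\<^esub> \<longleftrightarrow> (\<exists>s\<in>carrier R. t = s \<otimes> a)" if "t \<in> carrier R" for t
    using coset_eq_zero_iff[OF ring_mod_module subJ, of t] col[OF that] that by simp
  have gl: "lin R ?P ?U (\<lambda>x. ?\<rho> (x n))" by (rule lin_comp[OF lin_coord lin_proj[OF ring_mod_module subJ]]) simp
  have kN: "?\<rho> (x n) = \<zero>\<^bsub>?U\<^esub>" if x: "x \<in> ?N" for x
  proof -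
    have "x \<in> carrier ?P" "\<exists>s\<in>carrier R. x n = s \<otimes> a" using x by (auto simp: ext_rel_def)
    then show ?thesis using \<rho>z[OF Fr_mem[of x "Suc n" n]] by simp
  qed
  have "\<exists>g. lin R ?M ?U g \<and> (\<forall>x\<in>carrier ?P. g (?c x) = ?\<rho> (x n))"
    by (rule quot_lift[OF Fr_module subN U gl], rule kN)
  then  obtain g where g: "lin R ?M ?U g" "\<And>x. x \<in> carrier ?P \<Longrightarrow> g (?c x) = ?\<rho> (x n)" by blast
  have Mr: "\<exists>x\<in>carrier ?P. m = ?c x" if "m \<in> carrier ?M" for m
    using that unfolding quot_mod_carrier[OF Fr_module subN] by auto
  have "exact3 R (power_mod ?T n) f ?M g ?U"
    unfolding exact3_def
  proof (intro conjI ballI f(1) g(1) inj_onI)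
    fix C D assume CD: "C \<in> carrier (power_mod ?T n)" "D \<in> carrier (power_mod ?T n)" "f C = f D"
    obtain x where x: "x \<in> carrier (Fr R n)" "?p x = C \<ominus>\<^bsub>power_mod ?T n\<^esub> D"
      using ps[OF Tn.minus_closed[OF CD(1,2)]] by blast
    have "f (C \<ominus>\<^bsub>power_mod ?T n\<^esub> D) = \<zero>\<^bsub>?M\<^esub>"
      by (rule lin_diff_zero[OF Tn ext_mod_module f(1) CD(1,2)]) (rule CD(3))
    then have "?c (?\<iota> x) = \<zero>\<^bsub>?M\<^esub>" using f(2)[OF x(1)] x(2) by simp
    then have "?p x = \<zero>\<^bsub>power_mod ?T n\<^esub>" using cz[OF \<iota>c[OF x(1)]] \<iota>N[OF x(1)] pz[OF x(1)] by simp
    then show "C = D" using x(2) Tn.diff_eq_zero_iff[OF CD(1,2)] by simp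
  next
    fix m assume "m \<in> carrier ?M"
    then obtain x where x: "x \<in> carrier ?P" "m = ?c x" using Mr by blast
    show "g m = \<zero>\<^bsub>?U\<^esub> \<longleftrightarrow> (\<exists>C\<in>carrier (power_mod ?T n). f C = m)"
    proof
      assume "g m = \<zero>\<^bsub>?U\<^esub>"
      then obtain q where q: "q \<in> carrier R" "x n = q \<otimes> a"
        using g(2)[OF x(1)] x(2) \<rho>z[OF Fr_mem[OF x(1)]] by auto
      \<comment> \<open>Subtracting \<open>q\<close> times the relation with last coordinate
        \<open>a\<close> clears the last coordinate of \<open>x\<close> and leaves these first
        coordinates.\<close>
      let ?x = "\<lambda>i\<in>{..<n}. x i \<oplus> q \<otimes> z i"
      have xm: "?x \<in> carrier (Fr R n)" using Fr_mem[OF x(1)] q zc by (auto simp: power_mod_simps)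
      have "x \<ominus>\<^bsub>?P\<^esub> ?\<iota> ?x \<in> ?N"
        unfolding ext_rel_def
      proof (intro CollectI conjI bexI[of _ q] allI impI q(1))
        show "x \<ominus>\<^bsub>?P\<^esub> ?\<iota> ?x \<in> carrier ?P" using x(1) \<iota>c[OF xm] by simp
        show "(x \<ominus>\<^bsub>?P\<^esub> ?\<iota> ?x) n = q \<otimes> a"
          using power_mod_minus[OF ring_mod_module x(1) \<iota>c[OF xm], of n] q a by (simp add: diff_zero_right)
        fix i assume i: "i < n"
        have "(x \<ominus>\<^bsub>?P\<^esub> ?\<iota> ?x) i \<oplus> q \<otimes> z i = (x i \<ominus> (x i \<oplus> q \<otimes> z i)) \<oplus> q \<otimes> z i"
          using power_mod_minus[OF ring_mod_module x(1) \<iota>c[OF xm], of i] i by simp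
        also have "\<dots> = \<zero>" using Fr_mem[OF x(1), of i] i q(1) zc[of i]
          by (simp add: a_minus_def minus_add a_ac l_neg r_neg)
        finally show "(x \<ominus>\<^bsub>?P\<^esub> ?\<iota> ?x) i \<oplus> q \<otimes> z i \<in> I" using d(2) by simp
      qed
      then have "?c x = ?c (?\<iota> ?x)" using coset_eq_iff[OF Fr_module subN x(1) \<iota>c[OF xm]] by blast
      then have "f (?p ?x) = m" using f(2)[OF xm] x(2) by simp
      then show "\<exists>C\<in>carrier (power_mod ?T n). f C = m" using pc[OF xm] by blast
    next
      assume "\<exists>C\<in>carrier (power_mod ?T n). f C = m"
      then obtain C where C: "C \<in> carrier (power_mod ?T n)" "f C = m" by blast
      then obtain y where y: "y \<in> carrier (Fr R n)" "?p y = C" using ps by blast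
      have "g m = ?\<rho> \<zero>" using g(2)[OF \<iota>c[OF y(1)]] f(2)[OF y(1)] y(2) C(2) by simp
      moreover have "\<exists>s\<in>carrier R. \<zero> = s \<otimes> a" using a by (intro bexI[of _ \<zero>]) auto
      ultimately show "g m = \<zero>\<^bsub>?U\<^esub>" using \<rho>z[OF zero_closed] by simp
    qed
  next
    fix t assume "t \<in> carrier ?U"
    then obtain r where r: "r \<in> carrier R" "t = ?\<rho> r" unfolding quot_mod_carrier[OF ring_mod_module subJ] by auto
    have m: "(\<lambda>i\<in>{..<Suc n}. r) \<in> carrier ?P" using r(1) by (auto simp: power_mod_simps)
    have "g (?c (\<lambda>i\<in>{..<Suc n}. r)) = t" using g(2)[OF m] r(2) by simp
    then show "\<exists>m\<in>carrier ?M. g m = t" using lin_closed[OF cl m] by blast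
  qed
  then show ?thesis by blast
qed

end

end

section \<open>Nakayama's lemma and linear algebra over the residue field\<close>

context noetherian_local_ring
begin

text \<open>Nakayama's lemma by eliminating one basis vector at a time. The induction carries a
  linear map \<open>\<Psi>\<close> that is the identity modulo \<open>B\<close> and whose values are
  supported on the first \<open>m\<close> coordinates; \<open>m\<close> goes down from
  \<open>k\<close>, where \<open>\<Psi>\<close> is the identity, to \<open>0\<close>, where it is
  zero.\<close>

lemma nakayama_Fr:
  assumes B: "submodule B R (Fr R k)"
    and gen: "\<And>i. i < k \<Longrightarrow> \<exists>b\<in>B. \<forall>j<k. (unit_vec R k i \<ominus>\<^bsub>Fr R k\<^esub> b) j \<in> \<mm>"
  shows "B = carrier (Fr R k)"
proof -
  let ?P = "Fr R k"
  interpret P: module R ?P by (rule Fr_module)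
  note b = submodule_memD[OF Fr_module B] and dm = idealD[OF max_ideal]
  have "\<exists>\<Psi>. lin R ?P ?P \<Psi> \<and> (\<forall>x\<in>carrier ?P. x \<ominus>\<^bsub>?P\<^esub> \<Psi> x \<in> B \<and> (\<forall>i<k. i \<notin> {..<m} \<longrightarrow> \<Psi> x i = \<zero>))"
    if "m \<le> k" for m
    using that
  proof (induction m rule: inc_induct)
    case base
    show ?case by (rule exI[of _ "\<lambda>x. x"]) (simp add: lin_id P.diff_self b(2))
  next
    case (step m)
    then obtain \<Psi> where \<Psi>: "lin R ?P ?P \<Psi>" "\<And>x. x \<in> carrier ?P \<Longrightarrow> x \<ominus>\<^bsub>?P\<^esub> \<Psi> x \<in> B"
      "\<And>x i. x \<in> carrier ?P \<Longrightarrow> i < k \<Longrightarrow> i \<notin> {..<Suc m} \<Longrightarrow> \<Psi> x i = \<zero>" by blast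
    have m: "m < k" by fact
    let ?E = "unit_vec R k m"
    obtain \<beta> where \<beta>: "\<beta> \<in> B" "\<And>j. j < k \<Longrightarrow> (?E \<ominus>\<^bsub>?P\<^esub> \<beta>) j \<in> \<mm>" using gen[OF m] by blast
    define \<mu> where "\<mu> = ?E \<ominus>\<^bsub>?P\<^esub> \<beta>"
    have \<mu>c: "\<mu> \<in> carrier ?P" unfolding \<mu>_def using b(1)[OF \<beta>(1)] by simp
    define \<nu> where "\<nu> = \<Psi> \<mu>"
    have \<nu>c: "\<nu> \<in> carrier ?P" unfolding \<nu>_def by (rule lin_closed[OF \<Psi>(1) \<mu>c])
    have \<nu>m: "\<nu> j \<in> \<mm>" if j: "j < k" for j
      unfolding \<nu>_def lin_Fr_apply[OF \<Psi>(1) \<mu>c j]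
    proof (rule ideal_finsum[OF max_ideal])
      fix i assume i: "i \<in> {..<k}"
      have "\<mu> i \<in> \<mm>" unfolding \<mu>_def using \<beta>(2) i by simp
      then show "\<mu> i \<otimes> \<Psi> (unit_vec R k i) j \<in> \<mm>"
        by (rule dm(7)[OF Fr_mem[OF lin_closed[OF \<Psi>(1) unit_vec_closed] j]])
    qed simp
    have E\<nu>: "?E \<ominus>\<^bsub>?P\<^esub> \<nu> \<in> B"
    proof -
      have "\<mu> \<ominus>\<^bsub>?P\<^esub> \<nu> \<in> B" unfolding \<nu>_def by (rule \<Psi>(2)[OF \<mu>c])
      then have "(\<mu> \<ominus>\<^bsub>?P\<^esub> \<nu>) \<oplus>\<^bsub>?P\<^esub> \<beta> \<in> B" by (rule b(3)[OF _ \<beta>(1)])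
      moreover have "(\<mu> \<ominus>\<^bsub>?P\<^esub> \<nu>) \<oplus>\<^bsub>?P\<^esub> \<beta> = ?E \<ominus>\<^bsub>?P\<^esub> \<nu>"
        unfolding \<mu>_def using b(1)[OF \<beta>(1)] \<nu>c by (intro P.diff_diff_add) auto
      ultimately show ?thesis by simp
    qed
    \<comment> \<open>Modulo \<open>B\<close> the basis vector \<open>?E\<close> equals
      \<open>\<nu>\<close>, which has entries in the maximal ideal and no support beyond
      \<open>m\<close>. The entry \<open>\<nu> m\<close> is moved to the other side and divided out
      as the unit \<open>1 - \<nu> m\<close>; what remains is \<open>v\<close>, supported strictly
      below \<open>m\<close>.\<close>
    obtain h where h: "h \<in> carrier R" "h \<otimes> (\<one> \<ominus> \<nu> m) = \<one>"
      using unit_of_not_max[OF _ one_minus_not_max[OF \<nu>m[OF m]]] dm(1)[OF \<nu>m[OF m]] by auto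
    define v where "v = (\<lambda>j\<in>{..<k}. if j = m then \<zero> else h \<otimes> \<nu> j)"
    have vc: "v \<in> carrier ?P" unfolding v_def using h(1) Fr_mem[OF \<nu>c] by (auto simp: power_mod_simps)
    have Ev: "?E \<ominus>\<^bsub>?P\<^esub> v = h \<odot>\<^bsub>?P\<^esub> (?E \<ominus>\<^bsub>?P\<^esub> \<nu>)"
    proof (rule power_mod_eqI)
      show "?E \<ominus>\<^bsub>?P\<^esub> v \<in> carrier ?P" "h \<odot>\<^bsub>?P\<^esub> (?E \<ominus>\<^bsub>?P\<^esub> \<nu>) \<in> carrier ?P" using vc \<nu>c h(1) by auto
      fix i assume i: "i < k"
      show "(?E \<ominus>\<^bsub>?P\<^esub> v) i = (h \<odot>\<^bsub>?P\<^esub> (?E \<ominus>\<^bsub>?P\<^esub> \<nu>)) i"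
      proof (cases "i = m")
        case True
        then show ?thesis
          using i h power_mod_minus[OF ring_mod_module unit_vec_closed vc i, of m]
            power_mod_minus[OF ring_mod_module unit_vec_closed \<nu>c i, of m]
          by (simp add: unit_vec_apply v_def diff_zero_right)
      next
        case False
        then show ?thesis
          using i h(1) Fr_mem[OF \<nu>c i] power_mod_minus[OF ring_mod_module unit_vec_closed vc i, of m]
            power_mod_minus[OF ring_mod_module unit_vec_closed \<nu>c i, of m]
          by (simp add: unit_vec_apply v_def a_minus_def r_minus)
      qed
    qed
    have EvB: "?E \<ominus>\<^bsub>?P\<^esub> v \<in> B" unfolding Ev by (rule b(6)[OF h(1) E\<nu>])
    let ?D = "?E \<ominus>\<^bsub>?P\<^esub> v"
    have Dc: "?D \<in> carrier ?P" by (rule b(1)[OF EvB])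
    have Dl: "lin R (ring_mod R) ?P (\<lambda>r. r \<odot>\<^bsub>?P\<^esub> ?D)"
      by (rule linI) (simp_all add: Dc P.smult_l_distr P.smult_assoc1 del: power_mod_apply)
    let ?\<Psi> = "\<lambda>x. \<Psi> x \<ominus>\<^bsub>?P\<^esub> \<Psi> x m \<odot>\<^bsub>?P\<^esub> ?D"
    have "lin R ?P ?P ?\<Psi>"
      by (intro lin_sub Fr_module \<Psi>(1) lin_comp[OF lin_comp[OF \<Psi>(1) lin_coord[OF m]] Dl])
    moreover have "x \<ominus>\<^bsub>?P\<^esub> ?\<Psi> x \<in> B" if x: "x \<in> carrier ?P" for x
    proof -
      have px: "\<Psi> x \<in> carrier ?P" "\<Psi> x m \<in> carrier R"
        using lin_closed[OF \<Psi>(1) x] Fr_mem[OF lin_closed[OF \<Psi>(1) x] m] by auto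
      have "x \<ominus>\<^bsub>?P\<^esub> ?\<Psi> x = (x \<ominus>\<^bsub>?P\<^esub> \<Psi> x) \<oplus>\<^bsub>?P\<^esub> \<Psi> x m \<odot>\<^bsub>?P\<^esub> ?D"
        using x px P.smult_closed[OF px(2) Dc]
        by (simp add: a_minus_def P.minus_add P.a_ac)
      then show ?thesis using b(3)[OF \<Psi>(2)[OF x] b(6)[OF px(2) EvB]] by simp
    qed
    moreover have "?\<Psi> x i = \<zero>" if x: "x \<in> carrier ?P" and i: "i < k" "i \<notin> {..<m}" for x i
    proof -
      have px: "\<Psi> x \<in> carrier ?P" "\<Psi> x m \<in> carrier R" "\<Psi> x i \<in> carrier R"
        using lin_closed[OF \<Psi>(1) x] Fr_mem[OF lin_closed[OF \<Psi>(1) x]] m i by auto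
      have "?\<Psi> x i = \<Psi> x i \<ominus> \<Psi> x m \<otimes> (?E i \<ominus> v i)"
        using power_mod_minus[OF ring_mod_module px(1) P.smult_closed[OF px(2) Dc] i(1)]
          power_mod_minus[OF ring_mod_module unit_vec_closed vc i(1), of m] i(1) by simp
      moreover have "\<Psi> x i = \<zero>" "h \<otimes> \<nu> i = \<zero>" if "i \<noteq> m"
        using \<Psi>(3)[OF x i(1)] \<Psi>(3)[OF \<mu>c i(1)] i(2) that h(1) unfolding \<nu>_def by auto
      ultimately show ?thesis
        using i(1) px by (cases "i = m") (simp_all add: unit_vec_apply v_def diff_zero_right diff_self)
    qed
    ultimately show ?case by (intro exI[of _ ?\<Psi>]) blast
  qed
  from this[of 0] obtain \<Psi> where \<Psi>: "lin R ?P ?P \<Psi>" "\<And>x. x \<in> carrier ?P \<Longrightarrow> x \<ominus>\<^bsub>?P\<^esub> \<Psi> x \<in> B"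
    "\<And>x i. x \<in> carrier ?P \<Longrightarrow> i < k \<Longrightarrow> \<Psi> x i = \<zero>" by auto
  have "x \<in> B" if x: "x \<in> carrier ?P" for x
  proof -
    have "\<Psi> x = \<zero>\<^bsub>?P\<^esub>"
      by (rule power_mod_eqI[OF lin_closed[OF \<Psi>(1) x] P.zero_closed]) (simp add: \<Psi>(3)[OF x])
    then show ?thesis using \<Psi>(2)[OF x] x by (simp add: P.diff_zero_right)
  qed
  then show ?thesis using b(1) by blast
qed

text \<open>The dimension bound for spanning vectors over the residue field, expressed by
  congruences so that no quotient ring is formed. Gaussian elimination on the last coordinate
  removes one coordinate and one vector, the pivot \<open>s0\<close>.\<close>

lemma spanning_card:
  assumes "finite S" "\<And>s i. s \<in> S \<Longrightarrow> i < k \<Longrightarrow> v s i \<in> carrier R"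
    and "\<And>x. (\<And>i. i < k \<Longrightarrow> x i \<in> carrier R) \<Longrightarrow>
      \<exists>c. (\<forall>s\<in>S. c s \<in> carrier R) \<and> (\<forall>i<k. x i \<ominus> (\<Oplus>s\<in>S. c s \<otimes> v s i) \<in> \<mm>)"
  shows "k \<le> card S"
  using assms
proof (induction k arbitrary: S v)
  case 0
  show ?case by simp
next
  case (Suc k)
  note dm = idealD[OF max_ideal]
  note vc = Suc.prems(2)
  have "\<exists>s0\<in>S. v s0 k \<notin> \<mm>"
  proof (rule ccontr)
    assume "\<not> (\<exists>s0\<in>S. v s0 k \<notin> \<mm>)"
    then have al: "v s k \<in> \<mm>" if "s \<in> S" for s using that by blast
    obtain c where c: "\<forall>s\<in>S. c s \<in> carrier R" "\<forall>i<Suc k. \<one> \<ominus> (\<Oplus>s\<in>S. c s \<otimes> v s i) \<in> \<mm>"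
      using Suc.prems(3)[of "\<lambda>i. \<one>"] by auto
    have "(\<Oplus>s\<in>S. c s \<otimes> v s k) \<in> \<mm>"
      by (rule ideal_finsum[OF max_ideal Suc.prems(1)]) (use dm(6) al c(1) in blast)
    then show False using one_minus_not_max c(2) by blast
  qed
  then obtain s0 where s0: "s0 \<in> S" "v s0 k \<notin> \<mm>" by blast
  have v0: "v s0 i \<in> carrier R" if "i < Suc k" for i using vc[OF s0(1) that] .
  obtain h where h: "h \<in> carrier R" "h \<otimes> v s0 k = \<one>" using unit_of_not_max[OF v0 s0(2)] by auto
  let ?S = "S - {s0}"
  have fS: "finite ?S" "s0 \<notin> ?S" "insert s0 ?S = S" using Suc.prems(1) s0(1) by auto
  define v' where "v' s i = v s i \<ominus> h \<otimes> v s k \<otimes> v s0 i" for s i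
  have "k \<le> card ?S"
  proof (rule Suc.IH[of ?S v'])
    show "finite ?S" by (rule fS)
    show "v' s i \<in> carrier R" if "s \<in> ?S" "i < k" for s i
      using that vc v0 h(1) by (simp add: v'_def)
    fix x assume x: "\<And>i. i < k \<Longrightarrow> x i \<in> carrier R"
    \<comment> \<open>Spanning is applied to the vector extended by a zero. Its last coordinate
      expresses the coefficient of the pivot through the other ones modulo the maximal ideal, so the
      same coefficients work for the reduced vectors.\<close>
    have "(if i < k then x i else \<zero>) \<in> carrier R" for i using x by simp
    from Suc.prems(3)[of "\<lambda>i. if i < k then x i else \<zero>", OF this]
    obtain c where c: "\<forall>s\<in>S. c s \<in> carrier R"
      "\<forall>i<Suc k. (if i < k then x i else \<zero>) \<ominus> (\<Oplus>s\<in>S. c s \<otimes> v s i) \<in> \<mm>" by blast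
    have cs: "c s \<in> carrier R" "v s i \<in> carrier R" if "s \<in> ?S" "i < Suc k" for s i using c(1) vc that by auto
    have c0: "c s0 \<in> carrier R" using c(1) s0(1) by blast
    define \<Sigma> where "\<Sigma> i = (\<Oplus>s\<in>?S. c s \<otimes> v s i)" for i
    have \<Sigma>c: "\<Sigma> i \<in> carrier R" if "i < Suc k" for i
      unfolding \<Sigma>_def using cs that by (intro finsum_closed) auto
    have all: "(\<Oplus>s\<in>S. c s \<otimes> v s i) = c s0 \<otimes> v s0 i \<oplus> \<Sigma> i" if i: "i < Suc k" for i
    proof -
      have "(\<Oplus>s\<in>insert s0 ?S. c s \<otimes> v s i) = c s0 \<otimes> v s0 i \<oplus> \<Sigma> i"
        unfolding \<Sigma>_def using cs i c0 v0[OF i] fS by (intro finsum_insert) auto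
      then show ?thesis unfolding fS(3) .
    qed
    have new: "(\<Oplus>s\<in>?S. c s \<otimes> v' s i) = \<Sigma> i \<ominus> h \<otimes> v0i \<otimes> \<Sigma> k"
      if i: "i < k" and v0i: "v0i = v s0 i" for i v0i
    proof -
      have i': "i < Suc k" using i by simp
      have v0c: "v0i \<in> carrier R" using v0[OF i'] v0i by simp
      have "(\<Oplus>s\<in>?S. c s \<otimes> v' s i) = (\<Oplus>s\<in>?S. c s \<otimes> v s i \<oplus> (\<ominus> (h \<otimes> v0i)) \<otimes> (c s \<otimes> v s k))"
      proof (intro finsum_cong' refl)
        have al: "C \<otimes> (V \<ominus> h \<otimes> W \<otimes> v0i) = C \<otimes> V \<oplus> (\<ominus> (h \<otimes> v0i)) \<otimes> (C \<otimes> W)"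
          if "C \<in> carrier R" "V \<in> carrier R" "W \<in> carrier R" for C V W
          using that h(1) v0c by algebra
        fix s assume s: "s \<in> ?S"
        show "c s \<otimes> v' s i = c s \<otimes> v s i \<oplus> (\<ominus> (h \<otimes> v0i)) \<otimes> (c s \<otimes> v s k)"
          unfolding v'_def v0i[symmetric] by (rule al) (use cs s i in auto)
      qed (use cs i' h v0c in auto)
      also have "\<dots> = \<Sigma> i \<oplus> (\<Oplus>s\<in>?S. (\<ominus> (h \<otimes> v0i)) \<otimes> (c s \<otimes> v s k))"
        unfolding \<Sigma>_def using cs i' h v0c by (intro finsum_addf) auto
      also have "(\<Oplus>s\<in>?S. (\<ominus> (h \<otimes> v0i)) \<otimes> (c s \<otimes> v s k)) = (\<ominus> (h \<otimes> v0i)) \<otimes> \<Sigma> k"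
        unfolding \<Sigma>_def using cs[of _ k] h(1) v0c fS(1) by (intro finsum_rdistr[symmetric]) auto
      also have "\<Sigma> i \<oplus> (\<ominus> (h \<otimes> v0i)) \<otimes> \<Sigma> k = \<Sigma> i \<ominus> h \<otimes> v0i \<otimes> \<Sigma> k"
        using \<Sigma>c[OF i'] \<Sigma>c[of k] h(1) v0c by (simp add: a_minus_def l_minus)
      finally show ?thesis .
    qed
    have km: "\<zero> \<ominus> (c s0 \<otimes> v s0 k \<oplus> \<Sigma> k) \<in> \<mm>" using c(2)[rule_format, of k] all[of k] by simp
    have "x i \<ominus> (\<Oplus>s\<in>?S. c s \<otimes> v' s i) \<in> \<mm>" if i: "i < k" for i
    proof -
      have i': "i < Suc k" using i by simp
      have im: "x i \<ominus> (c s0 \<otimes> v s0 i \<oplus> \<Sigma> i) \<in> \<mm>" using c(2)[rule_format, OF i'] all[OF i'] i by simp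
      have al: "X \<ominus> (S \<ominus> h \<otimes> V \<otimes> T) = (X \<ominus> (C \<otimes> V \<oplus> S)) \<ominus> h \<otimes> V \<otimes> (\<zero> \<ominus> (C \<otimes> W \<oplus> T))"
        if "X \<in> carrier R" "S \<in> carrier R" "V \<in> carrier R" "T \<in> carrier R" "C \<in> carrier R" "W \<in> carrier R"
          "h \<otimes> W = \<one>" for X S V T C W
      proof -
        have "(X \<ominus> (C \<otimes> V \<oplus> S)) \<ominus> h \<otimes> V \<otimes> (\<zero> \<ominus> (C \<otimes> W \<oplus> T)) =
            X \<ominus> S \<ominus> C \<otimes> V \<oplus> (h \<otimes> W) \<otimes> V \<otimes> C \<oplus> h \<otimes> V \<otimes> T"
          using that(1-6) h(1) by algebra
        also have "\<dots> = X \<ominus> (S \<ominus> h \<otimes> V \<otimes> T)" unfolding that(7) using that(1-6) h(1) by algebra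
        finally show ?thesis by simp
      qed
      have "x i \<ominus> (\<Oplus>s\<in>?S. c s \<otimes> v' s i) =
          (x i \<ominus> (c s0 \<otimes> v s0 i \<oplus> \<Sigma> i)) \<ominus> h \<otimes> v s0 i \<otimes> (\<zero> \<ominus> (c s0 \<otimes> v s0 k \<oplus> \<Sigma> k))"
        unfolding new[OF i refl] by (rule al[OF x[OF i] \<Sigma>c[OF i'] v0[OF i'] \<Sigma>c c0 v0 h(2)]) auto
      then show ?thesis using dm(5)[OF im dm(6)[OF _ km]] h(1) v0[OF i'] by simp
    qed
    then show "\<exists>c. (\<forall>s\<in>?S. c s \<in> carrier R) \<and> (\<forall>i<k. x i \<ominus> (\<Oplus>s\<in>?S. c s \<otimes> v' s i) \<in> \<mm>)"
      using c(1) by (intro exI[of _ c]) auto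
  qed
  moreover have "card S = Suc (card ?S)" by (rule card.remove[OF Suc.prems(1) s0(1)])
  ultimately show ?case by linarith
qed

end

text \<open>Gathers what the study of homomorphisms uses. The inclusions into \<open>P0\<close> turn
  relations with error terms in \<open>I\<close> or \<open>(0 : I)\<close> into hypotheses of
  \<open>indep\<close>, and \<open>Q\<close>, which contains the \<open>z u i\<close> but not
  \<open>a\<close>, keeps the coefficients of \<open>a\<close> comparable.\<close>

locale ext_family = noetherian_local_ring R \<mm> for R (structure) and \<mm> +
  fixes I P0 Q :: "'a set" and a :: 'a and n :: nat and z :: "'a \<Rightarrow> nat \<Rightarrow> 'a"
  assumes I: "ideal I R" and a: "a \<in> carrier R"
    and ann: "r \<in> carrier R \<Longrightarrow> r \<otimes> a = \<zero> \<longleftrightarrow> r \<in> I"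
    and col: "t \<in> carrier R \<Longrightarrow> t \<in> zero_colon R I \<longleftrightarrow> (\<exists>r\<in>carrier R. t = r \<otimes> a)"
    and P0: "primeideal P0 R" and IP0: "I \<subseteq> P0" and JP0: "zero_colon R I \<subseteq> P0"
    and Q: "ideal Q R" and aQ: "a \<notin> Q"
    and zQ: "u \<in> carrier R \<Longrightarrow> z u i \<in> Q \<inter> \<mm>"
    and indep: "u \<in> carrier R \<Longrightarrow> v \<in> carrier R \<Longrightarrow> (\<And>i. i < n \<Longrightarrow> A i \<in> carrier R) \<Longrightarrow>
      q \<in> carrier R \<Longrightarrow> j < n \<Longrightarrow> (\<Oplus>i\<in>{..<n}. A i \<otimes> z u i) \<ominus> q \<otimes> z v j \<in> P0 \<Longrightarrow>
      (\<forall>i<n. A i \<ominus> (if i = j then q else \<zero>) \<in> \<mm>) \<and> (j = 0 \<longrightarrow> A 0 \<otimes> u \<ominus> q \<otimes> v \<in> \<mm>)"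
    and n: "n \<ge> 1"
begin

section \<open>Homomorphisms and direct summands in the family\<close>

abbreviation "P \<equiv> Fr R (Suc n)"
abbreviation "N u \<equiv> ext_rel R I a n (z u)"
abbreviation "M u \<equiv> ext_mod R I a n (z u)"
abbreviation "E i \<equiv> unit_vec R (Suc n) i"

lemmas dm = idealD[OF max_ideal]

lemma P0_ideal: "ideal P0 R" using P0 by (rule primeideal.axioms(1))

lemma P0_max: "P0 \<subseteq> \<mm>"
  using primeideal.I_notcarr[OF P0] by (intro proper_ideal_le_max[OF P0_ideal]) auto

lemma a_colon: "a \<in> zero_colon R I"
  unfolding col[OF a] using a by (intro bexI[of _ \<one>]) auto

lemma a_max: "a \<in> \<mm>" using a_colon JP0 P0_max by blast

lemma z_carrier: "u \<in> carrier R \<Longrightarrow> z u i \<in> carrier R" using zQ[of u i] dm(1) by blast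

lemma N_submodule: "u \<in> carrier R \<Longrightarrow> submodule (N u) R P"
  by (rule ext_rel_submodule[OF I a z_carrier])

lemma M_module: "u \<in> carrier R \<Longrightarrow> module R (M u)"
  by (rule ext_mod_module[OF I a z_carrier])

lemma proj_lin: "u \<in> carrier R \<Longrightarrow> lin R P (M u) (\<lambda>x. N u +>\<^bsub>P\<^esub> x)"
  by (rule lin_proj[OF Fr_module N_submodule])

lemma M_rep: "u \<in> carrier R \<Longrightarrow> y \<in> carrier (M u) \<Longrightarrow> \<exists>x\<in>carrier P. y = N u +>\<^bsub>P\<^esub> x"
  unfolding quot_mod_carrier[OF Fr_module N_submodule] by auto

text \<open>Every relation is trivial modulo the maximal ideal. So the classes of the
  \<open>E i\<close> are a minimal system of generators, and statements about \<open>M u\<close>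
  modulo that ideal can be read off the coordinates of representatives.\<close>

lemma N_max:
  assumes u: "u \<in> carrier R" and x: "x \<in> N u" and i: "i < Suc n"
  shows "x i \<in> \<mm>"
proof -
  obtain q where q: "x \<in> carrier P" "q \<in> carrier R" "x n = q \<otimes> a" "\<forall>i<n. x i \<oplus> q \<otimes> z u i \<in> I"
    using x unfolding ext_rel_def by blast
  show ?thesis
  proof (cases "i = n")
    case True
    then show ?thesis using q(3) dm(6)[OF q(2) a_max] by simp
  next
    case False
    then have "x i \<oplus> q \<otimes> z u i \<in> I" using q(4) i by simp
    then have "x i \<oplus> q \<otimes> z u i \<in> \<mm>" using IP0 P0_max by blast
    moreover have "q \<otimes> z u i \<in> \<mm>" using dm(6)[OF q(2)] zQ[OF u] by blast
    ultimately show ?thesis by (rule ideal_cancel_right[OF max_ideal _ _ Fr_mem[OF q(1) i]])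
  qed
qed

text \<open>Otherwise \<open>indep\<close> with all coefficients \<open>A i\<close> zero and
  \<open>q = \<one>\<close> would put \<open>\<zero> \<ominus> \<one>\<close> into the maximal
  ideal.\<close>

lemma z_not_P0: assumes v: "v \<in> carrier R" shows "z v 0 \<notin> P0"
proof
  assume z0: "z v 0 \<in> P0"
  have n0: "0 < n" using n by simp
  have "(\<Oplus>i\<in>{..<n}. \<zero> \<otimes> z v i) = (\<Oplus>i\<in>{..<n}. \<zero>)"
    using z_carrier[OF v] by (intro finsum_cong') auto
  then have "(\<Oplus>i\<in>{..<n}. \<zero> \<otimes> z v i) = \<zero>" by (simp add: finsum_zero)
  then have "(\<Oplus>i\<in>{..<n}. \<zero> \<otimes> z v i) \<ominus> \<one> \<otimes> z v 0 \<in> P0"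
    using idealD(4)[OF P0_ideal z0] z_carrier[OF v] by (simp add: a_minus_def)
  from indep[OF v v _ one_closed n0 this] have "\<zero> \<ominus> \<one> \<in> \<mm>" using n0 by auto
  then have "\<ominus> (\<zero> \<ominus> \<one>) \<in> \<mm>" by (rule dm(4))
  then show False using one_not_max by (simp add: a_minus_def)
qed

lemma relator:
  assumes u: "u \<in> carrier R"
  shows "(\<lambda>i\<in>{..<Suc n}. if i < n then \<ominus> z u i else a) \<in> N u"
  unfolding ext_rel_def using z_carrier[OF u] a idealD(2)[OF I]
  by (intro CollectI conjI bexI[of _ \<one>]) (auto simp: power_mod_simps l_neg)

lemma scaled_basis:
  assumes u: "u \<in> carrier R" and t: "t \<in> I" and i: "i < n"
  shows "t \<odot>\<^bsub>P\<^esub> E i \<in> N u"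
proof -
  have tc: "t \<in> carrier R" by (rule idealD(1)[OF I t])
  have c: "t \<odot>\<^bsub>P\<^esub> E i \<in> carrier P" by (rule module.smult_closed[OF Fr_module tc unit_vec_closed])
  have "(t \<odot>\<^bsub>P\<^esub> E i) n = \<zero> \<otimes> a" using tc a i by (simp add: unit_vec_apply)
  moreover have "(t \<odot>\<^bsub>P\<^esub> E i) j \<oplus> \<zero> \<otimes> z u j \<in> I" if "j < n" for j
    using tc t z_carrier[OF u, of j] idealD(2)[OF I] that by (simp add: unit_vec_apply)
  ultimately show ?thesis unfolding ext_rel_def using c by blast
qed

text \<open>\<open>\<Phi>\<close> is a homomorphism from \<open>M u\<close> to \<open>M v\<close>
  lifted to the generators; all information comes from relations being sent to relations. The
  relations \<open>I e_i = 0\<close> control the last coordinates of the images of the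
  \<open>e_i\<close>, and the remaining relation controls the rest. The coordinates
  \<open>\<Phi> (E n) j\<close> with \<open>j < n\<close> stay arbitrary, as they occur multiplied
  by \<open>a\<close> and so disappear modulo \<open>P0\<close>.\<close>

lemma hom_entries:
  assumes u: "u \<in> carrier R" and v: "v \<in> carrier R" and \<Phi>: "lin R P P \<Phi>"
    and maps: "\<And>x. x \<in> N u \<Longrightarrow> \<Phi> x \<in> N v"
  shows "i < n \<Longrightarrow> \<Phi> (E i) n \<in> \<mm>"
    and "\<exists>q\<in>carrier R. q \<ominus> \<Phi> (E n) n \<in> \<mm> \<and>
      (\<forall>i<n. \<forall>j<n. \<Phi> (E i) j \<ominus> (if i = j then q else \<zero>) \<in> \<mm>) \<and> \<Phi> (E 0) 0 \<otimes> u \<ominus> q \<otimes> v \<in> \<mm>"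
proof -
  have \<Phi>c: "\<Phi> (E i) j \<in> carrier R" if "j < Suc n" for i j
    by (rule Fr_mem[OF lin_closed[OF \<Phi> unit_vec_closed] that])
  have n0: "0 < n" using n by simp
  note dI = idealD[OF I] and dP = idealD[OF P0_ideal] and dQ = idealD[OF Q]
  have aP: "a \<in> P0" using a_colon JP0 by blast
  show "\<Phi> (E i) n \<in> \<mm>" if i: "i < n" for i
  proof (rule ccontr)
    let ?s = "\<Phi> (E i) n"
    assume s: "?s \<notin> \<mm>"
    have sc: "?s \<in> carrier R" by (rule \<Phi>c) simp
    \<comment> \<open>The relation \<open>t e_i\<close> with \<open>t\<close> in \<open>I\<close> is
      sent to a relation: \<open>t ?s = q a\<close>, and \<open>q z v 0\<close> lies in
      \<open>I = (0 : a)\<close>. Hence \<open>?s z v 0 t = 0\<close>, and if \<open>?s\<close> is a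
      unit, \<open>z v 0\<close> annihilates \<open>I\<close>.\<close>
    have "z v 0 \<otimes> t = \<zero>" if t: "t \<in> I" for t
    proof -
      have tc: "t \<in> carrier R" by (rule dI(1)[OF t])
      have "t \<odot>\<^bsub>P\<^esub> \<Phi> (E i) \<in> N v"
        using maps[OF scaled_basis[OF u t i]] lin_smult[OF \<Phi> tc unit_vec_closed] by simp
      then obtain q where q: "q \<in> carrier R" "(t \<odot>\<^bsub>P\<^esub> \<Phi> (E i)) n = q \<otimes> a"
        "\<forall>j<n. (t \<odot>\<^bsub>P\<^esub> \<Phi> (E i)) j \<oplus> q \<otimes> z v j \<in> I"
        unfolding ext_rel_def by blast
      have ts: "t \<otimes> ?s = q \<otimes> a" using q(2) by simp
      have zc: "z v 0 \<in> carrier R" by (rule z_carrier[OF v])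
      have "q \<otimes> z v 0 \<in> I"
      proof (rule ideal_cancel_right[OF I])
        show "q \<otimes> z v 0 \<oplus> t \<otimes> \<Phi> (E i) 0 \<in> I"
          using q(3)[rule_format, OF n0] q(1) zc tc \<Phi>c[of 0 i] by (simp add: a_comm)
        show "t \<otimes> \<Phi> (E i) 0 \<in> I" by (rule dI(7)[OF \<Phi>c t]) simp
      qed (use q(1) zc in simp)
      then have "(q \<otimes> z v 0) \<otimes> a = \<zero>" using ann q(1) zc by simp
      then have "?s \<otimes> (z v 0 \<otimes> t) = \<zero>"
      proof -
        have "?s \<otimes> (z v 0 \<otimes> t) = (t \<otimes> ?s) \<otimes> z v 0" using sc zc tc by (simp add: m_ac)
        also have "\<dots> = (q \<otimes> z v 0) \<otimes> a" unfolding ts using q(1) zc a by (simp add: m_ac)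
        finally show ?thesis using \<open>(q \<otimes> z v 0) \<otimes> a = \<zero>\<close> by simp
      qed
      then have e: "?s \<otimes> (z v 0 \<otimes> t) \<in> {\<zero>}" by simp
      have "z v 0 \<otimes> t \<in> {\<zero>}"
        by (rule unit_cancel[OF zeroideal sc s m_closed[OF zc tc] e])
      then show ?thesis by simp
    qed
    then have "z v 0 \<in> zero_colon R I" using z_carrier[OF v] by (simp add: zero_colon_def)
    then show False using z_not_P0[OF v] JP0 by blast
  qed
  \<comment> \<open>\<open>\<rho>\<close> is the relation that involves \<open>a\<close>. Its image
    is \<open>q\<close> times the corresponding relation for \<open>v\<close>, up to entries in
    \<open>I\<close>, and this \<open>q\<close> is the common scalar.\<close>
  define \<rho> where "\<rho> = (\<lambda>i\<in>{..<Suc n}. if i < n then \<ominus> z u i else a)"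
  have \<rho>N: "\<rho> \<in> N u" unfolding \<rho>_def by (rule relator[OF u])
  have \<rho>c: "\<rho> \<in> carrier P" by (rule submodule_memD(1)[OF Fr_module N_submodule[OF u] \<rho>N])
  obtain q where q: "q \<in> carrier R" "\<Phi> \<rho> n = q \<otimes> a" "\<And>j. j < n \<Longrightarrow> \<Phi> \<rho> j \<oplus> q \<otimes> z v j \<in> I"
    using maps[OF \<rho>N] unfolding ext_rel_def by blast
  define \<Sigma> where "\<Sigma> j = (\<Oplus>i\<in>{..<n}. \<Phi> (E i) j \<otimes> z u i)" for j
  have \<Sigma>c: "\<Sigma> j \<in> carrier R" if "j < Suc n" for j
    unfolding \<Sigma>_def using \<Phi>c that z_carrier[OF u] by (intro finsum_closed) auto
  have \<rho>n: "\<rho> n = a" by (simp add: \<rho>_def)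
  have \<Phi>\<rho>: "\<Phi> \<rho> j = \<ominus> \<Sigma> j \<oplus> a \<otimes> \<Phi> (E n) j" if j: "j < Suc n" for j
  proof -
    have "\<Phi> \<rho> j = (\<Oplus>i\<in>{..<Suc n}. \<rho> i \<otimes> \<Phi> (E i) j)" by (rule lin_Fr_apply[OF \<Phi> \<rho>c j])
    also have "\<dots> = (\<Oplus>i\<in>{..<n}. \<rho> i \<otimes> \<Phi> (E i) j) \<oplus> \<rho> n \<otimes> \<Phi> (E n) j"
      using Fr_mem[OF \<rho>c] \<Phi>c[OF j] by (intro finsum_lessThan_Suc) auto
    also have "(\<Oplus>i\<in>{..<n}. \<rho> i \<otimes> \<Phi> (E i) j) = (\<Oplus>i\<in>{..<n}. (\<ominus> \<one>) \<otimes> (\<Phi> (E i) j \<otimes> z u i))"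
      using \<Phi>c[OF j] z_carrier[OF u] by (intro finsum_cong') (auto simp: \<rho>_def l_minus m_comm)
    also have "\<dots> = (\<ominus> \<one>) \<otimes> \<Sigma> j"
      unfolding \<Sigma>_def using \<Phi>c[OF j] z_carrier[OF u] by (intro finsum_rdistr[symmetric]) auto
    also have "\<dots> = \<ominus> \<Sigma> j" using \<Sigma>c[OF j] by (simp add: l_minus)
    finally show ?thesis unfolding \<rho>n .
  qed
  \<comment> \<open>The last coordinate of the image of \<open>\<rho>\<close> says that
    \<open>q - \<Phi> (E n) n\<close> times \<open>a\<close> is \<open>- \<Sigma> n\<close>, which
    is in \<open>Q\<close> because all \<open>z u i\<close> are. A unit factor would put
    \<open>a\<close> there as well.\<close>
  have qc: "q \<ominus> \<Phi> (E n) n \<in> \<mm>"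
  proof (rule ccontr)
    assume nm: "q \<ominus> \<Phi> (E n) n \<notin> \<mm>"
    have c: "\<Phi> (E n) n \<in> carrier R" by (rule \<Phi>c) simp
    have Sn: "\<Sigma> n \<in> carrier R" by (rule \<Sigma>c) simp
    have "\<Sigma> n \<in> Q"
      unfolding \<Sigma>_def
    proof (rule ideal_finsum[OF Q])
      fix i
      show "\<Phi> (E i) n \<otimes> z u i \<in> Q" by (rule dQ(6)[OF \<Phi>c]) (use zQ[OF u] in auto)
    qed simp
    have "(q \<ominus> \<Phi> (E n) n) \<otimes> a = q \<otimes> a \<ominus> a \<otimes> \<Phi> (E n) n"
      using q(1) c a by algebra
    also have "\<dots> = (\<ominus> \<Sigma> n \<oplus> a \<otimes> \<Phi> (E n) n) \<ominus> a \<otimes> \<Phi> (E n) n" using q(2) \<Phi>\<rho>[of n] by simp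
    also have "\<dots> = \<ominus> \<Sigma> n" using c a Sn by algebra
    finally have e: "(q \<ominus> \<Phi> (E n) n) \<otimes> a \<in> Q" using dQ(4)[OF \<open>\<Sigma> n \<in> Q\<close>] by simp
    have "a \<in> Q" by (rule unit_cancel[OF Q minus_closed[OF q(1) c] nm a e])
    then show False using aQ by blast
  qed
  \<comment> \<open>In the other coordinates the term with \<open>a\<close> and the element of
    \<open>I\<close> vanish modulo \<open>P0\<close>, which leaves a relation between the
    \<open>z u i\<close> and \<open>z v j\<close> alone, as \<open>indep\<close> requires.\<close>
  have rel: "\<Sigma> j \<ominus> q \<otimes> z v j \<in> P0" if j: "j < n" for j
  proof -
    have c: "\<Phi> (E n) j \<in> carrier R" "\<Sigma> j \<in> carrier R" "z v j \<in> carrier R"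
      using \<Phi>c \<Sigma>c z_carrier[OF v] j by auto
    have "\<Phi> \<rho> j \<oplus> q \<otimes> z v j \<in> P0" using q(3)[OF j] IP0 by blast
    then have "a \<otimes> \<Phi> (E n) j \<ominus> (\<Phi> \<rho> j \<oplus> q \<otimes> z v j) \<in> P0"
      by (rule dP(5)[OF dP(7)[OF c(1) aP]])
    moreover have "a \<otimes> \<Phi> (E n) j \<ominus> (\<Phi> \<rho> j \<oplus> q \<otimes> z v j) = \<Sigma> j \<ominus> q \<otimes> z v j"
    proof -
      have al: "A \<ominus> ((\<ominus> S \<oplus> A) \<oplus> T) = S \<ominus> T" if "A \<in> carrier R" "S \<in> carrier R" "T \<in> carrier R" for A S T
        using that by algebra
      show ?thesis using \<Phi>\<rho>[of j] j al[of "a \<otimes> \<Phi> (E n) j" "\<Sigma> j" "q \<otimes> z v j"] c q(1) a by simp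
    qed
    ultimately show ?thesis by simp
  qed
  have ent: "(\<forall>i<n. \<Phi> (E i) j \<ominus> (if i = j then q else \<zero>) \<in> \<mm>) \<and>
      (j = 0 \<longrightarrow> \<Phi> (E 0) j \<otimes> u \<ominus> q \<otimes> v \<in> \<mm>)" if j: "j < n" for j
    by (rule indep[OF u v _ q(1) j rel[OF j, unfolded \<Sigma>_def]]) (use \<Phi>c j in simp)
  show "\<exists>q\<in>carrier R. q \<ominus> \<Phi> (E n) n \<in> \<mm> \<and>
      (\<forall>i<n. \<forall>j<n. \<Phi> (E i) j \<ominus> (if i = j then q else \<zero>) \<in> \<mm>) \<and> \<Phi> (E 0) 0 \<otimes> u \<ominus> q \<otimes> v \<in> \<mm>"
    using q(1) qc ent ent[OF n0] by blast
qed

lemma max_combination: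
  assumes "\<And>i. i \<in> S \<Longrightarrow> x i \<in> carrier R" "\<And>i. i \<in> S \<Longrightarrow> y i \<in> \<mm>" "finite S"
  shows "(\<Oplus>i\<in>S. x i \<otimes> y i) \<in> \<mm>"
  by (rule ideal_finsum[OF max_ideal assms(3)]) (rule dm(6)[OF assms(1,2)])

text \<open>The contrapositive of the name: an isomorphism makes \<open>u\<close> and
  \<open>v\<close> agree in the residue field. The first diagonal entry is congruent to
  \<open>q\<close>, while its product with \<open>u\<close> is congruent to \<open>q v\<close>; this
  leaves \<open>q (u - v)\<close> in the maximal ideal, and \<open>q\<close> is a unit.\<close>

lemma not_isomorphic:
  assumes u: "u \<in> carrier R" and v: "v \<in> carrier R" and iso: "isomorphic_mod R (M u) (M v)"
  shows "u \<ominus> v \<in> \<mm>"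
proof -
  obtain h where h: "h \<in> mod_hom R (M u) (M v)" "bij_betw h (carrier (M u)) (carrier (M v))"
    using iso by (auto simp: isomorphic_mod_def mod_iso_def)
  have hl: "lin R (M u) (M v) h" by (rule mod_hom_lin[OF h(1)])
  let ?c = "\<lambda>x. N u +>\<^bsub>P\<^esub> x" and ?d = "\<lambda>x. N v +>\<^bsub>P\<^esub> x"
  note cl = proj_lin[OF u] and dl = proj_lin[OF v]
  have hc: "lin R P (M v) (\<lambda>x. h (?c x))" by (rule lin_comp[OF cl hl])
  have "\<exists>y\<in>carrier P. ?d y = h (?c x)" if x: "x \<in> carrier P" for x
    using M_rep[OF v lin_closed[OF hc x]] by metis
  from free_lift[OF Fr_module M_module[OF v] hc dl this]
  obtain \<Phi> where \<Phi>: "lin R P P \<Phi>" "\<And>x. x \<in> carrier P \<Longrightarrow> ?d (\<Phi> x) = h (?c x)" by blast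
  have maps: "\<Phi> x \<in> N v" if x: "x \<in> N u" for x
  proof -
    have xc: "x \<in> carrier P" by (rule submodule_memD(1)[OF Fr_module N_submodule[OF u] x])
    have "?c x = \<zero>\<^bsub>M u\<^esub>" using coset_eq_zero_iff[OF Fr_module N_submodule[OF u] xc] x by blast
    then have "?d (\<Phi> x) = \<zero>\<^bsub>M v\<^esub>" using \<Phi>(2)[OF xc] lin_zero[OF M_module[OF u] M_module[OF v] hl] by simp
    then show ?thesis using coset_eq_zero_iff[OF Fr_module N_submodule[OF v] lin_closed[OF \<Phi>(1) xc]] by blast
  qed
  note ent = hom_entries[OF u v \<Phi>(1) maps]
  obtain q where q: "q \<in> carrier R" "q \<ominus> \<Phi> (E n) n \<in> \<mm>"
    "\<forall>i<n. \<forall>j<n. \<Phi> (E i) j \<ominus> (if i = j then q else \<zero>) \<in> \<mm>" "\<Phi> (E 0) 0 \<otimes> u \<ominus> q \<otimes> v \<in> \<mm>"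
    using ent(2) by blast
  have \<Phi>c: "\<Phi> (E i) j \<in> carrier R" if "j < Suc n" for i j
    by (rule Fr_mem[OF lin_closed[OF \<Phi>(1) unit_vec_closed] that])
  \<comment> \<open>Modulo the maximal ideal the last coordinate of \<open>\<Phi> x\<close> is
    \<open>x n\<close> times this entry. Were the entry a nonunit, no \<open>\<Phi> x\<close> could
    be congruent to \<open>E n\<close>, against surjectivity.\<close>
  have cm: "\<Phi> (E n) n \<notin> \<mm>"
  proof
    assume cm: "\<Phi> (E n) n \<in> \<mm>"
    have "?d (E n) \<in> h ` carrier (M u)"
      using lin_closed[OF dl unit_vec_closed] bij_betw_imp_surj_on[OF h(2)] by simp
    then obtain y where y: "y \<in> carrier (M u)" "?d (E n) = h y" by auto
    obtain x where x: "x \<in> carrier P" "y = ?c x" using M_rep[OF u y(1)] by blast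
    have xc: "\<Phi> x \<in> carrier P" by (rule lin_closed[OF \<Phi>(1) x(1)])
    have "E n \<ominus>\<^bsub>P\<^esub> \<Phi> x \<in> N v"
      using coset_eq_iff[OF Fr_module N_submodule[OF v] unit_vec_closed xc] \<Phi>(2)[OF x(1)] y(2) x(2) by simp
    then have "(E n \<ominus>\<^bsub>P\<^esub> \<Phi> x) n \<in> \<mm>" by (rule N_max[OF v]) simp
    then have "\<one> \<ominus> \<Phi> x n \<in> \<mm>"
      using power_mod_minus[OF ring_mod_module unit_vec_closed xc, of n] by (simp add: unit_vec_apply)
    moreover have "\<Phi> x n \<in> \<mm>"
      unfolding lin_Fr_apply[OF \<Phi>(1) x(1), of n, OF lessI]
    proof (rule max_combination)
      show "\<Phi> (E i) n \<in> \<mm>" if "i \<in> {..<Suc n}" for i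
        using ent(1)[of i] cm that by (cases "i = n") auto
    qed (use Fr_mem[OF x(1)] in auto)
    ultimately show False using one_minus_not_max by blast
  qed
  have qm: "q \<notin> \<mm>"
  proof
    assume "q \<in> \<mm>"
    then have "q \<ominus> (q \<ominus> \<Phi> (E n) n) \<in> \<mm>" by (rule dm(5)[OF _ q(2)])
    moreover have "q \<ominus> (q \<ominus> \<Phi> (E n) n) = \<Phi> (E n) n"
    proof -
      have "q \<ominus> (q \<ominus> c) = c" if "c \<in> carrier R" for c using that q(1) by algebra
      then show ?thesis using \<Phi>c by simp
    qed
    ultimately show False using cm by simp
  qed
  have A: "\<Phi> (E 0) 0 \<ominus> q \<in> \<mm>" using q(3) n by force
  have "(\<Phi> (E 0) 0 \<otimes> u \<ominus> q \<otimes> v) \<ominus> (\<Phi> (E 0) 0 \<ominus> q) \<otimes> u \<in> \<mm>"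
    by (rule dm(5)[OF q(4) dm(7)[OF u A]])
  moreover have "(\<Phi> (E 0) 0 \<otimes> u \<ominus> q \<otimes> v) \<ominus> (\<Phi> (E 0) 0 \<ominus> q) \<otimes> u = q \<otimes> (u \<ominus> v)"
  proof -
    have "(A \<otimes> u \<ominus> q \<otimes> v) \<ominus> (A \<ominus> q) \<otimes> u = q \<otimes> (u \<ominus> v)" if "A \<in> carrier R" for A
      using that q(1) u v by algebra
    then show ?thesis using \<Phi>c by simp
  qed
  ultimately have "q \<otimes> (u \<ominus> v) \<in> \<mm>" by simp
  then show ?thesis using max_primeD[OF q(1), of "u \<ominus> v"] qm u v by auto
qed

lemma basis_not_max: "i < Suc n \<Longrightarrow> \<not> (\<forall>j<Suc n. E i j \<in> \<mm>)"
  using one_not_max by (auto simp: unit_vec_apply intro!: exI[of _ i])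

lemma not_zero_mod: assumes u: "u \<in> carrier R" shows "\<not> zero_mod (M u)"
proof
  assume "zero_mod (M u)"
  then have "N u +>\<^bsub>P\<^esub> E n = \<zero>\<^bsub>M u\<^esub>"
    using lin_closed[OF proj_lin[OF u] unit_vec_closed[of "Suc n" n]] unfolding zero_mod_def by blast
  then have "E n \<in> N u" using coset_eq_zero_iff[OF Fr_module N_submodule[OF u] unit_vec_closed] by blast
  then show False using N_max[OF u] basis_not_max[of n] by blast
qed

text \<open>\<open>\<alpha> i\<close> represents the component of \<open>E i\<close> in
  \<open>A\<close>, so these vectors form the matrix of the projection onto \<open>A\<close> along
  \<open>B\<close>. The hypotheses are arranged so that exchanging \<open>A\<close> and
  \<open>B\<close> gives the same result for the vectors \<open>E i\<close> minus
  \<open>\<alpha> i\<close>. Everything is reduced to the entry \<open>\<alpha> n n\<close>: it is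
  idempotent modulo the maximal ideal, and if it vanishes there, so does the scalar
  \<open>q\<close>, and with it the summand.\<close>

lemma summand_projection:
  assumes u: "u \<in> carrier R" and A: "submodule A R (M u)" and B: "submodule B R (M u)"
    and int: "A \<inter> B = {\<zero>\<^bsub>M u\<^esub>}"
    and \<alpha>: "\<And>i. \<alpha> i \<in> carrier P" "\<And>i. N u +>\<^bsub>P\<^esub> \<alpha> i \<in> A"
    and \<beta>: "\<And>i. E i \<ominus>\<^bsub>P\<^esub> \<alpha> i \<in> carrier P" "\<And>i. N u +>\<^bsub>P\<^esub> (E i \<ominus>\<^bsub>P\<^esub> \<alpha> i) \<in> B"
  shows "\<alpha> n n \<otimes> \<alpha> n n \<ominus> \<alpha> n n \<in> \<mm>" and "\<alpha> n n \<in> \<mm> \<Longrightarrow> A = {\<zero>\<^bsub>M u\<^esub>}"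
proof -
  interpret P: module R P by (rule Fr_module)
  let ?c = "\<lambda>x. N u +>\<^bsub>P\<^esub> x"
  note cl = proj_lin[OF u] and Mm = M_module[OF u] and Ns = N_submodule[OF u]
  define A' where "A' = {x \<in> carrier P. ?c x \<in> A}"
  define B' where "B' = {x \<in> carrier P. ?c x \<in> B}"
  have A': "submodule A' R P" unfolding A'_def by (rule submodule_preimage[OF Fr_module Mm cl A])
  have B': "submodule B' R P" unfolding B'_def by (rule submodule_preimage[OF Fr_module Mm cl B])
  note sA = submodule_memD[OF Fr_module A'] and sB = submodule_memD[OF Fr_module B']
    and sN = submodule_memD[OF Fr_module Ns]
  have AB: "x \<in> N u" if "x \<in> A'" "x \<in> B'" for x
  proof -
    have "?c x \<in> A \<inter> B" "x \<in> carrier P" using that by (auto simp: A'_def B'_def)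
    then show ?thesis using int coset_eq_zero_iff[OF Fr_module Ns, of x] by auto
  qed
  have NB: "x \<in> B'" if x: "x \<in> N u" for x
    using sN(1)[OF x] coset_eq_zero_iff[OF Fr_module Ns sN(1)[OF x]] x submodule_memD(2)[OF Mm B]
    by (simp add: B'_def)
  have \<alpha>A: "\<alpha> i \<in> A'" for i using \<alpha> by (simp add: A'_def)
  have \<beta>B: "E i \<ominus>\<^bsub>P\<^esub> \<alpha> i \<in> B'" for i using \<beta> by (simp add: B'_def)
  define \<Phi> where "\<Phi> = (\<lambda>x. \<Oplus>\<^bsub>P\<^esub>i\<in>{..<Suc n}. x i \<odot>\<^bsub>P\<^esub> \<alpha> i)"
  have \<Phi>: "lin R P P \<Phi>" unfolding \<Phi>_def by (rule free_hom_lin[OF Fr_module \<alpha>(1)])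
  have \<Phi>E: "\<Phi> (E i) = \<alpha> i" if "i < Suc n" for i
    unfolding \<Phi>_def by (rule free_hom_unit_vec[OF Fr_module \<alpha>(1) that])
  have \<Phi>A: "\<Phi> x \<in> A'" if x: "x \<in> carrier P" for x
    unfolding \<Phi>_def
    by (rule submodule_finsum[OF Fr_module A']) (use sA(6)[OF Fr_mem[OF x] \<alpha>A] in auto)
  have \<Psi>: "lin R P P (\<lambda>x. x \<ominus>\<^bsub>P\<^esub> \<Phi> x)" by (intro lin_sub Fr_module lin_id \<Phi>)
  have \<Psi>B: "x \<ominus>\<^bsub>P\<^esub> \<Phi> x \<in> B'" if x: "x \<in> carrier P" for x
    unfolding lin_expand[OF Fr_module \<Psi> x]
    by (rule submodule_finsum[OF Fr_module B']) (use sB(6)[OF Fr_mem[OF x] \<beta>B] \<Phi>E in auto)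
  \<comment> \<open>A relation \<open>x\<close> lies in \<open>B'\<close>, and so does
    \<open>x\<close> minus \<open>\<Phi> x\<close>. Hence \<open>\<Phi> x\<close> is in both
    \<open>A'\<close> and \<open>B'\<close>, and the elements common to these are relations.\<close>
  have maps: "\<Phi> x \<in> N u" if x: "x \<in> N u" for x
  proof (rule AB[OF \<Phi>A])
    show xc: "x \<in> carrier P" by (rule sN(1)[OF x])
    have pc: "\<Phi> x \<in> carrier P" by (rule lin_closed[OF \<Phi> xc])
    have "x \<ominus>\<^bsub>P\<^esub> (x \<ominus>\<^bsub>P\<^esub> \<Phi> x) \<in> B'" by (rule sB(5)[OF NB[OF x] \<Psi>B[OF xc]])
    moreover have "x \<ominus>\<^bsub>P\<^esub> (x \<ominus>\<^bsub>P\<^esub> \<Phi> x) = \<Phi> x"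
      by (subst P.diff_eq_iff) (use xc pc P.diff_eq_iff[of x "\<Phi> x" "x \<ominus>\<^bsub>P\<^esub> \<Phi> x"] in \<open>auto simp: P.a_comm\<close>)
    ultimately show "\<Phi> x \<in> B'" by simp
  qed
  have idem: "x \<ominus>\<^bsub>P\<^esub> \<Phi> x \<in> N u" if x: "x \<in> A'" for x
    by (rule AB[OF sA(5)[OF x \<Phi>A[OF sA(1)[OF x]]] \<Psi>B[OF sA(1)[OF x]]])
  have idem': "x j \<ominus> \<Phi> x j \<in> \<mm>" if x: "x \<in> A'" and j: "j < Suc n" for x j
    using N_max[OF u idem[OF x] j] power_mod_minus[OF ring_mod_module sA(1)[OF x] lin_closed[OF \<Phi> sA(1)[OF x]] j]
    by simp
  have s: "\<alpha> i n \<in> \<mm>" if i: "i < n" for i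
  proof -
    have "\<Phi> (E i) n \<in> \<mm>" by (rule hom_entries(1)[OF u u \<Phi> _ i]) (rule maps)
    then show ?thesis using \<Phi>E i by simp
  qed
  have \<alpha>c: "\<alpha> i j \<in> carrier R" if "j < Suc n" for i j by (rule Fr_mem[OF \<alpha>(1) that])
  have \<Phi>x: "\<Phi> x j = (\<Oplus>i\<in>{..<n}. x i \<otimes> \<alpha> i j) \<oplus> x n \<otimes> \<alpha> n j"
    if x: "x \<in> carrier P" and j: "j < Suc n" for x j
  proof -
    have "\<Phi> x j = (\<Oplus>i\<in>{..<Suc n}. x i \<otimes> \<Phi> (E i) j)" by (rule lin_Fr_apply[OF \<Phi> x j])
    also have "\<dots> = (\<Oplus>i\<in>{..<Suc n}. x i \<otimes> \<alpha> i j)"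
      using \<Phi>E \<alpha>c[OF j] Fr_mem[OF x] by (intro finsum_cong') auto
    also have "\<dots> = (\<Oplus>i\<in>{..<n}. x i \<otimes> \<alpha> i j) \<oplus> x n \<otimes> \<alpha> n j"
      using \<alpha>c[OF j] Fr_mem[OF x] by (intro finsum_lessThan_Suc) auto
    finally show ?thesis .
  qed
  have mdiff': "x \<in> \<mm>" if "x \<ominus> y \<in> \<mm>" "y \<in> \<mm>" "x \<in> carrier R" for x y
  proof -
    have "(x \<ominus> y) \<oplus> y \<in> \<mm>" using that by (intro dm(3))
    moreover have "(x \<ominus> y) \<oplus> y = x" using that dm(1)[OF that(2)] by algebra
    ultimately show ?thesis by simp
  qed
  have sumn: "(\<Oplus>i\<in>{..<n}. x i \<otimes> \<alpha> i n) \<in> \<mm>" if x: "x \<in> carrier P" for x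
    by (rule max_combination) (use s Fr_mem[OF x] in auto)
  have cc: "\<alpha> n n \<in> carrier R" by (rule \<alpha>c) simp
  show "\<alpha> n n \<otimes> \<alpha> n n \<ominus> \<alpha> n n \<in> \<mm>"
  proof -
    let ?k = "\<Oplus>i\<in>{..<n}. \<alpha> n i \<otimes> \<alpha> i n"
    have k: "?k \<in> \<mm>" by (rule sumn[OF \<alpha>(1)])
    have "\<alpha> n n \<ominus> (?k \<oplus> \<alpha> n n \<otimes> \<alpha> n n) \<in> \<mm>"
      using idem'[OF \<alpha>A, of n n] \<Phi>x[OF \<alpha>(1), of n n] by simp
    then have "\<ominus> ((\<alpha> n n \<ominus> (?k \<oplus> \<alpha> n n \<otimes> \<alpha> n n)) \<oplus> ?k) \<in> \<mm>" using k by (intro dm(3,4))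
    moreover have "\<ominus> ((c \<ominus> (k \<oplus> c \<otimes> c)) \<oplus> k) = c \<otimes> c \<ominus> c" if "c \<in> carrier R" "k \<in> carrier R" for c k
      using that by algebra
    ultimately show ?thesis using cc dm(1)[OF k] by simp
  qed
  assume cm: "\<alpha> n n \<in> \<mm>"
  obtain q where q: "q \<in> carrier R" "q \<ominus> \<alpha> n n \<in> \<mm>"
    "\<forall>i<n. \<forall>j<n. \<alpha> i j \<ominus> (if i = j then q else \<zero>) \<in> \<mm>"
  proof -
    have "\<exists>q\<in>carrier R. q \<ominus> \<Phi> (E n) n \<in> \<mm> \<and>
        (\<forall>i<n. \<forall>j<n. \<Phi> (E i) j \<ominus> (if i = j then q else \<zero>) \<in> \<mm>) \<and> \<Phi> (E 0) 0 \<otimes> u \<ominus> q \<otimes> u \<in> \<mm>"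
      by (rule hom_entries(2)[OF u u \<Phi>]) (rule maps)
    then obtain q where "q \<in> carrier R" "q \<ominus> \<Phi> (E n) n \<in> \<mm>"
      "\<forall>i<n. \<forall>j<n. \<Phi> (E i) j \<ominus> (if i = j then q else \<zero>) \<in> \<mm>" by blast
    then show thesis using \<Phi>E by (intro that[of q]) auto
  qed
  have qm: "q \<in> \<mm>" by (rule mdiff'[OF q(2) cm q(1)])
  have \<alpha>m: "\<alpha> i j \<in> \<mm>" if ij: "i < n" "j < Suc n" for i j
  proof (cases "j = n")
    case True
    then show ?thesis using s ij by simp
  next
    case False
    then have "\<alpha> i j \<ominus> (if i = j then q else \<zero>) \<in> \<mm>" using q(3) ij by simp
    then show ?thesis by (rule mdiff') (use qm dm(2) \<alpha>c ij in auto)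
  qed
  \<comment> \<open>An element \<open>x\<close> of \<open>A'\<close> is congruent to
    \<open>\<Phi> x\<close>. The entries \<open>\<alpha> n j\<close> with \<open>j < n\<close> are
    not controlled, so the last coordinate is treated first; once \<open>x n\<close> is in the
    maximal ideal, \<open>\<alpha> n\<close> contributes nothing to the other ones.\<close>
  have A'm: "x j \<in> \<mm>" if x: "x \<in> A'" and j: "j < Suc n" for x j
  proof -
    have xc: "x \<in> carrier P" by (rule sA(1)[OF x])
    have "\<Phi> x n \<in> \<mm>"
      unfolding \<Phi>x[OF xc lessI] by (rule dm(3)[OF sumn[OF xc] dm(6)[OF Fr_mem[OF xc] cm]]) simp
    then have xn: "x n \<in> \<mm>" using mdiff'[OF idem'[OF x lessI]] Fr_mem[OF xc lessI] by blast
    have "(\<Oplus>i\<in>{..<n}. x i \<otimes> \<alpha> i j) \<in> \<mm>"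
      by (rule max_combination) (use \<alpha>m j Fr_mem[OF xc] in auto)
    then have "\<Phi> x j \<in> \<mm>"
      unfolding \<Phi>x[OF xc j] by (rule dm(3)[OF _ dm(7)[OF \<alpha>c[OF j] xn]])
    then show ?thesis using mdiff'[OF idem'[OF x j]] Fr_mem[OF xc j] by blast
  qed
  \<comment> \<open>The vectors \<open>\<alpha> i\<close>, being in \<open>A'\<close>, have all
    their entries in the maximal ideal, so each \<open>E i\<close> is congruent to an element of
    \<open>B'\<close>.\<close>
  have "B' = carrier P"
  proof (rule nakayama_Fr[OF B'])
    fix i assume i: "i < Suc n"
    have ac: "\<alpha> i \<in> carrier P" by (rule \<alpha>(1))
    have "E i \<ominus>\<^bsub>P\<^esub> (E i \<ominus>\<^bsub>P\<^esub> \<alpha> i) = \<alpha> i"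
      by (subst P.diff_eq_iff) (use ac P.diff_eq_iff[of "E i" "\<alpha> i" "E i \<ominus>\<^bsub>P\<^esub> \<alpha> i"] in \<open>auto simp: P.a_comm\<close>)
    then have "\<forall>j<Suc n. (E i \<ominus>\<^bsub>P\<^esub> (E i \<ominus>\<^bsub>P\<^esub> \<alpha> i)) j \<in> \<mm>" using A'm[OF \<alpha>A] by simp
    then show "\<exists>b\<in>B'. \<forall>j<Suc n. (E i \<ominus>\<^bsub>P\<^esub> b) j \<in> \<mm>" using \<beta>B by blast
  qed
  show "A = {\<zero>\<^bsub>M u\<^esub>}"
  proof
    show "{\<zero>\<^bsub>M u\<^esub>} \<subseteq> A" using submodule_memD(2)[OF Mm A] by blast
    show "A \<subseteq> {\<zero>\<^bsub>M u\<^esub>}"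
    proof
      fix y assume y: "y \<in> A"
      then obtain x where x: "x \<in> carrier P" "y = ?c x" using M_rep[OF u submodule_memD(1)[OF Mm A]] by blast
      have "x \<in> A'" "x \<in> B'" using x y \<open>B' = carrier P\<close> by (auto simp: A'_def)
      then have "x \<in> N u" by (rule AB)
      then show "y \<in> {\<zero>\<^bsub>M u\<^esub>}" using coset_eq_zero_iff[OF Fr_module Ns x(1)] x(2) by simp
    qed
  qed
qed

text \<open>With \<open>c = \<alpha> n n\<close>, the product \<open>c (1 - c)\<close> lies in the
  maximal ideal, so one of the two complementary projections has its last diagonal entry there and
  is trivial.\<close>

lemma indecomposable:
  assumes u: "u \<in> carrier R"
  shows "indecomposable_mod R (M u)"
  unfolding indecomposable_mod_def
proof (intro conjI not_zero_mod[OF u] allI impI, elim conjE)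
  fix A B assume A: "submodule A R (M u)" and B: "submodule B R (M u)"
    and sum: "A <+>\<^bsub>M u\<^esub> B = carrier (M u)" and int: "A \<inter> B = {\<zero>\<^bsub>M u\<^esub>}"
  interpret P: module R P by (rule Fr_module)
  interpret M: module R "M u" by (rule M_module[OF u])
  let ?c = "\<lambda>x. N u +>\<^bsub>P\<^esub> x"
  note cl = proj_lin[OF u] and Mm = M_module[OF u]
  have "\<exists>x\<in>carrier P. ?c x \<in> A \<and> ?c (E i \<ominus>\<^bsub>P\<^esub> x) \<in> B" for i
  proof -
    have "?c (E i) \<in> A <+>\<^bsub>M u\<^esub> B" unfolding sum by (rule lin_closed[OF cl unit_vec_closed])
    then obtain y w where yw: "y \<in> A" "w \<in> B" "?c (E i) = y \<oplus>\<^bsub>M u\<^esub> w" by (auto simp: set_add_def')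
    have m: "y \<in> carrier (M u)" "w \<in> carrier (M u)"
      using submodule_memD(1)[OF Mm A yw(1)] submodule_memD(1)[OF Mm B yw(2)] .
    obtain x where x: "x \<in> carrier P" "y = ?c x" using M_rep[OF u m(1)] by blast
    have "?c (E i \<ominus>\<^bsub>P\<^esub> x) = ?c (E i) \<ominus>\<^bsub>M u\<^esub> y"
      unfolding x(2) by (rule lin_minus[OF Fr_module Mm cl unit_vec_closed x(1)])
    also have "\<dots> = w" using m yw(3) by (simp add: M.diff_eq_iff M.a_comm)
    finally show ?thesis using x yw by (intro bexI[of _ x]) auto
  qed
  then obtain \<alpha> where \<alpha>: "\<And>i. \<alpha> i \<in> carrier P" "\<And>i. ?c (\<alpha> i) \<in> A" "\<And>i. ?c (E i \<ominus>\<^bsub>P\<^esub> \<alpha> i) \<in> B" by metis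
  have \<beta>c: "E i \<ominus>\<^bsub>P\<^esub> \<alpha> i \<in> carrier P" for i using \<alpha>(1) by simp
  have \<beta>\<alpha>: "E i \<ominus>\<^bsub>P\<^esub> (E i \<ominus>\<^bsub>P\<^esub> \<alpha> i) = \<alpha> i" for i
  proof -
    have ac: "\<alpha> i \<in> carrier P" by (rule \<alpha>(1))
    show ?thesis
      by (subst P.diff_eq_iff) (use ac P.diff_eq_iff[of "E i" "\<alpha> i" "E i \<ominus>\<^bsub>P\<^esub> \<alpha> i"] in \<open>auto simp: P.a_comm\<close>)
  qed
  note pA = summand_projection[OF u A B int \<alpha>(1,2) \<beta>c \<alpha>(3)]
  have pB: "(E n \<ominus>\<^bsub>P\<^esub> \<alpha> n) n \<in> \<mm> \<Longrightarrow> B = {\<zero>\<^bsub>M u\<^esub>}"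
    by (rule summand_projection(2)[OF u B A, of "\<lambda>i. E i \<ominus>\<^bsub>P\<^esub> \<alpha> i"])
      (use int \<beta>c \<alpha> \<beta>\<alpha> in \<open>auto simp: Int_commute\<close>)
  have cc: "\<alpha> n n \<in> carrier R" by (rule Fr_mem[OF \<alpha>(1)]) simp
  have e: "(E n \<ominus>\<^bsub>P\<^esub> \<alpha> n) n = \<one> \<ominus> \<alpha> n n"
    using power_mod_minus[OF ring_mod_module unit_vec_closed \<alpha>(1), of n] by (simp add: unit_vec_apply)
  have "c \<otimes> (\<one> \<ominus> c) = \<ominus> (c \<otimes> c \<ominus> c)" if "c \<in> carrier R" for c using that by algebra
  then have "\<alpha> n n \<otimes> (\<one> \<ominus> \<alpha> n n) \<in> \<mm>" using dm(4)[OF pA(1)] cc by simp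
  then have "\<alpha> n n \<in> \<mm> \<or> \<one> \<ominus> \<alpha> n n \<in> \<mm>" using max_primeD[OF cc] cc by simp
  then show "A = {\<zero>\<^bsub>M u\<^esub>} \<or> B = {\<zero>\<^bsub>M u\<^esub>}" using pA(2) pB e by auto
qed

text \<open>No relation involves a unit, so \<open>M u\<close> modulo the maximal ideal has
  dimension \<open>n + 1\<close>, and the lower bound becomes linear algebra over the residue
  field.\<close>

lemma min_gens_eq:
  assumes u: "u \<in> carrier R"
  shows "min_gens R (M u) = Suc n"
  unfolding min_gens_def
proof (rule Least_equality)
  let ?c = "\<lambda>x. N u +>\<^bsub>P\<^esub> x"
  note cl = proj_lin[OF u] and Mm = M_module[OF u]
  interpret M: module R "M u" by (rule Mm)
  \<comment> \<open>\<open>min_gens\<close> counts the elements of a set, so the classes of the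
    basis vectors have to be distinct.\<close>
  have inj: "inj_on (\<lambda>i. ?c (E i)) {..<Suc n}"
  proof (rule inj_onI, rule ccontr)
    fix i j assume ij: "i \<in> {..<Suc n}" "j \<in> {..<Suc n}" "?c (E i) = ?c (E j)" "i \<noteq> j"
    have "E i \<ominus>\<^bsub>P\<^esub> E j \<in> N u"
      using coset_eq_iff[OF Fr_module N_submodule[OF u] unit_vec_closed unit_vec_closed] ij(3) by blast
    then have "(E i \<ominus>\<^bsub>P\<^esub> E j) i \<in> \<mm>" using N_max[OF u] ij(1) by simp
    then have "\<one> \<in> \<mm>"
      using power_mod_minus[OF ring_mod_module unit_vec_closed unit_vec_closed, of i] ij
      by (simp add: unit_vec_apply diff_zero_right)
    then show False using one_not_max by blast
  qed
  have g: "gen_by R (M u) (?c ` unit_vec R (Suc n) ` {..<Suc n})"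
    by (rule gen_by_image_basis[OF Mm cl]) (use M_rep[OF u] in metis)
  have c: "card (?c ` unit_vec R (Suc n) ` {..<Suc n}) = Suc n"
    unfolding image_image using card_image[OF inj] by simp
  show "\<exists>S. finite S \<and> card S = Suc n \<and> gen_by R (M u) S"
    by (rule exI, rule conjI[OF _ conjI[OF c g]]) simp
next
  fix l assume "\<exists>S. finite S \<and> card S = l \<and> gen_by R (M u) S"
  then obtain S where S: "finite S" "card S = l" "gen_by R (M u) S" by blast
  let ?c = "\<lambda>x. N u +>\<^bsub>P\<^esub> x"
  note cl = proj_lin[OF u] and Mm = M_module[OF u] and Ns = N_submodule[OF u]
  interpret P: module R P by (rule Fr_module)
  interpret M: module R "M u" by (rule Mm)
  have SM: "S \<subseteq> carrier (M u)" using S(3) by (simp add: gen_by_def)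
  have "\<exists>x. s \<in> S \<longrightarrow> x \<in> carrier P \<and> s = ?c x" for s using M_rep[OF u, of s] SM by blast
  then obtain v where v: "\<And>s. s \<in> S \<Longrightarrow> v s \<in> carrier P \<and> s = ?c (v s)" by metis
  \<comment> \<open>\<open>W\<close> is spanned by the lifts \<open>v s\<close> of the generators
    together with all vectors having entries in the maximal ideal. By \<open>N_max\<close> it
    contains the relations, so it is all of \<open>P\<close> as soon as its image contains
    \<open>S\<close>.\<close>
  define W where "W = {x \<in> carrier P. \<exists>c. (\<forall>s\<in>S. c s \<in> carrier R) \<and> (\<forall>i<Suc n. x i \<ominus> (\<Oplus>s\<in>S. c s \<otimes> v s i) \<in> \<mm>)}"
  have vc: "v s i \<in> carrier R" if "s \<in> S" "i < Suc n" for s i using v[OF that(1)] Fr_mem that(2) by blast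
  have sc: "(\<Oplus>s\<in>S. c s \<otimes> v s i) \<in> carrier R" if "\<forall>s\<in>S. c s \<in> carrier R" "i < Suc n" for c i
    using that vc by (intro finsum_closed) auto
  have Wadd: "x \<oplus>\<^bsub>P\<^esub> y \<in> W" if xy: "x \<in> W" "y \<in> W" for x y
  proof -
    obtain c d where cd: "x \<in> carrier P" "y \<in> carrier P" "\<forall>s\<in>S. c s \<in> carrier R" "\<forall>s\<in>S. d s \<in> carrier R"
      "\<forall>i<Suc n. x i \<ominus> (\<Oplus>s\<in>S. c s \<otimes> v s i) \<in> \<mm>" "\<forall>i<Suc n. y i \<ominus> (\<Oplus>s\<in>S. d s \<otimes> v s i) \<in> \<mm>"
      using xy unfolding W_def by blast
    have "(x \<oplus>\<^bsub>P\<^esub> y) i \<ominus> (\<Oplus>s\<in>S. (c s \<oplus> d s) \<otimes> v s i) \<in> \<mm>" if i: "i < Suc n" for i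
    proof -
      have "(\<Oplus>s\<in>S. (c s \<oplus> d s) \<otimes> v s i) = (\<Oplus>s\<in>S. c s \<otimes> v s i \<oplus> d s \<otimes> v s i)"
        using cd(3,4) vc i by (intro finsum_cong') (auto simp: l_distr)
      also have "\<dots> = (\<Oplus>s\<in>S. c s \<otimes> v s i) \<oplus> (\<Oplus>s\<in>S. d s \<otimes> v s i)"
        using cd(3,4) vc i by (intro finsum_addf) auto
      finally have e: "(\<Oplus>s\<in>S. (c s \<oplus> d s) \<otimes> v s i) = (\<Oplus>s\<in>S. c s \<otimes> v s i) \<oplus> (\<Oplus>s\<in>S. d s \<otimes> v s i)" .
      have al: "(X \<oplus> Y) \<ominus> (C \<oplus> D) = (X \<ominus> C) \<oplus> (Y \<ominus> D)"
        if "X \<in> carrier R" "Y \<in> carrier R" "C \<in> carrier R" "D \<in> carrier R" for X Y C D using that by algebra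
      have "(x \<oplus>\<^bsub>P\<^esub> y) i \<ominus> (\<Oplus>s\<in>S. (c s \<oplus> d s) \<otimes> v s i) =
          (x i \<ominus> (\<Oplus>s\<in>S. c s \<otimes> v s i)) \<oplus> (y i \<ominus> (\<Oplus>s\<in>S. d s \<otimes> v s i))"
        unfolding e using al[OF Fr_mem[OF cd(1) i] Fr_mem[OF cd(2) i] sc[OF cd(3) i] sc[OF cd(4) i]] i by simp
      then show ?thesis using dm(3) cd(5,6) i by simp
    qed
    then show ?thesis unfolding W_def using cd by (intro CollectI conjI exI[of _ "\<lambda>s. c s \<oplus> d s"]) auto
  qed
  have Wsm: "r \<odot>\<^bsub>P\<^esub> x \<in> W" if r: "r \<in> carrier R" and x: "x \<in> W" for r x
  proof -
    obtain c where cd: "x \<in> carrier P" "\<forall>s\<in>S. c s \<in> carrier R" "\<forall>i<Suc n. x i \<ominus> (\<Oplus>s\<in>S. c s \<otimes> v s i) \<in> \<mm>"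
      using x unfolding W_def by blast
    have "(r \<odot>\<^bsub>P\<^esub> x) i \<ominus> (\<Oplus>s\<in>S. (r \<otimes> c s) \<otimes> v s i) \<in> \<mm>" if i: "i < Suc n" for i
    proof -
      have "(\<Oplus>s\<in>S. (r \<otimes> c s) \<otimes> v s i) = (\<Oplus>s\<in>S. r \<otimes> (c s \<otimes> v s i))"
        using cd(2) vc i r by (intro finsum_cong') (auto simp: m_assoc)
      also have "\<dots> = r \<otimes> (\<Oplus>s\<in>S. c s \<otimes> v s i)"
        using cd(2) vc i r S(1) by (intro finsum_rdistr[symmetric]) auto
      finally have e: "(\<Oplus>s\<in>S. (r \<otimes> c s) \<otimes> v s i) = r \<otimes> (\<Oplus>s\<in>S. c s \<otimes> v s i)" .
      have al: "r \<otimes> X \<ominus> r \<otimes> C = r \<otimes> (X \<ominus> C)" if "X \<in> carrier R" "C \<in> carrier R" for X C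
        using that r by algebra
      have "(r \<odot>\<^bsub>P\<^esub> x) i \<ominus> (\<Oplus>s\<in>S. (r \<otimes> c s) \<otimes> v s i) = r \<otimes> (x i \<ominus> (\<Oplus>s\<in>S. c s \<otimes> v s i))"
        unfolding e using al[OF Fr_mem[OF cd(1) i] sc[OF cd(2) i]] i by simp
      then show ?thesis using dm(6)[OF r] cd(3) i by simp
    qed
    then show ?thesis unfolding W_def using cd r by (intro CollectI conjI exI[of _ "\<lambda>s. r \<otimes> c s"]) auto
  qed
  have NW: "x \<in> W" if x: "x \<in> N u" for x
    unfolding W_def
  proof (intro CollectI conjI exI[of _ "\<lambda>s. \<zero>"] ballI allI impI)
    show xc: "x \<in> carrier P" by (rule submodule_memD(1)[OF Fr_module Ns x])
    fix i assume i: "i < Suc n"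
    have "(\<Oplus>s\<in>S. \<zero> \<otimes> v s i) = (\<Oplus>s\<in>S. \<zero>)" using vc i by (intro finsum_cong') auto
    then have "(\<Oplus>s\<in>S. \<zero> \<otimes> v s i) = \<zero>" by (simp add: finsum_zero)
    then show "x i \<ominus> (\<Oplus>s\<in>S. \<zero> \<otimes> v s i) \<in> \<mm>" using N_max[OF u x i] Fr_mem[OF xc i] by (simp add: diff_zero_right)
  qed simp
  have vW: "v s \<in> W" if s: "s \<in> S" for s
    unfolding W_def
  proof (intro CollectI conjI exI[of _ "\<lambda>t. if s = t then \<one> else \<zero>"] ballI allI impI)
    show vp: "v s \<in> carrier P" using v[OF s] by blast
    fix i assume i: "i < Suc n"
    have "(\<Oplus>t\<in>S. (if s = t then \<one> else \<zero>) \<otimes> v t i) = (\<Oplus>t\<in>S. if s = t then v t i else \<zero>)"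
      using vc i by (intro finsum_cong') auto
    also have "\<dots> = v s i" using vc i s S(1) by (intro finsum_singleton) auto
    finally show "v s i \<ominus> (\<Oplus>t\<in>S. (if s = t then \<one> else \<zero>) \<otimes> v t i) \<in> \<mm>"
      using dm(2) Fr_mem[OF vp i] by (simp add: diff_self)
  qed simp
  have "submodule W R P"
  proof (rule P.submoduleI)
    show "W \<subseteq> carrier P" by (auto simp: W_def)
    show "\<zero>\<^bsub>P\<^esub> \<in> W" by (rule NW[OF submodule_memD(2)[OF Fr_module Ns]])
    show "\<ominus>\<^bsub>P\<^esub> x \<in> W" if x: "x \<in> W" for x
    proof -
      have xc: "x \<in> carrier P" using x by (simp add: W_def)
      have "(\<ominus> \<one>) \<odot>\<^bsub>P\<^esub> x = \<ominus>\<^bsub>P\<^esub> x" using P.smult_l_minus[OF one_closed xc] P.smult_one[OF xc] by simp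
      then show ?thesis using Wsm[OF _ x, of "\<ominus> \<one>"] by simp
    qed
  qed (fact Wadd Wsm)+
  then have "submodule (?c ` W) R (M u)"
  proof -
    assume W: "submodule W R P"
    have "lin R (P\<lparr>carrier := W\<rparr>) (M u) ?c"
      using cl submodule_memD(1)[OF Fr_module W] by (simp add: lin_def)
    from submodule_image[OF submodule.submodule_is_module[OF W Fr_module] Mm this] show ?thesis by simp
  qed
  moreover have "S \<subseteq> ?c ` W" using v vW by blast
  ultimately have "carrier (M u) \<subseteq> ?c ` W"
    using S(3) hull_minimal[of S "?c ` W" "\<lambda>N. submodule N R (M u)"] by (simp add: gen_by_def)
  then have PW: "x \<in> W" if x: "x \<in> carrier P" for x
  proof -
    assume sub: "carrier (M u) \<subseteq> ?c ` W"
    have "?c x \<in> ?c ` W" using sub lin_closed[OF cl x] by blast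
    then obtain y where y: "y \<in> W" "?c x = ?c y" by auto
    have yc: "y \<in> carrier P" using y(1) by (simp add: W_def)
    have "x \<ominus>\<^bsub>P\<^esub> y \<in> W" using NW coset_eq_iff[OF Fr_module Ns x yc] y(2) by blast
    moreover have "(x \<ominus>\<^bsub>P\<^esub> y) \<oplus>\<^bsub>P\<^esub> y = x" using P.diff_eq_iff[of x y "x \<ominus>\<^bsub>P\<^esub> y"] x yc by simp
    ultimately show ?thesis using Wadd[of "x \<ominus>\<^bsub>P\<^esub> y" y] y(1) by simp
  qed
  have "Suc n \<le> card S"
  proof (rule spanning_card[OF S(1)])
    show "v s i \<in> carrier R" if "s \<in> S" "i < Suc n" for s i by (rule vc[OF that])
    fix x assume x: "\<And>i. i < Suc n \<Longrightarrow> x i \<in> carrier R"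
    have "restrict x {..<Suc n} \<in> carrier P" using x by (auto simp: power_mod_simps)
    from PW[OF this] show "\<exists>c. (\<forall>s\<in>S. c s \<in> carrier R) \<and> (\<forall>i<Suc n. x i \<ominus> (\<Oplus>s\<in>S. c s \<otimes> v s i) \<in> \<mm>)"
      by (auto simp: W_def)
  qed
  then show "Suc n \<le> l" using S(2) by simp
qed

text \<open>The class of \<open>E 0\<close> is annihilated by \<open>I\<close>, which contains a
  nonzero element. In a free module an element killed by a nonzero scalar has all its coordinates in
  the maximal ideal, whereas \<open>E 0\<close> is part of a minimal system of generators.\<close>

lemma not_free:
  assumes u: "u \<in> carrier R"
  shows "\<not> free_mod R (M u)"
proof
  assume "free_mod R (M u)"
  then obtain k where "isomorphic_mod R (M u) (Fr R k)" by (auto simp: free_mod_def)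
  then obtain h where h: "h \<in> mod_hom R (M u) (Fr R k)" "bij_betw h (carrier (M u)) (carrier (Fr R k))"
    by (auto simp: isomorphic_mod_def mod_iso_def)
  let ?c = "\<lambda>x. N u +>\<^bsub>P\<^esub> x"
  have hl: "lin R (M u) (Fr R k) h" by (rule mod_hom_lin[OF h(1)])
  note cl = proj_lin[OF u] and Mm = M_module[OF u] and Ns = N_submodule[OF u]
  interpret P: module R P by (rule Fr_module)
  interpret F: module R "Fr R k" by (rule Fr_module)
  have hc: "lin R P (Fr R k) (\<lambda>x. h (?c x))" by (rule lin_comp[OF cl hl])
  let ?y = "h (?c (E 0))"
  have yc: "?y \<in> carrier (Fr R k)" by (rule lin_closed[OF hc unit_vec_closed])
  have "\<one> \<notin> zero_colon R I" using JP0 P0_max one_not_max by blast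
  then obtain t where t: "t \<in> I" "\<one> \<otimes> t \<noteq> \<zero>" by (auto simp: zero_colon_def)
  have tc: "t \<in> carrier R" by (rule idealD(1)[OF I t(1)])
  have n0: "0 < n" using n by simp
  have "?c (t \<odot>\<^bsub>P\<^esub> E 0) = \<zero>\<^bsub>M u\<^esub>"
    using coset_eq_zero_iff[OF Fr_module Ns P.smult_closed[OF tc unit_vec_closed]] scaled_basis[OF u t(1) n0] by blast
  then have ty: "t \<odot>\<^bsub>Fr R k\<^esub> ?y = \<zero>\<^bsub>Fr R k\<^esub>"
    using lin_smult[OF hc tc unit_vec_closed, of 0] lin_zero[OF Mm Fr_module hl] by simp
  have ym: "?y i \<in> \<mm>" if i: "i < k" for i
  proof (rule ccontr)
    assume nm: "?y i \<notin> \<mm>"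
    have "t \<otimes> ?y i = \<zero>" using fun_cong[OF ty, of i] i by simp
    then have e: "?y i \<otimes> t \<in> {\<zero>}" using tc Fr_mem[OF yc i] by (simp add: m_comm)
    have "t \<in> {\<zero>}" by (rule unit_cancel[OF zeroideal Fr_mem[OF yc i] nm tc e])
    then show False using t(2) tc by simp
  qed
  have sur: "\<exists>x\<in>carrier P. h (?c x) = w" if w: "w \<in> carrier (Fr R k)" for w
  proof -
    have "w \<in> h ` carrier (M u)" using bij_betw_imp_surj_on[OF h(2)] w by simp
    then obtain m where "m \<in> carrier (M u)" "w = h m" by auto
    then show ?thesis using M_rep[OF u] by blast
  qed
  \<comment> \<open>Pulling back the basis of \<open>R^k\<close> expresses the class of
    \<open>E 0\<close> with the coordinates of \<open>?y\<close> as coefficients. These are in the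
    maximal ideal, so \<open>N_max\<close> applied to the difference gives a contradiction.\<close>
  from free_lift[OF Fr_module Fr_module lin_id hc sur]
  obtain \<chi> where \<chi>: "lin R (Fr R k) P \<chi>" "\<And>w. w \<in> carrier (Fr R k) \<Longrightarrow> h (?c (\<chi> w)) = w" by blast
  have xc: "\<chi> ?y \<in> carrier P" by (rule lin_closed[OF \<chi>(1) yc])
  have "?c (E 0) = ?c (\<chi> ?y)"
    using inj_onD[OF bij_betw_imp_inj_on[OF h(2)] \<chi>(2)[OF yc, symmetric] lin_closed[OF cl unit_vec_closed] lin_closed[OF cl xc]] .
  then have "E 0 \<ominus>\<^bsub>P\<^esub> \<chi> ?y \<in> N u" using coset_eq_iff[OF Fr_module Ns unit_vec_closed xc] by blast
  then have "(E 0 \<ominus>\<^bsub>P\<^esub> \<chi> ?y) 0 \<in> \<mm>" by (rule N_max[OF u]) simp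
  then have "\<one> \<ominus> \<chi> ?y 0 \<in> \<mm>"
    using power_mod_minus[OF ring_mod_module unit_vec_closed xc, of 0] by (simp add: unit_vec_apply)
  moreover have "\<chi> ?y 0 \<in> \<mm>"
    unfolding lin_Fr_apply[OF \<chi>(1) yc zero_less_Suc]
  proof (rule ideal_finsum[OF max_ideal])
    fix i assume "i \<in> {..<k}"
    then have i: "i < k" by simp
    show "?y i \<otimes> \<chi> (unit_vec R k i) 0 \<in> \<mm>"
      by (rule dm(7)[OF Fr_mem[OF lin_closed[OF \<chi>(1) unit_vec_closed] zero_less_Suc] ym[OF i]])
  qed simp
  ultimately show False using one_minus_not_max by blast
qed

end

section \<open>Chains of primes from the conormal module\<close>

context cring
begin

lemma conormal_annihilator:
  assumes I: "ideal I R"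
  shows "I \<subseteq> annihilator R (conormal_mod R I)" "zero_colon R I \<subseteq> annihilator R (conormal_mod R I)"
proof -
  note d = idealD[OF I]
  let ?X = "(ring_mod R)\<lparr>carrier := I\<rparr>"
  have X: "module R ?X" by (rule submodule.submodule_is_module[OF ideal_submodule[OF I] ring_mod_module])
  interpret X: module R ?X by (rule X)
  have II: "ideal (I \<cdot> I) R" by (rule ideal_prod_is_ideal[OF I I])
  note dd = idealD[OF II]
  have sub: "I \<cdot> I \<subseteq> I" using ideal_prod_inter[OF I I] by blast
  \<comment> \<open>The inverse is formed inside the restricted carrier, so it has to be matched
    with the inverse in \<open>R\<close>.\<close>
  have inv: "\<ominus>\<^bsub>?X\<^esub> x = \<ominus> x" if x: "x \<in> I" for x
    by (rule X.minus_equality) (use x d(1)[OF x] d(4)[OF x] in \<open>simp_all add: l_neg\<close>)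
  have N: "submodule (I \<cdot> I) R ?X"
  proof (rule X.submoduleI)
    show "I \<cdot> I \<subseteq> carrier ?X" using sub by simp
    show "\<zero>\<^bsub>?X\<^esub> \<in> I \<cdot> I" using dd(2) by simp
    show "\<ominus>\<^bsub>?X\<^esub> x \<in> I \<cdot> I" if "x \<in> I \<cdot> I" for x using inv[of x] dd(4)[OF that] sub that by auto
    show "x \<oplus>\<^bsub>?X\<^esub> y \<in> I \<cdot> I" if "x \<in> I \<cdot> I" "y \<in> I \<cdot> I" for x y using dd(3)[OF that] by simp
    show "r \<odot>\<^bsub>?X\<^esub> x \<in> I \<cdot> I" if "r \<in> carrier R" "x \<in> I \<cdot> I" for r x using dd(6)[OF that] by simp
  qed
  have ann: "b \<in> annihilator R (conormal_mod R I)"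
    if b: "b \<in> carrier R" and bI: "\<And>y. y \<in> I \<Longrightarrow> b \<otimes> y \<in> I \<cdot> I" for b
    unfolding annihilator_def conormal_mod_def
  proof (intro CollectI conjI ballI b)
    fix C assume "C \<in> carrier (quot_mod R ?X (I \<cdot> I))"
    then obtain y where y: "y \<in> carrier ?X" "C = (I \<cdot> I) +>\<^bsub>?X\<^esub> y"
      unfolding quot_mod_carrier[OF X N] by blast
    have "b \<odot>\<^bsub>?X\<^esub> y \<in> carrier ?X" "b \<odot>\<^bsub>?X\<^esub> y \<in> I \<cdot> I" using bI[of y] y(1) sub by auto
    then show "b \<odot>\<^bsub>quot_mod R ?X (I \<cdot> I)\<^esub> C = \<zero>\<^bsub>quot_mod R ?X (I \<cdot> I)\<^esub>"
      unfolding y(2) coset_smult[OF X N b y(1)] using coset_eq_zero_iff[OF X N] by blast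
  qed
  show "I \<subseteq> annihilator R (conormal_mod R I)"
  proof
    fix b assume b: "b \<in> I"
    show "b \<in> annihilator R (conormal_mod R I)"
      by (rule ann[OF d(1)[OF b]]) (rule ideal_prod.prod[OF b])
  qed
  show "zero_colon R I \<subseteq> annihilator R (conormal_mod R I)"
  proof
    fix b assume "b \<in> zero_colon R I"
    then have b: "b \<in> carrier R" "\<And>y. y \<in> I \<Longrightarrow> b \<otimes> y = \<zero>" by (auto simp: zero_colon_def)
    show "b \<in> annihilator R (conormal_mod R I)"
      by (rule ann[OF b(1)]) (use b(2) dd(2) in simp)
  qed
qed

end

text \<open>The dimension is a supremum of lengths, so exceeding 1 already produces an actual chain;
  its length is an integer above 1, and the first three primes are kept.\<close>

lemma krull_dim_ge_two:
  assumes "krull_dim_mod R M \<ge> 2"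
  obtains P0 P1 P2 where "primeideal P0 R" "primeideal P1 R" "primeideal P2 R"
    "annihilator R M \<subseteq> P0" "P0 \<subset> P1" "P1 \<subset> P2"
proof -
  let ?S = "{ereal (real n) | n. \<exists>P :: nat \<Rightarrow> 'a set.
     (\<forall>i\<le>n. primeideal (P i) R \<and> annihilator R M \<subseteq> P i) \<and> (\<forall>i<n. P i \<subset> P (Suc i))}"
  have "1 < Sup ?S" using assms less_le_trans[of 1 "2 :: ereal"] by (simp add: krull_dim_mod_def)
  then obtain y where "y \<in> ?S" "1 < y" unfolding less_Sup_iff by blast
  then obtain n P where n: "1 < ereal (real n)"
    and P: "\<forall>i\<le>n. primeideal (P i) R \<and> annihilator R M \<subseteq> P i" "\<forall>i<n. P i \<subset> P (Suc i)" by blast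
  have "n \<ge> 2" using n by (simp add: one_ereal_def)
  then show thesis
    using that[of "P 0" "P 1" "P 2"] P(1)[rule_format, of 0] P(1)[rule_format, of 1] P(1)[rule_format, of 2]
      P(2)[rule_format, of 0] P(2)[rule_format, of 1] by (simp add: numeral_2_eq_2)
qed

lemma isomorphic_mod_refl:
  assumes "module R X"
  shows "isomorphic_mod R X X"
proof -
  have "restrict (\<lambda>x. x) (carrier X) \<in> mod_hom R X X" unfolding restrict_mod_hom[OF assms] by (rule lin_id)
  moreover have "bij_betw (restrict (\<lambda>x. x) (carrier X)) (carrier X) (carrier X)"
    by (simp add: bij_betw_def inj_on_def)
  ultimately show ?thesis unfolding isomorphic_mod_def mod_iso_def by blast
qed

section \<open>The family indexed by the residue field\<close>

theorem theorem1p3: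
  fixes R :: "('a, 'r) ring_scheme" and \<mm> I :: "'a set"
  assumes "noetherian_local_ring R \<mm>"
    and "quasi_Gorenstein R I"
    and "grade R I = 0"
    and "krull_dim_mod R (conormal_mod R I) \<ge> 2"
    and "zero_colon R (I \<cdot>\<^bsub>R\<^esub> I) = zero_colon R I \<or> G_regular (R Quot I)"
  shows "\<forall>n::nat\<ge>1.
      (\<exists>(M :: 'a set \<Rightarrow> ('a, (nat \<Rightarrow> 'a) set) module) f g.
         (\<forall>u\<in>carrier (R Quot \<mm>).
            short_exact R (power_mod (cyclic_mod R I) n) (f u) (M u) (g u)
              (cyclic_mod R (zero_colon R I)) \<and>
            \<not> free_mod R (M u) \<and> indecomposable_mod R (M u) \<and> totally_reflexive R (M u) \<and>
            min_gens R (M u) = n + 1) \<and>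
         (\<forall>u\<in>carrier (R Quot \<mm>). \<forall>v\<in>carrier (R Quot \<mm>).
            u \<noteq> v \<longrightarrow> \<not> isomorphic_mod R (M u) (M v))) \<and>
      (infinite (carrier (R Quot \<mm>)) \<longrightarrow>
        (\<exists>\<M> :: ('a, (nat \<Rightarrow> 'a) set) module set. infinite \<M> \<and>
          (\<forall>M\<in>\<M>.
            (\<exists>f g. short_exact R (power_mod (cyclic_mod R I) n) f M g
               (cyclic_mod R (zero_colon R I))) \<and>
            \<not> free_mod R M \<and> indecomposable_mod R M \<and> totally_reflexive R M \<and>
            min_gens R M = n + 1) \<and>
          (\<forall>M\<in>\<M>. \<forall>N\<in>\<M>. M \<noteq> N \<longrightarrow> \<not> isomorphic_mod R M N)))"
proof (intro allI impI)
  fix n :: nat assume n: "n \<ge> 1"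
  interpret noetherian_local_ring R \<mm> by (rule assms(1))
  let ?J = "zero_colon R I" and ?T = "cyclic_mod R I" and ?U = "cyclic_mod R (zero_colon R I)"
  have I: "ideal I R" "I \<noteq> carrier R" using assms(2) by (auto simp: quasi_Gorenstein_def)
  have J: "ideal ?J R" by (rule zero_colon_ideal) (use idealD(1)[OF I(1)] in blast)
  obtain a where a: "a \<in> carrier R" and ann: "\<And>r. r \<in> carrier R \<Longrightarrow> r \<otimes>\<^bsub>R\<^esub> a = \<zero>\<^bsub>R\<^esub> \<longleftrightarrow> r \<in> I"
    and col: "\<And>t. t \<in> carrier R \<Longrightarrow> t \<in> ?J \<longleftrightarrow> (\<exists>r\<in>carrier R. t = r \<otimes>\<^bsub>R\<^esub> a)"
    using quasi_Gorenstein_generator(1)[OF noetherian assms(2,3)] by blast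
  note acyc = quasi_Gorenstein_generator(2)[OF noetherian assms(2,3)]
  have T: "tot_refl R ?T" by (rule cyclic_tot_refl[OF noetherian I(1) a ann col acyc])
  have U: "tot_refl R ?U" by (rule cyclic_colon_tot_refl[OF noetherian I(1) a ann col acyc])
  have a0: "a \<noteq> \<zero>\<^bsub>R\<^esub>"
    using ann[OF one_closed] ideal.one_imp_carrier[OF I(1)] I(2) by auto
  obtain P0 P1 P2 where P: "primeideal P0 R" "primeideal P1 R" "primeideal P2 R"
    "annihilator R (conormal_mod R I) \<subseteq> P0" "P0 \<subset> P1" "P1 \<subset> P2"
    by (rule krull_dim_ge_two[OF assms(4)])
  obtain Q z where Q: "ideal Q R" "a \<notin> Q" and z: "\<forall>u\<in>carrier R. \<forall>i. z u i \<in> Q \<inter> \<mm>"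
    and ind: "\<forall>u\<in>carrier R. \<forall>v\<in>carrier R. \<forall>A q j. (\<forall>i<n. A i \<in> carrier R) \<longrightarrow> q \<in> carrier R \<longrightarrow> j < n \<longrightarrow>
      (\<Oplus>\<^bsub>R\<^esub>i\<in>{..<n}. A i \<otimes>\<^bsub>R\<^esub> z u i) \<ominus>\<^bsub>R\<^esub> q \<otimes>\<^bsub>R\<^esub> z v j \<in> P0 \<longrightarrow>
      (\<forall>i<n. A i \<ominus>\<^bsub>R\<^esub> (if i = j then q else \<zero>\<^bsub>R\<^esub>) \<in> \<mm>) \<and> (j = 0 \<longrightarrow> A 0 \<otimes>\<^bsub>R\<^esub> u \<ominus>\<^bsub>R\<^esub> q \<otimes>\<^bsub>R\<^esub> v \<in> \<mm>)"
    using independent_families[OF P(1,2,5,3,6) a a0, of n] by blast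
  have IP: "I \<subseteq> P0" "?J \<subseteq> P0" using conormal_annihilator[OF I(1)] P(4) by blast+
  have zQ: "z u i \<in> Q \<inter> \<mm>" if "u \<in> carrier R" for u i using z that by blast
  have ind': "(\<forall>i<n. A i \<ominus>\<^bsub>R\<^esub> (if i = j then q else \<zero>\<^bsub>R\<^esub>) \<in> \<mm>) \<and> (j = 0 \<longrightarrow> A 0 \<otimes>\<^bsub>R\<^esub> u \<ominus>\<^bsub>R\<^esub> q \<otimes>\<^bsub>R\<^esub> v \<in> \<mm>)"
    if "u \<in> carrier R" "v \<in> carrier R" "\<And>i. i < n \<Longrightarrow> A i \<in> carrier R" "q \<in> carrier R" "j < n"
      "(\<Oplus>\<^bsub>R\<^esub>i\<in>{..<n}. A i \<otimes>\<^bsub>R\<^esub> z u i) \<ominus>\<^bsub>R\<^esub> q \<otimes>\<^bsub>R\<^esub> z v j \<in> P0" for u v A q j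
  proof -
    have A: "\<forall>i<n. A i \<in> carrier R" using that(3) by blast
    show ?thesis
      by (rule ind[THEN bspec, OF that(1), THEN bspec, OF that(2), THEN spec, THEN spec, THEN spec, THEN mp, OF A,
            THEN mp, OF that(4), THEN mp, OF that(5), THEN mp, OF that(6)])
  qed
  interpret F: ext_family R \<mm> I P0 Q a n z
    by (rule ext_family.intro[OF assms(1) ext_family_axioms.intro[OF I(1) a ann col P(1) IP Q zQ ind' n]])
  have sub: "submodule \<mm> R (ring_mod R)" by (rule ideal_submodule[OF max_ideal])
  \<comment> \<open>Both are the set of cosets of the maximal ideal, so the coset criterion for
    modules can be applied to elements of the residue field.\<close>
  have "carrier (R Quot \<mm>) = carrier (cyclic_mod R \<mm>)"
    by (simp add: FactRing_def quot_mod_def A_RCOSETS_def' a_r_coset_def')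
  then have "\<exists>c\<in>carrier R. u = \<mm> +>\<^bsub>ring_mod R\<^esub> c" if "u \<in> carrier (R Quot \<mm>)" for u
    using that unfolding quot_mod_carrier[OF ring_mod_module sub] by auto
  \<comment> \<open>The members are indexed by residue classes, while \<open>z\<close> takes ring
    elements, so representatives are fixed. An isomorphism puts the difference of two
    representatives into the maximal ideal, which makes the classes equal.\<close>
  then obtain rep where rep: "\<And>u. u \<in> carrier (R Quot \<mm>) \<Longrightarrow> rep u \<in> carrier R"
    "\<And>u. u \<in> carrier (R Quot \<mm>) \<Longrightarrow> u = \<mm> +>\<^bsub>ring_mod R\<^esub> rep u" by metis
  define M where "M = (\<lambda>u. ext_mod R I a n (z (rep u)))"
  let ?K = "carrier (R Quot \<mm>)"
  have Mm: "module R (M u)" if "u \<in> ?K" for u unfolding M_def by (rule F.M_module[OF rep(1)[OF that]])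
  have Tn: "tot_refl R (power_mod ?T n)" by (rule tot_refl_power[OF T])
  have Tnm: "module R (power_mod ?T n)" using Tn by (simp add: tot_refl_def)
  have "\<exists>f g. exact3 R (power_mod ?T n) f (M u) g ?U" if u: "u \<in> ?K" for u
    unfolding M_def
    by (rule ext_mod_exact[OF I(1) a F.z_carrier[OF rep(1)[OF u]] _ J col]) (use ann in blast)
  then obtain f g where ex: "\<And>u. u \<in> ?K \<Longrightarrow> exact3 R (power_mod ?T n) (f u) (M u) (g u) ?U" by metis
  let ?f = "\<lambda>u. restrict (f u) (carrier (power_mod ?T n))" and ?g = "\<lambda>u. restrict (g u) (carrier (M u))"
  have props: "short_exact R (power_mod ?T n) (?f u) (M u) (?g u) ?U" "\<not> free_mod R (M u)"
    "indecomposable_mod R (M u)" "totally_reflexive R (M u)" "min_gens R (M u) = n + 1" if u: "u \<in> ?K" for u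
  proof -
    show "short_exact R (power_mod ?T n) (?f u) (M u) (?g u) ?U"
      by (rule exact3_short_exact[OF Tnm Mm[OF u] ex[OF u]])
    show "totally_reflexive R (M u)"
      by (rule tot_refl_totally_reflexive[OF tot_refl_extension[OF Tn U Mm[OF u] ex[OF u]]])
    show "\<not> free_mod R (M u)" "indecomposable_mod R (M u)" "min_gens R (M u) = n + 1"
      using F.not_free F.indecomposable F.min_gens_eq rep(1)[OF u] unfolding M_def by auto
  qed
  have niso: "\<not> isomorphic_mod R (M u) (M v)" if uv: "u \<in> ?K" "v \<in> ?K" "u \<noteq> v" for u v
  proof
    assume "isomorphic_mod R (M u) (M v)"
    then have "rep u \<ominus>\<^bsub>R\<^esub> rep v \<in> \<mm>"
      unfolding M_def by (rule F.not_isomorphic[OF rep(1)[OF uv(1)] rep(1)[OF uv(2)]])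
    then have "\<mm> +>\<^bsub>ring_mod R\<^esub> rep u = \<mm> +>\<^bsub>ring_mod R\<^esub> rep v"
      using coset_eq_iff[OF ring_mod_module sub, of "rep u" "rep v"] rep(1) uv by simp
    then show False using rep(2)[OF uv(1)] rep(2)[OF uv(2)] uv(3) by simp
  qed
  \<comment> \<open>Isomorphism is reflexive, so non-isomorphic members are different, and the set
    of members is infinite whenever the residue field is.\<close>
  have inj: "inj_on M ?K"
  proof (rule inj_onI, rule ccontr)
    fix u v assume uv: "u \<in> ?K" "v \<in> ?K" "M u = M v" "u \<noteq> v"
    show False using niso[OF uv(1,2,4)] isomorphic_mod_refl[OF Mm[OF uv(1)]] uv(3) by simp
  qed
  show "(\<exists>(M :: 'a set \<Rightarrow> ('a, (nat \<Rightarrow> 'a) set) module) f g.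
         (\<forall>u\<in>?K. short_exact R (power_mod ?T n) (f u) (M u) (g u) ?U \<and>
            \<not> free_mod R (M u) \<and> indecomposable_mod R (M u) \<and> totally_reflexive R (M u) \<and>
            min_gens R (M u) = n + 1) \<and>
         (\<forall>u\<in>?K. \<forall>v\<in>?K. u \<noteq> v \<longrightarrow> \<not> isomorphic_mod R (M u) (M v))) \<and>
      (infinite ?K \<longrightarrow>
        (\<exists>\<M> :: ('a, (nat \<Rightarrow> 'a) set) module set. infinite \<M> \<and>
          (\<forall>M\<in>\<M>. (\<exists>f g. short_exact R (power_mod ?T n) f M g ?U) \<and>
            \<not> free_mod R M \<and> indecomposable_mod R M \<and> totally_reflexive R M \<and>
            min_gens R M = n + 1) \<and>
          (\<forall>M\<in>\<M>. \<forall>N\<in>\<M>. M \<noteq> N \<longrightarrow> \<not> isomorphic_mod R M N)))"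
  proof (intro conjI impI)
    show "\<exists>(M :: 'a set \<Rightarrow> ('a, (nat \<Rightarrow> 'a) set) module) f g.
         (\<forall>u\<in>?K. short_exact R (power_mod ?T n) (f u) (M u) (g u) ?U \<and>
            \<not> free_mod R (M u) \<and> indecomposable_mod R (M u) \<and> totally_reflexive R (M u) \<and>
            min_gens R (M u) = n + 1) \<and>
         (\<forall>u\<in>?K. \<forall>v\<in>?K. u \<noteq> v \<longrightarrow> \<not> isomorphic_mod R (M u) (M v))"
      by (rule exI[of _ M], rule exI[of _ ?f], rule exI[of _ ?g]) (intro conjI ballI impI props niso)
    assume inf: "infinite ?K"
    show "\<exists>\<M> :: ('a, (nat \<Rightarrow> 'a) set) module set. infinite \<M> \<and>
          (\<forall>M\<in>\<M>. (\<exists>f g. short_exact R (power_mod ?T n) f M g ?U) \<and>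
            \<not> free_mod R M \<and> indecomposable_mod R M \<and> totally_reflexive R M \<and>
            min_gens R M = n + 1) \<and>
          (\<forall>M\<in>\<M>. \<forall>N\<in>\<M>. M \<noteq> N \<longrightarrow> \<not> isomorphic_mod R M N)"
    proof (rule exI[of _ "M ` ?K"], intro conjI ballI impI)
      show "infinite (M ` ?K)" using inf finite_imageD[OF _ inj] by blast
    next
      fix X assume "X \<in> M ` ?K"
      then obtain u where u: "u \<in> ?K" "X = M u" by blast
      show "\<exists>f g. short_exact R (power_mod ?T n) f X g ?U" unfolding u(2) using props(1)[OF u(1)] by blast
      show "\<not> free_mod R X" "indecomposable_mod R X" "totally_reflexive R X" "min_gens R X = n + 1"
        unfolding u(2) by (rule props[OF u(1)])+
    next
      fix X Y assume XY: "X \<in> M ` ?K" "Y \<in> M ` ?K" "X \<noteq> Y"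
      obtain u v where uv: "u \<in> ?K" "X = M u" "v \<in> ?K" "Y = M v" using XY(1,2) by blast
      then have "u \<noteq> v" using XY(3) by blast
      then show "\<not> isomorphic_mod R X Y" unfolding uv(2,4) by (rule niso[OF uv(1,3)])
    qed
  qed
qed

end
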